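(* Let $R$ be a commutative Noetherian ring. Let $S:\mathcal H\to\mathcal G$ and $T:\mathcal G\to\mathcal H$ be $R$-linear functors between $R$-linear idempotent complete categories such that $(S,T)$ is an adjoint pair ($S$ left adjoint to $T$). Assume that all $\mathrm{Hom}$-spaces in $\mathcal H$ and in $\mathcal G$ are of finite $R$-length, and that $(S,T)$ gives a normal subgroup situation, with $TS=\bigoplus_{i\in I}E_i$ for automorphisms $E_i$ of $\mathcal H$. Suppose that $\Gamma:=\{E_i\mid i\in I\}$ forms a group of automorphisms (with multiplication given by the structure map $\mu$ of the monad $TS$), and that $\Gamma$ is finite. For an indecomposable object $M$ of $\mathcal H$ let $I_S(M):=\{i\in I\mid E_iM\simeq M\}$ and $\Gamma_M:=\{E_i\mid i\in I_S(M)\}$. Suppose that $\mathcal G$ is the Karoubi envelope of the Kleisli category of the monad $TS$ (equivalently, of the orbit category $\mathcal H[\Gamma]$), with $(S,T)$ the corresponding adjoint pair. Then there is a commutative diagram of adjoint pairs $$\mathcal H\underset{T[\Gamma_M]}{\overset{S[\Gamma_M]}{\rightleftarrows}}\mathrm{Kar}(\mathcal H[\Gamma_M])\underset{T[\Gamma_M^0]}{\overset{S[\Gamma_M^0]}{\rightleftarrows}}\mathcal G,$$ i.e. $(S[\Gamma_M],T[\Gamma_M])$ and $(S[\Gamma_M^0],T[\Gamma_M^0])$ are adjoint pairs with $S=S[\Gamma_M^0]\circ S[\Gamma_M]$ and $T=T[\Gamma_M]\circ T[\Gamma_M^0]$; and for any indecomposable direct factor $M_0$ of $S[\Gamma_M](M)$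 in $\mathrm{Kar}(\mathcal H[\Gamma_M])$, the object $S[\Gamma_M^0](M_0)$ of $\mathcal G$ is indecomposable.
   Context: Normal subgroup situation: an adjoint pair $(S,T)$, $S:\mathcal H\to\mathcal G$, $T:\mathcal G\to\mathcal H$, gives a normal subgroup situation if $TS=\bigoplus_{i\in I}E_i$ for self-equivalences $E_i$ of $\mathcal H$. The monad of $(S,T)$ is $(A,\mu,\eta)$ with $A=TS$, $\mu=T\epsilon S$, where $\epsilon$ is the counit and $\eta$ the unit of the adjunction. Group with multiplication $\mu$: for all $i,j\in I$ the restriction of $\mu:A\circ A\to A$ to $E_iE_j$ has zero component in $E_k$ for all $k$ except a unique $k=k(i,j)$, for which the component $E_iE_j\to E_k$ is an equivalence, and $(i,j)\mapsto k(i,j)$ is the group law. Orbit category: for a group $\Gamma$ of automorphisms of $\mathcal H$, $\mathcal H[\Gamma]$ has the same objects as $\mathcal H$, and $\mathcal H[\Gamma](X,Y)=\bigoplus_{g\in\Gamma}\mathcal H(X,gY)$; the composite of $f\in\mathcal H(X,gY)$ and $f'\in\mathcal H(Y,hZ)$ is $g(f')\circ f\in\mathcal H(X,ghZ)$. It is the Kleisli category of the monad $\bigoplus_{g\in\Gamma}g$ on $\mathcal H$. The Kleisli adjoint pair is: $S_\Gamma:\mathcal H\to\mathcal H[\Gamma]$, the identity on objects, sending $f\in\mathcal H(X,Y)$ to $f$ in the component of $1\in\Gamma$; and its right adjoint $T_\Gamma:\mathcal H[\Gamma]\to\mathcal H$, $T_\Gamma(X)=\bigoplus_{g\in\Gamma}gX$.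 For a subgroup $\Gamma_0\le\Gamma$ there is an adjoint pair $(S_{\Gamma^0},T_{\Gamma^0})$ with $S_{\Gamma^0}:\mathcal H[\Gamma_0]\to\mathcal H[\Gamma]$, such that $S_\Gamma=S_{\Gamma^0}S_{\Gamma_0}$ and $T_\Gamma=T_{\Gamma_0}T_{\Gamma^0}$; $S_{\Gamma^0}$ is the identity on objects and is the natural functor on morphisms. Karoubi envelope $\mathrm{Kar}(\mathcal C)$ (idempotent completion): objects are pairs $(C,e)$ with $C$ an object of $\mathcal C$ and $e=e^2\in\mathrm{End}_{\mathcal C}(C)$; morphisms $(C,e)\to(D,f)$ are the $\alpha\in\mathcal C(C,D)$ with $\alpha e=\alpha=f\alpha$. $\mathcal C$ embeds fully faithfully via $C\mapsto(C,1_C)$, and if $\mathcal C$ is idempotent complete the embedding is an equivalence. A functor $F:\mathcal C\to\mathcal D$ extends to $\widehat F:\mathrm{Kar}(\mathcal C)\to\mathrm{Kar}(\mathcal D)$, $\widehat F(C,e)=(FC,Fe)$. In the claim, $S[\Gamma_M]$ denotes $S_{\Gamma_M}:\mathcal H\to\mathcal H[\Gamma_M]$ followed by the embedding into $\mathrm{Kar}(\mathcal H[\Gamma_M])$; $T[\Gamma_M]$ is the extension of $T_{\Gamma_M}$ to $\mathrm{Kar}(\mathcal H[\Gamma_M])$ (with values in $\mathcal H\simeq\mathrm{Kar}(\mathcal H)$); and $S[\Gamma_M^0],T[\Gamma_M^0]$ are the extensions to Karoubi envelopes of the adjoint pair $(S_{\Gamma^0},T_{\Gamma^0})$ for $\Gamma_0=\Gamma_M$.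 *)

theory Defs
  imports "HOL-Algebra.Module" "HOL-Algebra.Ring_Divisibility"
begin

section \<open>Linear categories\<close>

text \<open>
  Hom-spaces are modules in the sense of \<^theory>\<open>HOL-Algebra.Module\<close>; the fields \<open>mult\<close> and \<open>one\<close>
  of that record play no role. Hom-spaces need not be disjoint, so composition and the action of
  functors on morphisms carry the objects involved as arguments: \<open>Cmp C X Y Z g f\<close> is
  the composite of \<open>f : X \<rightarrow> Y\<close> and \<open>g : Y \<rightarrow> Z\<close>.
\<close>

record ('r, 'o, 'm) lcat =
  Ob :: "'o set"
  Hom :: "'o \<Rightarrow> 'o \<Rightarrow> ('r, 'm) module"
  Cmp :: "'o \<Rightarrow> 'o \<Rightarrow> 'o \<Rightarrow> 'm \<Rightarrow> 'm \<Rightarrow> 'm"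
  Idn :: "'o \<Rightarrow> 'm"

abbreviation Mor :: "('r, 'o, 'm) lcat \<Rightarrow> 'o \<Rightarrow> 'o \<Rightarrow> 'm set" where
  "Mor C X Y \<equiv> carrier (Hom C X Y)"

locale linear_category = R?: cring R
  for R :: "'r ring" and C :: "('r, 'o, 'm) lcat" +
  assumes hom_module: "\<lbrakk>X \<in> Ob C; Y \<in> Ob C\<rbrakk> \<Longrightarrow> module R (Hom C X Y)"
    and cmp_closed: "\<lbrakk>X \<in> Ob C; Y \<in> Ob C; Z \<in> Ob C; f \<in> Mor C X Y; g \<in> Mor C Y Z\<rbrakk>
      \<Longrightarrow> Cmp C X Y Z g f \<in> Mor C X Z"
    and cmp_assoc: "\<lbrakk>W \<in> Ob C; X \<in> Ob C; Y \<in> Ob C; Z \<in> Ob C;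
        f \<in> Mor C W X; g \<in> Mor C X Y; h \<in> Mor C Y Z\<rbrakk>
      \<Longrightarrow> Cmp C W X Z (Cmp C X Y Z h g) f = Cmp C W Y Z h (Cmp C W X Y g f)"
    and idn_closed: "X \<in> Ob C \<Longrightarrow> Idn C X \<in> Mor C X X"
    and cmp_idn_right: "\<lbrakk>X \<in> Ob C; Y \<in> Ob C; f \<in> Mor C X Y\<rbrakk> \<Longrightarrow> Cmp C X X Y f (Idn C X) = f"
    and cmp_idn_left: "\<lbrakk>X \<in> Ob C; Y \<in> Ob C; f \<in> Mor C X Y\<rbrakk> \<Longrightarrow> Cmp C X Y Y (Idn C Y) f = f"
    and cmp_add_right: "\<lbrakk>X \<in> Ob C; Y \<in> Ob C; Z \<in> Ob C; f \<in> Mor C X Y; f' \<in> Mor C X Y; g \<in> Mor C Y Z\<rbrakk>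
      \<Longrightarrow> Cmp C X Y Z g (f \<oplus>\<^bsub>Hom C X Y\<^esub> f') = Cmp C X Y Z g f \<oplus>\<^bsub>Hom C X Z\<^esub> Cmp C X Y Z g f'"
    and cmp_add_left: "\<lbrakk>X \<in> Ob C; Y \<in> Ob C; Z \<in> Ob C; f \<in> Mor C X Y; g \<in> Mor C Y Z; g' \<in> Mor C Y Z\<rbrakk>
      \<Longrightarrow> Cmp C X Y Z (g \<oplus>\<^bsub>Hom C Y Z\<^esub> g') f = Cmp C X Y Z g f \<oplus>\<^bsub>Hom C X Z\<^esub> Cmp C X Y Z g' f"
    and cmp_smult_right: "\<lbrakk>X \<in> Ob C; Y \<in> Ob C; Z \<in> Ob C; r \<in> carrier R; f \<in> Mor C X Y; g \<in> Mor C Y Z\<rbrakk>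
      \<Longrightarrow> Cmp C X Y Z g (r \<odot>\<^bsub>Hom C X Y\<^esub> f) = r \<odot>\<^bsub>Hom C X Z\<^esub> Cmp C X Y Z g f"
    and cmp_smult_left: "\<lbrakk>X \<in> Ob C; Y \<in> Ob C; Z \<in> Ob C; r \<in> carrier R; f \<in> Mor C X Y; g \<in> Mor C Y Z\<rbrakk>
      \<Longrightarrow> Cmp C X Y Z (r \<odot>\<^bsub>Hom C Y Z\<^esub> g) f = r \<odot>\<^bsub>Hom C X Z\<^esub> Cmp C X Y Z g f"

definition iso_in :: "('r, 'o, 'm) lcat \<Rightarrow> 'o \<Rightarrow> 'o \<Rightarrow> 'm \<Rightarrow> bool" where
  "iso_in C X Y f \<longleftrightarrow> f \<in> Mor C X Y \<and>
    (\<exists>g \<in> Mor C Y X. Cmp C X Y X g f = Idn C X \<and> Cmp C Y X Y f g = Idn C Y)"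

definition isomorphic_in :: "('r, 'o, 'm) lcat \<Rightarrow> 'o \<Rightarrow> 'o \<Rightarrow> bool" where
  "isomorphic_in C X Y \<longleftrightarrow> (\<exists>f. iso_in C X Y f)"

definition idempotent_in :: "('r, 'o, 'm) lcat \<Rightarrow> 'o \<Rightarrow> 'm \<Rightarrow> bool" where
  "idempotent_in C X e \<longleftrightarrow> e \<in> Mor C X X \<and> Cmp C X X X e e = e"

definition idempotent_complete :: "('r, 'o, 'm) lcat \<Rightarrow> bool" where
  "idempotent_complete C \<longleftrightarrow> (\<forall>X \<in> Ob C. \<forall>e. idempotent_in C X e \<longrightarrow>
    (\<exists>Y \<in> Ob C. \<exists>r \<in> Mor C X Y. \<exists>s \<in> Mor C Y X.
      Cmp C Y X Y r s = Idn C Y \<and> Cmp C X Y X s r = e))"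

definition zero_object :: "('r, 'o, 'm) lcat \<Rightarrow> 'o \<Rightarrow> bool" where
  "zero_object C X \<longleftrightarrow> X \<in> Ob C \<and>
    (\<forall>Y \<in> Ob C. Mor C X Y = {\<zero>\<^bsub>Hom C X Y\<^esub>} \<and> Mor C Y X = {\<zero>\<^bsub>Hom C Y X\<^esub>})"

definition is_direct_sum ::
  "('r, 'o, 'm) lcat \<Rightarrow> 'i set \<Rightarrow> ('i \<Rightarrow> 'o) \<Rightarrow> 'o \<Rightarrow> ('i \<Rightarrow> 'm) \<Rightarrow> ('i \<Rightarrow> 'm) \<Rightarrow> bool" where
  "is_direct_sum C I Y X inc prj \<longleftrightarrow>
    finite I \<and> X \<in> Ob C \<and>
    (\<forall>i \<in> I. Y i \<in> Ob C \<and> inc i \<in> Mor C (Y i) X \<and> prj i \<in> Mor C X (Y i)) \<and>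
    (\<forall>i \<in> I. \<forall>j \<in> I. Cmp C (Y i) X (Y j) (prj j) (inc i) =
       (if i = j then Idn C (Y i) else \<zero>\<^bsub>Hom C (Y i) (Y j)\<^esub>)) \<and>
    finsum (Hom C X X) (\<lambda>i. Cmp C X (Y i) X (inc i) (prj i)) I = Idn C X"

definition direct_factor :: "('r, 'o, 'm) lcat \<Rightarrow> 'o \<Rightarrow> 'o \<Rightarrow> bool" where
  "direct_factor C M X \<longleftrightarrow>
    (\<exists>Y inc prj. is_direct_sum C (UNIV :: bool set) Y X inc prj \<and> Y True = M)"

definition indecomposable :: "('r, 'o, 'm) lcat \<Rightarrow> 'o \<Rightarrow> bool" where
  "indecomposable C X \<longleftrightarrow> X \<in> Ob C \<and> \<not> zero_object C X \<and>
    (\<forall>Y inc prj. is_direct_sum C (UNIV :: bool set) Y X inc prj \<longrightarrow>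
       zero_object C (Y True) \<or> zero_object C (Y False))"

definition composition_series :: "'r ring \<Rightarrow> ('r, 'm) module \<Rightarrow> 'm set list \<Rightarrow> bool" where
  "composition_series R M Ns \<longleftrightarrow>
    Ns \<noteq> [] \<and> hd Ns = {\<zero>\<^bsub>M\<^esub>} \<and> last Ns = carrier M \<and> (\<forall>N \<in> set Ns. submodule N R M) \<and>
    (\<forall>i. Suc i < length Ns \<longrightarrow> Ns ! i \<subset> Ns ! Suc i \<and>
       (\<forall>N. submodule N R M \<and> Ns ! i \<subseteq> N \<and> N \<subseteq> Ns ! Suc i \<longrightarrow> N = Ns ! i \<or> N = Ns ! Suc i))"

definition finite_length :: "'r ring \<Rightarrow> ('r, 'm) module \<Rightarrow> bool" where
  "finite_length R M \<longleftrightarrow> (\<exists>Ns. composition_series R M Ns)"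


section \<open>Linear functors, natural transformations, adjunctions\<close>

record ('o, 'm, 'p, 'n) cfunctor =
  FOb :: "'o \<Rightarrow> 'p"
  FMor :: "'o \<Rightarrow> 'o \<Rightarrow> 'm \<Rightarrow> 'n"

locale linear_functor = C: linear_category R C + D: linear_category R D
  for R :: "'r ring" and C :: "('r, 'o, 'm) lcat" and D :: "('r, 'p, 'n) lcat"
    and F :: "('o, 'm, 'p, 'n) cfunctor" +
  assumes fob_closed: "X \<in> Ob C \<Longrightarrow> FOb F X \<in> Ob D"
    and fmor_closed: "\<lbrakk>X \<in> Ob C; Y \<in> Ob C; f \<in> Mor C X Y\<rbrakk> \<Longrightarrow> FMor F X Y f \<in> Mor D (FOb F X) (FOb F Y)"
    and fmor_idn: "X \<in> Ob C \<Longrightarrow> FMor F X X (Idn C X) = Idn D (FOb F X)"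
    and fmor_cmp: "\<lbrakk>X \<in> Ob C; Y \<in> Ob C; Z \<in> Ob C; f \<in> Mor C X Y; g \<in> Mor C Y Z\<rbrakk>
      \<Longrightarrow> FMor F X Z (Cmp C X Y Z g f) =
          Cmp D (FOb F X) (FOb F Y) (FOb F Z) (FMor F Y Z g) (FMor F X Y f)"
    and fmor_add: "\<lbrakk>X \<in> Ob C; Y \<in> Ob C; f \<in> Mor C X Y; g \<in> Mor C X Y\<rbrakk>
      \<Longrightarrow> FMor F X Y (f \<oplus>\<^bsub>Hom C X Y\<^esub> g) = FMor F X Y f \<oplus>\<^bsub>Hom D (FOb F X) (FOb F Y)\<^esub> FMor F X Y g"
    and fmor_smult: "\<lbrakk>X \<in> Ob C; Y \<in> Ob C; r \<in> carrier R; f \<in> Mor C X Y\<rbrakk>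
      \<Longrightarrow> FMor F X Y (r \<odot>\<^bsub>Hom C X Y\<^esub> f) = r \<odot>\<^bsub>Hom D (FOb F X) (FOb F Y)\<^esub> FMor F X Y f"

definition id_functor :: "('o, 'm, 'o, 'm) cfunctor" where
  "id_functor = \<lparr>FOb = (\<lambda>X. X), FMor = (\<lambda>X Y f. f)\<rparr>"

definition comp_functor ::
  "('p, 'n, 'q, 'k) cfunctor \<Rightarrow> ('o, 'm, 'p, 'n) cfunctor \<Rightarrow> ('o, 'm, 'q, 'k) cfunctor"
  (infixr \<open>\<circ>\<^sub>F\<close> 75) where
  "G \<circ>\<^sub>F F = \<lparr>FOb = (\<lambda>X. FOb G (FOb F X)),
             FMor = (\<lambda>X Y f. FMor G (FOb F X) (FOb F Y) (FMor F X Y f))\<rparr>"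

locale natural_transformation = F: linear_functor R C D F + G: linear_functor R C D G
  for R :: "'r ring" and C :: "('r, 'o, 'm) lcat" and D :: "('r, 'p, 'n) lcat"
    and F G :: "('o, 'm, 'p, 'n) cfunctor" and \<tau> :: "'o \<Rightarrow> 'n" +
  assumes component_closed: "X \<in> Ob C \<Longrightarrow> \<tau> X \<in> Mor D (FOb F X) (FOb G X)"
    and naturality: "\<lbrakk>X \<in> Ob C; Y \<in> Ob C; f \<in> Mor C X Y\<rbrakk>
      \<Longrightarrow> Cmp D (FOb F X) (FOb F Y) (FOb G Y) (\<tau> Y) (FMor F X Y f) =
          Cmp D (FOb F X) (FOb G X) (FOb G Y) (FMor G X Y f) (\<tau> X)"

definition nat_isomorphic ::
  "'r ring \<Rightarrow> ('r, 'o, 'm) lcat \<Rightarrow> ('r, 'p, 'n) lcat \<Rightarrow>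
    ('o, 'm, 'p, 'n) cfunctor \<Rightarrow> ('o, 'm, 'p, 'n) cfunctor \<Rightarrow> bool" where
  "nat_isomorphic R C D F G \<longleftrightarrow>
    (\<exists>\<tau>. natural_transformation R C D F G \<tau> \<and> (\<forall>X \<in> Ob C. iso_in D (FOb F X) (FOb G X) (\<tau> X)))"

definition equivalence_functor ::
  "'r ring \<Rightarrow> ('r, 'o, 'm) lcat \<Rightarrow> ('r, 'p, 'n) lcat \<Rightarrow> ('o, 'm, 'p, 'n) cfunctor \<Rightarrow> bool" where
  "equivalence_functor R C D F \<longleftrightarrow> linear_functor R C D F \<and>
    (\<exists>K. linear_functor R D C K \<and>
      nat_isomorphic R C C (K \<circ>\<^sub>F F) id_functor \<and> nat_isomorphic R D D (F \<circ>\<^sub>F K) id_functor)"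

locale adjunction = S: linear_functor R C D S + T: linear_functor R D C T +
    unit: natural_transformation R C C id_functor "T \<circ>\<^sub>F S" \<eta> +
    counit: natural_transformation R D D "S \<circ>\<^sub>F T" id_functor \<epsilon>
  for R :: "'r ring" and C :: "('r, 'o, 'm) lcat" and D :: "('r, 'p, 'n) lcat"
    and S :: "('o, 'm, 'p, 'n) cfunctor" and T :: "('p, 'n, 'o, 'm) cfunctor"
    and \<eta> :: "'o \<Rightarrow> 'm" and \<epsilon> :: "'p \<Rightarrow> 'n" +
  assumes triangle_left: "X \<in> Ob C \<Longrightarrow>
      Cmp D (FOb S X) (FOb S (FOb T (FOb S X))) (FOb S X)
        (\<epsilon> (FOb S X)) (FMor S X (FOb T (FOb S X)) (\<eta> X)) = Idn D (FOb S X)"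
    and triangle_right: "Y \<in> Ob D \<Longrightarrow>
      Cmp C (FOb T Y) (FOb T (FOb S (FOb T Y))) (FOb T Y)
        (FMor T (FOb S (FOb T Y)) Y (\<epsilon> Y)) (\<eta> (FOb T Y)) = Idn C (FOb T Y)"

definition adjoint_pair ::
  "'r ring \<Rightarrow> ('r, 'o, 'm) lcat \<Rightarrow> ('r, 'p, 'n) lcat \<Rightarrow>
    ('o, 'm, 'p, 'n) cfunctor \<Rightarrow> ('p, 'n, 'o, 'm) cfunctor \<Rightarrow> bool" where
  "adjoint_pair R C D S T \<longleftrightarrow> (\<exists>\<eta> \<epsilon>. adjunction R C D S T \<eta> \<epsilon>)"


section \<open>Karoubi envelope\<close>

definition karoubi :: "('r, 'o, 'm) lcat \<Rightarrow> ('r, 'o \<times> 'm, 'm) lcat" where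
  "karoubi C =
    \<lparr>Ob = {(X, e). X \<in> Ob C \<and> idempotent_in C X e},
     Hom = (\<lambda>(X, e) (Y, f). (Hom C X Y)
       \<lparr>carrier := {\<alpha> \<in> Mor C X Y. Cmp C X X Y \<alpha> e = \<alpha> \<and> Cmp C X Y Y f \<alpha> = \<alpha>}\<rparr>),
     Cmp = (\<lambda>(X, _) (Y, _) (Z, _). Cmp C X Y Z),
     Idn = snd\<rparr>"

definition kar_embed :: "('r, 'o, 'm) lcat \<Rightarrow> ('o, 'm, 'o \<times> 'm, 'm) cfunctor" where
  "kar_embed C = \<lparr>FOb = (\<lambda>X. (X, Idn C X)), FMor = (\<lambda>X Y f. f)\<rparr>"

definition kar_extend ::
  "('o, 'm, 'p, 'n) cfunctor \<Rightarrow> ('o \<times> 'm, 'm, 'p \<times> 'n, 'n) cfunctor" where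
  "kar_extend F = \<lparr>FOb = (\<lambda>(X, e). (FOb F X, FMor F X X e)),
                   FMor = (\<lambda>(X, _) (Y, _). FMor F X Y)\<rparr>"


section \<open>Kleisli category of a monad \<open>(A, \<mu>, \<eta>)\<close>\<close>

definition kleisli ::
  "('r, 'o, 'm) lcat \<Rightarrow> ('o, 'm, 'o, 'm) cfunctor \<Rightarrow> ('o \<Rightarrow> 'm) \<Rightarrow> ('o \<Rightarrow> 'm) \<Rightarrow> ('r, 'o, 'm) lcat" where
  "kleisli H A \<mu> \<eta> =
    \<lparr>Ob = Ob H,
     Hom = (\<lambda>X Y. Hom H X (FOb A Y)),
     Cmp = (\<lambda>X Y Z g f. Cmp H X (FOb A (FOb A Z)) (FOb A Z) (\<mu> Z)
              (Cmp H X (FOb A Y) (FOb A (FOb A Z)) (FMor A Y (FOb A Z) g) f)),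
     Idn = \<eta>\<rparr>"

definition kleisli_left ::
  "('r, 'o, 'm) lcat \<Rightarrow> ('o, 'm, 'o, 'm) cfunctor \<Rightarrow> ('o \<Rightarrow> 'm) \<Rightarrow> ('o, 'm, 'o, 'm) cfunctor" where
  "kleisli_left H A \<eta> =
    \<lparr>FOb = (\<lambda>X. X), FMor = (\<lambda>X Y f. Cmp H X Y (FOb A Y) (\<eta> Y) f)\<rparr>"

definition kleisli_right ::
  "('r, 'o, 'm) lcat \<Rightarrow> ('o, 'm, 'o, 'm) cfunctor \<Rightarrow> ('o \<Rightarrow> 'm) \<Rightarrow> ('o, 'm, 'o, 'm) cfunctor" where
  "kleisli_right H A \<mu> =
    \<lparr>FOb = FOb A,
     FMor = (\<lambda>X Y f. Cmp H (FOb A X) (FOb A (FOb A Y)) (FOb A Y) (\<mu> Y) (FMor A X (FOb A Y) f))\<rparr>"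


section \<open>Normal subgroup situations\<close>

text \<open>The isomorphism of \<open>T S\<close> with the direct sum of the \<open>E i\<close> is recorded by its natural
  injections \<open>inc i : E i \<rightarrow> T S\<close> and projections \<open>prj i : T S \<rightarrow> E i\<close>. Finiteness of the index set is
  part of \<^const>\<open>is_direct_sum\<close>.\<close>

locale normal_subgroup_situation = adjunction R H G S T \<eta> \<epsilon>
  for R :: "'r ring" and H :: "('r, 'o, 'm) lcat" and G :: "('r, 'p, 'n) lcat"
    and S :: "('o, 'm, 'p, 'n) cfunctor" and T :: "('p, 'n, 'o, 'm) cfunctor"
    and \<eta> :: "'o \<Rightarrow> 'm" and \<epsilon> :: "'p \<Rightarrow> 'n"
    and I :: "'i set" and E :: "'i \<Rightarrow> ('o, 'm, 'o, 'm) cfunctor"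
    and inc :: "'i \<Rightarrow> 'o \<Rightarrow> 'm" and prj :: "'i \<Rightarrow> 'o \<Rightarrow> 'm" +
  assumes self_equivalence: "i \<in> I \<Longrightarrow> equivalence_functor R H H (E i)"
    and inc_natural: "i \<in> I \<Longrightarrow> natural_transformation R H H (E i) (T \<circ>\<^sub>F S) (inc i)"
    and prj_natural: "i \<in> I \<Longrightarrow> natural_transformation R H H (T \<circ>\<^sub>F S) (E i) (prj i)"
    and direct_sum: "X \<in> Ob H \<Longrightarrow> is_direct_sum H I (\<lambda>i. FOb (E i) X) (FOb (T \<circ>\<^sub>F S) X)
          (\<lambda>i. inc i X) (\<lambda>i. prj i X)"

definition adj_mult ::
  "('o, 'm, 'p, 'n) cfunctor \<Rightarrow> ('p, 'n, 'o, 'm) cfunctor \<Rightarrow> ('p \<Rightarrow> 'n) \<Rightarrow> 'o \<Rightarrow> 'm" where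
  "adj_mult S T \<epsilon> X = FMor T (FOb S (FOb T (FOb S X))) (FOb S X) (\<epsilon> (FOb S X))"

text \<open>The component \<open>E i (E j Z) \<rightarrow> E k Z\<close> of \<open>\<mu> : A (A Z) \<rightarrow> A Z\<close>.\<close>

definition mult_component ::
  "('r, 'o, 'm) lcat \<Rightarrow> ('o, 'm, 'o, 'm) cfunctor \<Rightarrow> ('o \<Rightarrow> 'm) \<Rightarrow> ('i \<Rightarrow> ('o, 'm, 'o, 'm) cfunctor) \<Rightarrow>
    ('i \<Rightarrow> 'o \<Rightarrow> 'm) \<Rightarrow> ('i \<Rightarrow> 'o \<Rightarrow> 'm) \<Rightarrow> 'i \<Rightarrow> 'i \<Rightarrow> 'i \<Rightarrow> 'o \<Rightarrow> 'm" where
  "mult_component H A \<mu> E inc prj i j k Z =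
    (let EEZ = FOb (E i) (FOb (E j) Z); EAZ = FOb (E i) (FOb A Z);
         AAZ = FOb A (FOb A Z); AZ = FOb A Z; EZ = FOb (E k) Z
     in Cmp H EEZ AZ EZ (prj k Z)
          (Cmp H EEZ AAZ AZ (\<mu> Z)
            (Cmp H EEZ EAZ AAZ (inc i AZ) (FMor (E i) (FOb (E j) Z) AZ (inc j Z)))))"

text \<open>The \<open>E i\<close>, \<open>i \<in> carrier \<Gamma>\<close>, form a group with multiplication given by \<open>\<mu>\<close>, and \<open>\<Gamma>\<close> is
  this group (its elements are represented by the indices).\<close>

definition group_by_mult ::
  "('r, 'o, 'm) lcat \<Rightarrow> ('o, 'm, 'o, 'm) cfunctor \<Rightarrow> ('o \<Rightarrow> 'm) \<Rightarrow> ('i \<Rightarrow> ('o, 'm, 'o, 'm) cfunctor) \<Rightarrow>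
    ('i \<Rightarrow> 'o \<Rightarrow> 'm) \<Rightarrow> ('i \<Rightarrow> 'o \<Rightarrow> 'm) \<Rightarrow> 'i monoid \<Rightarrow> bool" where
  "group_by_mult H A \<mu> E inc prj \<Gamma> \<longleftrightarrow> group \<Gamma> \<and>
    (\<forall>i \<in> carrier \<Gamma>. \<forall>j \<in> carrier \<Gamma>. \<forall>k \<in> carrier \<Gamma>. \<forall>Z \<in> Ob H.
      (if k = i \<otimes>\<^bsub>\<Gamma>\<^esub> j
       then iso_in H (FOb (E i) (FOb (E j) Z)) (FOb (E k) Z) (mult_component H A \<mu> E inc prj i j k Z)
       else mult_component H A \<mu> E inc prj i j k Z = \<zero>\<^bsub>Hom H (FOb (E i) (FOb (E j) Z)) (FOb (E k) Z)\<^esub>))"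

definition stabilizer_index ::
  "('r, 'o, 'm) lcat \<Rightarrow> ('i \<Rightarrow> ('o, 'm, 'o, 'm) cfunctor) \<Rightarrow> 'i set \<Rightarrow> 'o \<Rightarrow> 'i set" where
  "stabilizer_index H E I M = {i \<in> I. isomorphic_in H (FOb (E i) M) M}"


section \<open>Orbit categories\<close>

text \<open>
  The identifications of \<open>E g (E h Z)\<close> with \<open>E (g h) Z\<close> and of \<open>X\<close> with \<open>E 1 X\<close> are explicit:
  \<open>m g h Z : E g (E h Z) \<rightarrow> E (g h) Z\<close> and \<open>u X : X \<rightarrow> E 1 X\<close>. For a strict action they are
  identities and disappear from the formulas below. The group \<open>\<Gamma>\<close> is finite, so a morphism
  is the family of its components.
\<close>

definition orbit_cat ::
  "('r, 'o, 'm) lcat \<Rightarrow> ('i \<Rightarrow> ('o, 'm, 'o, 'm) cfunctor) \<Rightarrow> ('i \<Rightarrow> 'i \<Rightarrow> 'o \<Rightarrow> 'm) \<Rightarrow> ('o \<Rightarrow> 'm) \<Rightarrow>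
    'i monoid \<Rightarrow> ('r, 'o, 'i \<Rightarrow> 'm) lcat" where
  "orbit_cat H E m u \<Gamma> =
    \<lparr>Ob = Ob H,
     Hom = (\<lambda>X Y.
       \<lparr>carrier = (\<Pi>\<^sub>E g \<in> carrier \<Gamma>. Mor H X (FOb (E g) Y)),
        mult = undefined, one = undefined,
        zero = (\<lambda>g \<in> carrier \<Gamma>. \<zero>\<^bsub>Hom H X (FOb (E g) Y)\<^esub>),
        add = (\<lambda>a b. \<lambda>g \<in> carrier \<Gamma>. a g \<oplus>\<^bsub>Hom H X (FOb (E g) Y)\<^esub> b g),
        smult = (\<lambda>r a. \<lambda>g \<in> carrier \<Gamma>. r \<odot>\<^bsub>Hom H X (FOb (E g) Y)\<^esub> a g)\<rparr>),
     Cmp = (\<lambda>X Y Z f' f. \<lambda>k \<in> carrier \<Gamma>.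
       finsum (Hom H X (FOb (E k) Z))
         (\<lambda>(g, h). Cmp H X (FOb (E g) (FOb (E h) Z)) (FOb (E k) Z) (m g h Z)
            (Cmp H X (FOb (E g) Y) (FOb (E g) (FOb (E h) Z))
               (FMor (E g) Y (FOb (E h) Z) (f' h)) (f g)))
         {(g, h) \<in> carrier \<Gamma> \<times> carrier \<Gamma>. g \<otimes>\<^bsub>\<Gamma>\<^esub> h = k}),
     Idn = (\<lambda>X. \<lambda>g \<in> carrier \<Gamma>. if g = \<one>\<^bsub>\<Gamma>\<^esub> then u X else \<zero>\<^bsub>Hom H X (FOb (E g) X)\<^esub>)\<rparr>"

definition orbit_left ::
  "('r, 'o, 'm) lcat \<Rightarrow> ('i \<Rightarrow> ('o, 'm, 'o, 'm) cfunctor) \<Rightarrow> ('o \<Rightarrow> 'm) \<Rightarrow>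
    'i monoid \<Rightarrow> ('o, 'm, 'o, 'i \<Rightarrow> 'm) cfunctor" where
  "orbit_left H E u \<Gamma> =
    \<lparr>FOb = (\<lambda>X. X),
     FMor = (\<lambda>X Y f. \<lambda>g \<in> carrier \<Gamma>.
       if g = \<one>\<^bsub>\<Gamma>\<^esub> then Cmp H X Y (FOb (E g) Y) (u Y) f else \<zero>\<^bsub>Hom H X (FOb (E g) Y)\<^esub>)\<rparr>"

text \<open>The right adjoint of \<^const>\<open>orbit_left\<close>, for a choice \<open>D X\<close> (with injections \<open>dinc g X\<close> and
  projections \<open>dprj g X\<close>) of a direct sum of the \<open>E g X\<close>, \<open>g \<in> carrier \<Gamma>\<close>. On the summand \<open>E g X\<close>
  the component \<open>f h : X \<rightarrow> E h Y\<close> of a morphism \<open>f\<close> acts by \<open>E g (f h) : E g X \<rightarrow> E g (E h Y)\<close>.\<close>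

definition orbit_right ::
  "('r, 'o, 'm) lcat \<Rightarrow> ('i \<Rightarrow> ('o, 'm, 'o, 'm) cfunctor) \<Rightarrow> ('i \<Rightarrow> 'i \<Rightarrow> 'o \<Rightarrow> 'm) \<Rightarrow>
    ('o \<Rightarrow> 'o) \<Rightarrow> ('i \<Rightarrow> 'o \<Rightarrow> 'm) \<Rightarrow> ('i \<Rightarrow> 'o \<Rightarrow> 'm) \<Rightarrow>
    'i monoid \<Rightarrow> ('o, 'i \<Rightarrow> 'm, 'o, 'm) cfunctor" where
  "orbit_right H E m D dinc dprj \<Gamma> =
    \<lparr>FOb = D,
     FMor = (\<lambda>X Y f. finsum (Hom H (D X) (D Y))
       (\<lambda>(g, h). Cmp H (D X) (FOb (E (g \<otimes>\<^bsub>\<Gamma>\<^esub> h)) Y) (D Y) (dinc (g \<otimes>\<^bsub>\<Gamma>\<^esub> h) Y)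
          (Cmp H (D X) (FOb (E g) (FOb (E h) Y)) (FOb (E (g \<otimes>\<^bsub>\<Gamma>\<^esub> h)) Y) (m g h Y)
             (Cmp H (D X) (FOb (E g) X) (FOb (E g) (FOb (E h) Y))
                (FMor (E g) X (FOb (E h) Y) (f h)) (dprj g X))))
       (carrier \<Gamma> \<times> carrier \<Gamma>))\<rparr>"

text \<open>The natural functor between the orbit categories of a subgroup \<open>\<Gamma>0\<close> and of \<open>\<Gamma>\<close>.\<close>

definition orbit_incl ::
  "('r, 'o, 'm) lcat \<Rightarrow> ('i \<Rightarrow> ('o, 'm, 'o, 'm) cfunctor) \<Rightarrow>
    'i monoid \<Rightarrow> 'i monoid \<Rightarrow> ('o, 'i \<Rightarrow> 'm, 'o, 'i \<Rightarrow> 'm) cfunctor" where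
  "orbit_incl H E \<Gamma>0 \<Gamma> =
    \<lparr>FOb = (\<lambda>X. X),
     FMor = (\<lambda>X Y f. \<lambda>g \<in> carrier \<Gamma>.
       if g \<in> carrier \<Gamma>0 then f g else \<zero>\<^bsub>Hom H X (FOb (E g) Y)\<^esub>)\<rparr>"

text \<open>The isomorphism from the orbit category to the Kleisli category of \<open>A\<close>, the direct sum of the
  \<open>E g\<close> with injections \<open>inc g\<close>.\<close>

definition orbit_to_kleisli ::
  "('r, 'o, 'm) lcat \<Rightarrow> ('i \<Rightarrow> ('o, 'm, 'o, 'm) cfunctor) \<Rightarrow> ('o, 'm, 'o, 'm) cfunctor \<Rightarrow>
    ('i \<Rightarrow> 'o \<Rightarrow> 'm) \<Rightarrow> 'i monoid \<Rightarrow> ('o, 'i \<Rightarrow> 'm, 'o, 'm) cfunctor" where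
  "orbit_to_kleisli H E A inc \<Gamma> =
    \<lparr>FOb = (\<lambda>X. X),
     FMor = (\<lambda>X Y f. finsum (Hom H X (FOb A Y))
       (\<lambda>g. Cmp H X (FOb (E g) Y) (FOb A Y) (inc g Y) (f g)) (carrier \<Gamma>))\<rparr>"

end

theory Submission
  imports Defs
begin

text \<open>
  Write \<open>A = T S\<close>, \<open>K\<close> for the stabilizer of \<open>M\<close> in \<open>\<Gamma>\<close>, and \<open>H[K]\<close> for the orbit category of a
  subgroup \<open>K\<close>.

  The diagram. A morphism \<open>X \<rightarrow> A Y\<close> is the family of its components \<open>X \<rightarrow> E g Y\<close>, and in these terms
  the composition of the Kleisli category is that of the orbit category (\<open>kleisli_component\<close>). So
  \<open>H[K]\<close> is the part of the Kleisli category where the components outside \<open>K\<close> vanish, from which it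
  inherits the laws of a category (\<open>orbit_linear_category\<close>). Each adjunction is given by its counit, a
  universal arrow. For \<open>H \<rightarrow> H[K]\<close> it is the family of projections of the direct sum of the \<open>E g Y\<close>,
  \<open>g \<in> K\<close> (\<open>orbit_right_adjoint\<close>), and for \<open>H[K] \<rightarrow> H[\<Gamma>]\<close> the family of projections of the direct sum of
  the \<open>E t Y\<close> over a transversal of \<open>K\<close> in \<open>\<Gamma>\<close> (\<open>orbit_incl_right_adjoint\<close>). These adjunctions extend to
  Karoubi envelopes and are composed with quasi-inverses of the equivalences of \<open>H\<close> with its Karoubi
  envelope and of the Karoubi envelope of \<open>H[\<Gamma>]\<close> with \<open>G\<close>. The left adjoints compose to \<open>S\<close>, so the
  right adjoints compose to \<open>T\<close> by uniqueness of adjoints (\<open>adjoint_pairs_diagram\<close>).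

  Indecomposability. By Fitting's lemma every endomorphism of \<open>M\<close>, and of an indecomposable direct
  factor \<open>M0\<close> of the image of \<open>M\<close>, is nilpotent or invertible. If \<open>g \<notin> K\<close> then \<open>M\<close> and \<open>E g M\<close> are
  not isomorphic, so all morphisms \<open>M \<rightarrow> E g M\<close> lie in the radical of \<open>H\<close>
  (\<open>radical_of_not_isomorphic\<close>). Hence an endomorphism of \<open>M\<close> in \<open>H[\<Gamma>]\<close> is the sum of a morphism of
  \<open>H[K]\<close> and of one with radical components. The right adjoint \<open>H[\<Gamma>] \<rightarrow> H\<close> sends the latter to a
  matrix with radical entries (\<open>full_orbit_right_radical\<close>). It is faithful, and a radical idempotent
  is zero, so the morphisms that it makes radical form an ideal without nonzero idempotents. Modulo
  this ideal each endomorphism of the image of \<open>M0\<close> comes from one of \<open>M0\<close>, and therefore the image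
  of \<open>M0\<close> has only the trivial idempotents as well (\<open>trivial_idempotents_modulo_radical\<close>).
\<close>

section \<open>Arithmetic of morphisms\<close>

context linear_category
begin

declare cmp_closed [simp] idn_closed [simp] cmp_idn_left [simp] cmp_idn_right [simp]

lemma hom_abelian_group: "\<lbrakk>X \<in> Ob C; Y \<in> Ob C\<rbrakk> \<Longrightarrow> abelian_group (Hom C X Y)"
  using hom_module module.axioms(2) by blast

lemma hom_abelian_monoid: "\<lbrakk>X \<in> Ob C; Y \<in> Ob C\<rbrakk> \<Longrightarrow> abelian_monoid (Hom C X Y)"
  using hom_abelian_group abelian_group.axioms(1) by blast

lemma hom_zero [simp]: "\<lbrakk>X \<in> Ob C; Y \<in> Ob C\<rbrakk> \<Longrightarrow> \<zero>\<^bsub>Hom C X Y\<^esub> \<in> Mor C X Y"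
  by (simp add: abelian_monoid.zero_closed hom_abelian_monoid)

lemma hom_add [simp]:
  "\<lbrakk>X \<in> Ob C; Y \<in> Ob C; f \<in> Mor C X Y; g \<in> Mor C X Y\<rbrakk> \<Longrightarrow> f \<oplus>\<^bsub>Hom C X Y\<^esub> g \<in> Mor C X Y"
  by (simp add: abelian_monoid.a_closed hom_abelian_monoid)

lemma hom_neg [simp]: "\<lbrakk>X \<in> Ob C; Y \<in> Ob C; f \<in> Mor C X Y\<rbrakk> \<Longrightarrow> \<ominus>\<^bsub>Hom C X Y\<^esub> f \<in> Mor C X Y"
  by (simp add: abelian_group.a_inv_closed hom_abelian_group)

lemma hom_smult [simp]:
  "\<lbrakk>X \<in> Ob C; Y \<in> Ob C; r \<in> carrier R; f \<in> Mor C X Y\<rbrakk> \<Longrightarrow> r \<odot>\<^bsub>Hom C X Y\<^esub> f \<in> Mor C X Y"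
  by (rule module.smult_closed[OF hom_module])

lemma hom_l_zero [simp]:
  "\<lbrakk>X \<in> Ob C; Y \<in> Ob C; f \<in> Mor C X Y\<rbrakk> \<Longrightarrow> \<zero>\<^bsub>Hom C X Y\<^esub> \<oplus>\<^bsub>Hom C X Y\<^esub> f = f"
  by (simp add: abelian_monoid.l_zero hom_abelian_monoid)

lemma hom_r_zero [simp]:
  "\<lbrakk>X \<in> Ob C; Y \<in> Ob C; f \<in> Mor C X Y\<rbrakk> \<Longrightarrow> f \<oplus>\<^bsub>Hom C X Y\<^esub> \<zero>\<^bsub>Hom C X Y\<^esub> = f"
  by (simp add: abelian_monoid.r_zero hom_abelian_monoid)

lemma hom_r_neg [simp]:
  "\<lbrakk>X \<in> Ob C; Y \<in> Ob C; f \<in> Mor C X Y\<rbrakk>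
    \<Longrightarrow> f \<oplus>\<^bsub>Hom C X Y\<^esub> \<ominus>\<^bsub>Hom C X Y\<^esub> f = \<zero>\<^bsub>Hom C X Y\<^esub>"
  by (simp add: abelian_group.r_neg hom_abelian_group)

lemma hom_add_assoc:
  "\<lbrakk>X \<in> Ob C; Y \<in> Ob C; f \<in> Mor C X Y; g \<in> Mor C X Y; h \<in> Mor C X Y\<rbrakk>
    \<Longrightarrow> (f \<oplus>\<^bsub>Hom C X Y\<^esub> g) \<oplus>\<^bsub>Hom C X Y\<^esub> h = f \<oplus>\<^bsub>Hom C X Y\<^esub> (g \<oplus>\<^bsub>Hom C X Y\<^esub> h)"
  by (simp add: abelian_monoid.a_assoc hom_abelian_monoid)

lemma hom_add_comm:
  "\<lbrakk>X \<in> Ob C; Y \<in> Ob C; f \<in> Mor C X Y; g \<in> Mor C X Y\<rbrakk>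
    \<Longrightarrow> f \<oplus>\<^bsub>Hom C X Y\<^esub> g = g \<oplus>\<^bsub>Hom C X Y\<^esub> f"
  by (simp add: abelian_monoid.a_comm hom_abelian_monoid)

lemma hom_add_cancel_zero:
  assumes "X \<in> Ob C" "Y \<in> Ob C" "f \<in> Mor C X Y" "g \<in> Mor C X Y" "g = f \<oplus>\<^bsub>Hom C X Y\<^esub> g"
  shows "f = \<zero>\<^bsub>Hom C X Y\<^esub>"
proof -
  have "f \<oplus>\<^bsub>Hom C X Y\<^esub> (g \<oplus>\<^bsub>Hom C X Y\<^esub> \<ominus>\<^bsub>Hom C X Y\<^esub> g) = g \<oplus>\<^bsub>Hom C X Y\<^esub> \<ominus>\<^bsub>Hom C X Y\<^esub> g"
    using assms by (metis hom_add_assoc hom_neg)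
  then show ?thesis
    using assms by simp
qed

lemma cmp_zero_right [simp]:
  assumes "X \<in> Ob C" "Y \<in> Ob C" "Z \<in> Ob C" "g \<in> Mor C Y Z"
  shows "Cmp C X Y Z g \<zero>\<^bsub>Hom C X Y\<^esub> = \<zero>\<^bsub>Hom C X Z\<^esub>"
proof (rule hom_add_cancel_zero[OF assms(1,3)])
  show "Cmp C X Y Z g \<zero>\<^bsub>Hom C X Y\<^esub> =
    Cmp C X Y Z g \<zero>\<^bsub>Hom C X Y\<^esub> \<oplus>\<^bsub>Hom C X Z\<^esub> Cmp C X Y Z g \<zero>\<^bsub>Hom C X Y\<^esub>"
    using assms by (subst cmp_add_right[symmetric]) auto
qed (use assms cmp_closed in auto)

lemma cmp_zero_left [simp]:
  assumes "X \<in> Ob C" "Y \<in> Ob C" "Z \<in> Ob C" "f \<in> Mor C X Y"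
  shows "Cmp C X Y Z \<zero>\<^bsub>Hom C Y Z\<^esub> f = \<zero>\<^bsub>Hom C X Z\<^esub>"
proof (rule hom_add_cancel_zero[OF assms(1,3)])
  show "Cmp C X Y Z \<zero>\<^bsub>Hom C Y Z\<^esub> f =
    Cmp C X Y Z \<zero>\<^bsub>Hom C Y Z\<^esub> f \<oplus>\<^bsub>Hom C X Z\<^esub> Cmp C X Y Z \<zero>\<^bsub>Hom C Y Z\<^esub> f"
    using assms by (subst cmp_add_left[symmetric]) auto
qed (use assms cmp_closed in auto)

lemma cmp_neg_right:
  assumes "X \<in> Ob C" "Y \<in> Ob C" "Z \<in> Ob C" "f \<in> Mor C X Y" "g \<in> Mor C Y Z"
  shows "Cmp C X Y Z g (\<ominus>\<^bsub>Hom C X Y\<^esub> f) = \<ominus>\<^bsub>Hom C X Z\<^esub> Cmp C X Y Z g f"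
proof -
  have "Cmp C X Y Z g (\<ominus>\<^bsub>Hom C X Y\<^esub> f) \<oplus>\<^bsub>Hom C X Z\<^esub> Cmp C X Y Z g f = \<zero>\<^bsub>Hom C X Z\<^esub>"
    using assms by (subst cmp_add_right[symmetric]) (auto simp: hom_add_comm[of X Y "\<ominus>\<^bsub>Hom C X Y\<^esub> f"])
  then show ?thesis
    using assms abelian_group.minus_equality[OF hom_abelian_group] by (metis cmp_closed hom_neg)
qed

lemma cmp_neg_left:
  assumes "X \<in> Ob C" "Y \<in> Ob C" "Z \<in> Ob C" "f \<in> Mor C X Y" "g \<in> Mor C Y Z"
  shows "Cmp C X Y Z (\<ominus>\<^bsub>Hom C Y Z\<^esub> g) f = \<ominus>\<^bsub>Hom C X Z\<^esub> Cmp C X Y Z g f"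
proof -
  have "Cmp C X Y Z (\<ominus>\<^bsub>Hom C Y Z\<^esub> g) f \<oplus>\<^bsub>Hom C X Z\<^esub> Cmp C X Y Z g f = \<zero>\<^bsub>Hom C X Z\<^esub>"
    using assms by (subst cmp_add_left[symmetric]) (auto simp: hom_add_comm[of Y Z "\<ominus>\<^bsub>Hom C Y Z\<^esub> g"])
  then show ?thesis
    using assms abelian_group.minus_equality[OF hom_abelian_group] by (metis cmp_closed hom_neg)
qed

lemma hom_finsum_closed:
  "\<lbrakk>X \<in> Ob C; Y \<in> Ob C; \<And>i. i \<in> I \<Longrightarrow> f i \<in> Mor C X Y\<rbrakk> \<Longrightarrow> finsum (Hom C X Y) f I \<in> Mor C X Y"
  by (rule abelian_monoid.finsum_closed[OF hom_abelian_monoid]) auto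

lemma hom_finsum_insert:
  "\<lbrakk>X \<in> Ob C; Y \<in> Ob C; finite I; i \<notin> I; f i \<in> Mor C X Y; \<And>j. j \<in> I \<Longrightarrow> f j \<in> Mor C X Y\<rbrakk>
    \<Longrightarrow> finsum (Hom C X Y) f (insert i I) = f i \<oplus>\<^bsub>Hom C X Y\<^esub> finsum (Hom C X Y) f I"
  by (rule abelian_monoid.finsum_insert[OF hom_abelian_monoid]) auto

lemma hom_finsum_empty [simp]:
  "\<lbrakk>X \<in> Ob C; Y \<in> Ob C\<rbrakk> \<Longrightarrow> finsum (Hom C X Y) f {} = \<zero>\<^bsub>Hom C X Y\<^esub>"
  by (rule abelian_monoid.finsum_empty[OF hom_abelian_monoid])

lemma hom_finsum_cong:
  "\<lbrakk>X \<in> Ob C; Y \<in> Ob C; \<And>i. i \<in> I \<Longrightarrow> f i = g i; \<And>i. i \<in> I \<Longrightarrow> g i \<in> Mor C X Y\<rbrakk>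
    \<Longrightarrow> finsum (Hom C X Y) f I = finsum (Hom C X Y) g I"
  by (rule abelian_monoid.finsum_cong'[OF hom_abelian_monoid]) auto

lemma hom_finsum_reindex:
  "\<lbrakk>X \<in> Ob C; Y \<in> Ob C; inj_on h I; \<And>i. i \<in> I \<Longrightarrow> f (h i) \<in> Mor C X Y\<rbrakk>
    \<Longrightarrow> finsum (Hom C X Y) f (h ` I) = finsum (Hom C X Y) (\<lambda>i. f (h i)) I"
  by (rule abelian_monoid.finsum_reindex[OF hom_abelian_monoid]) auto

lemma hom_finsum_single:
  assumes "X \<in> Ob C" "Y \<in> Ob C" "finite I" "i \<in> I" "f i \<in> Mor C X Y"
    "\<And>j. \<lbrakk>j \<in> I; j \<noteq> i\<rbrakk> \<Longrightarrow> f j = \<zero>\<^bsub>Hom C X Y\<^esub>"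
  shows "finsum (Hom C X Y) f I = f i"
proof -
  have "finsum (Hom C X Y) f I = finsum (Hom C X Y) (\<lambda>j. if i = j then f j else \<zero>\<^bsub>Hom C X Y\<^esub>) I"
    by (rule hom_finsum_cong) (use assms in auto)
  also have "\<dots> = f i"
  proof (rule abelian_monoid.finsum_singleton[OF hom_abelian_monoid])
    show "f \<in> I \<rightarrow> Mor C X Y"
      using assms by (metis Pi_I hom_zero)
  qed (use assms in auto)
  finally show ?thesis .
qed

lemma hom_finsum_zero:
  assumes "X \<in> Ob C" "Y \<in> Ob C" "\<And>j. j \<in> I \<Longrightarrow> f j = \<zero>\<^bsub>Hom C X Y\<^esub>"
  shows "finsum (Hom C X Y) f I = \<zero>\<^bsub>Hom C X Y\<^esub>"
  using hom_finsum_cong[OF assms(1,2), of I f "\<lambda>_. \<zero>\<^bsub>Hom C X Y\<^esub>"]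
    abelian_monoid.finsum_zero[OF hom_abelian_monoid[OF assms(1,2)]] assms by simp

lemma cmp_finsum_right:
  assumes "X \<in> Ob C" "Y \<in> Ob C" "Z \<in> Ob C" "g \<in> Mor C Y Z" "finite I" "\<And>i. i \<in> I \<Longrightarrow> f i \<in> Mor C X Y"
  shows "Cmp C X Y Z g (finsum (Hom C X Y) f I) = finsum (Hom C X Z) (\<lambda>i. Cmp C X Y Z g (f i)) I"
  using assms(5,6)
proof (induction I)
  case (insert i I)
  have f: "f i \<in> Mor C X Y" "\<And>j. j \<in> I \<Longrightarrow> f j \<in> Mor C X Y"
    using insert by auto
  have "Cmp C X Y Z g (finsum (Hom C X Y) f (insert i I)) =
        Cmp C X Y Z g (f i) \<oplus>\<^bsub>Hom C X Z\<^esub> Cmp C X Y Z g (finsum (Hom C X Y) f I)"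
    using assms(1-4) insert.hyps f by (simp add: hom_finsum_insert cmp_add_right hom_finsum_closed)
  also have "\<dots> = finsum (Hom C X Z) (\<lambda>i. Cmp C X Y Z g (f i)) (insert i I)"
    using assms(1-4) insert f by (subst hom_finsum_insert) (auto simp: cmp_closed)
  finally show ?case .
qed (use assms in auto)

lemma cmp_finsum_left:
  assumes "X \<in> Ob C" "Y \<in> Ob C" "Z \<in> Ob C" "f \<in> Mor C X Y" "finite I" "\<And>i. i \<in> I \<Longrightarrow> g i \<in> Mor C Y Z"
  shows "Cmp C X Y Z (finsum (Hom C Y Z) g I) f = finsum (Hom C X Z) (\<lambda>i. Cmp C X Y Z (g i) f) I"
  using assms(5,6)
proof (induction I)
  case (insert i I)
  have g: "g i \<in> Mor C Y Z" "\<And>j. j \<in> I \<Longrightarrow> g j \<in> Mor C Y Z"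
    using insert by auto
  have "Cmp C X Y Z (finsum (Hom C Y Z) g (insert i I)) f =
        Cmp C X Y Z (g i) f \<oplus>\<^bsub>Hom C X Z\<^esub> Cmp C X Y Z (finsum (Hom C Y Z) g I) f"
    using assms(1-4) insert.hyps g by (simp add: hom_finsum_insert cmp_add_left hom_finsum_closed)
  also have "\<dots> = finsum (Hom C X Z) (\<lambda>i. Cmp C X Y Z (g i) f) (insert i I)"
    using assms(1-4) insert g by (subst hom_finsum_insert) (auto simp: cmp_closed)
  finally show ?case .
qed (use assms in auto)

lemma zero_object_iff: "zero_object C X \<longleftrightarrow> X \<in> Ob C \<and> Idn C X = \<zero>\<^bsub>Hom C X X\<^esub>"
proof
  assume "zero_object C X"
  then show "X \<in> Ob C \<and> Idn C X = \<zero>\<^bsub>Hom C X X\<^esub>"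
    unfolding zero_object_def using idn_closed by blast
next
  assume X: "X \<in> Ob C \<and> Idn C X = \<zero>\<^bsub>Hom C X X\<^esub>"
  have "f = \<zero>\<^bsub>Hom C X Y\<^esub>" if "Y \<in> Ob C" "f \<in> Mor C X Y" for Y f
    using cmp_idn_right[of X Y f] X that by simp
  moreover have "f = \<zero>\<^bsub>Hom C Y X\<^esub>" if "Y \<in> Ob C" "f \<in> Mor C Y X" for Y f
    using cmp_idn_left[of Y X f] X that by simp
  ultimately show "zero_object C X"
    unfolding zero_object_def using X by auto
qed

end

section \<open>Isomorphisms\<close>

context linear_category
begin

lemma iso_inE:
  assumes "iso_in C X Y f"
  obtains g where "f \<in> Mor C X Y" "g \<in> Mor C Y X" "Cmp C X Y X g f = Idn C X" "Cmp C Y X Y f g = Idn C Y"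
    "iso_in C Y X g"
  using assms unfolding iso_in_def by blast

lemma iso_in_idn: "X \<in> Ob C \<Longrightarrow> iso_in C X X (Idn C X)"
  unfolding iso_in_def using idn_closed cmp_idn_left by metis

lemma iso_in_cmp:
  assumes X: "X \<in> Ob C" "Y \<in> Ob C" "Z \<in> Ob C" and "iso_in C X Y f" "iso_in C Y Z g"
  shows "iso_in C X Z (Cmp C X Y Z g f)"
proof -
  obtain f' where f: "f \<in> Mor C X Y" "f' \<in> Mor C Y X" "Cmp C X Y X f' f = Idn C X" "Cmp C Y X Y f f' = Idn C Y"
    using assms(4) by (rule iso_inE)
  obtain g' where g: "g \<in> Mor C Y Z" "g' \<in> Mor C Z Y" "Cmp C Y Z Y g' g = Idn C Y" "Cmp C Z Y Z g g' = Idn C Z"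
    using assms(5) by (rule iso_inE)
  have "Cmp C X Z X (Cmp C Z Y X f' g') (Cmp C X Y Z g f) = Cmp C X Y X f' (Cmp C X Y Y (Cmp C Y Z Y g' g) f)"
    using X f(1,2) g(1,2) by (simp add: cmp_assoc cmp_closed)
  moreover have "Cmp C Z X Z (Cmp C X Y Z g f) (Cmp C Z Y X f' g') = Cmp C Z Y Z g (Cmp C Z Y Y (Cmp C Y X Y f
      f') g')"
    using X f(1,2) g(1,2) by (simp add: cmp_assoc cmp_closed)
  ultimately show ?thesis
    unfolding iso_in_def using X f g by (auto simp: cmp_closed cmp_idn_left intro!: bexI[of _ "Cmp C Z Y X f' g'"])
qed

lemma isomorphic_in_sym: "isomorphic_in C X Y \<Longrightarrow> isomorphic_in C Y X"
  unfolding isomorphic_in_def iso_in_def by blast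

lemma isomorphic_in_trans:
  "\<lbrakk>X \<in> Ob C; Y \<in> Ob C; Z \<in> Ob C; isomorphic_in C X Y; isomorphic_in C Y Z\<rbrakk> \<Longrightarrow> isomorphic_in C X Z"
  unfolding isomorphic_in_def using iso_in_cmp by blast

lemma iso_cancel_left:
  assumes X: "X \<in> Ob C" "Y \<in> Ob C" "Z \<in> Ob C" and "iso_in C Y Z g" and f: "f \<in> Mor C X Y" "f' \<in> Mor C X Y"
    and eq: "Cmp C X Y Z g f = Cmp C X Y Z g f'"
  shows "f = f'"
proof -
  obtain g' where g: "g \<in> Mor C Y Z" "g' \<in> Mor C Z Y" "Cmp C Y Z Y g' g = Idn C Y"
    using assms(4) by (rule iso_inE)
  have "Cmp C X Y Y (Cmp C Y Z Y g' g) f = Cmp C X Y Y (Cmp C Y Z Y g' g) f'"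
    using X f g(1,2) eq by (simp add: cmp_assoc)
  then show ?thesis
    using X f g(3) by (simp add: cmp_idn_left)
qed

lemma iso_cancel_right:
  assumes X: "X \<in> Ob C" "Y \<in> Ob C" "Z \<in> Ob C" and "iso_in C X Y f" and g: "g \<in> Mor C Y Z" "g' \<in> Mor C Y Z"
    and eq: "Cmp C X Y Z g f = Cmp C X Y Z g' f"
  shows "g = g'"
proof -
  obtain f' where f: "f \<in> Mor C X Y" "f' \<in> Mor C Y X" "Cmp C Y X Y f f' = Idn C Y"
    using assms(4) by (rule iso_inE)
  have "Cmp C Y Y Z g (Cmp C Y X Y f f') = Cmp C Y Y Z g' (Cmp C Y X Y f f')"
    using X f(1,2) g eq by (simp flip: cmp_assoc)
  then show ?thesis
    using X g f(3) by (simp add: cmp_idn_right)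
qed

end

section \<open>Direct sums\<close>

lemma is_direct_sumD:
  assumes "is_direct_sum C I Y X inc prj"
  shows "finite I" "X \<in> Ob C" "\<And>i. i \<in> I \<Longrightarrow> Y i \<in> Ob C"
    "\<And>i. i \<in> I \<Longrightarrow> inc i \<in> Mor C (Y i) X" "\<And>i. i \<in> I \<Longrightarrow> prj i \<in> Mor C X (Y i)"
    "\<And>i. i \<in> I \<Longrightarrow> Cmp C (Y i) X (Y i) (prj i) (inc i) = Idn C (Y i)"
    "\<And>i j. \<lbrakk>i \<in> I; j \<in> I; i \<noteq> j\<rbrakk> \<Longrightarrow> Cmp C (Y i) X (Y j) (prj j) (inc i) = \<zero>\<^bsub>Hom C (Y i) (Y j)\<^esub>"
    "finsum (Hom C X X) (\<lambda>i. Cmp C X (Y i) X (inc i) (prj i)) I = Idn C X"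
  using assms unfolding is_direct_sum_def by auto

context linear_category
begin

lemma direct_sum_expand_in:
  assumes ds: "is_direct_sum C I Y X inc prj" and W: "W \<in> Ob C" "f \<in> Mor C W X"
  shows "f = finsum (Hom C W X) (\<lambda>i. Cmp C W (Y i) X (inc i) (Cmp C W X (Y i) (prj i) f)) I"
proof -
  note D = is_direct_sumD[OF ds]
  have "f = Cmp C W X X (finsum (Hom C X X) (\<lambda>i. Cmp C X (Y i) X (inc i) (prj i)) I) f"
    using D W by (simp add: cmp_idn_left)
  also have "\<dots> = finsum (Hom C W X) (\<lambda>i. Cmp C W X X (Cmp C X (Y i) X (inc i) (prj i)) f) I"
    using D W by (intro cmp_finsum_left) (auto simp: cmp_closed)
  also have "\<dots> = finsum (Hom C W X) (\<lambda>i. Cmp C W (Y i) X (inc i) (Cmp C W X (Y i) (prj i) f)) I"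
    using D W by (intro hom_finsum_cong) (auto simp: cmp_closed cmp_assoc)
  finally show ?thesis .
qed

lemma direct_sum_ext_in:
  assumes ds: "is_direct_sum C I Y X inc prj" and W: "W \<in> Ob C" "f \<in> Mor C W X" "g \<in> Mor C W X"
    and eq: "\<And>i. i \<in> I \<Longrightarrow> Cmp C W X (Y i) (prj i) f = Cmp C W X (Y i) (prj i) g"
  shows "f = g"
proof -
  note D = is_direct_sumD[OF ds]
  have "f = finsum (Hom C W X) (\<lambda>i. Cmp C W (Y i) X (inc i) (Cmp C W X (Y i) (prj i) f)) I"
    by (rule direct_sum_expand_in[OF ds W(1,2)])
  also have "\<dots> = finsum (Hom C W X) (\<lambda>i. Cmp C W (Y i) X (inc i) (Cmp C W X (Y i) (prj i) g)) I"
    using D W eq by (intro hom_finsum_cong) (auto simp: cmp_closed)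
  also have "\<dots> = g"
    by (rule direct_sum_expand_in[OF ds W(1,3), symmetric])
  finally show ?thesis .
qed

lemma direct_sum_tuple:
  assumes ds: "is_direct_sum C I Y X inc prj" and W: "W \<in> Ob C" and P: "P \<subseteq> I"
    and f: "\<And>i. i \<in> P \<Longrightarrow> f i \<in> Mor C W (Y i)" and j: "j \<in> I"
  shows "finsum (Hom C W X) (\<lambda>i. Cmp C W (Y i) X (inc i) (f i)) P \<in> Mor C W X"
    and "Cmp C W X (Y j) (prj j) (finsum (Hom C W X) (\<lambda>i. Cmp C W (Y i) X (inc i) (f i)) P) =
      (if j \<in> P then f j else \<zero>\<^bsub>Hom C W (Y j)\<^esub>)"
proof -
  note D = is_direct_sumD[OF ds]
  have fP: "finite P"
    using P D(1) finite_subset by blast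
  have YP: "Y i \<in> Ob C" "inc i \<in> Mor C (Y i) X" if "i \<in> P" for i
    using that P D by auto
  show "finsum (Hom C W X) (\<lambda>i. Cmp C W (Y i) X (inc i) (f i)) P \<in> Mor C W X"
    using D(2) W f YP by (intro hom_finsum_closed) (auto simp: cmp_closed)
  have t: "Cmp C W X (Y j) (prj j) (Cmp C W (Y i) X (inc i) (f i)) =
      (if i = j then f j else \<zero>\<^bsub>Hom C W (Y j)\<^esub>)" if "i \<in> P" for i
  proof -
    have "Cmp C W X (Y j) (prj j) (Cmp C W (Y i) X (inc i) (f i)) =
      Cmp C W (Y i) (Y j) (Cmp C (Y i) X (Y j) (prj j) (inc i)) (f i)"
      using D(2,3,5) W f YP j that by (simp add: cmp_assoc)
    then show ?thesis
      using that P D(3,6,7) f W j by (auto simp: cmp_idn_left)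
  qed
  have "Cmp C W X (Y j) (prj j) (finsum (Hom C W X) (\<lambda>i. Cmp C W (Y i) X (inc i) (f i)) P) =
     finsum (Hom C W (Y j)) (\<lambda>i. Cmp C W X (Y j) (prj j) (Cmp C W (Y i) X (inc i) (f i))) P"
    using D(2,3,5) W f YP j fP by (intro cmp_finsum_right) (auto simp: cmp_closed)
  also have "\<dots> = (if j \<in> P then f j else \<zero>\<^bsub>Hom C W (Y j)\<^esub>)"
  proof (cases "j \<in> P")
    case True
    then show ?thesis
      using D(3) W f j fP t by (subst hom_finsum_single[of _ _ _ j]) auto
  next
    case False
    have "finsum (Hom C W (Y j)) (\<lambda>i. Cmp C W X (Y j) (prj j) (Cmp C W (Y i) X (inc i) (f i))) P = \<zero>\<^bsub>Hom C W (Y j)\<^esub>"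
      using D(3) W j t False by (intro hom_finsum_zero) auto
    with False show ?thesis by simp
  qed
  finally show "Cmp C W X (Y j) (prj j) (finsum (Hom C W X) (\<lambda>i. Cmp C W (Y i) X (inc i) (f i)) P) =
      (if j \<in> P then f j else \<zero>\<^bsub>Hom C W (Y j)\<^esub>)" .
qed

text \<open>Idempotent completeness provides every partial sum of a direct sum: it is the image of the
  idempotent that projects onto the chosen summands.\<close>

lemma partial_direct_sum:
  assumes ds: "is_direct_sum C I Y X inc prj" and P: "P \<subseteq> I" and ic: "idempotent_complete C"
  shows "\<exists>X' inc' prj'. is_direct_sum C P Y X' inc' prj'"
proof -
  note D = is_direct_sumD[OF ds]
  define p where "p = finsum (Hom C X X) (\<lambda>i. Cmp C X (Y i) X (inc i) (prj i)) P"
  have fP: "finite P"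
    using P D(1) finite_subset by blast
  have DP: "Y i \<in> Ob C" "inc i \<in> Mor C (Y i) X" "prj i \<in> Mor C X (Y i)" if "i \<in> P" for i
    using that P D by auto
  have p: "p \<in> Mor C X X"
    and prj_p: "Cmp C X X (Y j) (prj j) p = (if j \<in> P then prj j else \<zero>\<^bsub>Hom C X (Y j)\<^esub>)" if "j \<in> I" for j
    unfolding p_def using direct_sum_tuple[OF ds D(2) P, of prj j] DP that by auto
  have pX: "p \<in> Mor C X X"
    unfolding p_def using D(2) DP by (intro hom_finsum_closed) (auto simp: cmp_closed)
  have "Cmp C X X X p p = p"
  proof (rule direct_sum_ext_in[OF ds D(2) _ pX])
    fix i assume i: "i \<in> I"
    have "Cmp C X X (Y i) (prj i) (Cmp C X X X p p) = Cmp C X X (Y i) (Cmp C X X (Y i) (prj i) p) p"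
      using D i pX by (simp add: cmp_assoc)
    then show "Cmp C X X (Y i) (prj i) (Cmp C X X X p p) = Cmp C X X (Y i) (prj i) p"
      using i D pX by (simp add: prj_p)
  qed (use D pX cmp_closed in auto)
  then have "idempotent_in C X p"
    unfolding idempotent_in_def using pX by simp
  then obtain X' r s where X': "X' \<in> Ob C" "r \<in> Mor C X X'" "s \<in> Mor C X' X"
      "Cmp C X' X X' r s = Idn C X'" "Cmp C X X' X s r = p"
    using ic D(2) unfolding idempotent_complete_def by meson
  have prj_inc: "Cmp C (Y i) X' (Y j) (Cmp C X' X (Y j) (prj j) s) (Cmp C (Y i) X X' r (inc i)) =
     Cmp C (Y i) X (Y j) (prj j) (inc i)" if "i \<in> P" "j \<in> P" for i j
  proof -
    have "Cmp C (Y i) X' (Y j) (Cmp C X' X (Y j) (prj j) s) (Cmp C (Y i) X X' r (inc i)) =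
      Cmp C (Y i) X (Y j) (Cmp C X X (Y j) (prj j) (Cmp C X X' X s r)) (inc i)"
      using that DP X'(1-3) D(2) by (simp add: cmp_assoc cmp_closed)
    also have "\<dots> = Cmp C (Y i) X (Y j) (prj j) (inc i)"
      using that P X'(5) prj_p by (simp add: subset_iff)
    finally show ?thesis .
  qed
  have "finsum (Hom C X' X') (\<lambda>i. Cmp C X' (Y i) X' (Cmp C (Y i) X X' r (inc i)) (Cmp C X' X (Y i) (prj i) s)) P =
     finsum (Hom C X' X') (\<lambda>i. Cmp C X' X X' r (Cmp C X' X X (Cmp C X (Y i) X (inc i) (prj i)) s)) P"
    using X' DP D(2) by (intro hom_finsum_cong) (auto simp: cmp_assoc cmp_closed)
  also have "\<dots> = Cmp C X' X X' r (finsum (Hom C X' X) (\<lambda>i. (Cmp C X' X X (Cmp C X (Y i) X (inc i) (prj i)) s)) P)"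
    using X' DP D(2) fP by (intro cmp_finsum_right[symmetric]) (auto simp: cmp_closed)
  also have "\<dots> = Cmp C X' X X' r (Cmp C X' X X p s)"
    using X' DP D(2) fP unfolding p_def by (subst cmp_finsum_left) (auto simp: cmp_closed)
  also have "\<dots> = Cmp C X' X' X' (Cmp C X' X X' r s) (Cmp C X' X X' r s)"
    using X'(1-3) D(2) by (simp add: cmp_assoc cmp_closed flip: X'(5))
  also have "\<dots> = Idn C X'"
    using X' by (simp add: cmp_idn_left idn_closed)
  finally have "is_direct_sum C P Y X' (\<lambda>i. Cmp C (Y i) X X' r (inc i)) (\<lambda>i. Cmp C X' X (Y i) (prj i) s)"
    unfolding is_direct_sum_def using X'(1-3) DP D(2) fP prj_inc P D(6,7)
    by (auto simp: cmp_closed subset_iff)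
  then show ?thesis by blast
qed

end

section \<open>Linear functors\<close>

context linear_functor
begin

declare fob_closed [simp] fmor_closed [simp]

lemma fmor_zero: "\<lbrakk>X \<in> Ob C; Y \<in> Ob C\<rbrakk> \<Longrightarrow> FMor F X Y \<zero>\<^bsub>Hom C X Y\<^esub> = \<zero>\<^bsub>Hom D (FOb F X) (FOb F Y)\<^esub>"
  using fmor_add[of X Y "\<zero>\<^bsub>Hom C X Y\<^esub>" "\<zero>\<^bsub>Hom C X Y\<^esub>"]
  by (intro D.hom_add_cancel_zero) auto

lemma fmor_finsum:
  assumes "X \<in> Ob C" "Y \<in> Ob C" "finite I" "\<And>i. i \<in> I \<Longrightarrow> f i \<in> Mor C X Y"
  shows "FMor F X Y (finsum (Hom C X Y) f I) = finsum (Hom D (FOb F X) (FOb F Y)) (\<lambda>i. FMor F X Y (f i)) I"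
  using assms(3,4)
proof (induction I)
  case (insert i I)
  have f: "f i \<in> Mor C X Y" "\<And>j. j \<in> I \<Longrightarrow> f j \<in> Mor C X Y"
    using insert by auto
  have "FMor F X Y (finsum (Hom C X Y) f (insert i I)) =
        FMor F X Y (f i) \<oplus>\<^bsub>Hom D (FOb F X) (FOb F Y)\<^esub> FMor F X Y (finsum (Hom C X Y) f I)"
    using assms(1,2) insert.hyps f by (simp add: C.hom_finsum_insert fmor_add C.hom_finsum_closed)
  also have "\<dots> = finsum (Hom D (FOb F X) (FOb F Y)) (\<lambda>i. FMor F X Y (f i)) (insert i I)"
    using assms(1,2) insert f by (subst D.hom_finsum_insert) (auto simp: fmor_closed fob_closed)
  finally show ?case .
qed (use assms in \<open>auto simp: fmor_zero fob_closed\<close>)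

lemma fmor_iso_in:
  assumes "X \<in> Ob C" "Y \<in> Ob C" "iso_in C X Y f"
  shows "iso_in D (FOb F X) (FOb F Y) (FMor F X Y f)"
proof -
  obtain f' where f: "f \<in> Mor C X Y" "f' \<in> Mor C Y X" "Cmp C X Y X f' f = Idn C X" "Cmp C Y X Y f f' = Idn C Y"
    using assms(3) by (rule C.iso_inE)
  then show ?thesis
    unfolding iso_in_def using assms(1,2) fmor_cmp[of X Y X f f'] fmor_cmp[of Y X Y f' f]
    by (auto simp: fmor_closed fmor_idn intro!: bexI[of _ "FMor F Y X f'"])
qed

lemma fob_isomorphic_in:
  "\<lbrakk>X \<in> Ob C; Y \<in> Ob C; isomorphic_in C X Y\<rbrakk> \<Longrightarrow> isomorphic_in D (FOb F X) (FOb F Y)"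
  unfolding isomorphic_in_def using fmor_iso_in by blast

lemma functor_direct_sum:
  assumes "is_direct_sum C I Y X inc prj"
  shows "is_direct_sum D I (\<lambda>i. FOb F (Y i)) (FOb F X)
    (\<lambda>i. FMor F (Y i) X (inc i)) (\<lambda>i. FMor F X (Y i) (prj i))"
proof -
  note DS = is_direct_sumD[OF assms]
  have c: "Cmp D (FOb F (Y i)) (FOb F X) (FOb F (Y j)) (FMor F X (Y j) (prj j)) (FMor F (Y i) X (inc i)) =
    FMor F (Y i) (Y j) (Cmp C (Y i) X (Y j) (prj j) (inc i))" if "i \<in> I" "j \<in> I" for i j
    using DS that by (simp add: fmor_cmp)
  have "finsum (Hom D (FOb F X) (FOb F X)) (\<lambda>i. Cmp D (FOb F X) (FOb F (Y i)) (FOb F X)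
      (FMor F (Y i) X (inc i)) (FMor F X (Y i) (prj i))) I =
    finsum (Hom D (FOb F X) (FOb F X)) (\<lambda>i. FMor F X X (Cmp C X (Y i) X (inc i) (prj i))) I"
    using DS by (intro D.hom_finsum_cong) (auto simp: fmor_cmp fob_closed D.cmp_closed fmor_closed)
  also have "\<dots> = FMor F X X (Idn C X)"
    using DS by (subst fmor_finsum[symmetric]) (auto simp: C.cmp_closed)
  finally show ?thesis
    unfolding is_direct_sum_def using DS c by (auto simp: fob_closed fmor_closed fmor_idn fmor_zero)
qed

end

lemma linear_functor_comp:
  assumes "linear_functor R C D F" "linear_functor R D E G"
  shows "linear_functor R C E (G \<circ>\<^sub>F F)"
proof -
  interpret F: linear_functor R C D F by fact
  interpret G: linear_functor R D E G by fact
  show ?thesis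
    by unfold_locales
       (simp_all add: comp_functor_def F.fob_closed G.fob_closed F.fmor_closed G.fmor_closed
         F.fmor_idn G.fmor_idn F.fmor_cmp G.fmor_cmp F.fmor_add G.fmor_add F.fmor_smult G.fmor_smult)
qed

lemma linear_functor_id:
  assumes "linear_category R C"
  shows "linear_functor R C C id_functor"
proof -
  interpret linear_category R C by fact
  show ?thesis
    by unfold_locales (simp_all add: id_functor_def)
qed

section \<open>Natural isomorphisms\<close>

lemma nat_isomorphicI:
  assumes "linear_functor R C D F" "linear_functor R C D G"
    and "\<And>X. X \<in> Ob C \<Longrightarrow> iso_in D (FOb F X) (FOb G X) (\<tau> X)"
    and "\<And>X Y f. \<lbrakk>X \<in> Ob C; Y \<in> Ob C; f \<in> Mor C X Y\<rbrakk> \<Longrightarrow>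
          Cmp D (FOb F X) (FOb F Y) (FOb G Y) (\<tau> Y) (FMor F X Y f) =
          Cmp D (FOb F X) (FOb G X) (FOb G Y) (FMor G X Y f) (\<tau> X)"
  shows "nat_isomorphic R C D F G"
  unfolding nat_isomorphic_def natural_transformation_def natural_transformation_axioms_def
  using assms iso_in_def by metis

lemma nat_isomorphic_of_agree:
  assumes "linear_functor R C D F" "linear_functor R C D G"
    and ob: "\<And>X. X \<in> Ob C \<Longrightarrow> FOb F X = FOb G X"
    and mor: "\<And>X Y f. \<lbrakk>X \<in> Ob C; Y \<in> Ob C; f \<in> Mor C X Y\<rbrakk> \<Longrightarrow> FMor F X Y f = FMor G X Y f"
  shows "nat_isomorphic R C D F G"
proof -
  interpret F: linear_functor R C D F by fact
  interpret G: linear_functor R C D G by fact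
  show ?thesis
    by (rule nat_isomorphicI[where \<tau> = "\<lambda>X. Idn D (FOb F X)"])
       (use assms F.D.iso_in_idn F.fmor_closed F.fob_closed in auto)
qed

lemma nat_isomorphic_trans:
  assumes "nat_isomorphic R C D F G" "nat_isomorphic R C D G K"
  shows "nat_isomorphic R C D F K"
proof -
  obtain \<sigma> where nat_s: "natural_transformation R C D F G \<sigma>"
    and iso_s: "\<forall>X\<in>Ob C. iso_in D (FOb F X) (FOb G X) (\<sigma> X)"
    using assms(1) unfolding nat_isomorphic_def by blast
  note F = natural_transformation.axioms(1)[OF nat_s] and G = natural_transformation.axioms(2)[OF nat_s]
    and s = iso_s[rule_format] natural_transformation.component_closed[OF nat_s]
    and nats = natural_transformation.naturality[OF nat_s]
  obtain \<tau> where nat_t: "natural_transformation R C D G K \<tau>"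
    and iso_t: "\<forall>X\<in>Ob C. iso_in D (FOb G X) (FOb K X) (\<tau> X)"
    using assms(2) unfolding nat_isomorphic_def by blast
  note G2 = natural_transformation.axioms(1)[OF nat_t] and K = natural_transformation.axioms(2)[OF nat_t]
    and t = iso_t[rule_format] natural_transformation.component_closed[OF nat_t]
    and natt = natural_transformation.naturality[OF nat_t]
  interpret F: linear_functor R C D F by fact
  interpret G: linear_functor R C D G by fact
  interpret K: linear_functor R C D K by fact
  show ?thesis
  proof (rule nat_isomorphicI[OF F K, of "\<lambda>X. Cmp D (FOb F X) (FOb G X) (FOb K X) (\<tau> X) (\<sigma> X)"])
    fix X Y f assume XY: "X \<in> Ob C" "Y \<in> Ob C" and f: "f \<in> Mor C X Y"
    have "Cmp D (FOb F X) (FOb F Y) (FOb K Y) (Cmp D (FOb F Y) (FOb G Y) (FOb K Y) (\<tau> Y) (\<sigma> Y)) (FMor F X Y f)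
       = Cmp D (FOb F X) (FOb G X) (FOb K Y) (Cmp D (FOb G X) (FOb G Y) (FOb K Y) (\<tau> Y) (FMor G X Y f)) (\<sigma> X)"
      using XY f s(2) t(2) by (simp add: F.D.cmp_assoc nats)
    then show "Cmp D (FOb F X) (FOb F Y) (FOb K Y) (Cmp D (FOb F Y) (FOb G Y) (FOb K Y) (\<tau> Y) (\<sigma> Y)) (FMor F X Y f)
       = Cmp D (FOb F X) (FOb K X) (FOb K Y) (FMor K X Y f) (Cmp D (FOb F X) (FOb G X) (FOb K X) (\<tau> X) (\<sigma> X))"
      using XY f s(2) t(2) by (simp add: F.D.cmp_assoc natt)
  qed (use F.D.iso_in_cmp s t in auto)
qed

lemma nat_isomorphic_whisker_left:
  assumes "nat_isomorphic R C D F G" and K: "linear_functor R D E K"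
  shows "nat_isomorphic R C E (K \<circ>\<^sub>F F) (K \<circ>\<^sub>F G)"
proof -
  obtain \<tau> where nat_t: "natural_transformation R C D F G \<tau>"
    and iso_t: "\<forall>X\<in>Ob C. iso_in D (FOb F X) (FOb G X) (\<tau> X)"
    using assms(1) unfolding nat_isomorphic_def by blast
  note F = natural_transformation.axioms(1)[OF nat_t] and G = natural_transformation.axioms(2)[OF nat_t]
    and t = iso_t[rule_format] natural_transformation.component_closed[OF nat_t]
    and nat = natural_transformation.naturality[OF nat_t]
  interpret F: linear_functor R C D F by fact
  interpret G: linear_functor R C D G by fact
  interpret K: linear_functor R D E K by fact
  show ?thesis
    by (rule nat_isomorphicI[where \<tau> = "\<lambda>X. FMor K (FOb F X) (FOb G X) (\<tau> X)"])
       (use F G K linear_functor_comp t nat in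
         \<open>auto simp: comp_functor_def K.fmor_iso_in simp flip: K.fmor_cmp\<close>)
qed

lemma nat_isomorphic_whisker_right:
  assumes "nat_isomorphic R D E F G" and K: "linear_functor R C D K"
  shows "nat_isomorphic R C E (F \<circ>\<^sub>F K) (G \<circ>\<^sub>F K)"
proof -
  obtain \<tau> where nat_t: "natural_transformation R D E F G \<tau>"
    and iso_t: "\<forall>X\<in>Ob D. iso_in E (FOb F X) (FOb G X) (\<tau> X)"
    using assms(1) unfolding nat_isomorphic_def by blast
  note F = natural_transformation.axioms(1)[OF nat_t] and G = natural_transformation.axioms(2)[OF nat_t]
    and t = iso_t[rule_format] natural_transformation.component_closed[OF nat_t]
    and nat = natural_transformation.naturality[OF nat_t]
  interpret K: linear_functor R C D K by fact
  show ?thesis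
    by (rule nat_isomorphicI[where \<tau> = "\<lambda>X. \<tau> (FOb K X)"])
       (use F G K linear_functor_comp t nat in \<open>auto simp: comp_functor_def\<close>)
qed

lemma comp_functor_assoc: "(F \<circ>\<^sub>F G) \<circ>\<^sub>F K = F \<circ>\<^sub>F (G \<circ>\<^sub>F K)"
  by (simp add: comp_functor_def)

lemma comp_id_functor [simp]: "id_functor \<circ>\<^sub>F F = F" "F \<circ>\<^sub>F id_functor = F"
  by (simp_all add: comp_functor_def id_functor_def)


section \<open>Adjunctions as universal arrows\<close>

text \<open>For composition, transfer and uniqueness of adjunctions it is convenient to have only the
  counit, with its universal property: \<open>f \<mapsto> \<epsilon> Y \<circ> S f\<close> is a bijection from \<open>C(X, T Y)\<close> to \<open>D(S X, Y)\<close>.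
  The functor laws for \<open>T\<close> and the unit are then consequences.\<close>

text \<open>The morphism \<open>S X \<rightarrow> Y\<close> that corresponds to \<open>f : X \<rightarrow> T Y\<close>.\<close>

abbreviation "adjunct D S T \<epsilon> X Y f \<equiv>
    Cmp D (FOb S X) (FOb S (FOb T Y)) Y (\<epsilon> Y) (FMor S X (FOb T Y) f)"

locale universal_arrows = S: linear_functor R C D S
  for R :: "'r ring" and C :: "('r, 'o, 'm) lcat" and D :: "('r, 'p, 'n) lcat"
    and S :: "('o, 'm, 'p, 'n) cfunctor" +
  fixes T :: "('p, 'n, 'o, 'm) cfunctor" and \<epsilon> :: "'p \<Rightarrow> 'n"
  assumes T_ob: "Y \<in> Ob D \<Longrightarrow> FOb T Y \<in> Ob C"
    and T_mor: "\<lbrakk>Y \<in> Ob D; Y' \<in> Ob D; g \<in> Mor D Y Y'\<rbrakk> \<Longrightarrow> FMor T Y Y' g \<in> Mor C (FOb T Y) (FOb T Y')"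
    and arrow: "Y \<in> Ob D \<Longrightarrow> \<epsilon> Y \<in> Mor D (FOb S (FOb T Y)) Y"
    and arrow_natural: "\<lbrakk>Y \<in> Ob D; Y' \<in> Ob D; g \<in> Mor D Y Y'\<rbrakk> \<Longrightarrow>
      adjunct D S T \<epsilon> (FOb T Y) Y' (FMor T Y Y' g) =
      Cmp D (FOb S (FOb T Y)) Y Y' g (\<epsilon> Y)"
    and factor_ex: "\<lbrakk>X \<in> Ob C; Y \<in> Ob D; h \<in> Mor D (FOb S X) Y\<rbrakk> \<Longrightarrow>
      \<exists>f' \<in> Mor C X (FOb T Y). adjunct D S T \<epsilon> X Y f' = h"
    and factor_unique: "\<lbrakk>X \<in> Ob C; Y \<in> Ob D; f \<in> Mor C X (FOb T Y); f' \<in> Mor C X (FOb T Y);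
        adjunct D S T \<epsilon> X Y f =
        adjunct D S T \<epsilon> X Y f'\<rbrakk> \<Longrightarrow> f = f'"
begin

declare T_ob [simp] T_mor [simp] arrow [simp]

lemma right_linear_functor: "linear_functor R D C T"
proof
  fix X assume X: "X \<in> Ob D"
  show "FMor T X X (Idn D X) = Idn C (FOb T X)"
    by (rule factor_unique[OF T_ob[OF X] X]) (use X in \<open>simp_all add: arrow_natural S.fmor_idn\<close>)
next
  fix X Y Z f g assume X: "X \<in> Ob D" "Y \<in> Ob D" "Z \<in> Ob D" and f: "f \<in> Mor D X Y" "g \<in> Mor D Y Z"
  have "adjunct D S T \<epsilon> (FOb T X) Z (Cmp C (FOb T X) (FOb T Y) (FOb T Z) (FMor T Y Z g) (FMor T X Y f)) =
     Cmp D (FOb S (FOb T X)) (FOb S (FOb T Y)) Z (adjunct D S T \<epsilon> (FOb T Y) Z (FMor T Y Z g)) (FMor S (FOb T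
         X) (FOb T Y) (FMor T X Y f))"
    using X f by (simp add: S.fmor_cmp S.D.cmp_assoc)
  also have "\<dots> = Cmp D (FOb S (FOb T X)) X Z (Cmp D X Y Z g f) (\<epsilon> X)"
    using X f by (simp add: arrow_natural S.D.cmp_assoc)
  finally show "FMor T X Z (Cmp D X Y Z g f) =
     Cmp C (FOb T X) (FOb T Y) (FOb T Z) (FMor T Y Z g) (FMor T X Y f)"
    by (intro factor_unique[OF T_ob[OF X(1)] X(3)]) (use X f in \<open>simp_all add: arrow_natural\<close>)
next
  fix X Y f g assume X: "X \<in> Ob D" "Y \<in> Ob D" and f: "f \<in> Mor D X Y" "g \<in> Mor D X Y"
  show "FMor T X Y (f \<oplus>\<^bsub>Hom D X Y\<^esub> g) = FMor T X Y f \<oplus>\<^bsub>Hom C (FOb T X) (FOb T Y)\<^esub> FMor T X Y g"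
    by (rule factor_unique[OF T_ob[OF X(1)] X(2)])
       (use X f in \<open>simp_all add: arrow_natural S.fmor_add S.D.cmp_add_left S.D.cmp_add_right\<close>)
next
  fix X Y r f assume X: "X \<in> Ob D" "Y \<in> Ob D" and f: "r \<in> carrier R" "f \<in> Mor D X Y"
  show "FMor T X Y (r \<odot>\<^bsub>Hom D X Y\<^esub> f) = r \<odot>\<^bsub>Hom C (FOb T X) (FOb T Y)\<^esub> FMor T X Y f"
    by (rule factor_unique[OF T_ob[OF X(1)] X(2)])
       (use X f in \<open>simp_all add: arrow_natural S.fmor_smult S.D.cmp_smult_left S.D.cmp_smult_right\<close>)
qed (use T_ob T_mor in auto)

lemma adjunction_exists: "\<exists>\<eta>. adjunction R C D S T \<eta> \<epsilon>"
proof -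
  interpret T: linear_functor R D C T by (rule right_linear_functor)
  have "\<exists>\<eta>. \<forall>X\<in>Ob C. \<eta> X \<in> Mor C X (FOb T (FOb S X)) \<and>
     adjunct D S T \<epsilon> X (FOb S X) (\<eta> X) = Idn D (FOb S X)"
  proof (intro bchoice ballI)
    fix X assume X: "X \<in> Ob C"
    show "\<exists>y. y \<in> Mor C X (FOb T (FOb S X)) \<and>
     adjunct D S T \<epsilon> X (FOb S X) y = Idn D (FOb S X)"
      using factor_ex[of X "FOb S X" "Idn D (FOb S X)"] X by auto
  qed
  then obtain \<eta> where \<eta>: "\<eta> X \<in> Mor C X (FOb T (FOb S X))"
     "adjunct D S T \<epsilon> X (FOb S X) (\<eta> X) = Idn D (FOb S X)"
    if "X \<in> Ob C" for X by metis
  have TS: "linear_functor R C C (T \<circ>\<^sub>F S)" and ST: "linear_functor R D D (S \<circ>\<^sub>F T)"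
    by (rule linear_functor_comp[OF S.linear_functor_axioms T.linear_functor_axioms]
             linear_functor_comp[OF T.linear_functor_axioms S.linear_functor_axioms])+
  have "adjunction R C D S T \<eta> \<epsilon>"
  proof (intro adjunction.intro natural_transformation.intro natural_transformation_axioms.intro
      adjunction_axioms.intro TS ST linear_functor_id S.linear_functor_axioms
      T.linear_functor_axioms S.C.linear_category_axioms S.D.linear_category_axioms)
    fix X Y f assume X: "X \<in> Ob C" "Y \<in> Ob C" and f: "f \<in> Mor C X Y"
    have "adjunct D S T \<epsilon> X (FOb S Y) (Cmp C X (FOb T (FOb S X)) (FOb T (FOb S Y)) (FMor T (FOb S X) (FOb S Y)
        (FMor S X Y f)) (\<eta> X)) =
      Cmp D (FOb S X) (FOb S (FOb T (FOb S X))) (FOb S Y)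
         (adjunct D S T \<epsilon> (FOb T (FOb S X)) (FOb S Y) (FMor T (FOb S X) (FOb S Y) (FMor S X Y f)))
         (FMor S X (FOb T (FOb S X)) (\<eta> X))"
      using X f \<eta> by (simp add: S.fmor_cmp S.D.cmp_assoc)
    also have "\<dots> = FMor S X Y f"
      using X f \<eta> by (simp add: arrow_natural S.D.cmp_assoc)
    also have "\<dots> = Cmp D (FOb S X) (FOb S Y) (FOb S Y)
       (adjunct D S T \<epsilon> Y (FOb S Y) (\<eta> Y))
       (FMor S X Y f)"
      using X f \<eta> by simp
    also have "\<dots> = adjunct D S T \<epsilon> X (FOb S Y) (Cmp C X Y (FOb T (FOb S Y)) (\<eta> Y) f)"
      using X f \<eta>(1) by (simp add: S.fmor_cmp S.D.cmp_assoc)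
    finally have "Cmp C X (FOb T (FOb S X)) (FOb T (FOb S Y)) (FMor T (FOb S X) (FOb S Y) (FMor S X Y f)) (\<eta> X) =
        Cmp C X Y (FOb T (FOb S Y)) (\<eta> Y) f"
      by (intro factor_unique[of X "FOb S Y"]) (use X f \<eta>(1) in simp_all)
    then show "Cmp C (FOb id_functor X) (FOb id_functor Y) (FOb (T \<circ>\<^sub>F S) Y) (\<eta> Y) (FMor id_functor X Y f) =
        Cmp C (FOb id_functor X) (FOb (T \<circ>\<^sub>F S) X) (FOb (T \<circ>\<^sub>F S) Y) (FMor (T \<circ>\<^sub>F S) X Y f) (\<eta> X)"
      by (simp add: comp_functor_def id_functor_def)
  next
    fix Y assume Y: "Y \<in> Ob D"
    have "adjunct D S T \<epsilon> (FOb T Y) Y (Cmp C (FOb T Y) (FOb T (FOb S (FOb T Y))) (FOb T Y) (FMor T (FOb S (FOb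
        T Y)) Y (\<epsilon> Y)) (\<eta> (FOb T Y))) =
      Cmp D (FOb S (FOb T Y)) (FOb S (FOb T (FOb S (FOb T Y)))) Y
       (adjunct D S T \<epsilon> (FOb T (FOb S (FOb T Y))) Y (FMor T (FOb S (FOb T Y)) Y (\<epsilon> Y)))
       (FMor S (FOb T Y) (FOb T (FOb S (FOb T Y))) (\<eta> (FOb T Y)))"
      using Y \<eta> by (simp add: S.fmor_cmp S.D.cmp_assoc)
    also have "\<dots> = \<epsilon> Y"
      using Y \<eta> by (simp add: arrow_natural S.D.cmp_assoc)
    finally show "Cmp C (FOb T Y) (FOb T (FOb S (FOb T Y))) (FOb T Y) (FMor T (FOb S (FOb T Y)) Y (\<epsilon> Y)) (\<eta>
        (FOb T Y)) =
       Idn C (FOb T Y)"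
      by (intro factor_unique[of "FOb T Y" Y]) (use Y \<eta> in \<open>simp_all add: S.fmor_idn\<close>)
  qed (auto simp: \<eta> comp_functor_def id_functor_def arrow_natural)
  then show ?thesis by blast
qed

end

lemma adjunction_universal_arrows:
  assumes "adjunction R C D S T \<eta> \<epsilon>"
  shows "universal_arrows R C D S T \<epsilon>"
proof -
  interpret adjunction R C D S T \<eta> \<epsilon> by fact
  have \<epsilon>: "\<epsilon> Y \<in> Mor D (FOb S (FOb T Y)) Y" if "Y \<in> Ob D" for Y
    using counit.component_closed[OF that] by (simp add: comp_functor_def id_functor_def)
  have \<eta>: "\<eta> X \<in> Mor C X (FOb T (FOb S X))" if "X \<in> Ob C" for X
    using unit.component_closed[OF that] by (simp add: comp_functor_def id_functor_def)
  have nat_\<epsilon>: "adjunct D S T \<epsilon> (FOb T X) Y (FMor T X Y f) =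
      Cmp D (FOb S (FOb T X)) X Y f (\<epsilon> X)" if "X \<in> Ob D" "Y \<in> Ob D" "f \<in> Mor D X Y" for X Y f
    using counit.naturality[OF that] by (simp add: comp_functor_def id_functor_def)
  have nat_\<eta>: "Cmp C X Y (FOb T (FOb S Y)) (\<eta> Y) f =
     Cmp C X (FOb T (FOb S X)) (FOb T (FOb S Y)) (FMor T (FOb S X) (FOb S Y) (FMor S X Y f)) (\<eta> X)"
    if "X \<in> Ob C" "Y \<in> Ob C" "f \<in> Mor C X Y" for X Y f
    using unit.naturality[OF that] by (simp add: comp_functor_def id_functor_def)
  show ?thesis
  proof
    fix X Y f assume X: "X \<in> Ob C" "Y \<in> Ob D" and f: "f \<in> Mor D (FOb S X) Y"
    have "adjunct D S T \<epsilon> X Y (Cmp C X (FOb T (FOb S X)) (FOb T Y) (FMor T (FOb S X) Y f) (\<eta> X)) =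
      Cmp D (FOb S X) (FOb S (FOb T (FOb S X))) Y (adjunct D S T \<epsilon> (FOb T (FOb S X)) Y (FMor T (FOb S X) Y f))
          (FMor S X (FOb T (FOb S X)) (\<eta> X))"
      using X f \<eta> \<epsilon> by (simp add: S.fmor_cmp S.D.cmp_assoc)
    also have "\<dots> = f"
      using X f \<eta> \<epsilon> by (simp add: nat_\<epsilon> S.D.cmp_assoc triangle_left)
    finally show "\<exists>f'\<in>Mor C X (FOb T Y). adjunct D S T \<epsilon> X Y f' = f"
      using X f \<eta> by (intro bexI[of _ "Cmp C X (FOb T (FOb S X)) (FOb T Y) (FMor T (FOb S X) Y f) (\<eta> X)"]) simp_all
  next
    fix X Y f f' assume X: "X \<in> Ob C" "Y \<in> Ob D" and f: "f \<in> Mor C X (FOb T Y)" "f' \<in> Mor C X (FOb T Y)"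
      and eq: "adjunct D S T \<epsilon> X Y f =
        adjunct D S T \<epsilon> X Y f'"
    have "g = Cmp C X (FOb T (FOb S X)) (FOb T Y) (FMor T (FOb S X) Y
       (adjunct D S T \<epsilon> X Y g)) (\<eta> X)"
      if g: "g \<in> Mor C X (FOb T Y)" for g
    proof -
      have "g = Cmp C X (FOb T Y) (FOb T Y) (Cmp C (FOb T Y) (FOb T (FOb S (FOb T Y))) (FOb T Y)
        (FMor T (FOb S (FOb T Y)) Y (\<epsilon> Y)) (\<eta> (FOb T Y))) g"
        using X g by (simp add: triangle_right)
      also have "\<dots> = Cmp C X (FOb T (FOb S X)) (FOb T Y) (FMor T (FOb S X) Y
       (adjunct D S T \<epsilon> X Y g)) (\<eta> X)"
        using X g \<epsilon> \<eta> by (simp add: S.C.cmp_assoc nat_\<eta> T.fmor_cmp)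
      finally show ?thesis .
    qed
    from this[OF f(1)] this[OF f(2)] eq show "f = f'" by simp
  qed (use \<epsilon> nat_\<epsilon> in auto)
qed

lemma adjoint_pair_iff: "adjoint_pair R C D S T \<longleftrightarrow> (\<exists>\<epsilon>. universal_arrows R C D S T \<epsilon>)"
  unfolding adjoint_pair_def
  using adjunction_universal_arrows universal_arrows.adjunction_exists by metis

text \<open>A right adjoint may be given by objects and counit alone: the universal property determines its
  values on morphisms.\<close>

lemma right_adjoint_from_objects:
  assumes "linear_functor R C D S"
    and ob: "\<And>Y. Y \<in> Ob D \<Longrightarrow> t Y \<in> Ob C"
    and arrow: "\<And>Y. Y \<in> Ob D \<Longrightarrow> \<epsilon> Y \<in> Mor D (FOb S (t Y)) Y"
    and ex: "\<And>X Y f. \<lbrakk>X \<in> Ob C; Y \<in> Ob D; f \<in> Mor D (FOb S X) Y\<rbrakk> \<Longrightarrow>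
      \<exists>f' \<in> Mor C X (t Y). Cmp D (FOb S X) (FOb S (t Y)) Y (\<epsilon> Y) (FMor S X (t Y) f') = f"
    and unique: "\<And>X Y f f'. \<lbrakk>X \<in> Ob C; Y \<in> Ob D; f \<in> Mor C X (t Y); f' \<in> Mor C X (t Y);
        Cmp D (FOb S X) (FOb S (t Y)) Y (\<epsilon> Y) (FMor S X (t Y) f) =
        Cmp D (FOb S X) (FOb S (t Y)) Y (\<epsilon> Y) (FMor S X (t Y) f')\<rbrakk> \<Longrightarrow> f = f'"
  shows "\<exists>T. FOb T = t \<and> universal_arrows R C D S T \<epsilon>"
proof -
  interpret S: linear_functor R C D S by fact
  define T where "T = \<lparr>FOb = t, FMor = (\<lambda>X Y f. SOME f'. f' \<in> Mor C (t X) (t Y) \<and>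
    Cmp D (FOb S (t X)) (FOb S (t Y)) Y (\<epsilon> Y) (FMor S (t X) (t Y) f') = Cmp D (FOb S (t X)) X Y f (\<epsilon> X))\<rparr>"
  have T: "FMor T X Y f \<in> Mor C (t X) (t Y) \<and>
      Cmp D (FOb S (t X)) (FOb S (t Y)) Y (\<epsilon> Y) (FMor S (t X) (t Y) (FMor T X Y f)) = Cmp D (FOb S (t X)) X Y f (\<epsilon> X)"
    if "X \<in> Ob D" "Y \<in> Ob D" "f \<in> Mor D X Y" for X Y f
    unfolding T_def cfunctor.simps
    by (rule someI_ex) (use ex[of "t X" Y "Cmp D (FOb S (t X)) X Y f (\<epsilon> X)"] that ob arrow in auto)
  have "FOb T = t" by (simp add: T_def)
  moreover have "universal_arrows R C D S T \<epsilon>"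
  proof
    show "f = f'" if "X \<in> Ob C" "Y \<in> Ob D" "f \<in> Mor C X (FOb T Y)" "f' \<in> Mor C X (FOb T Y)"
        "adjunct D S T \<epsilon> X Y f =
        adjunct D S T \<epsilon> X Y f'" for X Y f f'
      using unique that \<open>FOb T = t\<close> by auto
  qed (use T ob arrow ex \<open>FOb T = t\<close> in auto)
  ultimately show ?thesis by blast
qed

lemma universal_arrows_comp:
  assumes "universal_arrows R C D S T \<epsilon>" "universal_arrows R D E S' T' \<epsilon>'"
  shows "universal_arrows R C E (S' \<circ>\<^sub>F S) (T \<circ>\<^sub>F T')
    (\<lambda>Z. adjunct E S' T' \<epsilon>' (FOb S (FOb T (FOb T' Z))) Z (\<epsilon> (FOb T' Z)))"
    (is "universal_arrows R C E ?S ?T ?\<epsilon>")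
proof -
  interpret U: universal_arrows R C D S T \<epsilon> by fact
  interpret U': universal_arrows R D E S' T' \<epsilon>' by fact
  have key: "adjunct E ?S ?T ?\<epsilon> X Z f =
      adjunct E S' T' \<epsilon>' (FOb S X) Z (adjunct D S T \<epsilon> X (FOb T' Z) f)"
    if "X \<in> Ob C" "Z \<in> Ob E" "f \<in> Mor C X (FOb ?T Z)" for X Z f
    using that by (simp add: comp_functor_def U'.S.fmor_cmp U'.S.D.cmp_assoc)
  have "linear_functor R C E ?S"
    by (rule linear_functor_comp[OF U.S.linear_functor_axioms U'.S.linear_functor_axioms])
  then show ?thesis
  proof (intro universal_arrows.intro universal_arrows_axioms.intro)
    fix X Y f assume X: "X \<in> Ob E" "Y \<in> Ob E" and f: "f \<in> Mor E X Y"
    have T: "FMor ?T X Y f \<in> Mor C (FOb ?T X) (FOb ?T Y)" "FOb ?T X \<in> Ob C"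
      using X f by (simp_all add: comp_functor_def)
    have "adjunct E ?S ?T ?\<epsilon> (FOb ?T X) Y (FMor ?T X Y f) =
      adjunct E S' T' \<epsilon>' (FOb S (FOb ?T X)) Y (Cmp D (FOb S (FOb ?T X)) (FOb T' X) (FOb T' Y) (FMor T' X Y f)
          (\<epsilon> (FOb T' X)))"
      using X f T by (subst key) (simp_all add: comp_functor_def U.arrow_natural)
    also have "\<dots> = Cmp E (FOb S' (FOb S (FOb ?T X))) (FOb S' (FOb T' X)) Y
        (adjunct E S' T' \<epsilon>' (FOb T' X) Y (FMor T' X Y f))
        (FMor S' (FOb S (FOb ?T X)) (FOb T' X) (\<epsilon> (FOb T' X)))"
      using X f by (simp add: comp_functor_def U'.S.fmor_cmp U'.S.D.cmp_assoc)
    also have "\<dots> = Cmp E (FOb ?S (FOb ?T X)) X Y f (?\<epsilon> X)"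
      using X f by (simp add: comp_functor_def U'.arrow_natural U'.S.D.cmp_assoc)
    finally show "adjunct E ?S ?T ?\<epsilon> (FOb ?T X) Y (FMor ?T X Y f) =
      Cmp E (FOb ?S (FOb ?T X)) X Y f (?\<epsilon> X)" .
  next
    fix X Z f assume X: "X \<in> Ob C" "Z \<in> Ob E" and f: "f \<in> Mor E (FOb ?S X) Z"
    obtain g where g: "g \<in> Mor D (FOb S X) (FOb T' Z)"
       "adjunct E S' T' \<epsilon>' (FOb S X) Z g = f"
      using U'.factor_ex[of "FOb S X" Z f] X f by (auto simp: comp_functor_def)
    obtain h where h: "h \<in> Mor C X (FOb T (FOb T' Z))"
       "adjunct D S T \<epsilon> X (FOb T' Z) h = g"
      using U.factor_ex[of X "FOb T' Z" g] X g by auto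
    show "\<exists>f'\<in>Mor C X (FOb ?T Z). adjunct E ?S ?T ?\<epsilon> X Z f' = f"
      by (rule bexI[of _ h], subst key) (use X g h in \<open>auto simp: comp_functor_def\<close>)
  next
    fix X Z f f' assume X: "X \<in> Ob C" "Z \<in> Ob E" and f: "f \<in> Mor C X (FOb ?T Z)" "f' \<in> Mor C X (FOb ?T Z)"
     and eq0: "adjunct E ?S ?T ?\<epsilon> X Z f =
       adjunct E ?S ?T ?\<epsilon> X Z f'"
    note eq = eq0[unfolded key[OF X f(1)] key[OF X f(2)]]
    have f': "f \<in> Mor C X (FOb T (FOb T' Z))" "f' \<in> Mor C X (FOb T (FOb T' Z))"
      using f by (simp_all add: comp_functor_def)
    show "f = f'"
      by (rule U.factor_unique[OF X(1) _ f'], simp add: X, rule U'.factor_unique[OF _ X(2) _ _ eq])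
         (use X f' in simp_all)
  qed (auto simp: comp_functor_def)
qed

lemma adjoint_pair_comp:
  "\<lbrakk>adjoint_pair R C D S T; adjoint_pair R D E S' T'\<rbrakk> \<Longrightarrow> adjoint_pair R C E (S' \<circ>\<^sub>F S) (T \<circ>\<^sub>F T')"
  unfolding adjoint_pair_iff using universal_arrows_comp by blast

lemma adjoint_pair_left_iso:
  assumes "adjoint_pair R C D S T" and "nat_isomorphic R C D S' S"
  shows "adjoint_pair R C D S' T"
proof -
  obtain \<epsilon> where "universal_arrows R C D S T \<epsilon>"
    using assms(1) unfolding adjoint_pair_iff by blast
  then interpret U: universal_arrows R C D S T \<epsilon> .
  obtain \<sigma> where nat_s: "natural_transformation R C D S' S \<sigma>"
    and iso_s: "\<forall>X\<in>Ob C. iso_in D (FOb S' X) (FOb S X) (\<sigma> X)"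
    using assms(2) unfolding nat_isomorphic_def by blast
  note S' = natural_transformation.axioms(1)[OF nat_s] and S = natural_transformation.axioms(2)[OF nat_s]
    and s = iso_s[rule_format] natural_transformation.component_closed[OF nat_s]
    and nat = natural_transformation.naturality[OF nat_s]
  interpret S': linear_functor R C D S' by fact
  define \<epsilon>' where "\<epsilon>' Y = Cmp D (FOb S' (FOb T Y)) (FOb S (FOb T Y)) Y (\<epsilon> Y) (\<sigma> (FOb T Y))" for Y
  have key: "adjunct D S' T \<epsilon>' X Y f =
     Cmp D (FOb S' X) (FOb S X) Y (adjunct D S T \<epsilon> X Y f) (\<sigma> X)"
    if "X \<in> Ob C" "Y \<in> Ob D" "f \<in> Mor C X (FOb T Y)" for X Y f
    using that s(2) by (simp add: \<epsilon>'_def U.S.D.cmp_assoc nat)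
  have "universal_arrows R C D S' T \<epsilon>'"
  proof
    fix X Y f assume X: "X \<in> Ob D" "Y \<in> Ob D" and f: "f \<in> Mor D X Y"
    show "adjunct D S' T \<epsilon>' (FOb T X) Y (FMor T X Y f) =
        Cmp D (FOb S' (FOb T X)) X Y f (\<epsilon>' X)"
      by (subst key) (use X f s(2) in \<open>simp_all add: U.arrow_natural \<epsilon>'_def U.S.D.cmp_assoc\<close>)
  next
    fix X Y f assume X: "X \<in> Ob C" "Y \<in> Ob D" and f: "f \<in> Mor D (FOb S' X) Y"
    obtain s' where s': "s' \<in> Mor D (FOb S X) (FOb S' X)"
       "Cmp D (FOb S' X) (FOb S X) (FOb S' X) s' (\<sigma> X) = Idn D (FOb S' X)"
      using s(1)[OF X(1)] U.S.D.iso_inE by metis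
    obtain f' where f': "f' \<in> Mor C X (FOb T Y)" "adjunct D S T \<epsilon> X Y f' =
       Cmp D (FOb S X) (FOb S' X) Y f s'"
      using U.factor_ex[of X Y "Cmp D (FOb S X) (FOb S' X) Y f s'"] X f s'(1) by auto
    show "\<exists>f'\<in>Mor C X (FOb T Y). adjunct D S' T \<epsilon>' X Y f' = f"
      by (rule bexI[OF _ f'(1)]) (use X f s' f' s(2) in \<open>simp add: key U.S.D.cmp_assoc\<close>)
  next
    fix X Y f f' assume X: "X \<in> Ob C" "Y \<in> Ob D" and f: "f \<in> Mor C X (FOb T Y)" "f' \<in> Mor C X (FOb T Y)"
     and eq0: "adjunct D S' T \<epsilon>' X Y f =
       adjunct D S' T \<epsilon>' X Y f'"
    note eq = eq0[unfolded key[OF X f(1)] key[OF X f(2)]]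
    show "f = f'"
      by (rule U.factor_unique[OF X f], rule U.S.D.iso_cancel_right[OF _ _ _ s(1)[OF X(1)] _ _ eq]) (use X f
          in simp_all)
  qed (use s(2) in \<open>auto simp: \<epsilon>'_def\<close>)
  then show ?thesis
    unfolding adjoint_pair_iff by blast
qed

text \<open>The isomorphism is the factorization of one counit through the other.\<close>

lemma right_adjoint_unique:
  assumes "adjoint_pair R C D S T" and "adjoint_pair R C D S T'"
  shows "nat_isomorphic R D C T T'"
proof -
  obtain \<epsilon> \<epsilon>' where "universal_arrows R C D S T \<epsilon>" "universal_arrows R C D S T' \<epsilon>'"
    using assms unfolding adjoint_pair_iff by blast
  then interpret U: universal_arrows R C D S T \<epsilon> + U': universal_arrows R C D S T' \<epsilon>' .
  interpret T: linear_functor R D C T by (rule U.right_linear_functor)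
  interpret T': linear_functor R D C T' by (rule U'.right_linear_functor)
  have "\<exists>\<theta>. \<forall>Y\<in>Ob D. \<theta> Y \<in> Mor C (FOb T Y) (FOb T' Y) \<and> adjunct D S T' \<epsilon>' (FOb T Y) Y (\<theta> Y) = \<epsilon> Y"
    by (intro bchoice ballI) (use U'.factor_ex in \<open>metis U.arrow U.T_ob\<close>)
  then obtain \<theta> where t: "\<theta> Y \<in> Mor C (FOb T Y) (FOb T' Y)"
     "adjunct D S T' \<epsilon>' (FOb T Y) Y (\<theta> Y) = \<epsilon> Y"
    if "Y \<in> Ob D" for Y by metis
  have "\<exists>\<theta>. \<forall>Y\<in>Ob D. \<theta> Y \<in> Mor C (FOb T' Y) (FOb T Y) \<and> adjunct D S T \<epsilon> (FOb T' Y) Y (\<theta> Y) = \<epsilon>' Y"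
    by (intro bchoice ballI) (use U.factor_ex in \<open>metis U'.arrow U'.T_ob\<close>)
  then obtain \<theta>' where t': "\<theta>' Y \<in> Mor C (FOb T' Y) (FOb T Y)"
     "adjunct D S T \<epsilon> (FOb T' Y) Y (\<theta>' Y) = \<epsilon>' Y"
    if "Y \<in> Ob D" for Y by metis
  show ?thesis
  proof (rule nat_isomorphicI[OF U.right_linear_functor U'.right_linear_functor, of \<theta>])
    fix Y assume Y: "Y \<in> Ob D"
    have "Cmp C (FOb T Y) (FOb T' Y) (FOb T Y) (\<theta>' Y) (\<theta> Y) = Idn C (FOb T Y)"
      by (rule U.factor_unique[of "FOb T Y" Y])
         (use Y t t' in \<open>simp_all add: U.S.fmor_cmp U.S.fmor_idn flip: U.S.D.cmp_assoc\<close>)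
    moreover have "Cmp C (FOb T' Y) (FOb T Y) (FOb T' Y) (\<theta> Y) (\<theta>' Y) = Idn C (FOb T' Y)"
      by (rule U'.factor_unique[of "FOb T' Y" Y])
         (use Y t t' in \<open>simp_all add: U.S.fmor_cmp U.S.fmor_idn flip: U.S.D.cmp_assoc\<close>)
    ultimately show "iso_in C (FOb T Y) (FOb T' Y) (\<theta> Y)"
      unfolding iso_in_def using t t' Y by blast
  next
    fix X Y f assume X: "X \<in> Ob D" "Y \<in> Ob D" and f: "f \<in> Mor D X Y"
    have "adjunct D S T' \<epsilon>' (FOb T X) Y (Cmp C (FOb T X) (FOb T Y) (FOb T' Y) (\<theta> Y) (FMor T X Y f)) =
      Cmp D (FOb S (FOb T X)) (FOb S (FOb T Y)) Y (adjunct D S T' \<epsilon>' (FOb T Y) Y (\<theta> Y)) (FMor S (FOb T X) (FOb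
          T Y) (FMor T X Y f))"
      using X f t(1) by (simp add: U.S.fmor_cmp U.S.D.cmp_assoc)
    also have "\<dots> = Cmp D (FOb S (FOb T X)) X Y f (adjunct D S T' \<epsilon>' (FOb T X) X (\<theta> X))"
      using X f by (simp add: t U.arrow_natural)
    also have "\<dots> = Cmp D (FOb S (FOb T X)) (FOb S (FOb T' X)) Y (Cmp D (FOb S (FOb T' X)) X Y f (\<epsilon>' X))
        (FMor S (FOb T X) (FOb T' X) (\<theta> X))"
      using X f t(1) by (simp add: U.S.D.cmp_assoc)
    also have "\<dots> = adjunct D S T' \<epsilon>' (FOb T X) Y (Cmp C (FOb T X) (FOb T' X) (FOb T' Y) (FMor T' X Y f) (\<theta> X))"
      using X f t(1) by (simp add: U.S.fmor_cmp U.S.D.cmp_assoc flip: U'.arrow_natural)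
    finally show "Cmp C (FOb T X) (FOb T Y) (FOb T' Y) (\<theta> Y) (FMor T X Y f) =
        Cmp C (FOb T X) (FOb T' X) (FOb T' Y) (FMor T' X Y f) (\<theta> X)"
      by (intro U'.factor_unique[of "FOb T X" Y]) (use X f t(1) in simp_all)
  qed
qed


section \<open>Equivalences\<close>

definition fully_faithful ::
  "('r, 'o, 'm) lcat \<Rightarrow> ('r, 'p, 'n) lcat \<Rightarrow> ('o, 'm, 'p, 'n) cfunctor \<Rightarrow> bool" where
  "fully_faithful C D F \<longleftrightarrow>
    (\<forall>X \<in> Ob C. \<forall>Y \<in> Ob C. bij_betw (FMor F X Y) (Mor C X Y) (Mor D (FOb F X) (FOb F Y)))"

definition essentially_surjective ::
  "('r, 'o, 'm) lcat \<Rightarrow> ('r, 'p, 'n) lcat \<Rightarrow> ('o, 'm, 'p, 'n) cfunctor \<Rightarrow> bool" where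
  "essentially_surjective C D F \<longleftrightarrow> (\<forall>Y \<in> Ob D. \<exists>X \<in> Ob C. isomorphic_in D (FOb F X) Y)"

lemma fully_faithful_inj:
  "\<lbrakk>fully_faithful C D F; X \<in> Ob C; Y \<in> Ob C; f \<in> Mor C X Y; g \<in> Mor C X Y; FMor F X Y f = FMor F X Y g\<rbrakk> \<Longrightarrow> f = g"
  unfolding fully_faithful_def bij_betw_def inj_on_def by blast

lemma fully_faithful_surj:
  assumes "fully_faithful C D F" "X \<in> Ob C" "Y \<in> Ob C" "g \<in> Mor D (FOb F X) (FOb F Y)"
  obtains f where "f \<in> Mor C X Y" "FMor F X Y f = g"
  using assms unfolding fully_faithful_def bij_betw_def by (metis imageE)

lemma fully_faithful_comp:
  assumes "linear_functor R C D F" "fully_faithful C D F" "fully_faithful D E G"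
  shows "fully_faithful C E (G \<circ>\<^sub>F F)"
proof -
  interpret F: linear_functor R C D F by fact
  show ?thesis
    unfolding fully_faithful_def
  proof (intro ballI)
    fix X Y assume X: "X \<in> Ob C" "Y \<in> Ob C"
    have "bij_betw (FMor G (FOb F X) (FOb F Y) \<circ> FMor F X Y) (Mor C X Y) (Mor E (FOb G (FOb F X)) (FOb G (FOb F Y)))"
      using X assms(2,3) unfolding fully_faithful_def by (intro bij_betw_trans) auto
    then show "bij_betw (FMor (G \<circ>\<^sub>F F) X Y) (Mor C X Y) (Mor E (FOb (G \<circ>\<^sub>F F) X) (FOb (G \<circ>\<^sub>F F) Y))"
      by (simp add: comp_functor_def comp_def)
  qed
qed

lemma essentially_surjective_comp:
  assumes "linear_functor R C D F" "linear_functor R D E G"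
    "essentially_surjective C D F" "essentially_surjective D E G"
  shows "essentially_surjective C E (G \<circ>\<^sub>F F)"
  unfolding essentially_surjective_def
proof
  interpret F: linear_functor R C D F by fact
  interpret G: linear_functor R D E G by fact
  fix Z assume Z: "Z \<in> Ob E"
  obtain Y where Y: "Y \<in> Ob D" "isomorphic_in E (FOb G Y) Z"
    using Z assms(4) unfolding essentially_surjective_def by blast
  obtain X where X: "X \<in> Ob C" "isomorphic_in D (FOb F X) Y"
    using Y assms(3) unfolding essentially_surjective_def by blast
  have "isomorphic_in E (FOb G (FOb F X)) Z"
    using G.D.isomorphic_in_trans[OF _ _ Z G.fob_isomorphic_in[OF _ _ X(2)] Y(2)] X(1) Y(1) by simp
  then show "\<exists>X\<in>Ob C. isomorphic_in E (FOb (G \<circ>\<^sub>F F) X) Z"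
    using X(1) by (auto simp: comp_functor_def)
qed

lemma fully_faithful_reflects_iso:
  assumes "linear_functor R C D F" "fully_faithful C D F"
    and X: "X \<in> Ob C" "Y \<in> Ob C" and f: "f \<in> Mor C X Y" "iso_in D (FOb F X) (FOb F Y) (FMor F X Y f)"
  shows "iso_in C X Y f"
proof -
  interpret F: linear_functor R C D F by fact
  obtain g where g: "g \<in> Mor D (FOb F Y) (FOb F X)"
    "Cmp D (FOb F X) (FOb F Y) (FOb F X) g (FMor F X Y f) = Idn D (FOb F X)"
    "Cmp D (FOb F Y) (FOb F X) (FOb F Y) (FMor F X Y f) g = Idn D (FOb F Y)"
    using f(2) F.D.iso_inE by metis
  obtain h where h: "h \<in> Mor C Y X" "FMor F Y X h = g"
    using fully_faithful_surj[OF assms(2) X(2,1) g(1)] by blast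
  have "Cmp C X Y X h f = Idn C X"
    by (rule fully_faithful_inj[OF assms(2) X(1) X(1)]) (use X f h g in \<open>simp_all add: F.fmor_cmp F.fmor_idn\<close>)
  moreover have "Cmp C Y X Y f h = Idn C Y"
    by (rule fully_faithful_inj[OF assms(2) X(2) X(2)]) (use X f h g in \<open>simp_all add: F.fmor_cmp F.fmor_idn\<close>)
  ultimately show ?thesis
    unfolding iso_in_def using f(1) h(1) by blast
qed

lemma faithful_of_retraction:
  fixes C :: "('r, 'o, 'm) lcat" and D :: "('r, 'p, 'n) lcat"
  assumes F: "linear_functor R C D F" and iso: "nat_isomorphic R C C (K \<circ>\<^sub>F F) id_functor"
    and X: "X \<in> Ob C" "Y \<in> Ob C" "f \<in> Mor C X Y" "g \<in> Mor C X Y" "FMor F X Y f = FMor F X Y g"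
  shows "f = g"
proof -
  obtain \<tau> where nat_t: "natural_transformation R C C (K \<circ>\<^sub>F F) id_functor \<tau>"
    and iso_t: "\<forall>X\<in>Ob C. iso_in C (FOb (K \<circ>\<^sub>F F) X) (FOb (id_functor :: ('o, 'm, 'o, 'm) cfunctor) X) (\<tau> X)"
    using iso unfolding nat_isomorphic_def by blast
  note KF = natural_transformation.axioms(1)[OF nat_t] and IdF = natural_transformation.axioms(2)[OF nat_t]
    and t = iso_t[rule_format] natural_transformation.component_closed[OF nat_t]
    and nat = natural_transformation.naturality[OF nat_t]
  interpret F: linear_functor R C D F by fact
  interpret KF: linear_functor R C C "K \<circ>\<^sub>F F" by fact
  have KX: "FOb K (FOb F X) \<in> Ob C" and tX: "iso_in C (FOb K (FOb F X)) X (\<tau> X)"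
    using KF.fob_closed[OF X(1)] t(1)[OF X(1)] by (simp_all add: comp_functor_def id_functor_def)
  show ?thesis
    by (rule F.C.iso_cancel_right[OF KX X(1,2) tX X(3,4)])
       (use nat[OF X(1-3)] nat[OF X(1,2,4)] X(5) in \<open>simp add: id_functor_def comp_functor_def\<close>)
qed

text \<open>A preimage of \<open>g : F X \<rightarrow> F Y\<close> is the conjugate \<open>f\<close> of \<open>K g\<close> by the isomorphisms \<open>K F X \<rightarrow> X\<close> and
  \<open>K F Y \<rightarrow> Y\<close>; then \<open>K F f = K g\<close>, and \<open>F f = g\<close> because \<open>K\<close> is faithful as well.\<close>

lemma equivalence_functorD:
  fixes C :: "('r, 'o, 'm) lcat" and D :: "('r, 'p, 'n) lcat"
  assumes "equivalence_functor R C D F"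
  shows "linear_functor R C D F" "fully_faithful C D F" "essentially_surjective C D F"
proof -
  obtain K where F: "linear_functor R C D F" and K: "linear_functor R D C K"
    and KF: "nat_isomorphic R C C (K \<circ>\<^sub>F F) id_functor" and FK: "nat_isomorphic R D D (F \<circ>\<^sub>F K) id_functor"
    using assms unfolding equivalence_functor_def by blast
  interpret F: linear_functor R C D F by fact
  interpret K: linear_functor R D C K by fact
  show "linear_functor R C D F" by fact
  show "fully_faithful C D F"
    unfolding fully_faithful_def bij_betw_def
  proof (intro ballI conjI)
    fix X Y assume X: "X \<in> Ob C" "Y \<in> Ob C"
    show "inj_on (FMor F X Y) (Mor C X Y)"
      using faithful_of_retraction[OF F KF X] by (auto intro: inj_onI)
    show "FMor F X Y ` Mor C X Y = Mor D (FOb F X) (FOb F Y)"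
    proof
      show "FMor F X Y ` Mor C X Y \<subseteq> Mor D (FOb F X) (FOb F Y)"
        using X by auto
      show "Mor D (FOb F X) (FOb F Y) \<subseteq> FMor F X Y ` Mor C X Y"
      proof
        fix g assume g: "g \<in> Mor D (FOb F X) (FOb F Y)"
        obtain \<tau> where nat_t: "natural_transformation R C C (K \<circ>\<^sub>F F) id_functor \<tau>"
          and iso_t: "\<forall>X\<in>Ob C. iso_in C (FOb (K \<circ>\<^sub>F F) X) (FOb (id_functor :: ('o, 'm, 'o, 'm) cfunctor) X) (\<tau> X)"
          using KF unfolding nat_isomorphic_def by blast
        note KF2 = natural_transformation.axioms(1)[OF nat_t] and IdF = natural_transformation.axioms(2)[OF nat_t]
          and t = iso_t[rule_format] natural_transformation.component_closed[OF nat_t]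
          and nat = natural_transformation.naturality[OF nat_t]
        have tX: "iso_in C (FOb K (FOb F X)) X (\<tau> X)" and tY: "iso_in C (FOb K (FOb F Y)) Y (\<tau> Y)"
          and tYm: "\<tau> Y \<in> Mor C (FOb K (FOb F Y)) Y"
          using t X by (auto simp: comp_functor_def id_functor_def)
        obtain s where s: "s \<in> Mor C X (FOb K (FOb F X))" "Cmp C (FOb K (FOb F X)) X (FOb K (FOb F X)) s (\<tau> X)
            = Idn C (FOb K (FOb F X))"
          and tXm: "\<tau> X \<in> Mor C (FOb K (FOb F X)) X"
          using tX by (rule F.C.iso_inE)
        define Kg where "Kg = FMor K (FOb F X) (FOb F Y) g"
        have Kg: "Kg \<in> Mor C (FOb K (FOb F X)) (FOb K (FOb F Y))"
          unfolding Kg_def using X g by simp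
        define f where "f = Cmp C X (FOb K (FOb F Y)) Y (\<tau> Y) (Cmp C X (FOb K (FOb F X)) (FOb K (FOb F Y)) Kg s)"
        have f: "f \<in> Mor C X Y"
          unfolding f_def using X Kg s tYm by simp
        have "adjunct C K F \<tau> (FOb F X) Y (FMor F X Y f) =
           Cmp C (FOb K (FOb F X)) X Y f (\<tau> X)"
          using nat[OF X f] by (simp add: comp_functor_def id_functor_def)
        also have "\<dots> = Cmp C (FOb K (FOb F X)) (FOb K (FOb F Y)) Y (\<tau> Y) Kg"
          unfolding f_def using X Kg s tYm tXm by (simp add: F.C.cmp_assoc)
        finally have eq: "adjunct C K F \<tau> (FOb F X) Y (FMor F X Y f) =
           Cmp C (FOb K (FOb F X)) (FOb K (FOb F Y)) Y (\<tau> Y) Kg" .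
        have "FMor K (FOb F X) (FOb F Y) (FMor F X Y f) = Kg"
          by (rule F.C.iso_cancel_left[OF _ _ _ tY _ _ eq]) (use X f Kg in simp_all)
        then have "FMor F X Y f = g"
          unfolding Kg_def using X f g by (intro faithful_of_retraction[OF K FK, of "FOb F X" "FOb F Y"]) simp_all
        then show "g \<in> FMor F X Y ` Mor C X Y"
          using f by blast
      qed
    qed
  qed
  show "essentially_surjective C D F"
    unfolding essentially_surjective_def
  proof
    fix Y assume Y: "Y \<in> Ob D"
    have "isomorphic_in D (FOb F (FOb K Y)) Y"
      using FK Y unfolding nat_isomorphic_def isomorphic_in_def by (auto simp: comp_functor_def id_functor_def)
    then show "\<exists>X\<in>Ob C. isomorphic_in D (FOb F X) Y"
      using Y K.fob_closed by blast
  qed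
qed

text \<open>The quasi-inverse is chosen as a right adjoint, so that it can be composed with other adjunctions.\<close>

lemma quasi_inverse_exists:
  assumes F: "linear_functor R C D F" and ff: "fully_faithful C D F" and es: "essentially_surjective C D F"
  obtains K where "adjoint_pair R C D F K" "nat_isomorphic R C C (K \<circ>\<^sub>F F) id_functor"
    "nat_isomorphic R D D (F \<circ>\<^sub>F K) id_functor"
proof -
  interpret F: linear_functor R C D F by fact
  have "\<exists>t. \<forall>Y\<in>Ob D. t Y \<in> Ob C \<and> isomorphic_in D (FOb F (t Y)) Y"
    using es unfolding essentially_surjective_def by (intro bchoice) blast
  then obtain t where t: "t Y \<in> Ob C" "isomorphic_in D (FOb F (t Y)) Y" if "Y \<in> Ob D" for Y
    by blast
  have "\<exists>\<epsilon>. \<forall>Y\<in>Ob D. iso_in D (FOb F (t Y)) Y (\<epsilon> Y)"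
    using t(2) unfolding isomorphic_in_def by (intro bchoice) blast
  then obtain \<epsilon> where \<epsilon>: "iso_in D (FOb F (t Y)) Y (\<epsilon> Y)" if "Y \<in> Ob D" for Y
    by blast
  have \<epsilon>m: "\<epsilon> Y \<in> Mor D (FOb F (t Y)) Y" if "Y \<in> Ob D" for Y
    using \<epsilon>[OF that] unfolding iso_in_def by simp
  have "\<exists>T. FOb T = t \<and> universal_arrows R C D F T \<epsilon>"
  proof (rule right_adjoint_from_objects[OF F])
    fix X Y f assume X: "X \<in> Ob C" "Y \<in> Ob D" and f: "f \<in> Mor D (FOb F X) Y"
    obtain s where s: "s \<in> Mor D Y (FOb F (t Y))" "Cmp D Y (FOb F (t Y)) Y (\<epsilon> Y) s = Idn D Y"
      using \<epsilon>[OF X(2)] F.D.iso_inE by metis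
    obtain f' where f': "f' \<in> Mor C X (t Y)" "FMor F X (t Y) f' = Cmp D (FOb F X) Y (FOb F (t Y)) s f"
      using fully_faithful_surj[OF ff X(1) t(1)[OF X(2)], of "Cmp D (FOb F X) Y (FOb F (t Y)) s f"] X f s t by auto
    show "\<exists>f'\<in>Mor C X (t Y). Cmp D (FOb F X) (FOb F (t Y)) Y (\<epsilon> Y) (FMor F X (t Y) f') = f"
      by (rule bexI[OF _ f'(1)])
         (use X f s t \<epsilon>m in \<open>simp add: f'(2) flip: F.D.cmp_assoc\<close>)
  next
    fix X Y f f' assume X: "X \<in> Ob C" "Y \<in> Ob D" and f: "f \<in> Mor C X (t Y)" "f' \<in> Mor C X (t Y)"
      and eq: "Cmp D (FOb F X) (FOb F (t Y)) Y (\<epsilon> Y) (FMor F X (t Y) f) =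
        Cmp D (FOb F X) (FOb F (t Y)) Y (\<epsilon> Y) (FMor F X (t Y) f')"
    have "FMor F X (t Y) f = FMor F X (t Y) f'"
      by (rule F.D.iso_cancel_left[OF _ _ _ \<epsilon>[OF X(2)] _ _ eq]) (use X f t in auto)
    then show "f = f'"
      using fully_faithful_inj[OF ff X(1) t(1)[OF X(2)] f] by simp
  qed (use t \<epsilon>m in auto)
  then obtain K where Kt: "FOb K = t" and "universal_arrows R C D F K \<epsilon>" by blast
  interpret U: universal_arrows R C D F K \<epsilon> by fact
  interpret K: linear_functor R D C K by (rule U.right_linear_functor)
  have "nat_isomorphic R D D (F \<circ>\<^sub>F K) id_functor"
    by (rule nat_isomorphicI[where \<tau> = \<epsilon>])
       (use linear_functor_comp[OF U.right_linear_functor F] linear_functor_id[OF F.D.linear_category_axioms] \<epsilon> in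
         \<open>auto simp: comp_functor_def id_functor_def U.arrow_natural[unfolded Kt] Kt\<close>)
  moreover have "nat_isomorphic R C C (K \<circ>\<^sub>F F) id_functor"
  proof -
    have "\<exists>\<tau>. \<forall>X\<in>Ob C. \<tau> X \<in> Mor C (FOb K (FOb F X)) X \<and> FMor F (FOb K (FOb F X)) X (\<tau> X) = \<epsilon> (FOb F X)"
    proof (intro bchoice ballI)
      fix X assume X: "X \<in> Ob C"
      show "\<exists>y. y \<in> Mor C (FOb K (FOb F X)) X \<and> FMor F (FOb K (FOb F X)) X y = \<epsilon> (FOb F X)"
        using fully_faithful_surj[OF ff, of "FOb K (FOb F X)" X "\<epsilon> (FOb F X)"] X by (metis U.T_ob U.arrow
            F.fob_closed)
    qed
    then obtain \<tau> where \<tau>: "\<tau> X \<in> Mor C (FOb K (FOb F X)) X" "FMor F (FOb K (FOb F X)) X (\<tau> X) = \<epsilon> (FOb F X)"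
      if "X \<in> Ob C" for X by blast
    show ?thesis
    proof (rule nat_isomorphicI[where \<tau> = \<tau>])
      fix X assume X: "X \<in> Ob C"
      have "iso_in C (FOb K (FOb F X)) X (\<tau> X)"
        by (rule fully_faithful_reflects_iso[OF F ff]) (use X \<tau> \<epsilon>[of "FOb F X"] in \<open>auto simp: Kt t\<close>)
      then show "iso_in C (FOb (K \<circ>\<^sub>F F) X) (FOb id_functor X) (\<tau> X)"
        by (simp add: comp_functor_def id_functor_def)
    next
      fix X Y f assume X: "X \<in> Ob C" "Y \<in> Ob C" and f: "f \<in> Mor C X Y"
      have "adjunct C K F \<tau> (FOb F X) Y (FMor F X Y f) =
         Cmp C (FOb K (FOb F X)) X Y f (\<tau> X)"
        by (rule fully_faithful_inj[OF ff, of "FOb K (FOb F X)" Y]) (use X f \<tau> in \<open>simp_all add: F.fmor_cmp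
            U.arrow_natural\<close>)
      then show "Cmp C (FOb (K \<circ>\<^sub>F F) X) (FOb (K \<circ>\<^sub>F F) Y) (FOb id_functor Y) (\<tau> Y) (FMor (K \<circ>\<^sub>F F) X Y f) =
            Cmp C (FOb (K \<circ>\<^sub>F F) X) (FOb id_functor X) (FOb id_functor Y) (FMor id_functor X Y f) (\<tau> X)"
        by (simp add: comp_functor_def id_functor_def)
    qed (use linear_functor_comp[OF F U.right_linear_functor] linear_functor_id[OF F.C.linear_category_axioms]
        in auto)
  qed
  ultimately show ?thesis
    using that \<open>universal_arrows R C D F K \<epsilon>\<close> unfolding adjoint_pair_iff by blast
qed

section \<open>Karoubi envelopes\<close>

lemma karoubi_Ob: "Z \<in> Ob (karoubi C) \<longleftrightarrow> fst Z \<in> Ob C \<and> idempotent_in C (fst Z) (snd Z)"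
  by (simp add: karoubi_def case_prod_unfold)

lemma karoubi_Mor: "Mor (karoubi C) Z W = {\<alpha> \<in> Mor C (fst Z) (fst W).
    Cmp C (fst Z) (fst Z) (fst W) \<alpha> (snd Z) = \<alpha> \<and> Cmp C (fst Z) (fst W) (fst W) (snd W) \<alpha> = \<alpha>}"
  by (simp add: karoubi_def case_prod_unfold)

lemma karoubi_simps [simp]:
  "Cmp (karoubi C) Z W V = Cmp C (fst Z) (fst W) (fst V)"
  "Idn (karoubi C) = snd"
  "\<zero>\<^bsub>Hom (karoubi C) Z W\<^esub> = \<zero>\<^bsub>Hom C (fst Z) (fst W)\<^esub>"
  "f \<oplus>\<^bsub>Hom (karoubi C) Z W\<^esub> g = f \<oplus>\<^bsub>Hom C (fst Z) (fst W)\<^esub> g"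
  "r \<odot>\<^bsub>Hom (karoubi C) Z W\<^esub> g = r \<odot>\<^bsub>Hom C (fst Z) (fst W)\<^esub> g"
  by (simp_all add: karoubi_def case_prod_unfold)

lemma kar_embed_simps [simp]: "FOb (kar_embed C) X = (X, Idn C X)" "FMor (kar_embed C) X Y f = f"
  by (simp_all add: kar_embed_def)

lemma kar_extend_simps [simp]:
  "FOb (kar_extend F) Z = (FOb F (fst Z), FMor F (fst Z) (fst Z) (snd Z))"
  "FMor (kar_extend F) Z W f = FMor F (fst Z) (fst W) f"
  by (simp_all add: kar_extend_def case_prod_unfold)

context linear_category
begin

lemma karoubi_hom_submodule:
  assumes "Z \<in> Ob (karoubi C)" "W \<in> Ob (karoubi C)"
  shows "submodule (Mor (karoubi C) Z W) R (Hom C (fst Z) (fst W))"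
proof -
  have Z: "fst Z \<in> Ob C" "snd Z \<in> Mor C (fst Z) (fst Z)" "fst W \<in> Ob C" "snd W \<in> Mor C (fst W) (fst W)"
    using assms by (auto simp: karoubi_Ob idempotent_in_def)
  interpret M: module R "Hom C (fst Z) (fst W)" using hom_module Z by blast
  show ?thesis
    by (rule M.submoduleI)
       (use Z in \<open>auto simp: karoubi_Mor cmp_add_right cmp_add_left cmp_smult_right cmp_smult_left
         cmp_neg_left cmp_neg_right\<close>)
qed

lemma karoubi_linear_category: "linear_category R (karoubi C)"
proof (intro linear_category.intro linear_category_axioms.intro R.cring_axioms)
  fix Z W assume Z: "Z \<in> Ob (karoubi C)" "W \<in> Ob (karoubi C)"
  have "Hom (karoubi C) Z W = (Hom C (fst Z) (fst W))\<lparr>carrier := Mor (karoubi C) Z W\<rparr>"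
    by (simp add: karoubi_Mor) (simp add: karoubi_def case_prod_unfold)
  then show "module R (Hom (karoubi C) Z W)"
    using submodule.submodule_is_module[OF karoubi_hom_submodule[OF Z]] hom_module Z by (metis karoubi_Ob)
qed (auto simp: karoubi_Ob karoubi_Mor idempotent_in_def cmp_assoc cmp_add_right cmp_add_left
      cmp_smult_right cmp_smult_left simp flip: cmp_assoc[of _ _ _ _ _ _ "snd _"])

lemma karoubi_idempotent_complete: "idempotent_complete (karoubi C)"
  unfolding idempotent_complete_def
proof (intro ballI allI impI)
  fix Z p assume Z: "Z \<in> Ob (karoubi C)" and "idempotent_in (karoubi C) Z p"
  then have p: "fst Z \<in> Ob C" "p \<in> Mor C (fst Z) (fst Z)" "Cmp C (fst Z) (fst Z) (fst Z) p p = p"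
    "Cmp C (fst Z) (fst Z) (fst Z) p (snd Z) = p" "Cmp C (fst Z) (fst Z) (fst Z) (snd Z) p = p"
    by (auto simp: karoubi_Ob idempotent_in_def karoubi_Mor)
  show "\<exists>Y\<in>Ob (karoubi C). \<exists>r\<in>Mor (karoubi C) Z Y. \<exists>s\<in>Mor (karoubi C) Y Z.
     Cmp (karoubi C) Y Z Y r s = Idn (karoubi C) Y \<and> Cmp (karoubi C) Z Y Z s r = p"
    by (rule bexI[of _ "(fst Z, p)"], rule bexI[of _ p], rule bexI[of _ p])
       (use p in \<open>simp_all add: karoubi_Ob karoubi_Mor idempotent_in_def\<close>)
qed

lemma kar_embed_linear_functor: "linear_functor R C (karoubi C) (kar_embed C)"
proof -
  interpret K: linear_category R "karoubi C" by (rule karoubi_linear_category)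
  show ?thesis
    by unfold_locales (auto simp: karoubi_Ob karoubi_Mor idempotent_in_def)
qed

lemma kar_embed_fully_faithful: "fully_faithful C (karoubi C) (kar_embed C)"
  unfolding fully_faithful_def by (auto simp: karoubi_Mor bij_betw_def inj_on_def)

lemma kar_embed_essentially_surjective:
  assumes "idempotent_complete C"
  shows "essentially_surjective C (karoubi C) (kar_embed C)"
  unfolding essentially_surjective_def
proof
  fix Z assume "Z \<in> Ob (karoubi C)"
  then have Z: "fst Z \<in> Ob C" "snd Z \<in> Mor C (fst Z) (fst Z)" and id: "idempotent_in C (fst Z) (snd Z)"
    by (auto simp: karoubi_Ob idempotent_in_def)
  obtain Y r s where Y: "Y \<in> Ob C" "r \<in> Mor C (fst Z) Y" "s \<in> Mor C Y (fst Z)"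
      "Cmp C Y (fst Z) Y r s = Idn C Y" "Cmp C (fst Z) Y (fst Z) s r = snd Z"
    using assms Z(1) id unfolding idempotent_complete_def by meson
  have "Cmp C Y (fst Z) (fst Z) (snd Z) s = s" "Cmp C (fst Z) (fst Z) Y r (snd Z) = r"
    using Y(1-4) Z by (simp_all add: cmp_assoc flip: Y(5)) (simp flip: cmp_assoc)
  then have "iso_in (karoubi C) (FOb (kar_embed C) Y) Z s"
    unfolding iso_in_def using Y Z by (auto simp: karoubi_Mor intro!: bexI[of _ r])
  then show "\<exists>X\<in>Ob C. isomorphic_in (karoubi C) (FOb (kar_embed C) X) Z"
    using Y(1) unfolding isomorphic_in_def by blast
qed

end

context linear_functor
begin

lemma kar_extend_linear_functor: "linear_functor R (karoubi C) (karoubi D) (kar_extend F)"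
proof -
  interpret KC: linear_category R "karoubi C" by (rule C.karoubi_linear_category)
  interpret KD: linear_category R "karoubi D" by (rule D.karoubi_linear_category)
  show ?thesis
    by unfold_locales
       (auto simp: karoubi_Ob karoubi_Mor idempotent_in_def fmor_add fmor_smult fmor_cmp simp flip: fmor_cmp)
qed

lemma kar_extend_embed_agree:
  "nat_isomorphic R C (karoubi D) (kar_embed D \<circ>\<^sub>F F) (kar_extend F \<circ>\<^sub>F kar_embed C)"
proof (rule nat_isomorphic_of_agree)
  show "linear_functor R C (karoubi D) (kar_embed D \<circ>\<^sub>F F)"
    by (rule linear_functor_comp[OF linear_functor_axioms D.kar_embed_linear_functor])
  show "linear_functor R C (karoubi D) (kar_extend F \<circ>\<^sub>F kar_embed C)"
    by (rule linear_functor_comp[OF C.kar_embed_linear_functor kar_extend_linear_functor])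
qed (auto simp: comp_functor_def fmor_idn)

lemma kar_extend_fully_faithful:
  assumes ff: "fully_faithful C D F"
  shows "fully_faithful (karoubi C) (karoubi D) (kar_extend F)"
  unfolding fully_faithful_def bij_betw_def
proof (intro ballI conjI)
  fix Z W assume Z: "Z \<in> Ob (karoubi C)" "W \<in> Ob (karoubi C)"
  then have X: "fst Z \<in> Ob C" "fst W \<in> Ob C" "snd Z \<in> Mor C (fst Z) (fst Z)" "snd W \<in> Mor C (fst W) (fst W)"
    by (auto simp: karoubi_Ob idempotent_in_def)
  show "inj_on (FMor (kar_extend F) Z W) (Mor (karoubi C) Z W)"
    using fully_faithful_inj[OF ff X(1,2)] by (auto simp: karoubi_Mor inj_on_def)
  show "FMor (kar_extend F) Z W ` Mor (karoubi C) Z W = Mor (karoubi D) (FOb (kar_extend F) Z) (FOb (kar_extend F) W)"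
  proof
    show "FMor (kar_extend F) Z W ` Mor (karoubi C) Z W \<subseteq> Mor (karoubi D) (FOb (kar_extend F) Z) (FOb
        (kar_extend F) W)"
      using linear_functor.fmor_closed[OF kar_extend_linear_functor] Z by blast
    show "Mor (karoubi D) (FOb (kar_extend F) Z) (FOb (kar_extend F) W) \<subseteq> FMor (kar_extend F) Z W ` Mor
        (karoubi C) Z W"
    proof
      fix g assume g: "g \<in> Mor (karoubi D) (FOb (kar_extend F) Z) (FOb (kar_extend F) W)"
      then have "g \<in> Mor D (FOb F (fst Z)) (FOb F (fst W))" by (simp add: karoubi_Mor)
      then obtain f where f: "f \<in> Mor C (fst Z) (fst W)" "FMor F (fst Z) (fst W) f = g"
        using fully_faithful_surj[OF ff X(1,2)] by blast
      have "Cmp C (fst Z) (fst Z) (fst W) f (snd Z) = f"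
        by (rule fully_faithful_inj[OF ff X(1,2)]) (use X f g in \<open>simp_all add: fmor_cmp karoubi_Mor\<close>)
      moreover have "Cmp C (fst Z) (fst W) (fst W) (snd W) f = f"
        by (rule fully_faithful_inj[OF ff X(1,2)]) (use X f g in \<open>simp_all add: fmor_cmp karoubi_Mor\<close>)
      ultimately have "f \<in> Mor (karoubi C) Z W" using f by (simp add: karoubi_Mor)
      then show "g \<in> FMor (kar_extend F) Z W ` Mor (karoubi C) Z W"
        using f(2) by force
    qed
  qed
qed

lemma kar_extend_essentially_surjective:
  assumes ff: "fully_faithful C D F" and surj: "FOb F ` Ob C = Ob D"
  shows "essentially_surjective (karoubi C) (karoubi D) (kar_extend F)"
  unfolding essentially_surjective_def
proof
  fix W assume W: "W \<in> Ob (karoubi D)"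
  then have w: "fst W \<in> Ob D" "snd W \<in> Mor D (fst W) (fst W)"
     "Cmp D (fst W) (fst W) (fst W) (snd W) (snd W) = snd W"
    by (auto simp: karoubi_Ob idempotent_in_def)
  obtain X where X: "X \<in> Ob C" "FOb F X = fst W" using surj w(1) by force
  obtain e where e: "e \<in> Mor C X X" "FMor F X X e = snd W"
    using fully_faithful_surj[OF ff X(1) X(1)] w(2) X(2) by metis
  have "Cmp C X X X e e = e"
    by (rule fully_faithful_inj[OF ff X(1) X(1)]) (use X e w in \<open>simp_all add: fmor_cmp\<close>)
  then have "(X, e) \<in> Ob (karoubi C)" using X e by (simp add: karoubi_Ob idempotent_in_def)
  moreover have "FOb (kar_extend F) (X, e) = W" using X e by simp
  ultimately show "\<exists>Z\<in>Ob (karoubi C). isomorphic_in (karoubi D) (FOb (kar_extend F) Z) W"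
    using linear_category.iso_in_idn[OF D.karoubi_linear_category W] unfolding isomorphic_in_def by metis
qed

end

text \<open>The counit at \<open>(Y, f)\<close> is \<open>f \<circ> \<epsilon> Y\<close>.\<close>

lemma kar_extend_adjoint_pair:
  assumes "adjoint_pair R C D S T"
  shows "adjoint_pair R (karoubi C) (karoubi D) (kar_extend S) (kar_extend T)"
proof -
  obtain \<epsilon> where "universal_arrows R C D S T \<epsilon>"
    using assms unfolding adjoint_pair_iff by blast
  then interpret U: universal_arrows R C D S T \<epsilon> .
  interpret T: linear_functor R D C T by (rule U.right_linear_functor)
  interpret KS: linear_functor R "karoubi C" "karoubi D" "kar_extend S" by (rule U.S.kar_extend_linear_functor)
  interpret KT: linear_functor R "karoubi D" "karoubi C" "kar_extend T" by (rule T.kar_extend_linear_functor)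
  define \<epsilon>' where "\<epsilon>' W = Cmp D (FOb S (FOb T (fst W))) (fst W) (fst W) (snd W) (\<epsilon> (fst W))" for W
  have Ob: "fst W \<in> Ob D" "snd W \<in> Mor D (fst W) (fst W)" "Cmp D (fst W) (fst W) (fst W) (snd W) (snd W) = snd W"
    if "W \<in> Ob (karoubi D)" for W
    using that by (auto simp: karoubi_Ob idempotent_in_def)
  have ObC: "fst Z \<in> Ob C" "snd Z \<in> Mor C (fst Z) (fst Z)" if "Z \<in> Ob (karoubi C)" for Z
    using that by (auto simp: karoubi_Ob idempotent_in_def)
  \<comment> \<open>On morphisms of the envelope the idempotent in the counit can be dropped, as \<open>T f \<circ> \<alpha> = \<alpha>\<close>.\<close>
  have key: "Cmp D (FOb S (fst Z)) (FOb S (FOb T (fst W))) (fst W) (\<epsilon>' W) (FMor S (fst Z) (FOb T (fst W)) \<alpha>) =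
      adjunct D S T \<epsilon> (fst Z) (fst W) \<alpha>"
    if W: "W \<in> Ob (karoubi D)" and Z: "Z \<in> Ob (karoubi C)" and \<alpha>: "\<alpha> \<in> Mor (karoubi C) Z (FOb (kar_extend T)
        W)" for Z W \<alpha>
  proof -
    have a: "\<alpha> \<in> Mor C (fst Z) (FOb T (fst W))"
      "Cmp C (fst Z) (FOb T (fst W)) (FOb T (fst W)) (FMor T (fst W) (fst W) (snd W)) \<alpha> = \<alpha>"
      using \<alpha> by (simp_all add: karoubi_Mor)
    have "Cmp D (FOb S (fst Z)) (FOb S (FOb T (fst W))) (fst W) (\<epsilon>' W) (FMor S (fst Z) (FOb T (fst W)) \<alpha>) =
      Cmp D (FOb S (fst Z)) (FOb S (FOb T (fst W))) (fst W)
       (adjunct D S T \<epsilon> (FOb T (fst W)) (fst W) (FMor T (fst W) (fst W) (snd W)))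
       (FMor S (fst Z) (FOb T (fst W)) \<alpha>)"
      using Ob[OF W] ObC[OF Z] a(1) by (simp add: \<epsilon>'_def U.arrow_natural)
    also have "\<dots> = adjunct D S T \<epsilon> (fst Z) (fst W) (Cmp C (fst Z) (FOb T (fst W)) (FOb T (fst W)) (FMor T (fst
        W) (fst W) (snd W)) \<alpha>)"
      using Ob[OF W] ObC[OF Z] a(1) by (simp add: U.S.fmor_cmp U.S.D.cmp_assoc)
    finally show ?thesis by (simp add: a(2))
  qed
  have "universal_arrows R (karoubi C) (karoubi D) (kar_extend S) (kar_extend T) \<epsilon>'"
  proof
    fix W assume "W \<in> Ob (karoubi D)"
    note W = Ob[OF this]
    show "\<epsilon>' W \<in> Mor (karoubi D) (FOb (kar_extend S) (FOb (kar_extend T) W)) W"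
      using W by (simp add: karoubi_Mor \<epsilon>'_def U.S.D.cmp_assoc U.arrow_natural)
        (simp add: W(3) flip: U.S.D.cmp_assoc)
  next
    fix W V f assume WV: "W \<in> Ob (karoubi D)" "V \<in> Ob (karoubi D)" and f: "f \<in> Mor (karoubi D) W V"
    have "Cmp D (FOb S (FOb T (fst W))) (FOb S (FOb T (fst V))) (fst V) (\<epsilon>' V)
        (FMor S (FOb T (fst W)) (FOb T (fst V)) (FMor T (fst W) (fst V) f)) =
       Cmp D (FOb S (FOb T (fst W))) (fst W) (fst V) f (\<epsilon> (fst W))"
      using key[OF WV(2) KT.fob_closed[OF WV(1)] KT.fmor_closed[OF WV f]] Ob[OF WV(1)] Ob[OF WV(2)] f
      by (simp add: karoubi_Mor U.arrow_natural)
    also have "\<dots> = Cmp D (FOb S (FOb T (fst W))) (fst W) (fst V) f (\<epsilon>' W)"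
      using Ob[OF WV(1)] Ob[OF WV(2)] f by (simp add: karoubi_Mor \<epsilon>'_def flip: U.S.D.cmp_assoc)
    finally show "adjunct (karoubi D) (kar_extend S) (kar_extend T) \<epsilon>' (FOb (kar_extend T) W) V (FMor
        (kar_extend T) W V f) =
       Cmp (karoubi D) (FOb (kar_extend S) (FOb (kar_extend T) W)) W V f (\<epsilon>' W)"
      by simp
  next
    fix Z W f assume Z: "Z \<in> Ob (karoubi C)" and W: "W \<in> Ob (karoubi D)" and "f \<in> Mor (karoubi D) (FOb
        (kar_extend S) Z) W"
    then have f: "f \<in> Mor D (FOb S (fst Z)) (fst W)"
      "Cmp D (FOb S (fst Z)) (FOb S (fst Z)) (fst W) f (FMor S (fst Z) (fst Z) (snd Z)) = f"
      "Cmp D (FOb S (fst Z)) (fst W) (fst W) (snd W) f = f"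
      by (simp_all add: karoubi_Mor)
    obtain g where g: "g \<in> Mor C (fst Z) (FOb T (fst W))"
       "adjunct D S T \<epsilon> (fst Z) (fst W) g = f"
      using U.factor_ex[OF ObC(1)[OF Z] Ob(1)[OF W] f(1)] by blast
    have "Cmp C (fst Z) (fst Z) (FOb T (fst W)) g (snd Z) = g"
      by (rule U.factor_unique[OF ObC(1)[OF Z] Ob(1)[OF W]])
         (use ObC[OF Z] Ob[OF W] f g in \<open>simp_all add: U.S.fmor_cmp flip: U.S.D.cmp_assoc\<close>)
    moreover have "Cmp C (fst Z) (FOb T (fst W)) (FOb T (fst W)) (FMor T (fst W) (fst W) (snd W)) g = g"
    proof (rule U.factor_unique[OF ObC(1)[OF Z] Ob(1)[OF W]])
      have "adjunct D S T \<epsilon> (fst Z) (fst W) (Cmp C (fst Z) (FOb T (fst W)) (FOb T (fst W)) (FMor T (fst W)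
          (fst W) (snd W)) g) =
        Cmp D (FOb S (fst Z)) (FOb S (FOb T (fst W))) (fst W) (adjunct D S T \<epsilon> (FOb T (fst W)) (fst W) (FMor T
            (fst W) (fst W) (snd W))) (FMor S (fst Z) (FOb T (fst W)) g)"
        using ObC[OF Z] Ob[OF W] g(1) by (simp add: U.S.fmor_cmp U.S.D.cmp_assoc)
      also have "\<dots> = f"
        using ObC[OF Z] Ob[OF W] g f by (simp add: U.arrow_natural U.S.D.cmp_assoc)
      finally show "adjunct D S T \<epsilon> (fst Z) (fst W) (Cmp C (fst Z) (FOb T (fst W)) (FOb T (fst W)) (FMor T
          (fst W) (fst W) (snd W)) g) =
          adjunct D S T \<epsilon> (fst Z) (fst W) g"
        using g(2) by simp
    qed (use ObC[OF Z] Ob[OF W] g in simp_all)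
    ultimately have g': "g \<in> Mor (karoubi C) Z (FOb (kar_extend T) W)"
      using g(1) by (simp add: karoubi_Mor)
    show "\<exists>f'\<in>Mor (karoubi C) Z (FOb (kar_extend T) W).
       adjunct (karoubi D) (kar_extend S) (kar_extend T) \<epsilon>' Z W f' = f"
      by (rule bexI[OF _ g']) (use key[OF W Z g'] g(2) in simp)
  next
    fix Z W f f' assume Z: "Z \<in> Ob (karoubi C)" and W: "W \<in> Ob (karoubi D)"
      and f: "f \<in> Mor (karoubi C) Z (FOb (kar_extend T) W)" "f' \<in> Mor (karoubi C) Z (FOb (kar_extend T) W)"
      and eq: "adjunct (karoubi D) (kar_extend S) (kar_extend T) \<epsilon>' Z W f =
        adjunct (karoubi D) (kar_extend S) (kar_extend T) \<epsilon>' Z W f'"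
    show "f = f'"
      by (rule U.factor_unique[OF ObC(1)[OF Z] Ob(1)[OF W]])
         (use f eq key[OF W Z f(1)] key[OF W Z f(2)] in \<open>simp_all add: karoubi_Mor\<close>)
  qed (use KT.fob_closed KT.fmor_closed in auto)
  then show ?thesis
    unfolding adjoint_pair_iff by blast
qed

section \<open>Categories and functors recognised through a faithful functor\<close>

text \<open>The laws of a category may be checked after applying a faithful map to a category. This is how the
  Kleisli category (mapped to the target of \<open>S\<close>) and the orbit categories (mapped to the Kleisli
  category) are seen to be categories; a direct proof for orbit categories would need coherence laws
  for the maps \<open>m g h\<close> and \<open>u\<close>, which here are hidden in the monad.\<close>

lemma linear_category_through_faithful:
  assumes "linear_category R D"
    and module: "\<And>X Y. \<lbrakk>X \<in> Ob C; Y \<in> Ob C\<rbrakk> \<Longrightarrow> module R (Hom C X Y)"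
    and cmp: "\<And>X Y Z f g. \<lbrakk>X \<in> Ob C; Y \<in> Ob C; Z \<in> Ob C; f \<in> Mor C X Y; g \<in> Mor C Y Z\<rbrakk>
      \<Longrightarrow> Cmp C X Y Z g f \<in> Mor C X Z"
    and idn: "\<And>X. X \<in> Ob C \<Longrightarrow> Idn C X \<in> Mor C X X"
    and F_ob: "\<And>X. X \<in> Ob C \<Longrightarrow> FOb F X \<in> Ob D"
    and F_mor: "\<And>X Y f. \<lbrakk>X \<in> Ob C; Y \<in> Ob C; f \<in> Mor C X Y\<rbrakk> \<Longrightarrow> FMor F X Y f \<in> Mor D (FOb F X) (FOb F Y)"
    and F_idn: "\<And>X. X \<in> Ob C \<Longrightarrow> FMor F X X (Idn C X) = Idn D (FOb F X)"
    and F_cmp: "\<And>X Y Z f g. \<lbrakk>X \<in> Ob C; Y \<in> Ob C; Z \<in> Ob C; f \<in> Mor C X Y; g \<in> Mor C Y Z\<rbrakk>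
      \<Longrightarrow> FMor F X Z (Cmp C X Y Z g f) = Cmp D (FOb F X) (FOb F Y) (FOb F Z) (FMor F Y Z g) (FMor F X Y f)"
    and F_add: "\<And>X Y f g. \<lbrakk>X \<in> Ob C; Y \<in> Ob C; f \<in> Mor C X Y; g \<in> Mor C X Y\<rbrakk>
      \<Longrightarrow> FMor F X Y (f \<oplus>\<^bsub>Hom C X Y\<^esub> g) = FMor F X Y f \<oplus>\<^bsub>Hom D (FOb F X) (FOb F Y)\<^esub> FMor F X Y g"
    and F_smult: "\<And>X Y r f. \<lbrakk>X \<in> Ob C; Y \<in> Ob C; r \<in> carrier R; f \<in> Mor C X Y\<rbrakk>
      \<Longrightarrow> FMor F X Y (r \<odot>\<^bsub>Hom C X Y\<^esub> f) = r \<odot>\<^bsub>Hom D (FOb F X) (FOb F Y)\<^esub> FMor F X Y f"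
    and F_inj: "\<And>X Y f g. \<lbrakk>X \<in> Ob C; Y \<in> Ob C; f \<in> Mor C X Y; g \<in> Mor C X Y; FMor F X Y f = FMor F X Y g\<rbrakk> \<Longrightarrow> f = g"
  shows "linear_category R C" "linear_functor R C D F"
proof -
  interpret D: linear_category R D by fact
  have add: "f \<oplus>\<^bsub>Hom C X Y\<^esub> g \<in> Mor C X Y" if "X \<in> Ob C" "Y \<in> Ob C" "f \<in> Mor C X Y" "g \<in> Mor C X Y" for X Y f g
    using module[OF that(1,2)] module.axioms(2) abelian_group.axioms(1) abelian_monoid.a_closed that(3,4) by metis
  have smult: "r \<odot>\<^bsub>Hom C X Y\<^esub> f \<in> Mor C X Y" if "X \<in> Ob C" "Y \<in> Ob C" "r \<in> carrier R" "f \<in> Mor C X Y" for X Y r f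
    using module.smult_closed[OF module[OF that(1,2)] that(3,4)] .
  show C: "linear_category R C"
  proof (intro linear_category.intro linear_category_axioms.intro D.R.cring_axioms)
    fix W X Y Z f g h assume "W \<in> Ob C" "X \<in> Ob C" "Y \<in> Ob C" "Z \<in> Ob C" "f \<in> Mor C W X" "g \<in> Mor C X Y" "h \<in>
        Mor C Y Z"
    then show "Cmp C W X Z (Cmp C X Y Z h g) f = Cmp C W Y Z h (Cmp C W X Y g f)"
      by (intro F_inj[of W Z]) (simp_all add: cmp F_cmp F_ob F_mor D.cmp_assoc)
  next
    fix X Y f assume "X \<in> Ob C" "Y \<in> Ob C" "f \<in> Mor C X Y"
    then show "Cmp C X X Y f (Idn C X) = f"
      by (intro F_inj[of X Y]) (simp_all add: cmp idn F_idn F_cmp F_ob F_mor)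
  next
    fix X Y f assume "X \<in> Ob C" "Y \<in> Ob C" "f \<in> Mor C X Y"
    then show "Cmp C X Y Y (Idn C Y) f = f"
      by (intro F_inj[of X Y]) (simp_all add: cmp idn F_idn F_cmp F_ob F_mor)
  next
    fix X Y Z f f' g assume "X \<in> Ob C" "Y \<in> Ob C" "Z \<in> Ob C" "f \<in> Mor C X Y" "f' \<in> Mor C X Y" "g \<in> Mor C Y Z"
    then show "Cmp C X Y Z g (f \<oplus>\<^bsub>Hom C X Y\<^esub> f') = Cmp C X Y Z g f \<oplus>\<^bsub>Hom C X Z\<^esub> Cmp C X Y Z g f'"
      by (intro F_inj[of X Z]) (simp_all add: cmp add F_add F_cmp F_ob F_mor D.cmp_add_right)
  next
    fix X Y Z f g g' assume "X \<in> Ob C" "Y \<in> Ob C" "Z \<in> Ob C" "f \<in> Mor C X Y" "g \<in> Mor C Y Z" "g' \<in> Mor C Y Z"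
    then show "Cmp C X Y Z (g \<oplus>\<^bsub>Hom C Y Z\<^esub> g') f = Cmp C X Y Z g f \<oplus>\<^bsub>Hom C X Z\<^esub> Cmp C X Y Z g' f"
      by (intro F_inj[of X Z]) (simp_all add: cmp add F_add F_cmp F_ob F_mor D.cmp_add_left)
  next
    fix X Y Z r f g assume "X \<in> Ob C" "Y \<in> Ob C" "Z \<in> Ob C" "r \<in> carrier R" "f \<in> Mor C X Y" "g \<in> Mor C Y Z"
    then show "Cmp C X Y Z g (r \<odot>\<^bsub>Hom C X Y\<^esub> f) = r \<odot>\<^bsub>Hom C X Z\<^esub> Cmp C X Y Z g f"
      by (intro F_inj[of X Z]) (simp_all add: cmp smult F_smult F_cmp F_ob F_mor D.cmp_smult_right)
  next
    fix X Y Z r f g assume "X \<in> Ob C" "Y \<in> Ob C" "Z \<in> Ob C" "r \<in> carrier R" "f \<in> Mor C X Y" "g \<in> Mor C Y Z"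
    then show "Cmp C X Y Z (r \<odot>\<^bsub>Hom C Y Z\<^esub> g) f = r \<odot>\<^bsub>Hom C X Z\<^esub> Cmp C X Y Z g f"
      by (intro F_inj[of X Z]) (simp_all add: cmp smult F_smult F_cmp F_ob F_mor D.cmp_smult_left)
  qed (use module cmp idn in auto)
  show "linear_functor R C D F"
    by (intro linear_functor.intro linear_functor_axioms.intro C D.linear_category_axioms)
       (use F_ob F_mor F_idn F_cmp F_add F_smult in auto)
qed

lemma linear_functor_through_faithful:
  assumes "linear_functor R B D Q" and "linear_functor R C D L"
    and inj: "\<And>X Y f g. \<lbrakk>X \<in> Ob C; Y \<in> Ob C; f \<in> Mor C X Y; g \<in> Mor C X Y; FMor L X Y f = FMor L X Y g\<rbrakk> \<Longrightarrow> f = g"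
    and ob: "\<And>X. X \<in> Ob B \<Longrightarrow> FOb P X \<in> Ob C"
    and mor: "\<And>X Y f. \<lbrakk>X \<in> Ob B; Y \<in> Ob B; f \<in> Mor B X Y\<rbrakk> \<Longrightarrow> FMor P X Y f \<in> Mor C (FOb P X) (FOb P Y)"
    and L_ob: "\<And>X. X \<in> Ob B \<Longrightarrow> FOb L (FOb P X) = FOb Q X"
    and L_mor: "\<And>X Y f. \<lbrakk>X \<in> Ob B; Y \<in> Ob B; f \<in> Mor B X Y\<rbrakk> \<Longrightarrow> FMor L (FOb P X) (FOb P Y) (FMor P X Y f) = FMor
        Q X Y f"
  shows "linear_functor R B C P"
proof -
  interpret Q: linear_functor R B D Q by fact
  interpret L: linear_functor R C D L by fact
  show ?thesis
  proof (intro linear_functor.intro linear_functor_axioms.intro Q.C.linear_category_axioms L.C.linear_category_axioms)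
    fix X assume X: "X \<in> Ob B"
    show "FMor P X X (Idn B X) = Idn C (FOb P X)"
      by (rule inj[of "FOb P X" "FOb P X"])
         (use X in \<open>simp_all add: ob mor L_mor L_ob Q.fmor_idn L.fmor_idn\<close>)
  next
    fix X Y Z f g assume X: "X \<in> Ob B" "Y \<in> Ob B" "Z \<in> Ob B" "f \<in> Mor B X Y" "g \<in> Mor B Y Z"
    show "FMor P X Z (Cmp B X Y Z g f) = Cmp C (FOb P X) (FOb P Y) (FOb P Z) (FMor P Y Z g) (FMor P X Y f)"
      by (rule inj[of "FOb P X" "FOb P Z"])
         (use X in \<open>simp_all add: ob mor L_mor L_ob Q.fmor_cmp L.fmor_cmp\<close>)
  next
    fix X Y f g assume X: "X \<in> Ob B" "Y \<in> Ob B" "f \<in> Mor B X Y" "g \<in> Mor B X Y"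
    show "FMor P X Y (f \<oplus>\<^bsub>Hom B X Y\<^esub> g) = FMor P X Y f \<oplus>\<^bsub>Hom C (FOb P X) (FOb P Y)\<^esub> FMor P X Y g"
      by (rule inj[of "FOb P X" "FOb P Y"])
         (use X in \<open>simp_all add: ob mor L_mor L_ob Q.fmor_add L.fmor_add\<close>)
  next
    fix X Y r f assume X: "X \<in> Ob B" "Y \<in> Ob B" "r \<in> carrier R" "f \<in> Mor B X Y"
    show "FMor P X Y (r \<odot>\<^bsub>Hom B X Y\<^esub> f) = r \<odot>\<^bsub>Hom C (FOb P X) (FOb P Y)\<^esub> FMor P X Y f"
      by (rule inj[of "FOb P X" "FOb P Y"])
         (use X in \<open>simp_all add: ob mor L_mor L_ob Q.fmor_smult L.fmor_smult\<close>)
  qed (use ob mor in auto)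
qed

lemma product_module:
  assumes "cring R" and M: "\<And>i. i \<in> I \<Longrightarrow> module R (M i)"
  shows "module R \<lparr>carrier = (\<Pi>\<^sub>E i \<in> I. carrier (M i)), mult = undefined, one = undefined,
     zero = (\<lambda>i \<in> I. \<zero>\<^bsub>M i\<^esub>), add = (\<lambda>a b. \<lambda>i \<in> I. a i \<oplus>\<^bsub>M i\<^esub> b i),
     smult = (\<lambda>r a. \<lambda>i \<in> I. r \<odot>\<^bsub>M i\<^esub> a i)\<rparr>" (is "module R ?P")
proof (rule moduleI[OF assms(1)])
  have ag: "abelian_group (M i)" if "i \<in> I" for i
    using M[OF that] module.axioms(2) by blast
  note am = abelian_group.axioms(1)[OF ag]
  show "abelian_group ?P"
  proof (rule abelian_groupI)
    fix x assume x: "x \<in> carrier ?P"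
    show "\<exists>y\<in>carrier ?P. y \<oplus>\<^bsub>?P\<^esub> x = \<zero>\<^bsub>?P\<^esub>"
      by (rule bexI[of _ "\<lambda>i\<in>I. \<ominus>\<^bsub>M i\<^esub> x i"])
         (use x in \<open>auto simp: PiE_iff abelian_group.l_neg[OF ag] abelian_group.a_inv_closed[OF ag] intro!:
             restrict_ext\<close>)
  next
    fix x assume x: "x \<in> carrier ?P"
    show "\<zero>\<^bsub>?P\<^esub> \<oplus>\<^bsub>?P\<^esub> x = x"
      by (rule extensionalityI[of _ I])
         (use x in \<open>auto simp: PiE_iff abelian_monoid.l_zero[OF am]\<close>)
  qed (auto simp: PiE_iff abelian_monoid.a_closed[OF am] abelian_monoid.zero_closed[OF am]
        abelian_monoid.a_assoc[OF am] intro!: restrict_ext intro: abelian_monoid.a_comm[OF am])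
  fix x assume x: "x \<in> carrier ?P"
  show "\<one>\<^bsub>R\<^esub> \<odot>\<^bsub>?P\<^esub> x = x"
    by (rule extensionalityI[of _ I]) (use x in \<open>auto simp: PiE_iff module.smult_one[OF M]\<close>)
qed (auto simp: PiE_iff module.smult_closed[OF M] module.smult_l_distr[OF M] module.smult_r_distr[OF M]
       module.smult_assoc1[OF M] intro!: restrict_ext)

context linear_category
begin

lemma hom_finsum_restrict:
  assumes "X \<in> Ob C" "Y \<in> Ob C" "finite I" "J \<subseteq> I" "\<And>i. i \<in> I - J \<Longrightarrow> f i = \<zero>\<^bsub>Hom C X Y\<^esub>"
    "\<And>i. i \<in> J \<Longrightarrow> f i \<in> Mor C X Y"
  shows "finsum (Hom C X Y) f I = finsum (Hom C X Y) f J"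
proof -
  interpret M: abelian_monoid "Hom C X Y" using hom_abelian_monoid assms by blast
  have "f \<in> I \<rightarrow> Mor C X Y"
    using assms(5,6) assms(1,2) hom_zero by (metis DiffI Pi_I)
  then show ?thesis
    by (intro M.add.finprod_mono_neutral_cong_right) (use assms in auto)
qed

end

section \<open>The Kleisli category\<close>

lemma kleisli_simps [simp]:
  "Ob (kleisli H A \<mu> \<eta>) = Ob H"
  "Hom (kleisli H A \<mu> \<eta>) X Y = Hom H X (FOb A Y)"
  "Cmp (kleisli H A \<mu> \<eta>) X Y Z g f = Cmp H X (FOb A (FOb A Z)) (FOb A Z) (\<mu> Z)
              (Cmp H X (FOb A Y) (FOb A (FOb A Z)) (FMor A Y (FOb A Z) g) f)"
  "Idn (kleisli H A \<mu> \<eta>) = \<eta>"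
  by (simp_all add: kleisli_def)

lemma kleisli_left_simps [simp]:
  "FOb (kleisli_left H A \<eta>) X = X"
  "FMor (kleisli_left H A \<eta>) X Y f = Cmp H X Y (FOb A Y) (\<eta> Y) f"
  by (simp_all add: kleisli_left_def)

text \<open>The comparison functor from the Kleisli category of \<open>T S\<close> to the target of \<open>S\<close>, which sends a
  morphism \<open>X \<rightarrow> T S Y\<close> to its adjunct \<open>S X \<rightarrow> S Y\<close>.\<close>

definition kleisli_comparison where
  "kleisli_comparison D S T \<epsilon> = \<lparr>FOb = FOb S,
     FMor = (\<lambda>X Y f. adjunct D S T \<epsilon> X (FOb S Y) f)\<rparr>"

context adjunction
begin

sublocale A: linear_functor R C C "T \<circ>\<^sub>F S"
  by (rule linear_functor_comp[OF S.linear_functor_axioms T.linear_functor_axioms])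

sublocale U: universal_arrows R C D S T \<epsilon>
  by (rule adjunction_universal_arrows[OF adjunction_axioms])

abbreviation "mu \<equiv> adj_mult S T \<epsilon>"
abbreviation "Kl \<equiv> kleisli C (T \<circ>\<^sub>F S) mu \<eta>"

lemma eta_closed [simp]: "X \<in> Ob C \<Longrightarrow> \<eta> X \<in> Mor C X (FOb (T \<circ>\<^sub>F S) X)"
  using unit.component_closed[of X] by (simp add: id_functor_def)

lemma eta_natural:
  "\<lbrakk>X \<in> Ob C; Y \<in> Ob C; f \<in> Mor C X Y\<rbrakk> \<Longrightarrow>
    Cmp C X (FOb (T \<circ>\<^sub>F S) X) (FOb (T \<circ>\<^sub>F S) Y) (FMor (T \<circ>\<^sub>F S) X Y f) (\<eta> X) = Cmp C X Y (FOb (T \<circ>\<^sub>F S) Y) (\<eta> Y) f"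
  using unit.naturality[of X Y f] by (simp add: id_functor_def)

lemma mu_closed [simp]: "X \<in> Ob C \<Longrightarrow> mu X \<in> Mor C (FOb (T \<circ>\<^sub>F S) (FOb (T \<circ>\<^sub>F S) X)) (FOb (T \<circ>\<^sub>F S) X)"
  by (simp add: adj_mult_def comp_functor_def)

lemma mu_eta_left: "X \<in> Ob C \<Longrightarrow>
   Cmp C (FOb (T \<circ>\<^sub>F S) X) (FOb (T \<circ>\<^sub>F S) (FOb (T \<circ>\<^sub>F S) X)) (FOb (T \<circ>\<^sub>F S) X) (mu X) (\<eta> (FOb (T \<circ>\<^sub>F S) X)) =
     Idn C (FOb (T \<circ>\<^sub>F S) X)"
  by (simp add: adj_mult_def comp_functor_def triangle_right)

lemma mu_eta_right: "X \<in> Ob C \<Longrightarrow>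
   Cmp C (FOb (T \<circ>\<^sub>F S) X) (FOb (T \<circ>\<^sub>F S) (FOb (T \<circ>\<^sub>F S) X)) (FOb (T \<circ>\<^sub>F S) X) (mu X) (FMor (T \<circ>\<^sub>F S) X (FOb
       (T \<circ>\<^sub>F S) X) (\<eta> X)) =
     Idn C (FOb (T \<circ>\<^sub>F S) X)"
  using eta_closed[of X]
  by (simp add: adj_mult_def comp_functor_def triangle_left T.fmor_idn flip: T.fmor_cmp)

lemma kleisli_comparison_inj:
  "\<lbrakk>X \<in> Ob C; Y \<in> Ob C; f \<in> Mor Kl X Y; g \<in> Mor Kl X Y;
    FMor (kleisli_comparison D S T \<epsilon>) X Y f = FMor (kleisli_comparison D S T \<epsilon>) X Y g\<rbrakk> \<Longrightarrow> f = g"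
  using U.factor_unique[of X "FOb S Y" f g] by (simp add: kleisli_comparison_def comp_functor_def)

lemma kleisli_linear_category: "linear_category R Kl"
  and kleisli_comparison_linear_functor: "linear_functor R Kl D (kleisli_comparison D S T \<epsilon>)"
proof -
  have cmp: "adjunct D S T \<epsilon> X (FOb S Z) (Cmp C X (FOb T (FOb S (FOb T (FOb S Z)))) (FOb T (FOb S Z)) (FMor T
      (FOb S (FOb T (FOb S Z))) (FOb S Z) (\<epsilon> (FOb S Z))) (Cmp C X (FOb T (FOb S Y)) (FOb T (FOb S (FOb T (FOb
          S Z)))) (FMor T (FOb S Y) (FOb S (FOb T (FOb S Z))) (FMor S Y (FOb T (FOb S Z)) g)) f)) =
     Cmp D (FOb S X) (FOb S Y) (FOb S Z)
       (adjunct D S T \<epsilon> Y (FOb S Z) g)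
       (adjunct D S T \<epsilon> X (FOb S Y) f)"
    if X: "X \<in> Ob C" "Y \<in> Ob C" "Z \<in> Ob C" and f: "f \<in> Mor C X (FOb T (FOb S Y))" "g \<in> Mor C Y (FOb T (FOb S
        Z))" for X Y Z f g
  proof -
    let ?h = "adjunct D S T \<epsilon> Y (FOb S Z) g"
    have "Cmp C X (FOb T (FOb S (FOb T (FOb S Z)))) (FOb T (FOb S Z)) (FMor T (FOb S (FOb T (FOb S Z))) (FOb S
        Z) (\<epsilon> (FOb S Z)))
        (Cmp C X (FOb T (FOb S Y)) (FOb T (FOb S (FOb T (FOb S Z))))
          (FMor T (FOb S Y) (FOb S (FOb T (FOb S Z))) (FMor S Y (FOb T (FOb S Z)) g)) f) =
       Cmp C X (FOb T (FOb S Y)) (FOb T (FOb S Z)) (FMor T (FOb S Y) (FOb S Z) ?h) f"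
      using X f by (simp add: T.fmor_cmp S.C.cmp_assoc)
    moreover have "adjunct D S T \<epsilon> X (FOb S Z) (Cmp C X (FOb T (FOb S Y)) (FOb T (FOb S Z)) (FMor T (FOb S Y)
        (FOb S Z) ?h) f) =
      Cmp D (FOb S X) (FOb S (FOb T (FOb S Y))) (FOb S Z) (adjunct D S T \<epsilon> (FOb T (FOb S Y)) (FOb S Z) (FMor T
          (FOb S Y) (FOb S Z) ?h)) (FMor S X (FOb T (FOb S Y)) f)"
      using X f by (simp add: S.fmor_cmp S.D.cmp_assoc)
    ultimately show ?thesis
      using X f U.arrow_natural[of "FOb S Y" "FOb S Z" ?h] by (simp add: S.D.cmp_assoc)
  qed
  note faithful = linear_category_through_faithful[where F = "kleisli_comparison D S T \<epsilon>" and D = D and R = R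
      and C = Kl]
  show "linear_category R Kl"
    by (rule faithful(1)) (use kleisli_comparison_inj eta_closed in \<open>auto simp: kleisli_comparison_def
      S.D.linear_category_axioms S.C.hom_module comp_functor_def adj_mult_def triangle_left S.fmor_add S.fmor_smult
      S.D.cmp_add_right S.D.cmp_smult_right cmp\<close>)
  show "linear_functor R Kl D (kleisli_comparison D S T \<epsilon>)"
    by (rule faithful(2)) (use kleisli_comparison_inj eta_closed in \<open>auto simp: kleisli_comparison_def
      S.D.linear_category_axioms S.C.hom_module comp_functor_def adj_mult_def triangle_left S.fmor_add S.fmor_smult
      S.D.cmp_add_right S.D.cmp_smult_right cmp\<close>)
qed

lemma kleisli_left_linear_functor: "linear_functor R C Kl (kleisli_left C (T \<circ>\<^sub>F S) \<eta>)"
proof (rule linear_functor_through_faithful[OF S.linear_functor_axioms kleisli_comparison_linear_functor])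
  fix X Y f assume X: "X \<in> Ob C" "Y \<in> Ob C" and f: "f \<in> Mor C X Y"
  have "adjunct D S T \<epsilon> X (FOb S Y) (Cmp C X Y (FOb T (FOb S Y)) (\<eta> Y) f) =
    Cmp D (FOb S X) (FOb S Y) (FOb S Y) (adjunct D S T \<epsilon> Y (FOb S Y) (\<eta> Y)) (FMor S X Y f)"
    using X f eta_closed[of Y] by (simp add: S.fmor_cmp S.D.cmp_assoc comp_functor_def)
  then show "FMor (kleisli_comparison D S T \<epsilon>) (FOb (kleisli_left C (T \<circ>\<^sub>F S) \<eta>) X) (FOb (kleisli_left C (T
      \<circ>\<^sub>F S) \<eta>) Y)
      (FMor (kleisli_left C (T \<circ>\<^sub>F S) \<eta>) X Y f) = FMor S X Y f"
    using X f by (simp add: kleisli_comparison_def comp_functor_def triangle_left)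
qed (use kleisli_comparison_inj in \<open>auto simp: kleisli_comparison_def comp_functor_def eta_closed[unfolded
    comp_functor_def, simplified]\<close>)

end

section \<open>Orbit categories inside the Kleisli category\<close>

lemma orbit_cat_simps [simp]:
  "Ob (orbit_cat H E m u \<Gamma>) = Ob H"
  "Mor (orbit_cat H E m u \<Gamma>) X Y = (\<Pi>\<^sub>E g \<in> carrier \<Gamma>. Mor H X (FOb (E g) Y))"
  "\<zero>\<^bsub>Hom (orbit_cat H E m u \<Gamma>) X Y\<^esub> = (\<lambda>g \<in> carrier \<Gamma>. \<zero>\<^bsub>Hom H X (FOb (E g) Y)\<^esub>)"
  "a \<oplus>\<^bsub>Hom (orbit_cat H E m u \<Gamma>) X Y\<^esub> b = (\<lambda>g \<in> carrier \<Gamma>. a g \<oplus>\<^bsub>Hom H X (FOb (E g) Y)\<^esub> b g)"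
  "r \<odot>\<^bsub>Hom (orbit_cat H E m u \<Gamma>) X Y\<^esub> a = (\<lambda>g \<in> carrier \<Gamma>. r \<odot>\<^bsub>Hom H X (FOb (E g) Y)\<^esub> a g)"
  "Idn (orbit_cat H E m u \<Gamma>) X = (\<lambda>g \<in> carrier \<Gamma>. if g = \<one>\<^bsub>\<Gamma>\<^esub> then u X else \<zero>\<^bsub>Hom H X (FOb (E g) X)\<^esub>)"
  by (simp_all add: orbit_cat_def)

lemma orbit_left_simps [simp]:
  "FOb (orbit_left H E u \<Gamma>) X = X"
  "FMor (orbit_left H E u \<Gamma>) X Y f = (\<lambda>g \<in> carrier \<Gamma>.
       if g = \<one>\<^bsub>\<Gamma>\<^esub> then Cmp H X Y (FOb (E g) Y) (u Y) f else \<zero>\<^bsub>Hom H X (FOb (E g) Y)\<^esub>)"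
  by (simp_all add: orbit_left_def)

lemma orbit_incl_simps [simp]:
  "FOb (orbit_incl H E \<Gamma>0 \<Gamma>) X = X"
  "FMor (orbit_incl H E \<Gamma>0 \<Gamma>) X Y f = (\<lambda>g \<in> carrier \<Gamma>.
       if g \<in> carrier \<Gamma>0 then f g else \<zero>\<^bsub>Hom H X (FOb (E g) Y)\<^esub>)"
  by (simp_all add: orbit_incl_def)

locale normal_subgroup_group = normal_subgroup_situation R H G S T \<eta> \<epsilon> "carrier \<Gamma>" E inc prj
  for R :: "'r ring" and H :: "('r, 'o, 'm) lcat" and G :: "('r, 'p, 'n) lcat"
    and S :: "('o, 'm, 'p, 'n) cfunctor" and T :: "('p, 'n, 'o, 'm) cfunctor"
    and \<eta> :: "'o \<Rightarrow> 'm" and \<epsilon> :: "'p \<Rightarrow> 'n" and \<Gamma> :: "'i monoid" (structure)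
    and E :: "'i \<Rightarrow> ('o, 'm, 'o, 'm) cfunctor"
    and inc :: "'i \<Rightarrow> 'o \<Rightarrow> 'm" and prj :: "'i \<Rightarrow> 'o \<Rightarrow> 'm" +
  assumes group_by_mult: "group_by_mult H (T \<circ>\<^sub>F S) (adj_mult S T \<epsilon>) E inc prj \<Gamma>"
    and finite_group: "finite (carrier \<Gamma>)"
begin

abbreviation "TS \<equiv> T \<circ>\<^sub>F S"
abbreviation "A \<equiv> FOb TS"
abbreviation "mc \<equiv> mult_component H TS mu E inc prj"
abbreviation "m \<equiv> \<lambda>g h. mc g h (g \<otimes> h)"
abbreviation "u \<equiv> \<lambda>X. Cmp H X (A X) (FOb (E \<one>) X) (prj \<one> X) (\<eta> X)"

text \<open>A single term of the composite of morphisms of the orbit category, for \<open>a : X \<rightarrow> E g Y\<close> and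
  \<open>b : Y \<rightarrow> E h Z\<close>. The index \<open>k\<close> is kept apart from \<open>g \<otimes> h\<close>, to which it is only provably equal where
  this is used.\<close>

abbreviation "summand X Y Z g h k b a \<equiv> Cmp H X (FOb (E g) (FOb (E h) Z)) (FOb (E k) Z) (mc g h k Z)
    (Cmp H X (FOb (E g) Y) (FOb (E g) (FOb (E h) Z)) (FMor (E g) Y (FOb (E h) Z) b) a)"

sublocale group \<Gamma>
  using group_by_mult by (simp add: group_by_mult_def)

lemma E_functor: "g \<in> carrier \<Gamma> \<Longrightarrow> linear_functor R H H (E g)"
  and E_fully_faithful: "g \<in> carrier \<Gamma> \<Longrightarrow> fully_faithful H H (E g)"
  using equivalence_functorD[OF self_equivalence] by auto

lemma E_ob [simp]: "\<lbrakk>g \<in> carrier \<Gamma>; X \<in> Ob H\<rbrakk> \<Longrightarrow> FOb (E g) X \<in> Ob H"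
  using linear_functor.fob_closed[OF E_functor] by blast

lemma E_mor [simp]: "\<lbrakk>g \<in> carrier \<Gamma>; X \<in> Ob H; Y \<in> Ob H; f \<in> Mor H X Y\<rbrakk> \<Longrightarrow>
    FMor (E g) X Y f \<in> Mor H (FOb (E g) X) (FOb (E g) Y)"
  using linear_functor.fmor_closed[OF E_functor] by blast

lemma E_cmp: "\<lbrakk>a \<in> carrier \<Gamma>; X \<in> Ob H; Y \<in> Ob H; Z \<in> Ob H; f \<in> Mor H X Y; g \<in> Mor H Y Z\<rbrakk> \<Longrightarrow>
    FMor (E a) X Z (Cmp H X Y Z g f) =
    Cmp H (FOb (E a) X) (FOb (E a) Y) (FOb (E a) Z) (FMor (E a) Y Z g) (FMor (E a) X Y f)"
  using linear_functor.fmor_cmp[OF E_functor] by blast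

lemma E_zero [simp]: "\<lbrakk>g \<in> carrier \<Gamma>; X \<in> Ob H; Y \<in> Ob H\<rbrakk> \<Longrightarrow>
    FMor (E g) X Y \<zero>\<^bsub>Hom H X Y\<^esub> = \<zero>\<^bsub>Hom H (FOb (E g) X) (FOb (E g) Y)\<^esub>"
  using linear_functor.fmor_zero[OF E_functor] by blast

lemma inc_closed [simp]: "\<lbrakk>g \<in> carrier \<Gamma>; X \<in> Ob H\<rbrakk> \<Longrightarrow> inc g X \<in> Mor H (FOb (E g) X) (A X)"
  and prj_closed [simp]: "\<lbrakk>g \<in> carrier \<Gamma>; X \<in> Ob H\<rbrakk> \<Longrightarrow> prj g X \<in> Mor H (A X) (FOb (E g) X)"
  using is_direct_sumD(4,5)[OF direct_sum] by auto

lemma inc_nat: "\<lbrakk>g \<in> carrier \<Gamma>; X \<in> Ob H; Y \<in> Ob H; f \<in> Mor H X Y\<rbrakk> \<Longrightarrow>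
   Cmp H (FOb (E g) X) (A X) (A Y) (FMor TS X Y f) (inc g X) =
   Cmp H (FOb (E g) X) (FOb (E g) Y) (A Y) (inc g Y) (FMor (E g) X Y f)"
  using natural_transformation.naturality[OF inc_natural] by simp

lemma prj_nat: "\<lbrakk>g \<in> carrier \<Gamma>; X \<in> Ob H; Y \<in> Ob H; f \<in> Mor H X Y\<rbrakk> \<Longrightarrow>
   Cmp H (A X) (A Y) (FOb (E g) Y) (prj g Y) (FMor TS X Y f) =
   Cmp H (A X) (FOb (E g) X) (FOb (E g) Y) (FMor (E g) X Y f) (prj g X)"
  using natural_transformation.naturality[OF prj_natural] by simp

lemma mc_closed [simp]: "\<lbrakk>g \<in> carrier \<Gamma>; h \<in> carrier \<Gamma>; k \<in> carrier \<Gamma>; Z \<in> Ob H\<rbrakk> \<Longrightarrow>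
    mc g h k Z \<in> Mor H (FOb (E g) (FOb (E h) Z)) (FOb (E k) Z)"
  by (simp add: mult_component_def Let_def)

lemma mc_iso: "\<lbrakk>g \<in> carrier \<Gamma>; h \<in> carrier \<Gamma>; Z \<in> Ob H\<rbrakk> \<Longrightarrow>
    iso_in H (FOb (E g) (FOb (E h) Z)) (FOb (E (g \<otimes> h)) Z) (m g h Z)"
  using group_by_mult by (simp add: group_by_mult_def)

lemma mc_zero: "\<lbrakk>g \<in> carrier \<Gamma>; h \<in> carrier \<Gamma>; k \<in> carrier \<Gamma>; Z \<in> Ob H; k \<noteq> g \<otimes> h\<rbrakk> \<Longrightarrow>
    mc g h k Z = \<zero>\<^bsub>Hom H (FOb (E g) (FOb (E h) Z)) (FOb (E k) Z)\<^esub>"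
  using group_by_mult by (simp add: group_by_mult_def)

lemma mc_apply:
  assumes "g \<in> carrier \<Gamma>" "h \<in> carrier \<Gamma>" "k \<in> carrier \<Gamma>" "Z \<in> Ob H" "W \<in> Ob H" "x \<in> Mor H W (FOb (E g) (FOb
      (E h) Z))"
  shows "Cmp H W (A Z) (FOb (E k) Z) (prj k Z) (Cmp H W (A (A Z)) (A Z) (mu Z)
     (Cmp H W (FOb (E g) (A Z)) (A (A Z)) (inc g (A Z))
       (Cmp H W (FOb (E g) (FOb (E h) Z)) (FOb (E g) (A Z)) (FMor (E g) (FOb (E h) Z) (A Z) (inc h Z)) x))) =
    Cmp H W (FOb (E g) (FOb (E h) Z)) (FOb (E k) Z) (mc g h k Z) x"
  using assms by (simp add: mult_component_def Let_def S.C.cmp_assoc)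

text \<open>On the summand \<open>E g Y\<close> of \<open>A Y\<close> only the component of \<open>\<psi>\<close> with index \<open>inv g \<otimes> k\<close>
  contributes to the index \<open>k\<close>.\<close>

lemma mult_summand:
  assumes X: "Y \<in> Ob H" "Z \<in> Ob H" and \<psi>: "\<psi> \<in> Mor H Y (A Z)" and g: "g \<in> carrier \<Gamma>" "k \<in> carrier \<Gamma>"
  shows "Cmp H (FOb (E g) Y) (A Z) (FOb (E k) Z) (prj k Z) (Cmp H (FOb (E g) Y) (A (A Z)) (A Z) (mu Z)
      (Cmp H (FOb (E g) Y) (FOb (E g) (A Z)) (A (A Z)) (inc g (A Z)) (FMor (E g) Y (A Z) \<psi>))) =
    Cmp H (FOb (E g) Y) (FOb (E g) (FOb (E (inv g \<otimes> k)) Z)) (FOb (E k) Z) (mc g (inv g \<otimes> k) k Z)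
      (FMor (E g) Y (FOb (E (inv g \<otimes> k)) Z)
        (Cmp H Y (A Z) (FOb (E (inv g \<otimes> k)) Z) (prj (inv g \<otimes> k) Z) \<psi>))"
    (is "?L = ?R")
proof -
  interpret Eg: linear_functor R H H "E g" by (rule E_functor[OF g(1)])
  let ?W = "FOb (E g) Y"
  let ?t = "\<lambda>h. Cmp H ?W (FOb (E g) (FOb (E h) Z)) (FOb (E g) (A Z)) (FMor (E g) (FOb (E h) Z) (A Z) (inc h Z))
      (Cmp H ?W (FOb (E g) (A Z)) (FOb (E g) (FOb (E h) Z)) (FMor (E g) (A Z) (FOb (E h) Z) (prj h Z))
       (FMor (E g) Y (A Z) \<psi>))"
  define N where "N = Cmp H (FOb (E g) (A Z)) (A Z) (FOb (E k) Z) (prj k Z)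
     (Cmp H (FOb (E g) (A Z)) (A (A Z)) (A Z) (mu Z) (inc g (A Z)))"
  have N: "N \<in> Mor H (FOb (E g) (A Z)) (FOb (E k) Z)"
    unfolding N_def using X g by simp
  have t: "?t h \<in> Mor H ?W (FOb (E g) (A Z))" if "h \<in> carrier \<Gamma>" for h
    using X g \<psi> that by simp
  have "?L = Cmp H ?W (FOb (E g) (A Z)) (FOb (E k) Z) N (FMor (E g) Y (A Z) \<psi>)"
    unfolding N_def using X g \<psi> by (simp add: S.C.cmp_assoc)
  also have "\<dots> = Cmp H ?W (FOb (E g) (A Z)) (FOb (E k) Z) N
      (finsum (Hom H ?W (FOb (E g) (A Z))) ?t (carrier \<Gamma>))"
    by (rule arg_cong[OF S.C.direct_sum_expand_in[OF Eg.functor_direct_sum[OF direct_sum]]]) (use X g \<psi> in simp_all)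
  also have "\<dots> =
      finsum (Hom H ?W (FOb (E k) Z)) (\<lambda>h. Cmp H ?W (FOb (E g) (A Z)) (FOb (E k) Z) N (?t h)) (carrier \<Gamma>)"
    by (rule S.C.cmp_finsum_right) (use X g N t finite_group in simp_all)
  also have "\<dots> = finsum (Hom H ?W (FOb (E k) Z))
     (\<lambda>h. Cmp H ?W (FOb (E g) (FOb (E h) Z)) (FOb (E k) Z) (mc g h k Z)
       (FMor (E g) Y (FOb (E h) Z) (Cmp H Y (A Z) (FOb (E h) Z) (prj h Z) \<psi>))) (carrier \<Gamma>)"
  proof (rule S.C.hom_finsum_cong)
    fix h assume h: "h \<in> carrier \<Gamma>"
    show "Cmp H ?W (FOb (E g) (A Z)) (FOb (E k) Z) N (?t h) =
      Cmp H ?W (FOb (E g) (FOb (E h) Z)) (FOb (E k) Z) (mc g h k Z)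
       (FMor (E g) Y (FOb (E h) Z) (Cmp H Y (A Z) (FOb (E h) Z) (prj h Z) \<psi>))"
      unfolding N_def using X g \<psi> h by (simp add: S.C.cmp_assoc mc_apply E_cmp)
  qed (use X g \<psi> in simp_all)
  also have "\<dots> = ?R"
  proof (rule S.C.hom_finsum_single[where i = "inv g \<otimes> k"])
    fix h assume h: "h \<in> carrier \<Gamma>" "h \<noteq> inv g \<otimes> k"
    then have "k \<noteq> g \<otimes> h"
      using g by (auto simp flip: m_assoc)
    then show "Cmp H ?W (FOb (E g) (FOb (E h) Z)) (FOb (E k) Z) (mc g h k Z)
       (FMor (E g) Y (FOb (E h) Z) (Cmp H Y (A Z) (FOb (E h) Z) (prj h Z) \<psi>)) = \<zero>\<^bsub>Hom H ?W (FOb (E k) Z)\<^esub>"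
      using X g \<psi> h by (simp add: mc_zero)
  qed (use X g \<psi> finite_group in simp_all)
  finally show ?thesis .
qed

text \<open>In components, composition in the Kleisli category is composition in the orbit category.\<close>

lemma kleisli_component:
  assumes X: "X \<in> Ob H" "Y \<in> Ob H" "Z \<in> Ob H" and f: "\<phi> \<in> Mor H X (A Y)" "\<psi> \<in> Mor H Y (A Z)"
    and k: "k \<in> carrier \<Gamma>"
  shows "Cmp H X (A Z) (FOb (E k) Z) (prj k Z) (Cmp Kl X Y Z \<psi> \<phi>) =
    finsum (Hom H X (FOb (E k) Z)) (\<lambda>g.
      summand X Y Z g (inv g \<otimes> k) k (Cmp H Y (A Z) (FOb (E (inv g \<otimes> k)) Z) (prj (inv g \<otimes> k) Z) \<psi>) (Cmp H X (A
          Y) (FOb (E g) Y) (prj g Y) \<phi>)) (carrier \<Gamma>)"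
proof -
  define L where "L = Cmp H (A Y) (A Z) (FOb (E k) Z) (prj k Z)
    (Cmp H (A Y) (A (A Z)) (A Z) (mu Z) (FMor TS Y (A Z) \<psi>))"
  have L: "L \<in> Mor H (A Y) (FOb (E k) Z)"
    unfolding L_def using X f k by simp
  have Linc: "Cmp H (FOb (E g) Y) (A Y) (FOb (E k) Z) L (inc g Y) =
     Cmp H (FOb (E g) Y) (FOb (E g) (FOb (E (inv g \<otimes> k)) Z)) (FOb (E k) Z) (mc g (inv g \<otimes> k) k Z)
      (FMor (E g) Y (FOb (E (inv g \<otimes> k)) Z)
        (Cmp H Y (A Z) (FOb (E (inv g \<otimes> k)) Z) (prj (inv g \<otimes> k) Z) \<psi>))"
    if g: "g \<in> carrier \<Gamma>" for g
    unfolding L_def using X f k g by (simp add: S.C.cmp_assoc inc_nat mult_summand)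
  have "Cmp H X (A Z) (FOb (E k) Z) (prj k Z) (Cmp Kl X Y Z \<psi> \<phi>) = Cmp H X (A Y) (FOb (E k) Z) L \<phi>"
    unfolding L_def using X f k by (simp add: S.C.cmp_assoc)
  also have "\<dots> = Cmp H X (A Y) (FOb (E k) Z) L (finsum (Hom H X (A Y)) (\<lambda>g.
      Cmp H X (FOb (E g) Y) (A Y) (inc g Y) (Cmp H X (A Y) (FOb (E g) Y) (prj g Y) \<phi>)) (carrier \<Gamma>))"
    by (rule arg_cong[OF S.C.direct_sum_expand_in[OF direct_sum]]) (use X f in simp_all)
  also have "\<dots> = finsum (Hom H X (FOb (E k) Z))
      (\<lambda>g. Cmp H X (A Y) (FOb (E k) Z) L (Cmp H X (FOb (E g) Y) (A Y) (inc g Y)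
      (Cmp H X (A Y) (FOb (E g) Y) (prj g Y) \<phi>))) (carrier \<Gamma>)"
    by (rule S.C.cmp_finsum_right) (use X f L k finite_group in simp_all)
  also have "\<dots> = finsum (Hom H X (FOb (E k) Z)) (\<lambda>g.
      summand X Y Z g (inv g \<otimes> k) k (Cmp H Y (A Z) (FOb (E (inv g \<otimes> k)) Z) (prj (inv g \<otimes> k) Z) \<psi>) (Cmp H X (A
          Y) (FOb (E g) Y) (prj g Y) \<phi>)) (carrier \<Gamma>)"
  proof (rule S.C.hom_finsum_cong)
    fix g assume g: "g \<in> carrier \<Gamma>"
    have "Cmp H X (A Y) (FOb (E k) Z) L (Cmp H X (FOb (E g) Y) (A Y) (inc g Y)
        (Cmp H X (A Y) (FOb (E g) Y) (prj g Y) \<phi>)) =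
      Cmp H X (FOb (E g) Y) (FOb (E k) Z) (Cmp H (FOb (E g) Y) (A Y) (FOb (E k) Z) L (inc g Y))
        (Cmp H X (A Y) (FOb (E g) Y) (prj g Y) \<phi>)"
      using X f L k g by (simp add: S.C.cmp_assoc)
    then show "Cmp H X (A Y) (FOb (E k) Z) L (Cmp H X (FOb (E g) Y) (A Y) (inc g Y)
        (Cmp H X (A Y) (FOb (E g) Y) (prj g Y) \<phi>)) =
      summand X Y Z g (inv g \<otimes> k) k (Cmp H Y (A Z) (FOb (E (inv g \<otimes> k)) Z) (prj (inv g \<otimes> k) Z) \<psi>) (Cmp H X (A
          Y) (FOb (E g) Y) (prj g Y) \<phi>)"
      using X f k g by (simp add: Linc S.C.cmp_assoc)
  qed (use X f k in simp_all)
  finally show ?thesis .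
qed

subsection \<open>The unit\<close>

text \<open>The unit law of the monad, read off on the summand \<open>E 1\<close>, kills every component of \<open>\<eta>\<close> except
  that of the neutral element, because the multiplication maps are invertible and \<open>E 1\<close> is faithful.\<close>

lemma eta_component:
  assumes X: "X \<in> Ob H" and k: "k \<in> carrier \<Gamma>"
  shows "Cmp H X (A X) (FOb (E k) X) (prj k X) (\<eta> X) =
    (if k = \<one> then u X else \<zero>\<^bsub>Hom H X (FOb (E k) X)\<^esub>)"
proof (cases "k = \<one>")
  case False
  let ?o = "\<one>"
  let ?W = "FOb (E ?o) X"
  let ?e = "Cmp H X (A X) (FOb (E k) X) (prj k X) (\<eta> X)"
  have "Cmp H ?W (FOb (E ?o) (FOb (E k) X)) (FOb (E k) X) (m ?o k X) (FMor (E ?o) X (FOb (E k) X) ?e) =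
     Cmp H ?W (A X) (FOb (E k) X) (prj k X) (Cmp H ?W (A (A X)) (A X) (mu X)
      (Cmp H ?W (FOb (E ?o) (A X)) (A (A X)) (inc ?o (A X)) (FMor (E ?o) X (A X) (\<eta> X))))"
    using X k by (subst mult_summand) simp_all
  also have "\<dots> = Cmp H ?W (A X) (FOb (E k) X) (prj k X) (Cmp H ?W (A X) (A X)
      (Cmp H (A X) (A (A X)) (A X) (mu X) (FMor TS X (A X) (\<eta> X))) (inc ?o X))"
    using X k by (simp add: S.C.cmp_assoc inc_nat)
  also have "\<dots> = \<zero>\<^bsub>Hom H ?W (FOb (E k) X)\<^esub>"
    using X k False is_direct_sumD(7)[OF direct_sum[OF X], of ?o k] by (simp add: mu_eta_right)
  finally have eq: "Cmp H ?W (FOb (E ?o) (FOb (E k) X)) (FOb (E k) X) (m ?o k X) (FMor (E ?o) X (FOb (E k) X) ?e) =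
     Cmp H ?W (FOb (E ?o) (FOb (E k) X)) (FOb (E k) X) (m ?o k X) \<zero>\<^bsub>Hom H ?W (FOb (E ?o) (FOb (E k) X))\<^esub>"
    using X k mc_closed[of ?o k k X] by simp
  have iso: "iso_in H (FOb (E ?o) (FOb (E k) X)) (FOb (E k) X) (m ?o k X)"
    using mc_iso[of ?o k X] X k by simp
  have "FMor (E ?o) X (FOb (E k) X) ?e = \<zero>\<^bsub>Hom H ?W (FOb (E ?o) (FOb (E k) X))\<^esub>"
    by (rule S.C.iso_cancel_left[OF _ _ _ iso _ _ eq]) (use X k in simp_all)
  then have "FMor (E ?o) X (FOb (E k) X) ?e = FMor (E ?o) X (FOb (E k) X) \<zero>\<^bsub>Hom H X (FOb (E k) X)\<^esub>"
    using X k by simp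
  from fully_faithful_inj[OF E_fully_faithful[of ?o] _ _ _ _ this] have "?e = \<zero>\<^bsub>Hom H X (FOb (E k) X)\<^esub>"
    using X k by simp
  then show ?thesis using False by simp
qed simp

lemma u_closed: "X \<in> Ob H \<Longrightarrow> u X \<in> Mor H X (FOb (E \<one>) X)"
  by simp

lemma u_nat:
  assumes "X \<in> Ob H" "Y \<in> Ob H" "f \<in> Mor H X Y"
  shows "Cmp H X (FOb (E \<one>) X) (FOb (E \<one>) Y) (FMor (E \<one>) X Y f) (u X) = Cmp H X Y (FOb (E \<one>) Y) (u Y) f"
proof -
  have "Cmp H X (FOb (E \<one>) X) (FOb (E \<one>) Y) (FMor (E \<one>) X Y f) (u X) =
    Cmp H X (A X) (FOb (E \<one>) Y) (Cmp H (A X) (FOb (E \<one>) X) (FOb (E \<one>) Y) (FMor (E \<one>) X Y f) (prj \<one> X)) (\<eta> X)"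
    using assms by (simp add: S.C.cmp_assoc)
  also have "\<dots> = Cmp H X (A Y) (FOb (E \<one>) Y) (prj \<one> Y) (Cmp H X (A X) (A Y) (FMor TS X Y f) (\<eta> X))"
    using assms by (simp add: S.C.cmp_assoc flip: prj_nat)
  also have "\<dots> = Cmp H X Y (FOb (E \<one>) Y) (u Y) f"
    using assms by (simp add: S.C.cmp_assoc eta_natural)
  finally show ?thesis .
qed

lemma eta_eq:
  assumes X: "X \<in> Ob H"
  shows "\<eta> X = Cmp H X (FOb (E \<one>) X) (A X) (inc \<one> X) (u X)"
proof (rule S.C.direct_sum_ext_in[OF direct_sum[OF X] X])
  fix k assume k: "k \<in> carrier \<Gamma>"
  have "Cmp H X (A X) (FOb (E k) X) (prj k X) (Cmp H X (FOb (E \<one>) X) (A X) (inc \<one> X) (u X)) =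
    Cmp H X (FOb (E \<one>) X) (FOb (E k) X) (Cmp H (FOb (E \<one>) X) (A X) (FOb (E k) X) (prj k X) (inc \<one> X)) (u X)"
    using X k u_closed[OF X] by (simp add: S.C.cmp_assoc)
  also have "\<dots> = (if k = \<one> then u X else \<zero>\<^bsub>Hom H X (FOb (E k) X)\<^esub>)"
    using X k u_closed[OF X] is_direct_sumD(6,7)[OF direct_sum[OF X]] by auto
  finally show "Cmp H X (A X) (FOb (E k) X) (prj k X) (\<eta> X) =
    Cmp H X (A X) (FOb (E k) X) (prj k X) (Cmp H X (FOb (E \<one>) X) (A X) (inc \<one> X) (u X))"
    using eta_component[OF X k] by simp
qed (use X u_closed in simp_all)

text \<open>The unit law \<open>\<mu> \<circ> \<eta> = 1\<close> on the summand \<open>E k X\<close> of \<open>A X\<close>.\<close>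

lemma m_one_left:
  assumes X: "X \<in> Ob H" and k: "k \<in> carrier \<Gamma>"
  shows "Cmp H (FOb (E k) X) (FOb (E \<one>) (FOb (E k) X)) (FOb (E k) X) (mc \<one> k k X) (u (FOb (E k) X)) = Idn H
      (FOb (E k) X)"
proof -
  let ?o = "\<one>"
  let ?W = "FOb (E k) X"
  have "Cmp H ?W (FOb (E ?o) ?W) ?W (mc ?o k k X) (u ?W) =
     Cmp H ?W (A X) ?W (prj k X) (Cmp H ?W (A (A X)) (A X) (mu X)
      (Cmp H ?W (FOb (E ?o) (A X)) (A (A X)) (inc ?o (A X))
       (Cmp H ?W (FOb (E ?o) ?W) (FOb (E ?o) (A X)) (FMor (E ?o) ?W (A X) (inc k X)) (u ?W))))"
    using X k u_closed[of ?W] by (subst mc_apply) simp_all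
  also have "\<dots> = Cmp H ?W (A X) ?W (prj k X) (Cmp H ?W (A (A X)) (A X) (mu X)
      (Cmp H ?W (A X) (A (A X)) (Cmp H (A X) (FOb (E ?o) (A X)) (A (A X)) (inc ?o (A X))
       (u (A X))) (inc k X)))"
    using X k u_closed[of ?W] u_closed[of "A X"] by (subst u_nat) (simp_all add: S.C.cmp_assoc)
  also have "\<dots> = Cmp H ?W (A X) ?W (prj k X) (Cmp H ?W (A X) (A X) (Cmp H (A X) (A (A X)) (A X) (mu X) (\<eta> (A
      X))) (inc k X))"
    using X k by (subst eta_eq[symmetric]) (simp_all add: S.C.cmp_assoc)
  also have "\<dots> = Idn H ?W"
    using X k is_direct_sumD(6)[OF direct_sum[OF X] k] by (simp add: mu_eta_left)
  finally show ?thesis .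
qed

text \<open>By the unit law \<open>\<mu> \<circ> A \<eta> = 1\<close>, \<open>E 1 (u X)\<close> is inverse to the multiplication \<open>E 1 (E 1 X) \<rightarrow> E 1 X\<close>, and
  \<open>E 1\<close> reflects isomorphisms.\<close>

lemma u_iso:
  assumes X: "X \<in> Ob H"
  shows "iso_in H X (FOb (E \<one>) X) (u X)"
proof (rule fully_faithful_reflects_iso[OF E_functor E_fully_faithful])
  let ?o = "\<one>"
  let ?W = "FOb (E ?o) X"
  obtain n where n: "m ?o ?o X \<in> Mor H (FOb (E ?o) ?W) (FOb (E ?o) X)" "n \<in> Mor H (FOb (E ?o) X) (FOb (E ?o) ?W)"
    "Cmp H (FOb (E ?o) X) (FOb (E ?o) ?W) (FOb (E ?o) X) (m ?o ?o X) n = Idn H (FOb (E ?o) X)"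
    "iso_in H (FOb (E ?o) X) (FOb (E ?o) ?W) n"
    using mc_iso[of ?o ?o X] X S.C.iso_inE[of "FOb (E ?o) ?W" "FOb (E (?o \<otimes> ?o)) X"] by (metis one_closed r_one)
  have "Cmp H ?W (FOb (E ?o) ?W) ?W (m ?o ?o X) (FMor (E ?o) X ?W (u X)) =
     Cmp H ?W (A X) ?W (prj ?o X) (Cmp H ?W (A (A X)) (A X) (mu X)
      (Cmp H ?W (FOb (E ?o) (A X)) (A (A X)) (inc ?o (A X)) (FMor (E ?o) X (A X) (\<eta> X))))"
    using X by (subst mult_summand) simp_all
  also have "\<dots> = Cmp H ?W (A X) ?W (prj ?o X) (Cmp H ?W (A X) (A X)
      (Cmp H (A X) (A (A X)) (A X) (mu X) (FMor TS X (A X) (\<eta> X))) (inc ?o X))"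
    using X by (simp add: S.C.cmp_assoc inc_nat)
  also have "\<dots> = Idn H ?W"
    using X is_direct_sumD(6)[OF direct_sum[OF X], of ?o] by (simp add: mu_eta_right)
  also have "\<dots> = Cmp H ?W (FOb (E ?o) ?W) ?W (m ?o ?o X) n"
    using n(3) by simp
  finally have eq: "Cmp H ?W (FOb (E ?o) ?W) ?W (m ?o ?o X) (FMor (E ?o) X ?W (u X)) = Cmp H ?W (FOb (E ?o)
      ?W) ?W (m ?o ?o X) n" .
  have "iso_in H (FOb (E ?o) ?W) ?W (m ?o ?o X)" using mc_iso[of ?o ?o X] X by simp
  from S.C.iso_cancel_left[OF _ _ _ this _ _ eq] have "FMor (E ?o) X ?W (u X) = n"
    using X n(2) u_closed[OF X] by simp
  then show "iso_in H (FOb (E ?o) X) (FOb (E ?o) ?W) (FMor (E ?o) X ?W (u X))"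
    using n(4) by simp
qed (use X u_closed in simp_all)

end

context normal_subgroup_group
begin

subsection \<open>Orbit categories of subgroups\<close>

abbreviation "sub K \<equiv> \<Gamma>\<lparr>carrier := K\<rparr>"
abbreviation "Orb K \<equiv> orbit_cat H E m u (sub K)"
abbreviation "J K \<equiv> orbit_to_kleisli H E TS inc (sub K)"

abbreviation "Orb\<^sub>\<Gamma> \<equiv> orbit_cat H E m u \<Gamma>"
abbreviation "J\<^sub>\<Gamma> \<equiv> orbit_to_kleisli H E TS inc \<Gamma>"
abbreviation "Ind K \<equiv> orbit_left H E u (sub K)"
abbreviation "Ind\<^sub>\<Gamma> \<equiv> orbit_left H E u \<Gamma>"
abbreviation "Incl K \<equiv> orbit_incl H E (sub K) \<Gamma>"

lemma orbit_hom_module: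
  "\<lbrakk>K \<subseteq> carrier \<Gamma>; X \<in> Ob H; Y \<in> Ob H\<rbrakk> \<Longrightarrow> module R (Hom (Orb K) X Y)"
  unfolding orbit_cat_def lcat.simps
  by (rule product_module) (use S.C.hom_module S.C.R.cring_axioms in \<open>auto simp: subset_iff\<close>)

lemma orbit_mor_apply [simp]:
  "\<lbrakk>f \<in> Mor (Orb K) X Y; g \<in> K\<rbrakk> \<Longrightarrow> f g \<in> Mor H X (FOb (E g) Y)"
  by (auto simp: PiE_iff)

lemma J_ob [simp]: "FOb (orbit_to_kleisli H E B inc \<Gamma>') X = X"
  by (simp add: orbit_to_kleisli_def)

lemma J_mor: "FMor (J K) X Y f = finsum (Hom H X (A Y)) (\<lambda>g. Cmp H X (FOb (E g) Y) (A Y) (inc g Y) (f g)) K"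
  by (simp add: orbit_to_kleisli_def)

lemma J_closed:
  assumes "K \<subseteq> carrier \<Gamma>" "X \<in> Ob H" "Y \<in> Ob H" "f \<in> Mor (Orb K) X Y"
  shows "FMor (J K) X Y f \<in> Mor H X (A Y)"
  unfolding J_mor by (rule S.C.hom_finsum_closed) (use assms in auto)

text \<open>So \<open>J K\<close> identifies the morphisms of the orbit category of \<open>K\<close> with the Kleisli morphisms whose
  components outside \<open>K\<close> vanish.\<close>

lemma prj_J:
  assumes "K \<subseteq> carrier \<Gamma>" "X \<in> Ob H" "Y \<in> Ob H" "f \<in> Mor (Orb K) X Y" "g \<in> carrier \<Gamma>"
  shows "Cmp H X (A Y) (FOb (E g) Y) (prj g Y) (FMor (J K) X Y f) =
    (if g \<in> K then f g else \<zero>\<^bsub>Hom H X (FOb (E g) Y)\<^esub>)"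
  unfolding J_mor by (rule S.C.direct_sum_tuple(2)[OF direct_sum]) (use assms in auto)

lemma J_inj:
  assumes "K \<subseteq> carrier \<Gamma>" "X \<in> Ob H" "Y \<in> Ob H" "f \<in> Mor (Orb K) X Y" "f' \<in> Mor (Orb K) X Y"
    "FMor (J K) X Y f = FMor (J K) X Y f'"
  shows "f = f'"
proof (rule PiE_ext)
  fix g assume g: "g \<in> K"
  then show "f g = f' g"
    using prj_J[OF assms(1-4), of g] prj_J[OF assms(1-3,5), of g] assms(1,6) by auto
qed (use assms in auto)

lemma orbit_cmp_closed:
  assumes K: "K \<subseteq> carrier \<Gamma>" and X: "X \<in> Ob H" "Y \<in> Ob H" "Z \<in> Ob H"
    and f: "f \<in> Mor (Orb K) X Y" "f' \<in> Mor (Orb K) Y Z"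
  shows "Cmp (Orb K) X Y Z f' f \<in> Mor (Orb K) X Z"
proof -
  have "finsum (Hom H X (FOb (E k) Z))
         (\<lambda>(g, h). Cmp H X (FOb (E g) (FOb (E h) Z)) (FOb (E k) Z) (m g h Z)
            (Cmp H X (FOb (E g) Y) (FOb (E g) (FOb (E h) Z))
               (FMor (E g) Y (FOb (E h) Z) (f' h)) (f g)))
         {(g, h) \<in> K \<times> K. g \<otimes> h = k} \<in> Mor H X (FOb (E k) Z)" if "k \<in> K" for k
    by (rule S.C.hom_finsum_closed) (use K X f that in \<open>auto simp: subset_iff PiE_iff\<close>)
  then show ?thesis
    by (simp add: orbit_cat_def)
qed

text \<open>In the formula for the composite of the orbit category the second index is determined by the first.\<close>

lemma orbit_cmp_apply:
  assumes K: "subgroup K \<Gamma>" and X: "X \<in> Ob H" "Y \<in> Ob H" "Z \<in> Ob H"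
    and f: "f \<in> Mor (Orb K) X Y" "f' \<in> Mor (Orb K) Y Z" and k: "k \<in> K"
  shows "Cmp (Orb K) X Y Z f' f k = finsum (Hom H X (FOb (E k) Z)) (\<lambda>g.
      summand X Y Z g (inv g \<otimes> k) k (f' (inv g \<otimes> k)) (f g)) K"
proof -
  have KG: "g \<in> carrier \<Gamma>" if "g \<in> K" for g
    using subgroup.mem_carrier[OF K that] .
  let ?p = "\<lambda>g. (g, inv g \<otimes> k)"
  let ?t = "\<lambda>(g, h). Cmp H X (FOb (E g) (FOb (E h) Z)) (FOb (E k) Z) (m g h Z)
            (Cmp H X (FOb (E g) Y) (FOb (E g) (FOb (E h) Z)) (FMor (E g) Y (FOb (E h) Z) (f' h)) (f g))"
  have gk: "g \<otimes> (inv g \<otimes> k) = k" "inv g \<otimes> k \<in> K" if "g \<in> K" for g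
    using that KG k subgroup.m_inv_closed[OF K] subgroup.m_closed[OF K] by (simp_all flip: m_assoc)
  have img: "{(g, h) \<in> K \<times> K. g \<otimes> h = k} = ?p ` K"
  proof (intro equalityI subsetI)
    fix x assume "x \<in> {(g, h) \<in> K \<times> K. g \<otimes> h = k}"
    then obtain g h where gh: "x = (g, h)" "g \<in> K" "h \<in> K" "g \<otimes> h = k"
      by blast
    then have "h = inv g \<otimes> k"
      using KG by (auto simp flip: m_assoc)
    then show "x \<in> ?p ` K"
      using gh by blast
  qed (use gk in auto)
  have "Cmp (Orb K) X Y Z f' f k = finsum (Hom H X (FOb (E k) Z)) ?t (?p ` K)"
    using k by (simp add: orbit_cat_def flip: img)
  also have "\<dots> = finsum (Hom H X (FOb (E k) Z)) (\<lambda>g. ?t (?p g)) K"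
    by (rule S.C.hom_finsum_reindex)
       (use X f k gk KG in \<open>auto simp: inj_on_def PiE_iff\<close>)
  finally show ?thesis
    by (simp add: gk cong: S.C.hom_finsum_cong) (rule S.C.hom_finsum_cong; use X f k gk KG in \<open>auto simp: PiE_iff\<close>)
qed

text \<open>A term with \<open>g \<in> K\<close> contributes to the index \<open>k\<close> only if \<open>inv g \<otimes> k \<in> K\<close>. As \<open>K\<close> is a subgroup, this
  means \<open>k \<in> K\<close>, so the Kleisli composite has again no components outside \<open>K\<close>.\<close>

lemma J_cmp:
  assumes K: "subgroup K \<Gamma>" and X: "X \<in> Ob H" "Y \<in> Ob H" "Z \<in> Ob H"
    and f: "f \<in> Mor (Orb K) X Y" "f' \<in> Mor (Orb K) Y Z"
  shows "FMor (J K) X Z (Cmp (Orb K) X Y Z f' f) = Cmp Kl X Y Z (FMor (J K) Y Z f') (FMor (J K) X Y f)"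
proof (rule S.C.direct_sum_ext_in[OF direct_sum[OF X(3)] X(1)])
  note KG = subgroup.subset[OF K]
  note Jf = J_closed[OF KG X(1,2) f(1)] J_closed[OF KG X(2,3) f(2)]
  note cl = orbit_cmp_closed[OF KG X f]
  show "FMor (J K) X Z (Cmp (Orb K) X Y Z f' f) \<in> Mor H X (A Z)"
    by (rule J_closed[OF KG X(1,3) cl])
  show "Cmp Kl X Y Z (FMor (J K) Y Z f') (FMor (J K) X Y f) \<in> Mor H X (A Z)"
    using Jf X by simp
  fix k assume k: "k \<in> carrier \<Gamma>"
  let ?t = "\<lambda>g. summand X Y Z g (inv g \<otimes> k) k (if inv g \<otimes> k \<in> K then f' (inv g \<otimes> k) else \<zero>\<^bsub>Hom H Y (FOb (E
      (inv g \<otimes> k)) Z)\<^esub>) (if g \<in> K then f g else \<zero>\<^bsub>Hom H X (FOb (E g) Y)\<^esub>)"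
  have t: "?t g \<in> Mor H X (FOb (E k) Z)" if "g \<in> carrier \<Gamma>" for g
    using that X k f by (auto simp: PiE_iff)
  have "Cmp H X (A Z) (FOb (E k) Z) (prj k Z) (Cmp Kl X Y Z (FMor (J K) Y Z f') (FMor (J K) X Y f)) =
     finsum (Hom H X (FOb (E k) Z)) ?t (carrier \<Gamma>)"
    unfolding kleisli_component[OF X Jf k]
    by (rule S.C.hom_finsum_cong) (use X f k KG t in \<open>simp_all add: prj_J del: if_split\<close>)
  also have "\<dots> = finsum (Hom H X (FOb (E k) Z)) ?t K"
    by (rule S.C.hom_finsum_restrict) (use X f k KG t finite_group in auto)
  also have "\<dots> = (if k \<in> K then Cmp (Orb K) X Y Z f' f k else \<zero>\<^bsub>Hom H X (FOb (E k) Z)\<^esub>)"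
  proof (cases "k \<in> K")
    case True
    have "inv g \<otimes> k \<in> K" if "g \<in> K" for g
      using that True subgroup.m_inv_closed[OF K] subgroup.m_closed[OF K] by blast
    then show ?thesis
      using True KG X k f by (simp add: orbit_cmp_apply[OF K X f True])
         (rule S.C.hom_finsum_cong; auto simp: PiE_iff subset_iff)
  next
    case False
    have "inv g \<otimes> k \<notin> K" if "g \<in> K" for g
    proof
      assume "inv g \<otimes> k \<in> K"
      then have "g \<otimes> (inv g \<otimes> k) \<in> K"
        using that subgroup.m_closed[OF K] by blast
      then show False
        using that KG k False by (auto simp: subset_iff simp flip: m_assoc)
    qed
    then have "finsum (Hom H X (FOb (E k) Z)) ?t K = \<zero>\<^bsub>Hom H X (FOb (E k) Z)\<^esub>"
      by (intro S.C.hom_finsum_zero) (use X f k KG in \<open>auto simp: subset_iff PiE_iff\<close>)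
    then show ?thesis using False by simp
  qed
  finally show "Cmp H X (A Z) (FOb (E k) Z) (prj k Z) (FMor (J K) X Z (Cmp (Orb K) X Y Z f' f)) =
      Cmp H X (A Z) (FOb (E k) Z) (prj k Z) (Cmp Kl X Y Z (FMor (J K) Y Z f') (FMor (J K) X Y f))"
    using prj_J[OF KG X(1,3) cl k] by simp
qed

lemma orbit_idn_closed: "\<lbrakk>K \<subseteq> carrier \<Gamma>; X \<in> Ob H\<rbrakk> \<Longrightarrow> Idn (Orb K) X \<in> Mor (Orb K) X X"
  by (auto simp: PiE_iff u_closed subset_iff)

lemma J_idn:
  assumes K: "subgroup K \<Gamma>" and X: "X \<in> Ob H"
  shows "FMor (J K) X X (Idn (Orb K) X) = \<eta> X"
proof (rule S.C.direct_sum_ext_in[OF direct_sum[OF X] X])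
  note KG = subgroup.subset[OF K]
  show "FMor (J K) X X (Idn (Orb K) X) \<in> Mor H X (A X)"
    by (rule J_closed[OF KG X X orbit_idn_closed[OF KG X]])
  fix k assume k: "k \<in> carrier \<Gamma>"
  show "Cmp H X (A X) (FOb (E k) X) (prj k X) (FMor (J K) X X (Idn (Orb K) X)) =
    Cmp H X (A X) (FOb (E k) X) (prj k X) (\<eta> X)"
    using prj_J[OF KG X X orbit_idn_closed[OF KG X] k] eta_component[OF X k] subgroup.one_closed[OF K] by auto
qed (use X in simp)

lemma J_add:
  assumes K: "K \<subseteq> carrier \<Gamma>" and X: "X \<in> Ob H" "Y \<in> Ob H"
    and f: "f \<in> Mor (Orb K) X Y" "g \<in> Mor (Orb K) X Y"
  shows "FMor (J K) X Y (f \<oplus>\<^bsub>Hom (Orb K) X Y\<^esub> g) = FMor (J K) X Y f \<oplus>\<^bsub>Hom H X (A Y)\<^esub> FMor (J K) X Y g"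
proof (rule S.C.direct_sum_ext_in[OF direct_sum[OF X(2)] X(1)])
  have fg: "f \<oplus>\<^bsub>Hom (Orb K) X Y\<^esub> g \<in> Mor (Orb K) X Y"
    using K X f by (auto simp: PiE_iff)
  show "FMor (J K) X Y (f \<oplus>\<^bsub>Hom (Orb K) X Y\<^esub> g) \<in> Mor H X (A Y)"
    by (rule J_closed[OF K X fg])
  note Jf = J_closed[OF K X f(1)] J_closed[OF K X f(2)]
  then show "FMor (J K) X Y f \<oplus>\<^bsub>Hom H X (A Y)\<^esub> FMor (J K) X Y g \<in> Mor H X (A Y)"
    using X by simp
  fix k assume k: "k \<in> carrier \<Gamma>"
  show "Cmp H X (A Y) (FOb (E k) Y) (prj k Y) (FMor (J K) X Y (f \<oplus>\<^bsub>Hom (Orb K) X Y\<^esub> g)) =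
    Cmp H X (A Y) (FOb (E k) Y) (prj k Y) (FMor (J K) X Y f \<oplus>\<^bsub>Hom H X (A Y)\<^esub> FMor (J K) X Y g)"
    unfolding prj_J[OF K X fg k] using X k Jf prj_J[OF K X f(1) k] prj_J[OF K X f(2) k]
    by (simp add: S.C.cmp_add_right)
qed

lemma J_smult:
  assumes K: "K \<subseteq> carrier \<Gamma>" and X: "X \<in> Ob H" "Y \<in> Ob H"
    and r: "r \<in> carrier R" and f: "f \<in> Mor (Orb K) X Y"
  shows "FMor (J K) X Y (r \<odot>\<^bsub>Hom (Orb K) X Y\<^esub> f) = r \<odot>\<^bsub>Hom H X (A Y)\<^esub> FMor (J K) X Y f"
proof (rule S.C.direct_sum_ext_in[OF direct_sum[OF X(2)] X(1)])
  have rf: "r \<odot>\<^bsub>Hom (Orb K) X Y\<^esub> f \<in> Mor (Orb K) X Y"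
    using K X f r by (auto simp: PiE_iff)
  show "FMor (J K) X Y (r \<odot>\<^bsub>Hom (Orb K) X Y\<^esub> f) \<in> Mor H X (A Y)"
    by (rule J_closed[OF K X rf])
  note Jf = J_closed[OF K X f]
  then show "r \<odot>\<^bsub>Hom H X (A Y)\<^esub> FMor (J K) X Y f \<in> Mor H X (A Y)"
    using X r by simp
  fix k assume k: "k \<in> carrier \<Gamma>"
  have zero: "r \<odot>\<^bsub>Hom H X (FOb (E k) Y)\<^esub> \<zero>\<^bsub>Hom H X (FOb (E k) Y)\<^esub> = \<zero>\<^bsub>Hom H X (FOb (E k) Y)\<^esub>"
    using module.smult_r_null[OF S.C.hom_module] X k r by simp
  show "Cmp H X (A Y) (FOb (E k) Y) (prj k Y) (FMor (J K) X Y (r \<odot>\<^bsub>Hom (Orb K) X Y\<^esub> f)) =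
    Cmp H X (A Y) (FOb (E k) Y) (prj k Y) (r \<odot>\<^bsub>Hom H X (A Y)\<^esub> FMor (J K) X Y f)"
    unfolding prj_J[OF K X rf k] using X k Jf r prj_J[OF K X f k] zero
    by (simp add: S.C.cmp_smult_right)
qed

lemma orbit_linear_category: "subgroup K \<Gamma> \<Longrightarrow> linear_category R (Orb K)"
  and J_linear_functor: "subgroup K \<Gamma> \<Longrightarrow> linear_functor R (Orb K) Kl (J K)"
proof -
  assume K: "subgroup K \<Gamma>"
  note KG = subgroup.subset[OF K]
  note faithful = linear_category_through_faithful[where F = "J K" and C = "Orb K", OF kleisli_linear_category]
  have module: "module R (Hom (Orb K) X Y)" if "X \<in> Ob (Orb K)" "Y \<in> Ob (Orb K)" for X Y
    by (rule orbit_hom_module[OF KG]) (use that in simp_all)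
  have cmp: "Cmp (Orb K) X Y Z g f \<in> Mor (Orb K) X Z"
    if "X \<in> Ob (Orb K)" "Y \<in> Ob (Orb K)" "Z \<in> Ob (Orb K)" "f \<in> Mor (Orb K) X Y" "g \<in> Mor (Orb K) Y Z" for X Y Z f g
    by (rule orbit_cmp_closed[OF KG _ _ _ that(4,5)]) (use that(1-3) in simp_all)
  have idn: "Idn (Orb K) X \<in> Mor (Orb K) X X" if "X \<in> Ob (Orb K)" for X
    by (rule orbit_idn_closed[OF KG]) (use that in simp)
  have ob: "FOb (J K) X \<in> Ob Kl" if "X \<in> Ob (Orb K)" for X
    using that by simp
  have mor: "FMor (J K) X Y f \<in> Mor Kl (FOb (J K) X) (FOb (J K) Y)"
    if "X \<in> Ob (Orb K)" "Y \<in> Ob (Orb K)" "f \<in> Mor (Orb K) X Y" for X Y f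
    using J_closed[OF KG _ _ that(3)] that(1,2) by simp
  have F_idn: "FMor (J K) X X (Idn (Orb K) X) = Idn Kl (FOb (J K) X)" if "X \<in> Ob (Orb K)" for X
    using J_idn[OF K, of X] that by simp
  have F_cmp: "FMor (J K) X Z (Cmp (Orb K) X Y Z g f) =
      Cmp Kl (FOb (J K) X) (FOb (J K) Y) (FOb (J K) Z) (FMor (J K) Y Z g) (FMor (J K) X Y f)"
    if "X \<in> Ob (Orb K)" "Y \<in> Ob (Orb K)" "Z \<in> Ob (Orb K)" "f \<in> Mor (Orb K) X Y" "g \<in> Mor (Orb K) Y Z" for X Y Z f g
    unfolding J_ob by (rule J_cmp[OF K _ _ _ that(4,5)]) (use that(1-3) in simp_all)
  have F_add: "FMor (J K) X Y (f \<oplus>\<^bsub>Hom (Orb K) X Y\<^esub> g) =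
      FMor (J K) X Y f \<oplus>\<^bsub>Hom Kl (FOb (J K) X) (FOb (J K) Y)\<^esub> FMor (J K) X Y g"
    if "X \<in> Ob (Orb K)" "Y \<in> Ob (Orb K)" "f \<in> Mor (Orb K) X Y" "g \<in> Mor (Orb K) X Y" for X Y f g
    unfolding J_ob kleisli_simps by (rule J_add[OF KG _ _ that(3,4)]) (use that(1,2) in simp_all)
  have F_smult: "FMor (J K) X Y (r \<odot>\<^bsub>Hom (Orb K) X Y\<^esub> f) =
      r \<odot>\<^bsub>Hom Kl (FOb (J K) X) (FOb (J K) Y)\<^esub> FMor (J K) X Y f"
    if "X \<in> Ob (Orb K)" "Y \<in> Ob (Orb K)" "r \<in> carrier R" "f \<in> Mor (Orb K) X Y" for X Y r f
    unfolding J_ob kleisli_simps by (rule J_smult[OF KG _ _ that(3,4)]) (use that(1,2) in simp_all)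
  have inj: "f = g" if "X \<in> Ob (Orb K)" "Y \<in> Ob (Orb K)" "f \<in> Mor (Orb K) X Y" "g \<in> Mor (Orb K) X Y"
      "FMor (J K) X Y f = FMor (J K) X Y g" for X Y f g
    by (rule J_inj[OF KG _ _ that(3-5)]) (use that(1,2) in simp_all)
  note facts = module cmp idn ob mor F_idn F_cmp F_add F_smult inj
  show "linear_category R (Orb K)" "linear_functor R (Orb K) Kl (J K)"
    by (rule faithful; fact facts)+
qed

lemma J_fully_faithful: "fully_faithful Orb\<^sub>\<Gamma> Kl J\<^sub>\<Gamma>"
  unfolding fully_faithful_def bij_betw_def
proof (intro ballI conjI)
  fix X Y assume "X \<in> Ob Orb\<^sub>\<Gamma>" "Y \<in> Ob Orb\<^sub>\<Gamma>"
  then have X: "X \<in> Ob H" "Y \<in> Ob H" by simp_all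
  note full = subset_refl[of "carrier \<Gamma>"]
  have sub: "sub (carrier \<Gamma>) = \<Gamma>" by simp
  show "inj_on (FMor J\<^sub>\<Gamma> X Y) (Mor Orb\<^sub>\<Gamma> X Y)"
    using J_inj[OF full X] unfolding sub by (auto intro: inj_onI)
  show "FMor J\<^sub>\<Gamma> X Y ` Mor Orb\<^sub>\<Gamma> X Y =
    Mor Kl (FOb J\<^sub>\<Gamma> X) (FOb J\<^sub>\<Gamma> Y)"
  proof
    show "FMor J\<^sub>\<Gamma> X Y ` Mor Orb\<^sub>\<Gamma> X Y \<subseteq>
      Mor Kl (FOb J\<^sub>\<Gamma> X) (FOb J\<^sub>\<Gamma> Y)"
      using J_closed[OF full X] J_ob unfolding sub by auto
    show "Mor Kl (FOb J\<^sub>\<Gamma> X) (FOb J\<^sub>\<Gamma> Y) \<subseteq>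
      FMor J\<^sub>\<Gamma> X Y ` Mor Orb\<^sub>\<Gamma> X Y"
    proof
      fix \<phi> assume "\<phi> \<in> Mor Kl (FOb J\<^sub>\<Gamma> X) (FOb J\<^sub>\<Gamma> Y)"
      then have \<phi>: "\<phi> \<in> Mor H X (A Y)"
        using J_ob unfolding sub by simp
      define f where "f = (\<lambda>g\<in>carrier \<Gamma>. Cmp H X (A Y) (FOb (E g) Y) (prj g Y) \<phi>)"
      have f: "f \<in> Mor (Orb (carrier \<Gamma>)) X Y"
        unfolding f_def using X \<phi> by auto
      have "FMor (J (carrier \<Gamma>)) X Y f = \<phi>"
      proof (rule S.C.direct_sum_ext_in[OF direct_sum[OF X(2)] X(1) J_closed[OF full X f] \<phi>])
        fix g assume g: "g \<in> carrier \<Gamma>"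
        show "Cmp H X (A Y) (FOb (E g) Y) (prj g Y) (FMor (J (carrier \<Gamma>)) X Y f) =
           Cmp H X (A Y) (FOb (E g) Y) (prj g Y) \<phi>"
          unfolding prj_J[OF full X f g] using g by (simp add: f_def)
      qed
      then show "\<phi> \<in> FMor J\<^sub>\<Gamma> X Y ` Mor Orb\<^sub>\<Gamma> X Y"
        using f unfolding sub by blast
    qed
  qed
qed

subsection \<open>The functors to orbit categories\<close>

lemma orbit_left_closed: "\<lbrakk>K \<subseteq> carrier \<Gamma>; X \<in> Ob H; Y \<in> Ob H; f \<in> Mor H X Y\<rbrakk> \<Longrightarrow>
   FMor (Ind K) X Y f \<in> Mor (Orb K) X Y"
  by (auto simp: PiE_iff u_closed subset_iff)

lemma J_orbit_left:
  assumes K: "subgroup K \<Gamma>" and X: "X \<in> Ob H" "Y \<in> Ob H" and f: "f \<in> Mor H X Y"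
  shows "FMor (J K) X Y (FMor (Ind K) X Y f) = Cmp H X Y (A Y) (\<eta> Y) f"
proof (rule S.C.direct_sum_ext_in[OF direct_sum[OF X(2)] X(1)])
  note KG = subgroup.subset[OF K]
  note l = orbit_left_closed[OF KG X f]
  show "FMor (J K) X Y (FMor (Ind K) X Y f) \<in> Mor H X (A Y)"
    by (rule J_closed[OF KG X l])
  fix k assume k: "k \<in> carrier \<Gamma>"
  have "Cmp H X (A Y) (FOb (E k) Y) (prj k Y) (Cmp H X Y (A Y) (\<eta> Y) f) =
    Cmp H X Y (FOb (E k) Y) (Cmp H Y (A Y) (FOb (E k) Y) (prj k Y) (\<eta> Y)) f"
    using X f k by (simp add: S.C.cmp_assoc)
  then show "Cmp H X (A Y) (FOb (E k) Y) (prj k Y) (FMor (J K) X Y (FMor (Ind K) X Y f)) =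
    Cmp H X (A Y) (FOb (E k) Y) (prj k Y) (Cmp H X Y (A Y) (\<eta> Y) f)"
    unfolding prj_J[OF KG X l k] eta_component[OF X(2) k] using X f k subgroup.one_closed[OF K] by auto
qed (use X f in simp)

lemma orbit_left_linear_functor:
  assumes K: "subgroup K \<Gamma>"
  shows "linear_functor R H (Orb K) (Ind K)"
  by (rule linear_functor_through_faithful[OF kleisli_left_linear_functor J_linear_functor[OF K]])
     (use J_inj[OF subgroup.subset[OF K]] orbit_left_closed[OF subgroup.subset[OF K]] J_orbit_left[OF K] in
       \<open>auto simp del: orbit_left_simps(2) orbit_cat_simps(2)\<close>)

lemma orbit_incl_closed: "\<lbrakk>K \<subseteq> carrier \<Gamma>; X \<in> Ob H; Y \<in> Ob H; f \<in> Mor (Orb K) X Y\<rbrakk> \<Longrightarrow>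
   FMor (Incl K) X Y f \<in> Mor (Orb (carrier \<Gamma>)) X Y"
  by (auto simp: PiE_iff)

lemma J_orbit_incl:
  assumes K: "K \<subseteq> carrier \<Gamma>" and X: "X \<in> Ob H" "Y \<in> Ob H" and f: "f \<in> Mor (Orb K) X Y"
  shows "FMor (J (carrier \<Gamma>)) X Y (FMor (Incl K) X Y f) = FMor (J K) X Y f"
proof (rule S.C.direct_sum_ext_in[OF direct_sum[OF X(2)] X(1)])
  note l = orbit_incl_closed[OF K X f]
  show "FMor (J (carrier \<Gamma>)) X Y (FMor (Incl K) X Y f) \<in> Mor H X (A Y)"
    by (rule J_closed[OF subset_refl X l])
  fix k assume k: "k \<in> carrier \<Gamma>"
  show "Cmp H X (A Y) (FOb (E k) Y) (prj k Y) (FMor (J (carrier \<Gamma>)) X Y (FMor (Incl K) X Y f)) =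
    Cmp H X (A Y) (FOb (E k) Y) (prj k Y) (FMor (J K) X Y f)"
    unfolding prj_J[OF subset_refl X l k] prj_J[OF K X f k] using k by simp
qed (rule J_closed[OF K X f])

lemma orbit_incl_linear_functor:
  assumes K: "subgroup K \<Gamma>"
  shows "linear_functor R (Orb K) (Orb (carrier \<Gamma>)) (Incl K)"
  by (rule linear_functor_through_faithful[OF J_linear_functor[OF K] J_linear_functor[OF subgroup_self]])
     (use J_inj[OF subset_refl] orbit_incl_closed[OF subgroup.subset[OF K]] J_orbit_incl[OF subgroup.subset[OF K]]
       orbit_cat_simps(1) in \<open>auto simp del: orbit_incl_simps(2) orbit_cat_simps(2) partial_object.surjective\<close>)

lemma orbit_incl_left:
  assumes K: "subgroup K \<Gamma>"
  shows "Incl K \<circ>\<^sub>F Ind K = Ind\<^sub>\<Gamma>"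
  using subgroup.one_closed[OF K]
  by (auto simp: comp_functor_def orbit_left_def orbit_incl_def fun_eq_iff restrict_def)

end

text \<open>The counit at \<open>S X\<close> has a section, the image of the unit, so \<open>f \<circ> \<epsilon> (S X)\<close> determines \<open>f\<close>.\<close>

lemma (in universal_arrows) right_faithful:
  assumes X: "X \<in> Ob C" "Y \<in> Ob D" and f: "f \<in> Mor D (FOb S X) Y" "g \<in> Mor D (FOb S X) Y"
    and eq: "FMor T (FOb S X) Y f = FMor T (FOb S X) Y g"
  shows "f = g"
proof -
  obtain s where s: "s \<in> Mor C X (FOb T (FOb S X))"
    "Cmp D (FOb S X) (FOb S (FOb T (FOb S X))) (FOb S X) (\<epsilon> (FOb S X)) (FMor S X (FOb T (FOb S X)) s) = Idn D
        (FOb S X)"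
    using factor_ex[of X "FOb S X" "Idn D (FOb S X)"] X by auto
  have "h = Cmp D (FOb S X) (FOb S (FOb T (FOb S X))) Y (Cmp D (FOb S (FOb T (FOb S X))) (FOb S (FOb T Y)) Y (\<epsilon> Y)
     (FMor S (FOb T (FOb S X)) (FOb T Y) (FMor T (FOb S X) Y h))) (FMor S X (FOb T (FOb S X)) s)"
    if "h \<in> Mor D (FOb S X) Y" for h
    using X that s by (simp add: arrow_natural S.D.cmp_assoc)
  from this[OF f(1)] this[OF f(2)] eq show ?thesis by simp
qed

lemma (in group) right_transversal:
  assumes K: "subgroup K G"
  obtains Tr where "Tr \<subseteq> carrier G" "\<And>g. g \<in> carrier G \<Longrightarrow> \<exists>k\<in>K. \<exists>t\<in>Tr. g = k \<otimes> t"
    "\<And>k k' t t'. \<lbrakk>k \<in> K; k' \<in> K; t \<in> Tr; t' \<in> Tr; k \<otimes> t = k' \<otimes> t'\<rbrakk> \<Longrightarrow> k = k' \<and> t = t'"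
proof -
  define rep where "rep g = (SOME x. x \<in> K #> g)" for g
  have rep: "rep g \<in> K #> g" if "g \<in> carrier G" for g
    unfolding rep_def using rcos_self[OF that K] by (rule someI)
  have rep_carrier: "rep g \<in> carrier G" if "g \<in> carrier G" for g
    using rep[OF that] r_coset_subset_G[OF subgroup.subset[OF K] that] by blast
  have coset_rep: "K #> rep g = K #> g" if "g \<in> carrier G" for g
    using repr_independence[OF rep[OF that] that K] by simp
  have coset_mult: "K #> (k \<otimes> x) = K #> x" if "k \<in> K" "x \<in> carrier G" for k x
  proof -
    have "k \<otimes> x \<in> K #> x" using that by (auto simp: r_coset_def)
    from repr_independence[OF this that(2) K] show ?thesis by simp
  qed
  show ?thesis
  proof (rule that[of "rep ` carrier G"])
    show "rep ` carrier G \<subseteq> carrier G" using rep_carrier by blast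
    fix g assume g: "g \<in> carrier G"
    have "g \<in> K #> rep g" using coset_rep[OF g] rcos_self[OF g K] by simp
    then show "\<exists>k\<in>K. \<exists>t\<in>rep ` carrier G. g = k \<otimes> t"
      using g by (auto simp: r_coset_def)
  next
    fix k k' t t' assume k: "k \<in> K" "k' \<in> K" and t: "t \<in> rep ` carrier G" "t' \<in> rep ` carrier G" and eq: "k \<otimes>
        t = k' \<otimes> t'"
    have tc: "t \<in> carrier G" "t' \<in> carrier G" using t rep_carrier by auto
    have "K #> t = K #> t'" using coset_mult[OF k(1) tc(1)] coset_mult[OF k(2) tc(2)] eq by simp
    then have "rep t = rep t'" by (simp add: rep_def)
    moreover have "rep t = t" if "t \<in> rep ` carrier G" for t
      using that coset_rep by (auto simp: rep_def)
    ultimately have "t = t'" using t by metis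
    then show "k = k' \<and> t = t'"
      using eq k tc subgroup.mem_carrier[OF K] by simp
  qed
qed

context normal_subgroup_group
begin

text \<open>Only the component of index \<open>1\<close> of the first morphism is nonzero, and the unit law removes it.\<close>

lemma orbit_cmp_left:
  assumes K: "subgroup K \<Gamma>" and X: "X \<in> Ob H" "Y \<in> Ob H" "Z \<in> Ob H"
    and f: "f \<in> Mor H X Y" "F \<in> Mor (Orb K) Y Z" and k: "k \<in> K"
  shows "Cmp (Orb K) X Y Z F (FMor (Ind K) X Y f) k = Cmp H X Y (FOb (E k) Z) (F k) f"
proof -
  note KG = subgroup.subset[OF K]
  have kc: "k \<in> carrier \<Gamma>" using KG k by blast
  have oK: "\<one> \<in> K" by (rule subgroup.one_closed[OF K])
  have fK: "finite K" using KG finite_group finite_subset by blast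
  have Fk: "F k \<in> Mor H Y (FOb (E k) Z)" using f(2) k by (auto simp: PiE_iff)
  let ?l = "FMor (Ind K) X Y f"
  let ?t = "\<lambda>g. summand X Y Z g (inv g \<otimes> k) k (F (inv g \<otimes> k)) (?l g)"
  have "Cmp (Orb K) X Y Z F ?l k = finsum (Hom H X (FOb (E k) Z)) ?t K"
    by (rule orbit_cmp_apply[OF K X orbit_left_closed[OF KG X(1,2) f(1)] f(2) k])
  also have "\<dots> = ?t \<one>"
  proof (rule S.C.hom_finsum_single[OF X(1) _ fK oK])
    fix g assume g: "g \<in> K" "g \<noteq> \<one>"
    have "inv g \<otimes> k \<in> K"
      using g k subgroup.m_inv_closed[OF K] subgroup.m_closed[OF K] by blast
    then have "F (inv g \<otimes> k) \<in> Mor H Y (FOb (E (inv g \<otimes> k)) Z)"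
      using f(2) by (auto simp: PiE_iff)
    then show "?t g = \<zero>\<^bsub>Hom H X (FOb (E k) Z)\<^esub>"
      using g X KG kc by (auto simp: subset_iff)
  qed (use X f kc k oK Fk u_closed[OF X(2)] in simp_all)
  also have "\<dots> = Cmp H X Y (FOb (E k) Z) (summand Y Y Z \<one> k k (F k) (u Y)) f"
    using X f kc k oK Fk u_closed[OF X(2)] by (simp add: S.C.cmp_assoc)
  also have "\<dots> = Cmp H X Y (FOb (E k) Z) (Cmp H Y (FOb (E k) Z) (FOb (E k) Z)
      (Cmp H (FOb (E k) Z) (FOb (E \<one>) (FOb (E k) Z)) (FOb (E k) Z) (mc \<one> k k Z) (u (FOb (E k) Z))) (F k)) f"
    using X f kc Fk u_closed[of "FOb (E k) Z"] by (subst u_nat) (simp_all add: S.C.cmp_assoc)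
  also have "\<dots> = Cmp H X Y (FOb (E k) Z) (F k) f"
    using X f kc Fk by (simp add: m_one_left)
  finally show ?thesis .
qed

text \<open>The counit at \<open>Y\<close> is the family of the projections of \<open>D Y\<close>. By \<open>orbit_cmp_left\<close> its universal property
  is that of the direct sum: a morphism \<open>X \<rightarrow> D Y\<close> is the family of its components.\<close>

lemma orbit_right_adjoint:
  assumes K: "subgroup K \<Gamma>"
    and D: "\<And>X. X \<in> Ob H \<Longrightarrow> is_direct_sum H K (\<lambda>g. FOb (E g) X) (D X) (\<lambda>g. dinc g X) (\<lambda>g. dprj g X)"
  shows "adjoint_pair R H (Orb K) (Ind K) (orbit_right H E m D dinc dprj (sub K))"
    (is "adjoint_pair R H _ ?S ?T")
proof -
  note KG = subgroup.subset[OF K]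
  interpret O: linear_category R "Orb K" by (rule orbit_linear_category[OF K])
  interpret S': linear_functor R H "Orb K" ?S by (rule orbit_left_linear_functor[OF K])
  have fK: "finite K" using KG finite_group finite_subset by blast
  have DX [simp]: "D X \<in> Ob H" if "X \<in> Ob H" for X using is_direct_sumD(2)[OF D[OF that]] .
  have dinc [simp]: "dinc g X \<in> Mor H (FOb (E g) X) (D X)"
   and dprj [simp]: "dprj g X \<in> Mor H (D X) (FOb (E g) X)" if "X \<in> Ob H" "g \<in> K" for X g
    using is_direct_sumD(4,5)[OF D[OF that(1)] that(2)] by simp_all
  have gc [simp]: "g \<in> carrier \<Gamma>" if "g \<in> K" for g using that KG by blast
  have mK [simp]: "g \<otimes> h \<in> K" if "g \<in> K" "h \<in> K" for g h using that subgroup.m_closed[OF K] by blast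
  define \<epsilon>' where "\<epsilon>' X = (\<lambda>g\<in>K. dprj g X)" for X
  have eps: "\<epsilon>' X \<in> Mor (Orb K) (D X) X" if "X \<in> Ob H" for X
    using that by (auto simp: \<epsilon>'_def)
  have comp: "Cmp (Orb K) X (D Y) Y (\<epsilon>' Y) (FMor ?S X (D Y) f) k = Cmp H X (D Y) (FOb (E k) Y) (dprj k Y) f"
    if "X \<in> Ob H" "Y \<in> Ob H" "f \<in> Mor H X (D Y)" "k \<in> K" for X Y f k
    using orbit_cmp_left[OF K that(1) DX[OF that(2)] that(2,3) eps[OF that(2)] that(4)] that by (simp add: \<epsilon>'_def)
  have T_ob: "FOb ?T X = D X" for X by (simp add: orbit_right_def)
  let ?t = "\<lambda>X Y F (g, h). Cmp H (D X) (FOb (E g) (FOb (E h) Y)) (FOb (E (g \<otimes> h)) Y) (m g h Y)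
             (Cmp H (D X) (FOb (E g) X) (FOb (E g) (FOb (E h) Y)) (FMor (E g) X (FOb (E h) Y) (F h)) (dprj g X))"
  have t: "?t X Y F (g, h) \<in> Mor H (D X) (FOb (E (g \<otimes> h)) Y)"
    if "X \<in> Ob H" "Y \<in> Ob H" "F \<in> Mor (Orb K) X Y" "g \<in> K" "h \<in> K" for X Y F g h
  proof -
    have "F h \<in> Mor H X (FOb (E h) Y)" using that by (auto simp: PiE_iff)
    then show ?thesis using that by simp
  qed
  let ?s = "\<lambda>X Y F (g, h). Cmp H (D X) (FOb (E (g \<otimes> h)) Y) (D Y) (dinc (g \<otimes> h) Y) (?t X Y F (g, h))"
  have T_mor: "FMor ?T X Y F = finsum (Hom H (D X) (D Y)) (?s X Y F) (K \<times> K)" for X Y F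
    by (simp add: orbit_right_def case_prod_unfold)
  have s: "?s X Y F p \<in> Mor H (D X) (D Y)" if "X \<in> Ob H" "Y \<in> Ob H" "F \<in> Mor (Orb K) X Y" "p \<in> K \<times> K" for X Y F p
    using t[OF that(1-3)] that by (cases p) auto
  have T_closed: "FMor ?T X Y F \<in> Mor H (D X) (D Y)" if "X \<in> Ob H" "Y \<in> Ob H" "F \<in> Mor (Orb K) X Y" for X Y F
    unfolding T_mor by (rule S.C.hom_finsum_closed) (use that s in simp_all)
  have T_nat: "Cmp H (D X) (D Y) (FOb (E k) Y) (dprj k Y) (FMor ?T X Y F) = Cmp (Orb K) (D X) X Y F (\<epsilon>' X) k"
    if X: "X \<in> Ob H" "Y \<in> Ob H" and F: "F \<in> Mor (Orb K) X Y" and k: "k \<in> K" for X Y F k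
  proof -
    have d: "Cmp H (D X) (D Y) (FOb (E k) Y) (dprj k Y) (?s X Y F (g, h)) =
       (if g \<otimes> h = k then ?t X Y F (g, h) else \<zero>\<^bsub>Hom H (D X) (FOb (E k) Y)\<^esub>)" if gh: "g \<in> K" "h \<in> K" for g h
    proof -
      define x where "x = ?t X Y F (g, h)"
      have x: "x \<in> Mor H (D X) (FOb (E (g \<otimes> h)) Y)"
        unfolding x_def by (rule t[OF X F gh])
      have "Cmp H (D X) (D Y) (FOb (E k) Y) (dprj k Y) (Cmp H (D X) (FOb (E (g \<otimes> h)) Y) (D Y) (dinc (g \<otimes> h) Y) x) =
        Cmp H (D X) (FOb (E (g \<otimes> h)) Y) (FOb (E k) Y) (Cmp H (FOb (E (g \<otimes> h)) Y) (D Y) (FOb (E k) Y) (dprj k Y)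
          (dinc (g \<otimes> h) Y)) x"
        using X k gh x by (simp add: S.C.cmp_assoc)
      also have "\<dots> = (if g \<otimes> h = k then x else \<zero>\<^bsub>Hom H (D X) (FOb (E k) Y)\<^esub>)"
        using is_direct_sumD(6,7)[OF D[OF X(2)]] X k gh x by auto
      finally show ?thesis by (simp add: x_def)
    qed
    have "Cmp H (D X) (D Y) (FOb (E k) Y) (dprj k Y) (FMor ?T X Y F) =
      finsum (Hom H (D X) (FOb (E k) Y)) (\<lambda>p. Cmp H (D X) (D Y) (FOb (E k) Y) (dprj k Y) (?s X Y F p)) (K \<times> K)"
      unfolding T_mor by (rule S.C.cmp_finsum_right) (use X F k s fK in simp_all)
    also have "\<dots> = finsum (Hom H (D X) (FOb (E k) Y)) (\<lambda>p. Cmp H (D X) (D Y) (FOb (E k) Y) (dprj k Y) (?s X Y F p))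
       {(g, h) \<in> K \<times> K. g \<otimes> h = k}"
    proof (rule S.C.hom_finsum_restrict)
      fix p assume "p \<in> K \<times> K - {(g, h) \<in> K \<times> K. g \<otimes> h = k}"
      then obtain g h where p: "p = (g, h)" "g \<in> K" "h \<in> K" "g \<otimes> h \<noteq> k" by auto
      then show "Cmp H (D X) (D Y) (FOb (E k) Y) (dprj k Y) (?s X Y F p) = \<zero>\<^bsub>Hom H (D X) (FOb (E k) Y)\<^esub>"
        using d[OF p(2,3)] by simp
    qed (use X F k s fK in auto)
    also have "\<dots> = finsum (Hom H (D X) (FOb (E k) Y))
         (\<lambda>(g, h). Cmp H (D X) (FOb (E g) (FOb (E h) Y)) (FOb (E k) Y) (m g h Y)
            (Cmp H (D X) (FOb (E g) X) (FOb (E g) (FOb (E h) Y))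
               (FMor (E g) X (FOb (E h) Y) (F h)) (\<epsilon>' X g)))
         {(g, h) \<in> K \<times> K. g \<otimes> h = k}"
    proof (rule S.C.hom_finsum_cong)
      fix p assume "p \<in> {(g, h) \<in> K \<times> K. g \<otimes> h = k}"
      then obtain g h where p: "p = (g, h)" "g \<in> K" "h \<in> K" "g \<otimes> h = k" by auto
      show "Cmp H (D X) (D Y) (FOb (E k) Y) (dprj k Y) (?s X Y F p) = (case p of (g, h) \<Rightarrow>
         Cmp H (D X) (FOb (E g) (FOb (E h) Y)) (FOb (E k) Y) (m g h Y)
            (Cmp H (D X) (FOb (E g) X) (FOb (E g) (FOb (E h) Y))
               (FMor (E g) X (FOb (E h) Y) (F h)) (\<epsilon>' X g)))"
        using d[OF p(2,3)] p by (simp add: \<epsilon>'_def)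
      show "(case p of (g, h) \<Rightarrow>
         Cmp H (D X) (FOb (E g) (FOb (E h) Y)) (FOb (E k) Y) (m g h Y)
            (Cmp H (D X) (FOb (E g) X) (FOb (E g) (FOb (E h) Y))
               (FMor (E g) X (FOb (E h) Y) (F h)) (\<epsilon>' X g))) \<in> Mor H (D X) (FOb (E k) Y)"
        using t[OF X F p(2,3)] p by (simp add: \<epsilon>'_def)
    qed (use X k in simp_all)
    finally show ?thesis
      using k by (simp add: orbit_cat_def)
  qed
  have "universal_arrows R H (Orb K) ?S ?T \<epsilon>'"
  proof (intro universal_arrows.intro universal_arrows_axioms.intro S'.linear_functor_axioms)
    fix X Y F assume "X \<in> Ob (Orb K)" "Y \<in> Ob (Orb K)" and F: "F \<in> Mor (Orb K) X Y"
    then have X: "X \<in> Ob H" "Y \<in> Ob H" by simp_all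
    show "FMor ?T X Y F \<in> Mor H (FOb ?T X) (FOb ?T Y)"
      unfolding T_ob by (rule T_closed[OF X F])
    show "Cmp (Orb K) (FOb ?S (FOb ?T X)) (FOb ?S (FOb ?T Y)) Y (\<epsilon>' Y) (FMor ?S (FOb ?T X) (FOb ?T Y) (FMor ?T
        X Y F)) =
        Cmp (Orb K) (FOb ?S (FOb ?T X)) X Y F (\<epsilon>' X)"
      unfolding T_ob orbit_left_simps(1)
    proof (rule PiE_ext)
      show "Cmp (Orb K) (D X) (D Y) Y (\<epsilon>' Y) (FMor ?S (D X) (D Y) (FMor ?T X Y F)) \<in> (\<Pi>\<^sub>E g\<in>K. Mor H (D X)
          (FOb (E g) Y))"
        using orbit_cmp_closed[OF KG _ _ X(2) orbit_left_closed[OF KG _ _ T_closed[OF X F]] eps[OF X(2)]] X by simp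
      show "Cmp (Orb K) (D X) X Y F (\<epsilon>' X) \<in> (\<Pi>\<^sub>E g\<in>K. Mor H (D X) (FOb (E g) Y))"
        using orbit_cmp_closed[OF KG _ X eps[OF X(1)] F] X by simp
      fix k assume k: "k \<in> K"
      show "Cmp (Orb K) (D X) (D Y) Y (\<epsilon>' Y) (FMor ?S (D X) (D Y) (FMor ?T X Y F)) k = Cmp (Orb K) (D X) X Y F
          (\<epsilon>' X) k"
        using comp[OF DX[OF X(1)] X(2) T_closed[OF X F] k] T_nat[OF X F k] by simp
    qed
  next
    fix X Y F assume X: "X \<in> Ob H" and "Y \<in> Ob (Orb K)" and "F \<in> Mor (Orb K) (FOb ?S X) Y"
    then have Y: "Y \<in> Ob H" and F: "F \<in> Mor (Orb K) X Y" by simp_all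
    have Fg: "F g \<in> Mor H X (FOb (E g) Y)" if "g \<in> K" for g using F that by (auto simp: PiE_iff)
    define f where "f = finsum (Hom H X (D Y)) (\<lambda>g. Cmp H X (FOb (E g) Y) (D Y) (dinc g Y) (F g)) K"
    have f: "f \<in> Mor H X (D Y)" "Cmp H X (D Y) (FOb (E k) Y) (dprj k Y) f = F k" if "k \<in> K" for k
      unfolding f_def using S.C.direct_sum_tuple[OF D[OF Y] X subset_refl, of F k] Fg that by auto
    have fm: "f \<in> Mor H X (D Y)" using f(1) subgroup.one_closed[OF K] by blast
    show "\<exists>f'\<in>Mor H X (FOb ?T Y). Cmp (Orb K) (FOb ?S X) (FOb ?S (FOb ?T Y)) Y (\<epsilon>' Y) (FMor ?S X (FOb ?T Y) f') = F"
      unfolding T_ob orbit_left_simps(1)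
    proof (rule bexI[OF _ fm], rule PiE_ext)
      show "Cmp (Orb K) X (D Y) Y (\<epsilon>' Y) (FMor ?S X (D Y) f) \<in> (\<Pi>\<^sub>E g\<in>K. Mor H X (FOb (E g) Y))"
        using orbit_cmp_closed[OF KG X _ Y orbit_left_closed[OF KG X _ fm] eps[OF Y]] Y by simp
      show "F \<in> (\<Pi>\<^sub>E g\<in>K. Mor H X (FOb (E g) Y))" using F by simp
      fix k assume k: "k \<in> K"
      show "Cmp (Orb K) X (D Y) Y (\<epsilon>' Y) (FMor ?S X (D Y) f) k = F k"
        using comp[OF X Y fm k] f(2)[OF k] by simp
    qed
  next
    fix X Y f f' assume X: "X \<in> Ob H" and "Y \<in> Ob (Orb K)" and "f \<in> Mor H X (FOb ?T Y)" "f' \<in> Mor H X (FOb ?T Y)"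
      and "Cmp (Orb K) (FOb ?S X) (FOb ?S (FOb ?T Y)) Y (\<epsilon>' Y) (FMor ?S X (FOb ?T Y) f) =
        Cmp (Orb K) (FOb ?S X) (FOb ?S (FOb ?T Y)) Y (\<epsilon>' Y) (FMor ?S X (FOb ?T Y) f')"
    then have Y: "Y \<in> Ob H" and f: "f \<in> Mor H X (D Y)" "f' \<in> Mor H X (D Y)"
      and eq: "Cmp (Orb K) X (D Y) Y (\<epsilon>' Y) (FMor ?S X (D Y) f) = Cmp (Orb K) X (D Y) Y (\<epsilon>' Y) (FMor ?S X (D Y) f')"
      unfolding T_ob orbit_left_simps(1) by simp_all
    show "f = f'"
    proof (rule S.C.direct_sum_ext_in[OF D[OF Y] X f])
      fix k assume k: "k \<in> K"
      show "Cmp H X (D Y) (FOb (E k) Y) (dprj k Y) f = Cmp H X (D Y) (FOb (E k) Y) (dprj k Y) f'"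
        by (rule fun_cong[OF eq, of k, unfolded comp[OF X Y f(1) k] comp[OF X Y f(2) k]])
    qed
  qed (use eps in \<open>auto simp: T_ob\<close>)
  then show ?thesis
    unfolding adjoint_pair_iff by blast
qed

text \<open>The right adjoint of the inclusion of a subgroup sends \<open>Y\<close> to the direct sum of the \<open>E t Y\<close> over a
  transversal of the right cosets: a component \<open>X \<rightarrow> E (k t) Y\<close> is the same as a component
  \<open>X \<rightarrow> E k (E t Y)\<close>.\<close>

lemma orbit_incl_right_adjoint:
  assumes K: "subgroup K \<Gamma>" and ic: "idempotent_complete H"
  shows "\<exists>T\<^sub>0. adjoint_pair R (Orb K) Orb\<^sub>\<Gamma> (Incl K) T\<^sub>0"
proof -
  note KG = subgroup.subset[OF K]
  let ?S = "Incl K"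
  have gc [simp]: "g \<in> carrier \<Gamma>" if "g \<in> K" for g using that KG by blast
  have fK: "finite K" using KG finite_group finite_subset by blast
  obtain Tr where Tr: "Tr \<subseteq> carrier \<Gamma>" "\<And>g. g \<in> carrier \<Gamma> \<Longrightarrow> \<exists>k\<in>K. \<exists>t\<in>Tr. g = k \<otimes> t"
    and uniq: "\<And>k k' t t'. \<lbrakk>k \<in> K; k' \<in> K; t \<in> Tr; t' \<in> Tr; k \<otimes> t = k' \<otimes> t'\<rbrakk> \<Longrightarrow> k = k' \<and> t = t'"
    using right_transversal[OF K] by blast
  have tc [simp]: "t \<in> carrier \<Gamma>" if "t \<in> Tr" for t using that Tr by blast
  have "\<exists>D0. \<forall>Y\<in>Ob H. is_direct_sum H Tr (\<lambda>t. FOb (E t) Y) (fst (D0 Y)) (fst (snd (D0 Y))) (snd (snd (D0 Y)))"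
    by (intro bchoice ballI) (use S.C.partial_direct_sum[OF direct_sum Tr(1) ic] in \<open>auto simp: split_paired_Ex\<close>)
  then obtain D0 where D0: "is_direct_sum H Tr (\<lambda>t. FOb (E t) Y) (fst (D0 Y)) (fst (snd (D0 Y))) (snd (snd (D0 Y)))"
    if "Y \<in> Ob H" for Y by blast
  define D where "D Y = fst (D0 Y)" for Y
  define i where "i t Y = fst (snd (D0 Y)) t" for t Y
  define p where "p t Y = snd (snd (D0 Y)) t" for t Y
  have ds: "is_direct_sum H Tr (\<lambda>t. FOb (E t) Y) (D Y) (\<lambda>t. i t Y) (\<lambda>t. p t Y)" if "Y \<in> Ob H" for Y
    unfolding D_def i_def p_def using D0[OF that] by simp
  have DY [simp]: "D Y \<in> Ob H" if "Y \<in> Ob H" for Y using is_direct_sumD(2)[OF ds[OF that]] .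
  have pm [simp]: "p t Y \<in> Mor H (D Y) (FOb (E t) Y)" if "t \<in> Tr" "Y \<in> Ob H" for t Y
    using is_direct_sumD(5)[OF ds[OF that(2)] that(1)] .
  define \<epsilon>' where "\<epsilon>' Y = (\<lambda>g\<in>carrier \<Gamma>. if g \<in> Tr then p g Y else \<zero>\<^bsub>Hom H (D Y) (FOb (E g) Y)\<^esub>)" for Y
  have eps: "\<epsilon>' Y \<in> Mor (Orb (carrier \<Gamma>)) (D Y) Y" if "Y \<in> Ob H" for Y
    using that by (auto simp: \<epsilon>'_def)
  have comp: "Cmp (Orb (carrier \<Gamma>)) X (D Y) Y (\<epsilon>' Y) (FMor ?S X (D Y) f) (k \<otimes> t) =
      Cmp H X (FOb (E k) (FOb (E t) Y)) (FOb (E (k \<otimes> t)) Y) (m k t Y)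
       (Cmp H X (FOb (E k) (D Y)) (FOb (E k) (FOb (E t) Y)) (FMor (E k) (D Y) (FOb (E t) Y) (p t Y)) (f k))"
    if X: "X \<in> Ob H" "Y \<in> Ob H" and f: "f \<in> Mor (Orb K) X (D Y)" and k: "k \<in> K" and t: "t \<in> Tr" for X Y f k t
  proof -
    let ?g = "k \<otimes> t"
    have g: "?g \<in> carrier \<Gamma>" using k t by simp
    have fa: "f a \<in> Mor H X (FOb (E a) (D Y))" if "a \<in> K" for a using f that by (auto simp: PiE_iff)
    have e: "\<epsilon>' Y b \<in> Mor H (D Y) (FOb (E b) Y)" if "b \<in> carrier \<Gamma>" for b
      using eps[OF X(2)] that by (auto simp: PiE_iff)
    let ?t = "\<lambda>a. summand X (D Y) Y a (inv a \<otimes> ?g) ?g (\<epsilon>' Y (inv a \<otimes> ?g)) (FMor ?S X (D Y) f a)"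
    have kt: "inv k \<otimes> ?g = t" using k t by (simp flip: m_assoc)
    have "Cmp (Orb (carrier \<Gamma>)) X (D Y) Y (\<epsilon>' Y) (FMor ?S X (D Y) f) ?g = finsum (Hom H X (FOb (E ?g) Y)) ?t
        (carrier \<Gamma>)"
      by (rule orbit_cmp_apply[OF subgroup_self X(1) _ X(2) orbit_incl_closed[OF KG X(1) _ f] eps[OF X(2)] g])
          (use X in simp_all)
    also have "\<dots> = ?t k"
    proof (rule S.C.hom_finsum_single[where i = k])
      fix a assume a: "a \<in> carrier \<Gamma>" "a \<noteq> k"
      show "?t a = \<zero>\<^bsub>Hom H X (FOb (E ?g) Y)\<^esub>"
      proof (cases "a \<in> K")
        case True
        have "inv a \<otimes> ?g \<notin> Tr"
        proof
          assume "inv a \<otimes> ?g \<in> Tr"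
          moreover have "a \<otimes> (inv a \<otimes> ?g) = k \<otimes> t"
            using a g by (simp flip: m_assoc)
          ultimately show False using uniq[OF True k _ t] a(2) by blast
        qed
        then show ?thesis using X a g fa True by (simp add: \<epsilon>'_def)
      next
        case False
        then show ?thesis using X a g e by simp
      qed
    qed (use X fa e k t g kt finite_group in simp_all)
    also have "\<dots> = Cmp H X (FOb (E k) (FOb (E t) Y)) (FOb (E ?g) Y) (m k t Y)
       (Cmp H X (FOb (E k) (D Y)) (FOb (E k) (FOb (E t) Y)) (FMor (E k) (D Y) (FOb (E t) Y) (p t Y)) (f k))"
      using k t by (simp add: kt \<epsilon>'_def)
    finally show ?thesis .
  qed
  have eds: "is_direct_sum H Tr (\<lambda>t. FOb (E k) (FOb (E t) Y)) (FOb (E k) (D Y))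
     (\<lambda>t. FMor (E k) (FOb (E t) Y) (D Y) (i t Y)) (\<lambda>t. FMor (E k) (D Y) (FOb (E t) Y) (p t Y))"
    if "k \<in> K" "Y \<in> Ob H" for k Y
    using linear_functor.functor_direct_sum[OF E_functor ds[OF that(2)]] that(1) by simp
  have "\<exists>T\<^sub>0. FOb T\<^sub>0 = D \<and> universal_arrows R (Orb K) (Orb (carrier \<Gamma>)) ?S T\<^sub>0 \<epsilon>'"
  proof (rule right_adjoint_from_objects[OF orbit_incl_linear_functor[OF K]])
    fix Y assume Y: "Y \<in> Ob (Orb (carrier \<Gamma>))"
    then show "D Y \<in> Ob (Orb K)" by simp
    show "\<epsilon>' Y \<in> Mor (Orb (carrier \<Gamma>)) (FOb ?S (D Y)) Y"
      unfolding orbit_incl_simps(1) by (rule eps) (use Y in simp)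
  next
    fix X Y F assume "X \<in> Ob (Orb K)" "Y \<in> Ob (Orb (carrier \<Gamma>))" and "F \<in> Mor (Orb (carrier \<Gamma>)) (FOb ?S X) Y"
    then have X: "X \<in> Ob H" "Y \<in> Ob H" and F: "F \<in> Mor (Orb (carrier \<Gamma>)) X Y" by simp_all
    have Fg: "F g \<in> Mor H X (FOb (E g) Y)" if "g \<in> carrier \<Gamma>" for g using F that by (auto simp: PiE_iff)
    have "\<exists>q. \<forall>k\<in>K. \<forall>t\<in>Tr. q k t \<in> Mor H X (FOb (E k) (FOb (E t) Y)) \<and>
       Cmp H X (FOb (E k) (FOb (E t) Y)) (FOb (E (k \<otimes> t)) Y) (m k t Y) (q k t) = F (k \<otimes> t)"
    proof (intro bchoice ballI)
      fix k t assume kt: "k \<in> K" "t \<in> Tr"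
      obtain n where n: "m k t Y \<in> Mor H (FOb (E k) (FOb (E t) Y)) (FOb (E (k \<otimes> t)) Y)"
        "n \<in> Mor H (FOb (E (k \<otimes> t)) Y) (FOb (E k) (FOb (E t) Y))"
        "Cmp H (FOb (E (k \<otimes> t)) Y) (FOb (E k) (FOb (E t) Y)) (FOb (E (k \<otimes> t)) Y) (m k t Y) n = Idn H (FOb (E
            (k \<otimes> t)) Y)"
        using mc_iso[of k t Y] kt X S.C.iso_inE by (metis gc tc)
      show "\<exists>y. y \<in> Mor H X (FOb (E k) (FOb (E t) Y)) \<and>
         Cmp H X (FOb (E k) (FOb (E t) Y)) (FOb (E (k \<otimes> t)) Y) (m k t Y) y = F (k \<otimes> t)"
        by (rule exI[of _ "Cmp H X (FOb (E (k \<otimes> t)) Y) (FOb (E k) (FOb (E t) Y)) n (F (k \<otimes> t))"])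
           (use X kt n Fg in \<open>simp flip: S.C.cmp_assoc\<close>)
    qed
    then obtain q where q: "q k t \<in> Mor H X (FOb (E k) (FOb (E t) Y))"
       "Cmp H X (FOb (E k) (FOb (E t) Y)) (FOb (E (k \<otimes> t)) Y) (m k t Y) (q k t) = F (k \<otimes> t)"
      if "k \<in> K" "t \<in> Tr" for k t by blast
    define f where "f = (\<lambda>k\<in>K. finsum (Hom H X (FOb (E k) (D Y)))
       (\<lambda>t. Cmp H X (FOb (E k) (FOb (E t) Y)) (FOb (E k) (D Y)) (FMor (E k) (FOb (E t) Y) (D Y) (i t Y)) (q k t)) Tr)"
    have fk: "f k \<in> Mor H X (FOb (E k) (D Y))"
       "Cmp H X (FOb (E k) (D Y)) (FOb (E k) (FOb (E t) Y)) (FMor (E k) (D Y) (FOb (E t) Y) (p t Y)) (f k) = q k t"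
      if "k \<in> K" "t \<in> Tr" for k t
      unfolding f_def using S.C.direct_sum_tuple[OF eds[OF that(1) X(2)] X(1) subset_refl, of "\<lambda>t. q k t" t] q
          that by auto
    obtain t0 where "t0 \<in> Tr" using Tr(2)[OF one_closed] by blast
    then have f: "f \<in> Mor (Orb K) X (D Y)" using fk(1) by (auto simp: f_def)
    show "\<exists>f'\<in>Mor (Orb K) X (D Y). Cmp (Orb (carrier \<Gamma>)) (FOb ?S X) (FOb ?S (D Y)) Y (\<epsilon>' Y) (FMor ?S X (D Y) f') = F"
      unfolding orbit_incl_simps(1)
    proof (rule bexI[OF _ f], rule PiE_ext)
      show "Cmp (Orb (carrier \<Gamma>)) X (D Y) Y (\<epsilon>' Y) (FMor ?S X (D Y) f) \<in> (\<Pi>\<^sub>E g\<in>carrier \<Gamma>. Mor H X (FOb (E g) Y))"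
        using orbit_cmp_closed[OF subset_refl X(1) _ X(2) orbit_incl_closed[OF KG X(1) _ f] eps[OF X(2)]] X by simp
      show "F \<in> (\<Pi>\<^sub>E g\<in>carrier \<Gamma>. Mor H X (FOb (E g) Y))" using F by simp
      fix g assume "g \<in> carrier \<Gamma>"
      then obtain k t where kt: "k \<in> K" "t \<in> Tr" "g = k \<otimes> t" using Tr(2) by blast
      show "Cmp (Orb (carrier \<Gamma>)) X (D Y) Y (\<epsilon>' Y) (FMor ?S X (D Y) f) g = F g"
        unfolding kt(3) comp[OF X f kt(1,2)] using fk(2)[OF kt(1,2)] q(2)[OF kt(1,2)] by simp
    qed
  next
    fix X Y f f' assume "X \<in> Ob (Orb K)" "Y \<in> Ob (Orb (carrier \<Gamma>))" and f: "f \<in> Mor (Orb K) X (D Y)" "f' \<in> Mor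
        (Orb K) X (D Y)"
      and "Cmp (Orb (carrier \<Gamma>)) (FOb ?S X) (FOb ?S (D Y)) Y (\<epsilon>' Y) (FMor ?S X (D Y) f) =
        Cmp (Orb (carrier \<Gamma>)) (FOb ?S X) (FOb ?S (D Y)) Y (\<epsilon>' Y) (FMor ?S X (D Y) f')"
    then have X: "X \<in> Ob H" "Y \<in> Ob H" and eq: "Cmp (Orb (carrier \<Gamma>)) X (D Y) Y (\<epsilon>' Y) (FMor ?S X (D Y) f) =
        Cmp (Orb (carrier \<Gamma>)) X (D Y) Y (\<epsilon>' Y) (FMor ?S X (D Y) f')" unfolding orbit_incl_simps(1) by simp_all
    have fa: "f a \<in> Mor H X (FOb (E a) (D Y))" "f' a \<in> Mor H X (FOb (E a) (D Y))" if "a \<in> K" for a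
      using f that by (auto simp: PiE_iff)
    show "f = f'"
    proof (rule PiE_ext)
      show "f \<in> (\<Pi>\<^sub>E g\<in>K. Mor H X (FOb (E g) (D Y)))" "f' \<in> (\<Pi>\<^sub>E g\<in>K. Mor H X (FOb (E g) (D Y)))" using f by simp_all
      fix k assume k: "k \<in> K"
      show "f k = f' k"
      proof (rule S.C.direct_sum_ext_in[OF eds[OF k X(2)] X(1) fa[OF k]])
        fix t assume t: "t \<in> Tr"
        have iso: "iso_in H (FOb (E k) (FOb (E t) Y)) (FOb (E (k \<otimes> t)) Y) (m k t Y)"
          using mc_iso[of k t Y] k t X by simp
        note eq' = fun_cong[OF eq, of "k \<otimes> t", unfolded comp[OF X f(1) k t] comp[OF X f(2) k t]]
        show "Cmp H X (FOb (E k) (D Y)) (FOb (E k) (FOb (E t) Y)) (FMor (E k) (D Y) (FOb (E t) Y) (p t Y)) (f k) =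
          Cmp H X (FOb (E k) (D Y)) (FOb (E k) (FOb (E t) Y)) (FMor (E k) (D Y) (FOb (E t) Y) (p t Y)) (f' k)"
          by (rule S.C.iso_cancel_left[OF X(1) _ _ iso _ _ eq']) (use X k t fa[OF k] in simp_all)
      qed
    qed
  qed
  then show ?thesis
    unfolding adjoint_pair_iff by auto
qed

end

section \<open>Descending chains of submodules\<close>

definition descending_chain_condition :: "'r ring \<Rightarrow> ('r, 'm) module \<Rightarrow> bool" where
  "descending_chain_condition R V \<longleftrightarrow>
    (\<forall>W :: nat \<Rightarrow> 'm set. (\<forall>n. submodule (W n) R V \<and> W (Suc n) \<subseteq> W n) \<longrightarrow> (\<exists>n. \<forall>k\<ge>n. W k = W n))"

lemma descending_chain_conditionD:
  assumes "descending_chain_condition R V" "\<And>n. submodule (W n) R V" "\<And>n. W (Suc n) \<subseteq> W n"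
  obtains n where "\<And>k. k \<ge> n \<Longrightarrow> W k = W n"
  using assms unfolding descending_chain_condition_def by blast

text \<open>A submodule \<open>W\<close> is recorded by the set of indices \<open>i\<close> at which it meets the \<open>i\<close>-th factor of a
  composition series. This set shrinks with \<open>W\<close>, and if it does not change then \<open>W\<close> does not either.\<close>

lemma finite_length_descending_chain_condition:
  assumes V: "module R V" and fl: "finite_length R V"
  shows "descending_chain_condition R V"
  unfolding descending_chain_condition_def
proof (intro allI impI)
  fix W :: "nat \<Rightarrow> 'b set"
  assume W: "\<forall>n. submodule (W n) R V \<and> W (Suc n) \<subseteq> W n"
  interpret V: module R V by fact
  obtain Ns where Ns: "Ns \<noteq> []" "hd Ns = {\<zero>\<^bsub>V\<^esub>}" "last Ns = carrier V" "\<And>N. N \<in> set Ns \<Longrightarrow> submodule N R V"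
    "\<And>i. Suc i < length Ns \<Longrightarrow> Ns ! i \<subset> Ns ! Suc i"
    "\<And>i N. \<lbrakk>Suc i < length Ns; submodule N R V; Ns ! i \<subseteq> N; N \<subseteq> Ns ! Suc i\<rbrakk> \<Longrightarrow> N = Ns ! i \<or> N = Ns ! Suc i"
    using fl unfolding finite_length_def composition_series_def by metis
  define D where "D U = {i. Suc i < length Ns \<and> \<not> U \<inter> Ns ! Suc i \<subseteq> Ns ! i}" for U
  have finD: "finite (D U)" for U
    by (rule finite_subset[of _ "{..<length Ns}"]) (auto simp: D_def)
  have Nsi: "submodule (Ns ! i) R V" if "i < length Ns" for i
    using Ns(4) that by simp
  have eq: "U = U'" if sU: "submodule U R V" and sU': "submodule U' R V" and sub: "U' \<subseteq> U" and DD: "D U \<subseteq> D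
      U'" for U U'
  proof -
    note u = V.submoduleE[OF sU] and u' = V.submoduleE[OF sU']
    have "U \<inter> Ns ! i \<subseteq> U'" if "i < length Ns" for i
      using that
    proof (induction i)
      case 0
      have "\<zero>\<^bsub>V\<^esub> \<in> U'"
        using sU' subgroup.one_closed[OF submodule.axioms(1)] by fastforce
      then show ?case using Ns(1,2) by (auto simp: hd_conv_nth)
    next
      case (Suc i)
      note IH = Suc.IH[OF Suc_lessD[OF Suc.prems]]
      show ?case
      proof
        fix x assume x: "x \<in> U \<inter> Ns ! Suc i"
        show "x \<in> U'"
        proof (cases "i \<in> D U")
          case False
          then show ?thesis using x IH Suc.prems by (auto simp: D_def)
        next
          case True
          then have "i \<in> D U'" using DD by blast
          then obtain w where w: "w \<in> U'" "w \<in> Ns ! Suc i" "w \<notin> Ns ! i" by (auto simp: D_def)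
          \<comment> \<open>By simplicity of the factor, \<open>U'\<close> and \<open>Ns ! i\<close> together span \<open>Ns ! Suc i\<close>.\<close>
          note a = V.submoduleE[OF Nsi[OF Suc_lessD[OF Suc.prems]]]
          note b = V.submoduleE[OF Nsi[OF Suc.prems]]
          have incl: "Ns ! i \<subseteq> Ns ! Suc i" using Ns(5)[OF Suc.prems] by blast
          define N where "N = {y. \<exists>v\<in>U' \<inter> Ns ! Suc i. \<exists>z\<in>Ns ! i. y = v \<oplus>\<^bsub>V\<^esub> z}"
          have zero: "\<zero>\<^bsub>V\<^esub> \<in> U'" "\<zero>\<^bsub>V\<^esub> \<in> Ns ! i" "\<zero>\<^bsub>V\<^esub> \<in> Ns ! Suc i"
            using subgroup.one_closed[OF submodule.axioms(1)[OF sU']]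
              subgroup.one_closed[OF submodule.axioms(1)[OF Nsi[OF Suc_lessD[OF Suc.prems]]]]
              subgroup.one_closed[OF submodule.axioms(1)[OF Nsi[OF Suc.prems]]] by simp_all
          have "submodule N R V"
          proof (rule V.submoduleI)
            show "N \<subseteq> carrier V" using a(1) u'(1) unfolding N_def by auto
            show "\<zero>\<^bsub>V\<^esub> \<in> N" unfolding N_def using zero V.l_zero[OF V.zero_closed] by (metis (mono_tags,
                lifting) IntI mem_Collect_eq)
          next
            fix y assume "y \<in> N"
            then obtain v z where vz: "v \<in> U'" "v \<in> Ns ! Suc i" "z \<in> Ns ! i" "y = v \<oplus>\<^bsub>V\<^esub> z" unfolding N_def by blast
            have "\<ominus>\<^bsub>V\<^esub> y = \<ominus>\<^bsub>V\<^esub> v \<oplus>\<^bsub>V\<^esub> \<ominus>\<^bsub>V\<^esub> z"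
              using vz a(1) u'(1) by (simp add: V.minus_add subset_iff)
            then show "\<ominus>\<^bsub>V\<^esub> y \<in> N" unfolding N_def using vz u'(3) b(3) a(3) by blast
          next
            fix y y' assume "y \<in> N" "y' \<in> N"
            then obtain v z v' z' where vz: "v \<in> U'" "v \<in> Ns ! Suc i" "z \<in> Ns ! i" "y = v \<oplus>\<^bsub>V\<^esub> z"
              "v' \<in> U'" "v' \<in> Ns ! Suc i" "z' \<in> Ns ! i" "y' = v' \<oplus>\<^bsub>V\<^esub> z'" unfolding N_def by blast
            have "y \<oplus>\<^bsub>V\<^esub> y' = (v \<oplus>\<^bsub>V\<^esub> v') \<oplus>\<^bsub>V\<^esub> (z \<oplus>\<^bsub>V\<^esub> z')"
              using vz a(1) u'(1) by (simp add: V.a_ac subset_iff)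
            then show "y \<oplus>\<^bsub>V\<^esub> y' \<in> N" unfolding N_def using vz u'(5) b(5) a(5) by blast
          next
            fix r y assume r: "r \<in> carrier R" and "y \<in> N"
            then obtain v z where vz: "v \<in> U'" "v \<in> Ns ! Suc i" "z \<in> Ns ! i" "y = v \<oplus>\<^bsub>V\<^esub> z" unfolding N_def by blast
            have "r \<odot>\<^bsub>V\<^esub> y = r \<odot>\<^bsub>V\<^esub> v \<oplus>\<^bsub>V\<^esub> r \<odot>\<^bsub>V\<^esub> z"
              using vz a(1) u'(1) r by (simp add: V.smult_r_distr subset_iff)
            then show "r \<odot>\<^bsub>V\<^esub> y \<in> N" unfolding N_def using vz r u'(4) b(4) a(4) by blast
          qed
          moreover have "Ns ! i \<subseteq> N"
          proof
            fix z assume z: "z \<in> Ns ! i"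
            then have "z = \<zero>\<^bsub>V\<^esub> \<oplus>\<^bsub>V\<^esub> z" using a(1) by (simp add: subset_iff)
            then show "z \<in> N" unfolding N_def using z zero by blast
          qed
          moreover have "N \<subseteq> Ns ! Suc i" unfolding N_def using b(5) incl by blast
          moreover have "w \<in> N"
          proof -
            have "w = w \<oplus>\<^bsub>V\<^esub> \<zero>\<^bsub>V\<^esub>" using w(1) u'(1) by (simp add: subset_iff)
            then show ?thesis unfolding N_def using w zero by blast
          qed
          ultimately have "N = Ns ! Suc i" using Ns(6)[OF Suc.prems, of N] w(3) by blast
          then obtain v z where vz: "v \<in> U'" "z \<in> Ns ! i" "x = v \<oplus>\<^bsub>V\<^esub> z" using x unfolding N_def by blast
          have vc: "v \<in> carrier V" "z \<in> carrier V" using vz u'(1) a(1) by auto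
          have "z = x \<oplus>\<^bsub>V\<^esub> \<ominus>\<^bsub>V\<^esub> v"
            unfolding vz(3) using vc by (simp add: V.a_comm[of v z] V.a_assoc V.r_neg)
          then have "z \<in> U" using x vz(1) sub u(3,5) by blast
          then have "z \<in> U'" using IH vz(2) by blast
          then show ?thesis using vz u'(5) by blast
        qed
      qed
    qed
    from this[of "length Ns - 1"] have "U \<inter> carrier V \<subseteq> U'"
      using Ns(1,3) by (simp add: last_conv_nth)
    then show ?thesis using u(1) sub by blast
  qed
  have mono: "W k \<subseteq> W n" if "n \<le> k" for n k
    using lift_Suc_antimono_le[of W n k] W that by blast
  obtain n where n: "card (D (W n)) \<le> card (D (W k))" for k
    using ex_has_least_nat[of "\<lambda>_. True" 0 "\<lambda>n. card (D (W n))"] by blast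
  have "W k = W n" if "n \<le> k" for k
  proof -
    have "D (W k) \<subseteq> D (W n)" using mono[OF that] by (auto simp: D_def)
    then have "D (W k) = D (W n)" using card_seteq[OF finD _ n] by blast
    then show ?thesis using eq[of "W n" "W k"] W mono[OF that] by auto
  qed
  then show "\<exists>n. \<forall>k\<ge>n. W k = W n" by blast
qed

lemma submodule_image:
  assumes "module R V" "module R V'" "submodule W R V"
    and f: "\<And>x. x \<in> carrier V \<Longrightarrow> f x \<in> carrier V'"
    "\<And>x y. \<lbrakk>x \<in> carrier V; y \<in> carrier V\<rbrakk> \<Longrightarrow> f (x \<oplus>\<^bsub>V\<^esub> y) = f x \<oplus>\<^bsub>V'\<^esub> f y"
    "\<And>r x. \<lbrakk>r \<in> carrier R; x \<in> carrier V\<rbrakk> \<Longrightarrow> f (r \<odot>\<^bsub>V\<^esub> x) = r \<odot>\<^bsub>V'\<^esub> f x"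
  shows "submodule (f ` W) R V'"
proof -
  interpret V: module R V by fact
  interpret V': module R V' by fact
  note w = V.submoduleE[OF assms(3)]
  have zero: "\<zero>\<^bsub>V\<^esub> \<in> W" using subgroup.one_closed[OF submodule.axioms(1)[OF assms(3)]] by simp
  have "f \<zero>\<^bsub>V\<^esub> \<oplus>\<^bsub>V'\<^esub> f \<zero>\<^bsub>V\<^esub> = f \<zero>\<^bsub>V\<^esub>"
    using f(2)[of "\<zero>\<^bsub>V\<^esub>" "\<zero>\<^bsub>V\<^esub>"] by simp
  then have f0: "f \<zero>\<^bsub>V\<^esub> = \<zero>\<^bsub>V'\<^esub>" using f(1)[OF V.zero_closed] by simp
  have fneg: "\<ominus>\<^bsub>V'\<^esub> f x = f (\<ominus>\<^bsub>V\<^esub> x)" if "x \<in> carrier V" for x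
    by (rule V'.minus_equality) (use that f f0 in \<open>auto simp: V.l_neg simp flip: f(2)\<close>)
  show ?thesis
  proof (rule V'.submoduleI)
    show "f ` W \<subseteq> carrier V'" using w(1) f(1) by blast
    show "\<zero>\<^bsub>V'\<^esub> \<in> f ` W" using zero f0 by (metis imageI)
    show "\<ominus>\<^bsub>V'\<^esub> a \<in> f ` W" if "a \<in> f ` W" for a using that w(1,3) fneg by (auto simp: subset_iff)
    show "a \<oplus>\<^bsub>V'\<^esub> b \<in> f ` W" if ab: "a \<in> f ` W" "b \<in> f ` W" for a b
    proof -
      obtain x y where xy: "x \<in> W" "y \<in> W" "a = f x" "b = f y" using ab by blast
      then have "a \<oplus>\<^bsub>V'\<^esub> b = f (x \<oplus>\<^bsub>V\<^esub> y)" using f(2) w(1) by (simp add: subset_iff)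
      then show ?thesis using w(5) xy by blast
    qed
    show "r \<odot>\<^bsub>V'\<^esub> a \<in> f ` W" if ra: "r \<in> carrier R" "a \<in> f ` W" for r a
    proof -
      obtain x where x: "x \<in> W" "a = f x" using ra by blast
      then have "r \<odot>\<^bsub>V'\<^esub> a = f (r \<odot>\<^bsub>V\<^esub> x)" using f(3) w(1) ra(1) by (simp add: subset_iff)
      then show ?thesis using w(4) x ra(1) by blast
    qed
  qed
qed

lemma descending_chain_condition_embedded:
  assumes V: "module R V" "module R V'" and dcc: "descending_chain_condition R V'"
    and f: "\<And>x. x \<in> carrier V \<Longrightarrow> f x \<in> carrier V'"
    "\<And>x y. \<lbrakk>x \<in> carrier V; y \<in> carrier V\<rbrakk> \<Longrightarrow> f (x \<oplus>\<^bsub>V\<^esub> y) = f x \<oplus>\<^bsub>V'\<^esub> f y"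
    "\<And>r x. \<lbrakk>r \<in> carrier R; x \<in> carrier V\<rbrakk> \<Longrightarrow> f (r \<odot>\<^bsub>V\<^esub> x) = r \<odot>\<^bsub>V'\<^esub> f x"
    and inj: "inj_on f (carrier V)"
  shows "descending_chain_condition R V"
  unfolding descending_chain_condition_def
proof (intro allI impI)
  fix W :: "nat \<Rightarrow> 'b set"
  assume W: "\<forall>n. submodule (W n) R V \<and> W (Suc n) \<subseteq> W n"
  have "submodule (f ` W n) R V'" for n using submodule_image[OF V _ f] W by blast
  moreover have "f ` W (Suc n) \<subseteq> f ` W n" for n using W by blast
  ultimately obtain n where n: "\<And>k. k \<ge> n \<Longrightarrow> f ` W k = f ` W n"
    using descending_chain_conditionD[OF dcc, of "\<lambda>n. f ` W n"] by metis
  have sub: "W k \<subseteq> carrier V" for k using W module.submoduleE(1)[OF V(1)] by blast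
  have "W k = W n" if "k \<ge> n" for k
    using n[OF that] inj_on_image_eq_iff[OF inj sub sub] by blast
  then show "\<exists>n. \<forall>k\<ge>n. W k = W n" by blast
qed


section \<open>Endomorphism rings of indecomposable objects\<close>

definition end_ring :: "('r, 'o, 'm) lcat \<Rightarrow> 'o \<Rightarrow> 'm ring" where
  "end_ring C X = \<lparr>carrier = Mor C X X, mult = Cmp C X X X, one = Idn C X,
     zero = \<zero>\<^bsub>Hom C X X\<^esub>, add = (\<lambda>f g. f \<oplus>\<^bsub>Hom C X X\<^esub> g)\<rparr>"

lemma end_ring_simps [simp]:
  "carrier (end_ring C X) = Mor C X X" "\<one>\<^bsub>end_ring C X\<^esub> = Idn C X"
  "\<zero>\<^bsub>end_ring C X\<^esub> = \<zero>\<^bsub>Hom C X X\<^esub>"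
  "f \<otimes>\<^bsub>end_ring C X\<^esub> g = Cmp C X X X f g" "f \<oplus>\<^bsub>end_ring C X\<^esub> g = f \<oplus>\<^bsub>Hom C X X\<^esub> g"
  by (simp_all add: end_ring_def)

lemma (in linear_category) end_ring:
  assumes X: "X \<in> Ob C"
  shows "ring (end_ring C X)"
proof (rule ringI)
  show "abelian_group (end_ring C X)"
  proof (rule abelian_groupI)
    fix f assume "f \<in> carrier (end_ring C X)"
    then show "\<exists>g\<in>carrier (end_ring C X). g \<oplus>\<^bsub>end_ring C X\<^esub> f = \<zero>\<^bsub>end_ring C X\<^esub>"
      using X by (intro bexI[of _ "\<ominus>\<^bsub>Hom C X X\<^esub> f"]) (simp_all add: hom_add_comm[of X X "\<ominus>\<^bsub>Hom C X X\<^esub> f"])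
  qed (use X in \<open>auto intro: hom_add_assoc hom_add_comm\<close>)
  show "monoid (end_ring C X)"
    by (rule monoidI) (use X in \<open>simp_all add: cmp_assoc\<close>)
qed (use X in \<open>simp_all add: cmp_add_left cmp_add_right\<close>)

definition trivial_idempotents :: "('r, 'o, 'm) lcat \<Rightarrow> 'o \<Rightarrow> bool" where
  "trivial_idempotents C X \<longleftrightarrow> (\<forall>e. idempotent_in C X e \<longrightarrow> e = \<zero>\<^bsub>Hom C X X\<^esub> \<or> e = Idn C X)"

definition nilpotent_or_invertible :: "('r, 'o, 'm) lcat \<Rightarrow> 'o \<Rightarrow> 'm \<Rightarrow> bool" where
  "nilpotent_or_invertible C X f \<longleftrightarrow>
     (\<exists>n::nat. f [^]\<^bsub>end_ring C X\<^esub> n = \<zero>\<^bsub>Hom C X X\<^esub>) \<or> (\<exists>g \<in> Mor C X X. Cmp C X X X g f = Idn C X)"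

text \<open>If \<open>a\<close> generates the same left and the same right ideal as its square, then \<open>a b = c a\<close> is an
  idempotent that absorbs \<open>a\<close>.\<close>

lemma (in ring) zero_or_left_invertible:
  assumes "a \<in> carrier R" "b \<in> carrier R" "c \<in> carrier R"
    and ab: "a = (a \<otimes> a) \<otimes> b" and ca: "a = c \<otimes> (a \<otimes> a)"
    and idem: "\<And>e. \<lbrakk>e \<in> carrier R; e \<otimes> e = e\<rbrakk> \<Longrightarrow> e = \<zero> \<or> e = \<one>"
  shows "a = \<zero> \<or> c \<otimes> a = \<one>"
proof -
  have "c \<otimes> a = c \<otimes> ((a \<otimes> a) \<otimes> b)" using ab by simp
  also have "\<dots> = (c \<otimes> (a \<otimes> a)) \<otimes> b" using assms(1-3) by (simp add: m_assoc)
  also have "\<dots> = a \<otimes> b" using ca by simp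
  finally have e: "c \<otimes> a = a \<otimes> b" .
  have "(c \<otimes> a) \<otimes> (a \<otimes> b) = (c \<otimes> (a \<otimes> a)) \<otimes> b" using assms(1-3) by (simp add: m_assoc)
  also have "\<dots> = a \<otimes> b" using ca by simp
  finally have "(c \<otimes> a) \<otimes> (c \<otimes> a) = c \<otimes> a" using e by simp
  then have "c \<otimes> a = \<zero> \<or> c \<otimes> a = \<one>" using idem assms(1-3) by simp
  moreover have "a = (c \<otimes> a) \<otimes> a" using ca assms(1-3) by (simp add: m_assoc)
  ultimately show ?thesis using assms(1) by (metis l_null)
qed

context linear_category
begin

text \<open>Fitting's lemma. The left and the right ideals generated by the powers of \<open>f\<close> are submodules of the
  endomorphism module; once both chains are stationary, \<open>zero_or_left_invertible\<close> applies to a power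
  of \<open>f\<close>.\<close>

lemma fitting:
  assumes X: "X \<in> Ob C" and dcc: "descending_chain_condition R (Hom C X X)"
    and triv: "trivial_idempotents C X" and f: "f \<in> Mor C X X"
  shows "nilpotent_or_invertible C X f"
proof -
  interpret B: ring "end_ring C X" by (rule end_ring[OF X])
  define p where "p n = f [^]\<^bsub>end_ring C X\<^esub> (n::nat)" for n
  have p [simp]: "p n \<in> Mor C X X" for n
    unfolding p_def using B.nat_pow_closed[of f n] f by simp
  have p_add: "p (i + j) = Cmp C X X X (p i) (p j)" for i j
    unfolding p_def using B.nat_pow_mult[of f i j] f by simp
  note M = hom_module[OF X X]
  have "submodule ((\<lambda>b. Cmp C X X X (p n) b) ` Mor C X X) R (Hom C X X)" for n
    by (rule submodule_image[OF M M module.carrier_is_submodule[OF M]])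
       (use X in \<open>simp_all add: cmp_add_right cmp_smult_right\<close>)
  moreover have "(\<lambda>b. Cmp C X X X (p (Suc n)) b) ` Mor C X X \<subseteq> (\<lambda>b. Cmp C X X X (p n) b) ` Mor C X X" for n
    using X p_add[of n 1] by (auto simp: cmp_assoc)
  ultimately obtain n where n: "\<And>k. k \<ge> n \<Longrightarrow>
     (\<lambda>b. Cmp C X X X (p k) b) ` Mor C X X = (\<lambda>b. Cmp C X X X (p n) b) ` Mor C X X"
    using descending_chain_conditionD[OF dcc, of "\<lambda>n. (\<lambda>b. Cmp C X X X (p n) b) ` Mor C X X"] by metis
  have "submodule ((\<lambda>b. Cmp C X X X b (p n)) ` Mor C X X) R (Hom C X X)" for n
    by (rule submodule_image[OF M M module.carrier_is_submodule[OF M]])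
       (use X in \<open>simp_all add: cmp_add_left cmp_smult_left\<close>)
  moreover have "(\<lambda>b. Cmp C X X X b (p (Suc n))) ` Mor C X X \<subseteq> (\<lambda>b. Cmp C X X X b (p n)) ` Mor C X X" for n
    using X p_add[of 1 n] by (auto simp flip: cmp_assoc)
  ultimately obtain n' where n': "\<And>k. k \<ge> n' \<Longrightarrow>
     (\<lambda>b. Cmp C X X X b (p k)) ` Mor C X X = (\<lambda>b. Cmp C X X X b (p n')) ` Mor C X X"
    using descending_chain_conditionD[OF dcc, of "\<lambda>n. (\<lambda>b. Cmp C X X X b (p n)) ` Mor C X X"] by metis
  define N where "N = Suc (max n n')"
  have N: "N \<ge> n" "N \<ge> n'" "N + N \<ge> n" "N + N \<ge> n'" by (auto simp: N_def)
  have "p N \<in> (\<lambda>b. Cmp C X X X (p N) b) ` Mor C X X"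
    using X by (intro image_eqI[of _ _ "Idn C X"]) simp_all
  then have "p N \<in> (\<lambda>b. Cmp C X X X (p (N + N)) b) ` Mor C X X"
    by (simp only: n[OF N(1)] n[OF N(3)])
  then obtain b where b: "b \<in> Mor C X X" "p N = Cmp C X X X (p (N + N)) b"
    by blast
  have "p N \<in> (\<lambda>b. Cmp C X X X b (p N)) ` Mor C X X"
    using X by (intro image_eqI[of _ _ "Idn C X"]) simp_all
  then have "p N \<in> (\<lambda>b. Cmp C X X X b (p (N + N))) ` Mor C X X"
    by (simp only: n'[OF N(2)] n'[OF N(4)])
  then obtain c where c: "c \<in> Mor C X X" "p N = Cmp C X X X c (p (N + N))"
    by blast
  have "p N = \<zero>\<^bsub>Hom C X X\<^esub> \<or> Cmp C X X X c (p N) = Idn C X"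
  proof (rule B.zero_or_left_invertible[of "p N" b c, unfolded end_ring_simps])
    show "p N = Cmp C X X X (Cmp C X X X (p N) (p N)) b" using b(2) by (simp only: p_add)
    show "p N = Cmp C X X X c (Cmp C X X X (p N) (p N))" using c(2) by (simp only: p_add)
    show "e = \<zero>\<^bsub>Hom C X X\<^esub> \<or> e = Idn C X" if "e \<in> Mor C X X" "Cmp C X X X e e = e" for e
      using triv that unfolding trivial_idempotents_def idempotent_in_def by blast
  qed (use b(1) c(1) in simp_all)
  then show ?thesis
  proof
    assume "p N = \<zero>\<^bsub>Hom C X X\<^esub>"
    then show ?thesis unfolding nilpotent_or_invertible_def p_def by blast
  next
    assume "Cmp C X X X c (p N) = Idn C X"
    moreover have "p N = Cmp C X X X (p (max n n')) f"
      using p_add[of "max n n'" 1] B.nat_pow_eone[of f] f by (simp add: N_def p_def)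
    ultimately have "Cmp C X X X (Cmp C X X X c (p (max n n'))) f = Idn C X"
      using X c(1) f by (simp add: cmp_assoc)
    then show ?thesis
      unfolding nilpotent_or_invertible_def using X c(1) by (metis cmp_closed p)
  qed
qed

lemma complement_idempotent:
  assumes X: "X \<in> Ob C" and e: "idempotent_in C X e"
  obtains e' where "idempotent_in C X e'" "e \<oplus>\<^bsub>Hom C X X\<^esub> e' = Idn C X"
    "Cmp C X X X e' e = \<zero>\<^bsub>Hom C X X\<^esub>" "Cmp C X X X e e' = \<zero>\<^bsub>Hom C X X\<^esub>"
proof -
  have em: "e \<in> Mor C X X" "Cmp C X X X e e = e" using e by (auto simp: idempotent_in_def)
  define e' where "e' = Idn C X \<oplus>\<^bsub>Hom C X X\<^esub> \<ominus>\<^bsub>Hom C X X\<^esub> e"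
  have e'm: "e' \<in> Mor C X X" unfolding e'_def using X em by simp
  have z: "Cmp C X X X e' e = \<zero>\<^bsub>Hom C X X\<^esub>" "Cmp C X X X e e' = \<zero>\<^bsub>Hom C X X\<^esub>"
    unfolding e'_def using X em by (simp_all add: cmp_add_left cmp_add_right cmp_neg_left cmp_neg_right)
  have "Cmp C X X X e' e' = Cmp C X X X e' (Idn C X) \<oplus>\<^bsub>Hom C X X\<^esub> Cmp C X X X e' (\<ominus>\<^bsub>Hom C X X\<^esub> e)"
    using X em e'm by (subst (2) e'_def) (simp add: cmp_add_right)
  also have "\<dots> = e'" using X em e'm z by (simp add: cmp_neg_right abelian_group.minus_minus
      abelian_monoid.r_zero hom_abelian_group)
      (metis abelian_group.r_neg hom_abelian_group hom_r_zero hom_zero hom_l_zero hom_neg)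
  finally have "idempotent_in C X e'" unfolding idempotent_in_def using e'm by simp
  moreover have "e \<oplus>\<^bsub>Hom C X X\<^esub> e' = Idn C X"
  proof -
    have "e \<oplus>\<^bsub>Hom C X X\<^esub> e' = Idn C X \<oplus>\<^bsub>Hom C X X\<^esub> (e \<oplus>\<^bsub>Hom C X X\<^esub> \<ominus>\<^bsub>Hom C X X\<^esub> e)"
      unfolding e'_def using X em by (metis hom_add_assoc hom_add_comm hom_neg idn_closed)
    then show ?thesis using X em by simp
  qed
  ultimately show ?thesis using that z by blast
qed

lemma indecomposable_of_trivial_idempotents:
  assumes X: "X \<in> Ob C" "Idn C X \<noteq> \<zero>\<^bsub>Hom C X X\<^esub>" and triv: "trivial_idempotents C X"
  shows "indecomposable C X"
  unfolding indecomposable_def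
proof (intro conjI allI impI)
  show "X \<in> Ob C" by fact
  show "\<not> zero_object C X" using X by (simp add: zero_object_iff)
  fix Y inc prj assume ds: "is_direct_sum C (UNIV :: bool set) Y X inc prj"
  note D = is_direct_sumD[OF ds, simplified]
  define e where "e = Cmp C X (Y True) X (inc True) (prj True)"
  have e: "e \<in> Mor C X X" unfolding e_def using D by simp
  have "Cmp C X X X e e = Cmp C X (Y True) X (inc True) (Cmp C X (Y True) (Y True) (Cmp C (Y True) X (Y True)
      (prj True) (inc True)) (prj True))"
    unfolding e_def using D(2-5) by (simp add: cmp_assoc)
  then have "idempotent_in C X e" unfolding idempotent_in_def using e D by (simp add: e_def)
  then consider "e = \<zero>\<^bsub>Hom C X X\<^esub>" | "e = Idn C X" using triv unfolding trivial_idempotents_def by blast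
  then show "zero_object C (Y True) \<or> zero_object C (Y False)"
  proof cases
    case 1
    have "Idn C (Y True) = Cmp C (Y True) X (Y True) (Cmp C X (Y True) (Y True) (Cmp C (Y True) X (Y True)
        (prj True) (inc True)) (prj True)) (inc True)"
      using D(2-6) by simp
    also have "\<dots> = Cmp C (Y True) X (Y True) (prj True) (Cmp C (Y True) X X e (inc True))"
      unfolding e_def using D(2-5) by (simp add: cmp_assoc)
    also have "\<dots> = \<zero>\<^bsub>Hom C (Y True) (Y True)\<^esub>" using 1 D(2-5) by simp
    finally show ?thesis using D(3) by (simp add: zero_object_iff)
  next
    case 2
    have "Idn C (Y False) = Cmp C (Y False) X (Y False) (prj False) (Cmp C (Y False) X X e (inc False))"
      using D(2-6) 2 by simp
    also have "\<dots> = Cmp C (Y False) (Y True) (Y False) (Cmp C (Y True) X (Y False) (prj False) (inc True))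
       (Cmp C (Y False) X (Y True) (prj True) (inc False))"
      unfolding e_def using D(2-5) by (simp add: cmp_assoc)
    also have "\<dots> = \<zero>\<^bsub>Hom C (Y False) (Y False)\<^esub>" using D(3,4,5) D(7)[of True False] D(2) by simp
    finally show ?thesis using D(3) by (simp add: zero_object_iff)
  qed
qed

text \<open>An idempotent and its complement split, and their images are the summands of a decomposition of \<open>X\<close>.\<close>

lemma indecomposable_trivial_idempotents:
  assumes ic: "idempotent_complete C" and ind: "indecomposable C X"
  shows "X \<in> Ob C" "Idn C X \<noteq> \<zero>\<^bsub>Hom C X X\<^esub>" "trivial_idempotents C X"
proof -
  show X: "X \<in> Ob C" and "Idn C X \<noteq> \<zero>\<^bsub>Hom C X X\<^esub>"
    using ind by (auto simp: indecomposable_def zero_object_iff)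
  show "trivial_idempotents C X"
    unfolding trivial_idempotents_def
  proof (intro allI impI)
    fix e assume e: "idempotent_in C X e"
    obtain e' where e': "idempotent_in C X e'" "e \<oplus>\<^bsub>Hom C X X\<^esub> e' = Idn C X"
      "Cmp C X X X e' e = \<zero>\<^bsub>Hom C X X\<^esub>" "Cmp C X X X e e' = \<zero>\<^bsub>Hom C X X\<^esub>"
      using complement_idempotent[OF X e] by blast
    have em: "e \<in> Mor C X X" "e' \<in> Mor C X X" using e e' by (auto simp: idempotent_in_def)
    obtain Y r s where Y: "Y \<in> Ob C" "r \<in> Mor C X Y" "s \<in> Mor C Y X"
      "Cmp C Y X Y r s = Idn C Y" "Cmp C X Y X s r = e"
      using ic X e unfolding idempotent_complete_def by meson
    obtain Y' r' s' where Y': "Y' \<in> Ob C" "r' \<in> Mor C X Y'" "s' \<in> Mor C Y' X"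
      "Cmp C Y' X Y' r' s' = Idn C Y'" "Cmp C X Y' X s' r' = e'"
      using ic X e'(1) unfolding idempotent_complete_def by meson
    have re: "Cmp C X X Y r e = r" "Cmp C Y X X e s = s"
      using X Y(1-4) by (simp_all add: cmp_assoc flip: Y(5)) (simp flip: cmp_assoc)
    have re': "Cmp C X X Y' r' e' = r'" "Cmp C Y' X X e' s' = s'"
      using X Y'(1-4) by (simp_all add: cmp_assoc flip: Y'(5)) (simp flip: cmp_assoc)
    have "Cmp C Y X Y' r' s = Cmp C Y X Y' (Cmp C X X Y' r' (Cmp C X X X e' e)) s"
      using X Y(1,3) Y'(1,2) em by (simp add: re(2) cmp_assoc) (simp add: re' flip: cmp_assoc)
    then have r's: "Cmp C Y X Y' r' s = \<zero>\<^bsub>Hom C Y Y'\<^esub>" using X Y(1,3) Y'(1,2) e'(3) by simp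
    have "Cmp C Y' X Y r s' = Cmp C Y' X Y (Cmp C X X Y r (Cmp C X X X e e')) s'"
      using X Y'(1,3) Y(1,2) em by (simp add: re'(2) cmp_assoc) (simp add: re flip: cmp_assoc)
    then have rs': "Cmp C Y' X Y r s' = \<zero>\<^bsub>Hom C Y' Y\<^esub>" using X Y'(1,3) Y(1,2) e'(4) by simp
    have "is_direct_sum C (UNIV :: bool set) (\<lambda>b. if b then Y else Y') X (\<lambda>b. if b then s else s') (\<lambda>b. if b
        then r else r')"
    proof -
      have "finsum (Hom C X X) (\<lambda>b. if b then Cmp C X Y X s r else Cmp C X Y' X s' r') {True, False} = Idn C X"
        using X em e'(2) by (subst hom_finsum_insert | simp add: Y(5) Y'(5))+
      moreover have "(\<lambda>b. Cmp C X (if b then Y else Y') X (if b then s else s') (if b then r else r')) =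
         (\<lambda>b. if b then Cmp C X Y X s r else Cmp C X Y' X s' r')" by auto
      moreover have "(UNIV :: bool set) = {True, False}" by auto
      ultimately show ?thesis
        unfolding is_direct_sum_def using X Y(1-4) Y'(1-4) r's rs' by auto
    qed
    then have "zero_object C Y \<or> zero_object C Y'"
      using ind unfolding indecomposable_def by (metis (full_types))
    then show "e = \<zero>\<^bsub>Hom C X X\<^esub> \<or> e = Idn C X"
    proof
      assume "zero_object C Y"
      then have "Idn C Y = \<zero>\<^bsub>Hom C Y Y\<^esub>" by (simp add: zero_object_iff)
      then have "s = \<zero>\<^bsub>Hom C Y X\<^esub>" using cmp_idn_right[OF Y(1) X Y(3)] X Y(1,3) by simp
      then show ?thesis using Y(5) X Y(1,2) by auto
    next
      assume "zero_object C Y'"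
      then have "Idn C Y' = \<zero>\<^bsub>Hom C Y' Y'\<^esub>" by (simp add: zero_object_iff)
      then have "s' = \<zero>\<^bsub>Hom C Y' X\<^esub>" using cmp_idn_right[OF Y'(1) X Y'(3)] X Y'(1,3) by simp
      then have "e' = \<zero>\<^bsub>Hom C X X\<^esub>" using Y'(5) X Y'(1,2) by auto
      then show ?thesis using e'(2) X em by simp
    qed
  qed
qed

end

lemma (in linear_functor) fully_faithful_trivial_idempotents:
  assumes ff: "fully_faithful C D F" and X: "X \<in> Ob C" and triv: "trivial_idempotents C X"
  shows "trivial_idempotents D (FOb F X)"
  unfolding trivial_idempotents_def
proof (intro allI impI)
  fix e assume "idempotent_in D (FOb F X) e"
  then have e: "e \<in> Mor D (FOb F X) (FOb F X)" "Cmp D (FOb F X) (FOb F X) (FOb F X) e e = e"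
    by (auto simp: idempotent_in_def)
  obtain e0 where e0: "e0 \<in> Mor C X X" "FMor F X X e0 = e"
    using fully_faithful_surj[OF ff X X e(1)] by blast
  have "Cmp C X X X e0 e0 = e0"
    by (rule fully_faithful_inj[OF ff X X]) (use X e e0 in \<open>simp_all add: fmor_cmp\<close>)
  then have "e0 = \<zero>\<^bsub>Hom C X X\<^esub> \<or> e0 = Idn C X"
    using triv e0(1) unfolding trivial_idempotents_def idempotent_in_def by blast
  then show "e = \<zero>\<^bsub>Hom D (FOb F X) (FOb F X)\<^esub> \<or> e = Idn D (FOb F X)"
    using e0(2) X fmor_zero fmor_idn by auto
qed


section \<open>The radical of a linear category\<close>

text \<open>A morphism \<open>f\<close> is radical if \<open>1 - g f\<close> has a left inverse \<open>h\<close> for all \<open>g\<close>. The equation for \<open>h\<close> is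
  written without a difference, as \<open>h = 1 + h g f\<close>.\<close>

definition radical :: "('r, 'o, 'm) lcat \<Rightarrow> 'o \<Rightarrow> 'o \<Rightarrow> 'm set" where
  "radical C X Y = {f \<in> Mor C X Y. \<forall>g \<in> Mor C Y X. \<exists>h \<in> Mor C X X.
     h = Idn C X \<oplus>\<^bsub>Hom C X X\<^esub> Cmp C X X X h (Cmp C X Y X g f)}"

lemma radical_mor: "f \<in> radical C X Y \<Longrightarrow> f \<in> Mor C X Y"
  by (simp add: radical_def)

lemma radicalE:
  assumes "f \<in> radical C X Y" "g \<in> Mor C Y X"
  obtains h where "h \<in> Mor C X X" "h = Idn C X \<oplus>\<^bsub>Hom C X X\<^esub> Cmp C X X X h (Cmp C X Y X g f)"
  using assms unfolding radical_def by blast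

context linear_category
begin

lemma radical_zero: "\<lbrakk>X \<in> Ob C; Y \<in> Ob C\<rbrakk> \<Longrightarrow> \<zero>\<^bsub>Hom C X Y\<^esub> \<in> radical C X Y"
  unfolding radical_def by (auto intro!: bexI[of _ "Idn C X"])

lemma radical_add:
  assumes X: "X \<in> Ob C" "Y \<in> Ob C" and f: "f \<in> radical C X Y" "f' \<in> radical C X Y"
  shows "f \<oplus>\<^bsub>Hom C X Y\<^esub> f' \<in> radical C X Y"
  unfolding radical_def
proof (intro CollectI conjI ballI)
  note fm = radical_mor[OF f(1)] radical_mor[OF f(2)]
  show "f \<oplus>\<^bsub>Hom C X Y\<^esub> f' \<in> Mor C X Y" using X fm by simp
  fix g assume g: "g \<in> Mor C Y X"
  obtain h where h: "h \<in> Mor C X X" "h = Idn C X \<oplus>\<^bsub>Hom C X X\<^esub> Cmp C X X X h (Cmp C X Y X g f)"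
    using radicalE[OF f(1) g] by blast
  obtain h' where h': "h' \<in> Mor C X X"
    "h' = Idn C X \<oplus>\<^bsub>Hom C X X\<^esub> Cmp C X X X h' (Cmp C X Y X (Cmp C Y X X h g) f')"
    using radicalE[OF f(2), of "Cmp C Y X X h g"] X g h(1) by auto
  have "Cmp C X X X h' h = Cmp C X X X h' (Idn C X \<oplus>\<^bsub>Hom C X X\<^esub> Cmp C X X X h (Cmp C X Y X g f))"
    using h(2) by simp
  also have "\<dots> = h' \<oplus>\<^bsub>Hom C X X\<^esub> Cmp C X X X (Cmp C X X X h' h) (Cmp C X Y X g f)"
    using X fm g h(1) h'(1) by (simp add: cmp_add_right cmp_assoc)
  also have "\<dots> = (Idn C X \<oplus>\<^bsub>Hom C X X\<^esub> Cmp C X X X h' (Cmp C X Y X (Cmp C Y X X h g) f'))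
      \<oplus>\<^bsub>Hom C X X\<^esub> Cmp C X X X (Cmp C X X X h' h) (Cmp C X Y X g f)"
    using h'(2) by simp
  also have "\<dots> = Idn C X \<oplus>\<^bsub>Hom C X X\<^esub> (Cmp C X X X (Cmp C X X X h' h) (Cmp C X Y X g f) \<oplus>\<^bsub>Hom C X X\<^esub>
      Cmp C X X X (Cmp C X X X h' h) (Cmp C X Y X g f'))"
    using X fm g h(1) h'(1) by (simp add: hom_add_assoc cmp_assoc hom_add_comm[of X X "Cmp C X X X h' (Cmp C X
        X X h (Cmp C X Y X g f'))"])
  also have "\<dots> = Idn C X \<oplus>\<^bsub>Hom C X X\<^esub> Cmp C X X X (Cmp C X X X h' h) (Cmp C X Y X g (f \<oplus>\<^bsub>Hom C X Y\<^esub> f'))"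
    using X fm g h(1) h'(1) by (simp add: cmp_add_right)
  finally show "\<exists>k\<in>Mor C X X. k = Idn C X \<oplus>\<^bsub>Hom C X X\<^esub> Cmp C X X X k (Cmp C X Y X g (f \<oplus>\<^bsub>Hom C X Y\<^esub> f'))"
    using X h(1) h'(1) cmp_closed by blast
qed

lemma radical_cmp_left:
  assumes X: "X \<in> Ob C" "Y \<in> Ob C" "Z \<in> Ob C" and f: "f \<in> radical C X Y" and b: "b \<in> Mor C Y Z"
  shows "Cmp C X Y Z b f \<in> radical C X Z"
  unfolding radical_def
proof (intro CollectI conjI ballI)
  note fm = radical_mor[OF f]
  show "Cmp C X Y Z b f \<in> Mor C X Z" using X fm b by simp
  fix g assume g: "g \<in> Mor C Z X"
  obtain h where "h \<in> Mor C X X" "h = Idn C X \<oplus>\<^bsub>Hom C X X\<^esub> Cmp C X X X h (Cmp C X Y X (Cmp C Y Z X g b) f)"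
    using radicalE[OF f, of "Cmp C Y Z X g b"] X g b by auto
  then show "\<exists>h\<in>Mor C X X. h = Idn C X \<oplus>\<^bsub>Hom C X X\<^esub> Cmp C X X X h (Cmp C X Z X g (Cmp C X Y Z b f))"
    using X fm b g by (auto simp: cmp_assoc)
qed

text \<open>The left inverse for \<open>f a\<close> comes from that for \<open>f\<close> by the identity
  \<open>(1 - g f a)\<^sup>-\<^sup>1 = 1 + g f (1 - a g f)\<^sup>-\<^sup>1 a\<close>.\<close>

lemma radical_cmp_right:
  assumes X: "W \<in> Ob C" "X \<in> Ob C" "Y \<in> Ob C" and f: "f \<in> radical C X Y" and a: "a \<in> Mor C W X"
  shows "Cmp C W X Y f a \<in> radical C W Y"
  unfolding radical_def
proof (intro CollectI conjI ballI)
  note fm = radical_mor[OF f]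
  show "Cmp C W X Y f a \<in> Mor C W Y" using X fm a by simp
  fix g assume g: "g \<in> Mor C Y W"
  obtain h where h: "h \<in> Mor C X X" "h = Idn C X \<oplus>\<^bsub>Hom C X X\<^esub> Cmp C X X X h (Cmp C X Y X (Cmp C Y W X a g) f)"
    using radicalE[OF f, of "Cmp C Y W X a g"] X g a by auto
  define gf where "gf = Cmp C X Y W g f"
  have gf: "gf \<in> Mor C X W" unfolding gf_def using X fm g by simp
  define k where "k = Idn C W \<oplus>\<^bsub>Hom C W W\<^esub> Cmp C W X W gf (Cmp C W X X h a)"
  have hh: "Cmp C W X X h a = a \<oplus>\<^bsub>Hom C W X\<^esub> Cmp C W X X h (Cmp C W W X a (Cmp C W X W gf a))"
  proof -
    have "Cmp C W X X h a = Cmp C W X X (Idn C X \<oplus>\<^bsub>Hom C X X\<^esub> Cmp C X X X h (Cmp C X Y X (Cmp C Y W X a g) f)) a"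
      using h(2) by simp
    then show ?thesis unfolding gf_def using X fm a g h(1) by (simp add: cmp_add_left cmp_assoc)
  qed
  have "Cmp C W W W k (Cmp C W X W gf a) = Cmp C W X W gf a \<oplus>\<^bsub>Hom C W W\<^esub>
      Cmp C W X W gf (Cmp C W X X h (Cmp C W W X a (Cmp C W X W gf a)))"
    unfolding k_def using X a gf h(1) by (simp add: cmp_add_left cmp_assoc)
  also have "\<dots> = Cmp C W X W gf (Cmp C W X X h a)"
    using X a gf h(1) by (subst hh) (simp add: cmp_add_right)
  finally have "k = Idn C W \<oplus>\<^bsub>Hom C W W\<^esub> Cmp C W W W k (Cmp C W Y W g (Cmp C W X Y f a))"
    unfolding k_def gf_def using X a g fm by (simp add: cmp_assoc)
  moreover have "k \<in> Mor C W W" unfolding k_def using X a gf h(1) by simp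
  ultimately show "\<exists>k\<in>Mor C W W. k = Idn C W \<oplus>\<^bsub>Hom C W W\<^esub> Cmp C W W W k (Cmp C W Y W g (Cmp C W X Y f a))"
    by blast
qed

lemma radical_finsum:
  assumes X: "X \<in> Ob C" "Y \<in> Ob C" and "finite I" "\<And>i. i \<in> I \<Longrightarrow> f i \<in> radical C X Y"
  shows "finsum (Hom C X Y) f I \<in> radical C X Y"
  using assms(3,4)
proof (induction I)
  case (insert i I)
  then show ?case
    using X radical_add[OF X] radical_mor[of _ C X Y] by (subst hom_finsum_insert) auto
qed (use X radical_zero in simp)

text \<open>If \<open>a\<close> is a radical idempotent, \<open>1 - a\<close> is left invertible and annihilates \<open>a\<close>.\<close>

lemma radical_idempotent_zero:
  assumes X: "X \<in> Ob C" and a: "a \<in> radical C X X" and idem: "Cmp C X X X a a = a"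
  shows "a = \<zero>\<^bsub>Hom C X X\<^esub>"
proof -
  note am = radical_mor[OF a]
  obtain h where h: "h \<in> Mor C X X" "h = Idn C X \<oplus>\<^bsub>Hom C X X\<^esub> Cmp C X X X h (Cmp C X X X (Idn C X) a)"
    using radicalE[OF a, of "Idn C X"] X by auto
  have "Cmp C X X X h a = Cmp C X X X (Idn C X \<oplus>\<^bsub>Hom C X X\<^esub> Cmp C X X X h a) a"
    using h X am by simp
  also have "\<dots> = a \<oplus>\<^bsub>Hom C X X\<^esub> Cmp C X X X h a"
    using X am h(1) idem by (simp add: cmp_add_left cmp_assoc)
  finally show ?thesis
    using X am h(1) by (intro hom_add_cancel_zero[OF X X am, of "Cmp C X X X h a"]) simp_all
qed

text \<open>The witness is the geometric series \<open>1 + x + \<dots> + x ^ (n - 1)\<close>. It is built by the recursion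
  \<open>h \<mapsto> 1 + h x\<close>, starting from \<open>0\<close>.\<close>

lemma nilpotent_quasi_regular:
  assumes X: "X \<in> Ob C" and x: "x \<in> Mor C X X" and nil: "x [^]\<^bsub>end_ring C X\<^esub> (n::nat) = \<zero>\<^bsub>Hom C X X\<^esub>"
  shows "\<exists>h \<in> Mor C X X. h = Idn C X \<oplus>\<^bsub>Hom C X X\<^esub> Cmp C X X X h x"
proof -
  interpret B: ring "end_ring C X" by (rule end_ring[OF X])
  have "\<exists>h \<in> Mor C X X. h \<oplus>\<^bsub>Hom C X X\<^esub> x [^]\<^bsub>end_ring C X\<^esub> n = Idn C X \<oplus>\<^bsub>Hom C X X\<^esub> Cmp C X X X h x" for n :: nat
  proof (induction n)
    case 0
    show ?case by (rule bexI[of _ "\<zero>\<^bsub>Hom C X X\<^esub>"]) (use X x in simp_all)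
  next
    case (Suc n)
    then obtain h where h: "h \<in> Mor C X X" "h \<oplus>\<^bsub>Hom C X X\<^esub> x [^]\<^bsub>end_ring C X\<^esub> n = Idn C X \<oplus>\<^bsub>Hom C X X\<^esub> Cmp C
        X X X h x" by blast
    have xn: "x [^]\<^bsub>end_ring C X\<^esub> n \<in> Mor C X X" using B.nat_pow_closed[of x n] x by simp
    define k where "k = Idn C X \<oplus>\<^bsub>Hom C X X\<^esub> Cmp C X X X h x"
    have "k \<oplus>\<^bsub>Hom C X X\<^esub> x [^]\<^bsub>end_ring C X\<^esub> Suc n =
       Idn C X \<oplus>\<^bsub>Hom C X X\<^esub> Cmp C X X X (h \<oplus>\<^bsub>Hom C X X\<^esub> x [^]\<^bsub>end_ring C X\<^esub> n) x"
      unfolding k_def using X x h(1) xn by (simp add: cmp_add_left hom_add_assoc)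
    then show ?case
      using h(2) X x h(1) by (intro bexI[of _ k]) (simp_all add: k_def)
  qed
  from this[of n] nil show ?thesis using X by auto
qed

text \<open>If \<open>g f\<close> is nilpotent then \<open>1 - g f\<close> is invertible. Otherwise \<open>g f\<close> has a left inverse, so \<open>f\<close> is a
  split monomorphism, and as \<open>Y\<close> has only trivial idempotents \<open>f\<close> would be an isomorphism.\<close>

lemma radical_of_not_isomorphic:
  assumes X: "X \<in> Ob C" "Y \<in> Ob C" "Idn C X \<noteq> \<zero>\<^bsub>Hom C X X\<^esub>"
    and fit: "\<And>f. f \<in> Mor C X X \<Longrightarrow> nilpotent_or_invertible C X f"
    and triv: "trivial_idempotents C Y" and niso: "\<not> isomorphic_in C X Y" and f: "f \<in> Mor C X Y"
  shows "f \<in> radical C X Y"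
  unfolding radical_def
proof (intro CollectI conjI ballI f)
  fix g assume g: "g \<in> Mor C Y X"
  have "nilpotent_or_invertible C X (Cmp C X Y X g f)" using fit X f g by simp
  then consider n :: nat where "(Cmp C X Y X g f) [^]\<^bsub>end_ring C X\<^esub> n = \<zero>\<^bsub>Hom C X X\<^esub>"
    | c where "c \<in> Mor C X X" "Cmp C X X X c (Cmp C X Y X g f) = Idn C X"
    unfolding nilpotent_or_invertible_def by blast
  then show "\<exists>h\<in>Mor C X X. h = Idn C X \<oplus>\<^bsub>Hom C X X\<^esub> Cmp C X X X h (Cmp C X Y X g f)"
  proof cases
    case 1
    then show ?thesis using nilpotent_quasi_regular X f g by simp
  next
    case 2
    define g' where "g' = Cmp C Y X X c g"
    have g': "g' \<in> Mor C Y X" "Cmp C X Y X g' f = Idn C X"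
      unfolding g'_def using X f g 2 by (simp_all add: cmp_assoc)
    have "Cmp C Y Y Y (Cmp C Y X Y f g') (Cmp C Y X Y f g') = Cmp C Y X Y f (Cmp C Y X X (Cmp C X Y X g' f) g')"
      using X f g'(1) by (simp add: cmp_assoc)
    then have "idempotent_in C Y (Cmp C Y X Y f g')"
      unfolding idempotent_in_def using X f g' by simp
    then consider "Cmp C Y X Y f g' = \<zero>\<^bsub>Hom C Y Y\<^esub>" | "Cmp C Y X Y f g' = Idn C Y"
      using triv unfolding trivial_idempotents_def by blast
    then show ?thesis
    proof cases
      case 1
      have "Idn C X = Cmp C X Y X (Cmp C Y X X (Cmp C X Y X g' f) g') f" using X f g' by simp
      also have "\<dots> = Cmp C X Y X g' (Cmp C X Y Y (Cmp C Y X Y f g') f)" using X f g'(1) by (simp add: cmp_assoc)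
      also have "\<dots> = \<zero>\<^bsub>Hom C X X\<^esub>" using 1 X f g' by simp
      finally show ?thesis using X(3) by simp
    next
      case 2
      then have "iso_in C X Y f" unfolding iso_in_def using f g' by blast
      then show ?thesis using niso unfolding isomorphic_in_def by blast
    qed
  qed
qed

text \<open>If \<open>h\<close> is a left inverse of \<open>1 - g f\<close> in \<open>C\<close>, then \<open>e h e\<close> is one of \<open>e - g f\<close> in the envelope, where
  \<open>e\<close> is the identity of the source.\<close>

lemma radical_karoubi:
  assumes Z: "Z \<in> Ob (karoubi C)" "W \<in> Ob (karoubi C)"
    and f: "f \<in> Mor (karoubi C) Z W" "f \<in> radical C (fst Z) (fst W)"
  shows "f \<in> radical (karoubi C) Z W"
  unfolding radical_def
proof (intro CollectI conjI ballI f)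
  let ?X = "fst Z" and ?Y = "fst W" and ?e = "snd Z"
  have X: "?X \<in> Ob C" "?e \<in> Mor C ?X ?X" "Cmp C ?X ?X ?X ?e ?e = ?e" "?Y \<in> Ob C"
    using Z by (auto simp: karoubi_Ob idempotent_in_def)
  have fm: "f \<in> Mor C ?X ?Y" "Cmp C ?X ?X ?Y f ?e = f" using f(1) by (auto simp: karoubi_Mor)
  fix g assume "g \<in> Mor (karoubi C) W Z"
  then have g: "g \<in> Mor C ?Y ?X" "Cmp C ?Y ?X ?X ?e g = g" by (auto simp: karoubi_Mor)
  obtain h where h: "h \<in> Mor C ?X ?X" "h = Idn C ?X \<oplus>\<^bsub>Hom C ?X ?X\<^esub> Cmp C ?X ?X ?X h (Cmp C ?X ?Y ?X g f)"
    using radicalE[OF f(2) g(1)] by blast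
  define k where "k = Cmp C ?X ?X ?X ?e (Cmp C ?X ?X ?X h ?e)"
  have "k = Cmp C ?X ?X ?X ?e (Cmp C ?X ?X ?X (Idn C ?X \<oplus>\<^bsub>Hom C ?X ?X\<^esub> Cmp C ?X ?X ?X h (Cmp C ?X ?Y ?X g f)) ?e)"
    unfolding k_def using h(2) by simp
  also have "\<dots> = ?e \<oplus>\<^bsub>Hom C ?X ?X\<^esub> Cmp C ?X ?X ?X ?e (Cmp C ?X ?X ?X h (Cmp C ?X ?Y ?X g f))"
    using X fm g(1) h(1) by (simp add: cmp_add_left cmp_add_right cmp_assoc)
  also have "Cmp C ?X ?X ?X ?e (Cmp C ?X ?X ?X h (Cmp C ?X ?Y ?X g f)) = Cmp C ?X ?X ?X k (Cmp C ?X ?Y ?X g f)"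
  proof -
    have "Cmp C ?X ?X ?X k (Cmp C ?X ?Y ?X g f) = Cmp C ?X ?X ?X ?e (Cmp C ?X ?X ?X h (Cmp C ?X ?Y ?X (Cmp C
        ?Y ?X ?X ?e g) f))"
      unfolding k_def using X fm(1) g(1) h(1) by (simp add: cmp_assoc)
    then show ?thesis using g(2) by simp
  qed
  finally have "k = ?e \<oplus>\<^bsub>Hom C ?X ?X\<^esub> Cmp C ?X ?X ?X k (Cmp C ?X ?Y ?X g f)" .
  moreover have "k \<in> Mor (karoubi C) Z Z"
  proof -
    have "Cmp C ?X ?X ?X k ?e = Cmp C ?X ?X ?X ?e (Cmp C ?X ?X ?X h (Cmp C ?X ?X ?X ?e ?e))"
      "Cmp C ?X ?X ?X ?e k = Cmp C ?X ?X ?X (Cmp C ?X ?X ?X ?e ?e) (Cmp C ?X ?X ?X h ?e)"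
      unfolding k_def using X(1,2) h(1) by (simp_all add: cmp_assoc)
    then show ?thesis using X h(1) by (simp add: karoubi_Mor k_def)
  qed
  ultimately show "\<exists>h\<in>Mor (karoubi C) Z Z. h = Idn (karoubi C) Z \<oplus>\<^bsub>Hom (karoubi C) Z Z\<^esub>
     Cmp (karoubi C) Z Z Z h (Cmp (karoubi C) Z W Z g f)"
    by auto
qed

end

lemma (in linear_functor) radical_fully_faithful:
  assumes ff: "fully_faithful C D F" and X: "X \<in> Ob C" "Y \<in> Ob C" and f: "f \<in> radical C X Y"
  shows "FMor F X Y f \<in> radical D (FOb F X) (FOb F Y)"
  unfolding radical_def
proof (intro CollectI conjI ballI)
  note fm = radical_mor[OF f]
  show "FMor F X Y f \<in> Mor D (FOb F X) (FOb F Y)" using X fm by simp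
  fix g assume "g \<in> Mor D (FOb F Y) (FOb F X)"
  then obtain g0 where g0: "g0 \<in> Mor C Y X" "FMor F Y X g0 = g"
    using fully_faithful_surj[OF ff X(2,1)] by blast
  obtain h where h: "h \<in> Mor C X X" "h = Idn C X \<oplus>\<^bsub>Hom C X X\<^esub> Cmp C X X X h (Cmp C X Y X g0 f)"
    using radicalE[OF f g0(1)] by blast
  have "FMor F X X h = FMor F X X (Idn C X \<oplus>\<^bsub>Hom C X X\<^esub> Cmp C X X X h (Cmp C X Y X g0 f))" using h(2) by simp
  also have "\<dots> = Idn D (FOb F X) \<oplus>\<^bsub>Hom D (FOb F X) (FOb F X)\<^esub> Cmp D (FOb F X) (FOb F X) (FOb F X) (FMor F X X h)
     (Cmp D (FOb F X) (FOb F Y) (FOb F X) g (FMor F X Y f))"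
    using X fm g0 h(1) by (simp add: fmor_add fmor_idn fmor_cmp)
  finally show "\<exists>h\<in>Mor D (FOb F X) (FOb F X). h = Idn D (FOb F X) \<oplus>\<^bsub>Hom D (FOb F X) (FOb F X)\<^esub>
     Cmp D (FOb F X) (FOb F X) (FOb F X) h (Cmp D (FOb F X) (FOb F Y) (FOb F X) g (FMor F X Y f))"
    using X h(1) by auto
qed

section \<open>Indecomposability above the stabilizer\<close>

text \<open>The endomorphisms of \<open>I Z\<close> are those induced from \<open>Z\<close>, up to morphisms that \<open>T\<close> makes radical.\<close>

definition full_modulo_radical where
  "full_modulo_radical B C D I T Z \<longleftrightarrow> (\<forall>\<phi> \<in> Mor C (FOb I Z) (FOb I Z).
     \<exists>\<phi>0 \<in> Mor B Z Z. \<exists>n \<in> Mor C (FOb I Z) (FOb I Z).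
       \<phi> = FMor I Z Z \<phi>0 \<oplus>\<^bsub>Hom C (FOb I Z) (FOb I Z)\<^esub> n \<and>
       FMor T (FOb I Z) (FOb I Z) n \<in> radical D (FOb T (FOb I Z)) (FOb T (FOb I Z)))"

text \<open>An endomorphism \<open>\<phi>\<close> of \<open>I Z\<close> is recovered from the endomorphism \<open>i \<phi> p\<close> of \<open>I M\<close>, and the radical is an
  ideal.\<close>

lemma full_modulo_radical_retract:
  assumes I: "linear_functor R B C I" and T: "linear_functor R C D T" and Z: "Z \<in> Ob B" "M \<in> Ob B"
    and i: "i \<in> Mor B Z M" and p: "p \<in> Mor B M Z" and pi: "Cmp B Z M Z p i = Idn B Z"
    and M: "full_modulo_radical B C D I T M"
  shows "full_modulo_radical B C D I T Z"
  unfolding full_modulo_radical_def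
proof
  interpret I: linear_functor R B C I by fact
  interpret T: linear_functor R C D T by fact
  let ?Z = "FOb I Z" and ?M = "FOb I M" and ?i = "FMor I Z M i" and ?p = "FMor I M Z p"
  have pi': "Cmp C ?Z ?M ?Z ?p ?i = Idn C ?Z"
    using Z i p pi by (simp add: I.fmor_idn flip: I.fmor_cmp)
  fix \<phi> assume \<phi>: "\<phi> \<in> Mor C ?Z ?Z"
  define f where "f = Cmp C ?M ?Z ?M ?i (Cmp C ?M ?Z ?Z \<phi> ?p)"
  have f: "f \<in> Mor C ?M ?M" unfolding f_def using Z i p \<phi> by simp
  obtain f0 n where f0: "f0 \<in> Mor B M M" and n: "n \<in> Mor C ?M ?M" and dec: "f = FMor I M M f0 \<oplus>\<^bsub>Hom C ?M ?M\<^esub> n"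
    and nr: "FMor T ?M ?M n \<in> radical D (FOb T ?M) (FOb T ?M)"
    using M f unfolding full_modulo_radical_def by blast
  define n' where "n' = Cmp C ?Z ?M ?Z ?p (Cmp C ?Z ?M ?M n ?i)"
  have n': "n' \<in> Mor C ?Z ?Z" unfolding n'_def using Z i p n by simp
  have "\<phi> = Cmp C ?Z ?Z ?Z (Cmp C ?Z ?M ?Z ?p ?i) (Cmp C ?Z ?Z ?Z \<phi> (Cmp C ?Z ?M ?Z ?p ?i))"
    using Z \<phi> by (simp add: pi')
  also have "\<dots> = Cmp C ?Z ?M ?Z ?p (Cmp C ?Z ?M ?M f ?i)"
    unfolding f_def using Z \<phi> i p by (simp add: I.D.cmp_assoc)
  also have "\<dots> = FMor I Z Z (Cmp B Z M Z p (Cmp B Z M M f0 i)) \<oplus>\<^bsub>Hom C ?Z ?Z\<^esub> n'"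
    unfolding dec n'_def using Z i p n f0 by (simp add: I.D.cmp_add_left I.D.cmp_add_right I.fmor_cmp)
  finally have "\<phi> = FMor I Z Z (Cmp B Z M Z p (Cmp B Z M M f0 i)) \<oplus>\<^bsub>Hom C ?Z ?Z\<^esub> n'" .
  moreover have "FMor T ?Z ?Z n' \<in> radical D (FOb T ?Z) (FOb T ?Z)"
    unfolding n'_def using Z i p n nr
    by (simp add: T.fmor_cmp T.D.radical_cmp_left T.D.radical_cmp_right)
  moreover have "Cmp B Z M Z p (Cmp B Z M M f0 i) \<in> Mor B Z Z" using Z i p f0 by simp
  ultimately show "\<exists>\<phi>0\<in>Mor B Z Z. \<exists>n\<in>Mor C ?Z ?Z. \<phi> = FMor I Z Z \<phi>0 \<oplus>\<^bsub>Hom C ?Z ?Z\<^esub> n \<and>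
      FMor T ?Z ?Z n \<in> radical D (FOb T ?Z) (FOb T ?Z)"
    using n' by blast
qed

text \<open>If \<open>End Z\<close> is local and \<open>End (I Z)\<close> is the sum of its image and of an ideal that contains no
  nonzero idempotent, then \<open>End (I Z)\<close> is local too: modulo the ideal an idempotent \<open>\<phi>\<close> agrees
  with some \<open>I \<phi>0\<close>, and \<open>\<phi>\<close> or \<open>1 - \<phi>\<close> lies in the ideal according to whether \<open>\<phi>0\<close> is nilpotent or
  invertible. The ideal is the preimage under a faithful functor \<open>T\<close> of the radical.\<close>

lemma trivial_idempotents_modulo_radical:
  assumes I: "linear_functor R B C I" and T: "linear_functor R C D T" and Z: "Z \<in> Ob B"
    and fit: "\<And>f. f \<in> Mor B Z Z \<Longrightarrow> nilpotent_or_invertible B Z f"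
    and faithful: "\<And>f. \<lbrakk>f \<in> Mor C (FOb I Z) (FOb I Z);
       FMor T (FOb I Z) (FOb I Z) f = \<zero>\<^bsub>Hom D (FOb T (FOb I Z)) (FOb T (FOb I Z))\<^esub>\<rbrakk> \<Longrightarrow> f = \<zero>\<^bsub>Hom C (FOb I Z)
           (FOb I Z)\<^esub>"
    and split: "full_modulo_radical B C D I T Z"
  shows "trivial_idempotents C (FOb I Z)"
  unfolding trivial_idempotents_def
proof (intro allI impI)
  interpret I: linear_functor R B C I by fact
  interpret T: linear_functor R C D T by fact
  interpret ring "end_ring B Z" by (rule I.C.end_ring[OF Z])
  let ?X = "FOb I Z"
  have X: "?X \<in> Ob C" using Z by simp
  define N where "N = {n \<in> Mor C ?X ?X. FMor T ?X ?X n \<in> radical D (FOb T ?X) (FOb T ?X)}"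
  have N_mor: "n \<in> Mor C ?X ?X" if "n \<in> N" for n using that by (simp add: N_def)
  have N_left: "Cmp C ?X ?X ?X a n \<in> N" and N_right: "Cmp C ?X ?X ?X n a \<in> N" if "n \<in> N" "a \<in> Mor C ?X ?X" for n a
    using that X T.D.radical_cmp_left[of "FOb T ?X" "FOb T ?X" "FOb T ?X" "FMor T ?X ?X n" "FMor T ?X ?X a"]
      T.D.radical_cmp_right[of "FOb T ?X" "FOb T ?X" "FOb T ?X" "FMor T ?X ?X n" "FMor T ?X ?X a"]
    by (auto simp: N_def T.fmor_cmp)
  have N_add: "n \<oplus>\<^bsub>Hom C ?X ?X\<^esub> n' \<in> N" if "n \<in> N" "n' \<in> N" for n n'
    using that X T.D.radical_add by (auto simp: N_def T.fmor_add)
  have N_idem: "n = \<zero>\<^bsub>Hom C ?X ?X\<^esub>" if "n \<in> N" "Cmp C ?X ?X ?X n n = n" for n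
  proof (rule faithful[OF N_mor[OF that(1)]])
    show "FMor T ?X ?X n = \<zero>\<^bsub>Hom D (FOb T ?X) (FOb T ?X)\<^esub>"
      by (rule T.D.radical_idempotent_zero)
         (use that X in \<open>simp_all add: N_def flip: T.fmor_cmp\<close>)
  qed
  fix \<phi> assume idem: "idempotent_in C ?X \<phi>"
  then have \<phi>: "\<phi> \<in> Mor C ?X ?X" "Cmp C ?X ?X ?X \<phi> \<phi> = \<phi>" by (auto simp: idempotent_in_def)
  obtain \<phi>0 n where \<phi>0: "\<phi>0 \<in> Mor B Z Z" and n: "n \<in> N" and dec: "\<phi> = FMor I Z Z \<phi>0 \<oplus>\<^bsub>Hom C ?X ?X\<^esub> n"
    using split \<phi>(1) unfolding N_def full_modulo_radical_def by blast
  note nm = N_mor[OF n]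
  from fit[OF \<phi>0] consider k :: nat where "\<phi>0 [^]\<^bsub>end_ring B Z\<^esub> k = \<zero>\<^bsub>Hom B Z Z\<^esub>"
    | \<psi> where "\<psi> \<in> Mor B Z Z" "Cmp B Z Z Z \<psi> \<phi>0 = Idn B Z"
    unfolding nilpotent_or_invertible_def by blast
  then show "\<phi> = \<zero>\<^bsub>Hom C ?X ?X\<^esub> \<or> \<phi> = Idn C ?X"
  proof cases
    case 1
    have pow: "\<phi>0 [^]\<^bsub>end_ring B Z\<^esub> j \<in> Mor B Z Z" for j :: nat
      using nat_pow_closed[of \<phi>0 j] \<phi>0 by simp
    have "\<exists>n' \<in> N. \<phi> = FMor I Z Z (\<phi>0 [^]\<^bsub>end_ring B Z\<^esub> Suc j) \<oplus>\<^bsub>Hom C ?X ?X\<^esub> n'" for j :: nat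
    proof (induction j)
      case 0
      then show ?case using dec n Z \<phi>0 by auto
    next
      case (Suc j)
      then obtain n' where n': "n' \<in> N" "\<phi> = FMor I Z Z (\<phi>0 [^]\<^bsub>end_ring B Z\<^esub> Suc j) \<oplus>\<^bsub>Hom C ?X ?X\<^esub> n'" by blast
      define a where "a = \<phi>0 [^]\<^bsub>end_ring B Z\<^esub> Suc j"
      have a: "a \<in> Mor B Z Z" unfolding a_def by (rule pow)
      have "\<phi> = Cmp C ?X ?X ?X (FMor I Z Z a \<oplus>\<^bsub>Hom C ?X ?X\<^esub> n') \<phi>"
        using \<phi>(2) n'(2) unfolding a_def by simp
      also have "\<dots> = Cmp C ?X ?X ?X (FMor I Z Z a) (FMor I Z Z \<phi>0 \<oplus>\<^bsub>Hom C ?X ?X\<^esub> n) \<oplus>\<^bsub>Hom C ?X ?X\<^esub> Cmp C ?X ?X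
          ?X n' \<phi>"
        using X Z a \<phi>(1) N_mor[OF n'(1)] by (simp add: I.D.cmp_add_left flip: dec)
      also have "\<dots> = FMor I Z Z (Cmp B Z Z Z a \<phi>0) \<oplus>\<^bsub>Hom C ?X ?X\<^esub>
          (Cmp C ?X ?X ?X (FMor I Z Z a) n \<oplus>\<^bsub>Hom C ?X ?X\<^esub> Cmp C ?X ?X ?X n' \<phi>)"
        using X Z a \<phi>(1) \<phi>0 nm N_mor[OF n'(1)] by (simp add: I.D.cmp_add_right I.D.hom_add_assoc I.fmor_cmp)
      finally show ?case
        using N_add[OF N_left[OF n] N_right[OF n'(1) \<phi>(1)], of "FMor I Z Z a"] Z a unfolding a_def by auto
    qed
    from this[of k] obtain n' where n': "n' \<in> N" "\<phi> = FMor I Z Z (\<phi>0 [^]\<^bsub>end_ring B Z\<^esub> Suc k) \<oplus>\<^bsub>Hom C ?X ?X\<^esub>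
        n'" by blast
    then have "\<phi> = n'" using 1 Z X \<phi>0 N_mor[OF n'(1)] by (simp add: I.fmor_zero)
    then show ?thesis using N_idem n'(1) \<phi>(2) by blast
  next
    case 2
    obtain \<phi>' where \<phi>': "idempotent_in C ?X \<phi>'" "\<phi> \<oplus>\<^bsub>Hom C ?X ?X\<^esub> \<phi>' = Idn C ?X" "Cmp C ?X ?X ?X \<phi> \<phi>' = \<zero>\<^bsub>Hom
        C ?X ?X\<^esub>"
      using I.D.complement_idempotent[OF X idem] by blast
    then have \<phi>'m: "\<phi>' \<in> Mor C ?X ?X" "Cmp C ?X ?X ?X \<phi>' \<phi>' = \<phi>'" by (auto simp: idempotent_in_def)
    have sum: "Cmp C ?X ?X ?X (FMor I Z Z \<phi>0) \<phi>' \<oplus>\<^bsub>Hom C ?X ?X\<^esub> Cmp C ?X ?X ?X n \<phi>' = \<zero>\<^bsub>Hom C ?X ?X\<^esub>"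
      using \<phi>'(3) dec X Z \<phi>0 nm \<phi>'m(1) by (simp add: I.D.cmp_add_left)
    have "Cmp C ?X ?X ?X (FMor I Z Z \<phi>0) \<phi>' = \<ominus>\<^bsub>Hom C ?X ?X\<^esub> Cmp C ?X ?X ?X n \<phi>'"
      using abelian_group.minus_equality[OF I.D.hom_abelian_group[OF X X] sum] X Z \<phi>0 nm \<phi>'m(1) by simp
    then have e: "Cmp C ?X ?X ?X (FMor I Z Z \<phi>0) \<phi>' = Cmp C ?X ?X ?X n (\<ominus>\<^bsub>Hom C ?X ?X\<^esub> \<phi>')"
      using X nm \<phi>'m(1) by (simp add: I.D.cmp_neg_right)
    have "\<phi>' = Cmp C ?X ?X ?X (FMor I Z Z (Cmp B Z Z Z \<psi> \<phi>0)) \<phi>'"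
      using 2 X Z \<phi>'m(1) by (simp add: I.fmor_idn)
    also have "\<dots> = Cmp C ?X ?X ?X (FMor I Z Z \<psi>) (Cmp C ?X ?X ?X n (\<ominus>\<^bsub>Hom C ?X ?X\<^esub> \<phi>'))"
      using 2(1) X Z \<phi>'m(1) \<phi>0 by (simp add: I.fmor_cmp I.D.cmp_assoc flip: e)
    finally have "\<phi>' \<in> N"
      using N_left[OF N_right[OF n, of "\<ominus>\<^bsub>Hom C ?X ?X\<^esub> \<phi>'"], of "FMor I Z Z \<psi>"] X Z \<phi>'m(1) 2(1) by simp
    then have "\<phi>' = \<zero>\<^bsub>Hom C ?X ?X\<^esub>" using N_idem \<phi>'m(2) by blast
    then show ?thesis using \<phi>'(2) X \<phi>(1) by simp
  qed
qed

context normal_subgroup_group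
begin

lemma stabilizer_subgroup:
  assumes M: "M \<in> Ob H"
  shows "subgroup (stabilizer_index H E (carrier \<Gamma>) M) \<Gamma>"
proof (rule subgroupI)
  have mm: "isomorphic_in H (FOb (E (g \<otimes> h)) M) (FOb (E g) (FOb (E h) M))" if "g \<in> carrier \<Gamma>" "h \<in> carrier \<Gamma>" for g h
    by (rule S.C.isomorphic_in_sym) (use mc_iso[OF that M] in \<open>auto simp: isomorphic_in_def\<close>)
  have Eg: "isomorphic_in H (FOb (E g) (FOb (E h) M)) (FOb (E g) M)"
    if "g \<in> carrier \<Gamma>" "h \<in> carrier \<Gamma>" "isomorphic_in H (FOb (E h) M) M" for g h
    using linear_functor.fob_isomorphic_in[OF E_functor[OF that(1)] _ M that(3)] that(2) M by simp
  have one: "isomorphic_in H (FOb (E \<one>) M) M"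
    by (rule S.C.isomorphic_in_sym) (use u_iso[OF M] in \<open>auto simp: isomorphic_in_def\<close>)
  then show "stabilizer_index H E (carrier \<Gamma>) M \<noteq> {}" by (auto simp: stabilizer_index_def)
  show "g \<otimes> h \<in> stabilizer_index H E (carrier \<Gamma>) M"
    if "g \<in> stabilizer_index H E (carrier \<Gamma>) M" "h \<in> stabilizer_index H E (carrier \<Gamma>) M" for g h
  proof -
    have gh: "g \<in> carrier \<Gamma>" "h \<in> carrier \<Gamma>" "isomorphic_in H (FOb (E g) M) M" "isomorphic_in H (FOb (E h) M) M"
      using that by (auto simp: stabilizer_index_def)
    have gM: "isomorphic_in H (FOb (E (g \<otimes> h)) M) (FOb (E g) M)"
      by (rule S.C.isomorphic_in_trans[OF _ _ _ mm[OF gh(1,2)] Eg[OF gh(1,2,4)]]) (use gh M in simp_all)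
    have "isomorphic_in H (FOb (E (g \<otimes> h)) M) M"
      by (rule S.C.isomorphic_in_trans[OF _ _ _ gM gh(3)]) (use gh M in simp_all)
    then show ?thesis using gh by (simp add: stabilizer_index_def)
  qed
  show "inv g \<in> stabilizer_index H E (carrier \<Gamma>) M" if "g \<in> stabilizer_index H E (carrier \<Gamma>) M" for g
  proof -
    have g: "g \<in> carrier \<Gamma>" "isomorphic_in H (FOb (E g) M) M"
      using that by (auto simp: stabilizer_index_def)
    have i1: "isomorphic_in H (FOb (E (inv g)) M) (FOb (E (inv g)) (FOb (E g) M))"
      by (rule S.C.isomorphic_in_sym[OF Eg]) (use g in simp_all)
    have i2: "isomorphic_in H (FOb (E (inv g)) (FOb (E g) M)) (FOb (E \<one>) M)"
      using S.C.isomorphic_in_sym[OF mm[of "inv g" g]] g by simp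
    have i3: "isomorphic_in H (FOb (E (inv g)) M) (FOb (E \<one>) M)"
      by (rule S.C.isomorphic_in_trans[OF _ _ _ i1 i2]) (use g M in simp_all)
    have "isomorphic_in H (FOb (E (inv g)) M) M"
      by (rule S.C.isomorphic_in_trans[OF _ _ _ i3 one]) (use g M in simp_all)
    then show ?thesis using g by (simp add: stabilizer_index_def)
  qed
qed (auto simp: stabilizer_index_def)

abbreviation "T\<^sub>\<Gamma> \<equiv> orbit_right H E m A inc prj \<Gamma>"

lemma full_orbit_right_adjoint: "adjoint_pair R H Orb\<^sub>\<Gamma> (Ind\<^sub>\<Gamma>) T\<^sub>\<Gamma>"
  using orbit_right_adjoint[OF subgroup_self direct_sum] by simp

text \<open>The right adjoint sends \<open>n\<close> to the matrix with entries \<open>m g h \<circ> E g (n h)\<close>, and the self-equivalence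
  \<open>E g\<close> preserves the radical.\<close>

lemma full_orbit_right_radical:
  assumes X: "X \<in> Ob H" "Y \<in> Ob H" and n: "\<And>h. h \<in> carrier \<Gamma> \<Longrightarrow> n h \<in> radical H X (FOb (E h) Y)"
  shows "FMor T\<^sub>\<Gamma> X Y n \<in> radical H (A X) (A Y)"
proof -
  have "Cmp H (A X) (FOb (E (g \<otimes> h)) Y) (A Y) (inc (g \<otimes> h) Y)
          (Cmp H (A X) (FOb (E g) (FOb (E h) Y)) (FOb (E (g \<otimes> h)) Y) (m g h Y)
             (Cmp H (A X) (FOb (E g) X) (FOb (E g) (FOb (E h) Y))
                (FMor (E g) X (FOb (E h) Y) (n h)) (prj g X))) \<in> radical H (A X) (A Y)"
    if gh: "g \<in> carrier \<Gamma>" "h \<in> carrier \<Gamma>" for g h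
  proof -
    have "FMor (E g) X (FOb (E h) Y) (n h) \<in> radical H (FOb (E g) X) (FOb (E g) (FOb (E h) Y))"
      by (rule linear_functor.radical_fully_faithful[OF E_functor E_fully_faithful]) (use gh X n in simp_all)
    then show ?thesis
      using gh X by (intro S.C.radical_cmp_left S.C.radical_cmp_right) simp_all
  qed
  then show ?thesis
    unfolding orbit_right_def cfunctor.simps
    by (intro S.C.radical_finsum) (use X finite_group in auto)
qed

text \<open>The endomorphisms of an object over \<open>X\<close> embed into \<open>H(X, A X)\<close>, which has finite length. This makes
  Fitting's lemma available in the Karoubi envelope of the orbit category.\<close>

lemma karoubi_orbit_endomorphisms_descending:
  assumes K: "subgroup K \<Gamma>" and Z: "Z \<in> Ob (karoubi (Orb K))"
    and fl: "\<And>X Y. \<lbrakk>X \<in> Ob H; Y \<in> Ob H\<rbrakk> \<Longrightarrow> finite_length R (Hom H X Y)"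
  shows "descending_chain_condition R (Hom (karoubi (Orb K)) Z Z)"
proof -
  interpret O: linear_category R "Orb K" by (rule orbit_linear_category[OF K])
  interpret KO: linear_category R "karoubi (Orb K)" by (rule O.karoubi_linear_category)
  interpret J: linear_functor R "Orb K" Kl "J K" by (rule J_linear_functor[OF K])
  let ?X = "fst Z"
  have X: "?X \<in> Ob H" "?X \<in> Ob (Orb K)" using Z by (simp_all add: karoubi_Ob)
  have mor: "f \<in> Mor (Orb K) ?X ?X" if "f \<in> Mor (karoubi (Orb K)) Z Z" for f
    using that unfolding karoubi_Mor by blast
  show ?thesis
  proof (rule descending_chain_condition_embedded[where f = "FMor (J K) ?X ?X"])
    show "module R (Hom (karoubi (Orb K)) Z Z)" using KO.hom_module[OF Z Z] .
    show "module R (Hom H ?X (A ?X))" using S.C.hom_module X by simp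
    show "descending_chain_condition R (Hom H ?X (A ?X))"
      by (rule finite_length_descending_chain_condition) (use X S.C.hom_module fl in simp_all)
    show "inj_on (FMor (J K) ?X ?X) (Mor (karoubi (Orb K)) Z Z)"
      using J_inj[OF subgroup.subset[OF K] X(1) X(1) mor mor] by (auto intro: inj_onI)
  next
    fix f assume f: "f \<in> Mor (karoubi (Orb K)) Z Z"
    show "FMor (J K) ?X ?X f \<in> Mor H ?X (A ?X)"
      using J.fmor_closed[OF X(2) X(2) mor[OF f]] by simp
  next
    fix f g assume f: "f \<in> Mor (karoubi (Orb K)) Z Z" "g \<in> Mor (karoubi (Orb K)) Z Z"
    show "FMor (J K) ?X ?X (f \<oplus>\<^bsub>Hom (karoubi (Orb K)) Z Z\<^esub> g) =
       FMor (J K) ?X ?X f \<oplus>\<^bsub>Hom H ?X (A ?X)\<^esub> FMor (J K) ?X ?X g"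
      using J.fmor_add[OF X(2) X(2) mor[OF f(1)] mor[OF f(2)]] by simp
  next
    fix r f assume r: "r \<in> carrier R" and f: "f \<in> Mor (karoubi (Orb K)) Z Z"
    show "FMor (J K) ?X ?X (r \<odot>\<^bsub>Hom (karoubi (Orb K)) Z Z\<^esub> f) = r \<odot>\<^bsub>Hom H ?X (A ?X)\<^esub> FMor (J K) ?X ?X f"
      using J.fmor_smult[OF X(2) X(2) r mor[OF f]] by simp
  qed
qed

text \<open>An endomorphism of \<open>M\<close> in the orbit category of \<open>\<Gamma>\<close> is split into its components inside and outside
  \<open>K\<close>; this passes to the direct factor \<open>Z\<close>.\<close>

lemma orbit_incl_trivial_idempotents:
  assumes ic: "idempotent_complete H"
    and fl: "\<And>X Y. \<lbrakk>X \<in> Ob H; Y \<in> Ob H\<rbrakk> \<Longrightarrow> finite_length R (Hom H X Y)"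
    and M: "indecomposable H M" and K_def: "K = stabilizer_index H E (carrier \<Gamma>) M"
    and factor: "direct_factor (karoubi (Orb K)) Z (FOb (kar_embed (Orb K)) M)"
    and Z: "indecomposable (karoubi (Orb K)) Z"
  shows "trivial_idempotents (karoubi Orb\<^sub>\<Gamma>) (FOb (kar_extend (Incl K)) Z)"
proof -
  note Mt = S.C.indecomposable_trivial_idempotents[OF ic M]
  have K: "subgroup K \<Gamma>" unfolding K_def by (rule stabilizer_subgroup[OF Mt(1)])
  note KG = subgroup.subset[OF K]
  let ?O = "Orb\<^sub>\<Gamma>" and ?incl = "Incl K"
  interpret O: linear_category R "Orb K" by (rule orbit_linear_category[OF K])
  interpret incl: linear_functor R "Orb K" ?O ?incl using orbit_incl_linear_functor[OF K] by simp
  obtain \<epsilon>' where "universal_arrows R H ?O (Ind\<^sub>\<Gamma>) T\<^sub>\<Gamma> \<epsilon>'"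
    using full_orbit_right_adjoint unfolding adjoint_pair_iff by blast
  then interpret adj: universal_arrows R H ?O "Ind\<^sub>\<Gamma>" T\<^sub>\<Gamma> \<epsilon>' .
  interpret T\<^sub>\<Gamma>: linear_functor R ?O H T\<^sub>\<Gamma> by (rule adj.right_linear_functor)
  interpret I: linear_functor R "karoubi (Orb K)" "karoubi ?O" "kar_extend ?incl" by (rule
      incl.kar_extend_linear_functor)
  interpret T: linear_functor R "karoubi ?O" "karoubi H" "kar_extend T\<^sub>\<Gamma>" by (rule T\<^sub>\<Gamma>.kar_extend_linear_functor)
  note Zt = I.C.indecomposable_trivial_idempotents[OF O.karoubi_idempotent_complete Z]
  let ?Z = "FOb (kar_extend ?incl) Z" and ?M = "FOb (kar_embed (Orb K)) M"
  let ?IM = "FOb (kar_extend ?incl) ?M"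
  obtain Y js ps where ds: "is_direct_sum (karoubi (Orb K)) (UNIV :: bool set) Y ?M js ps" and Y: "Y True = Z"
    using factor unfolding direct_factor_def by blast
  define i p where "i = js True" and "p = ps True"
  have M': "?M \<in> Ob (karoubi (Orb K))" and i: "i \<in> Mor (karoubi (Orb K)) Z ?M" and p: "p \<in> Mor (karoubi (Orb K)) ?M Z"
    and pi: "Cmp (karoubi (Orb K)) Z ?M Z p i = Idn (karoubi (Orb K)) Z"
    using is_direct_sumD(2)[OF ds] is_direct_sumD(4-6)[OF ds UNIV_I, of True] unfolding Y i_def p_def .
  have idM: "FMor ?incl M M (Idn (Orb K) M) = Idn ?O M"
    using incl.fmor_idn[of M] Mt(1) by (simp del: orbit_cat_simps(6) orbit_incl_simps(2))
  have IM: "?IM = (M, Idn ?O M)"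
    by (simp only: kar_embed_simps kar_extend_simps orbit_incl_simps(1) fst_conv snd_conv idM)
  \<comment> \<open>Outside the stabilizer all components of an endomorphism of \<open>M\<close> are radical.\<close>
  have rad: "f \<in> radical H M (FOb (E g) M)" if g: "g \<in> carrier \<Gamma>" "g \<notin> K" and f: "f \<in> Mor H M (FOb (E g) M)" for g f
  proof (rule S.C.radical_of_not_isomorphic[OF Mt(1) _ Mt(2) _ _ _ f])
    show "nilpotent_or_invertible H M f" if "f \<in> Mor H M M" for f
      by (rule S.C.fitting[OF Mt(1) finite_length_descending_chain_condition Mt(3) that])
         (use Mt(1) S.C.hom_module fl in simp_all)
    show "trivial_idempotents H (FOb (E g) M)"
      by (rule linear_functor.fully_faithful_trivial_idempotents[OF E_functor E_fully_faithful Mt(1) Mt(3)]) fact+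
    show "\<not> isomorphic_in H M (FOb (E g) M)"
      using g S.C.isomorphic_in_sym unfolding K_def stabilizer_index_def by blast
  qed (use g Mt(1) in simp)
  have "full_modulo_radical (karoubi (Orb K)) (karoubi ?O) (karoubi H) (kar_extend ?incl) (kar_extend T\<^sub>\<Gamma>) ?M"
    unfolding full_modulo_radical_def
  proof
    fix f assume fIM: "f \<in> Mor (karoubi ?O) ?IM ?IM"
    have f: "f \<in> Mor ?O M M" using fIM unfolding IM karoubi_Mor by simp
    then have fg: "f g \<in> Mor H M (FOb (E g) M)" if "g \<in> carrier \<Gamma>" for g using that by auto
    define f0 where "f0 = restrict f K"
    define n where "n = (\<lambda>g\<in>carrier \<Gamma>. if g \<in> K then \<zero>\<^bsub>Hom H M (FOb (E g) M)\<^esub> else f g)"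
    have f0: "f0 \<in> Mor (Orb K) M M" unfolding f0_def using fg KG by auto
    have n: "n \<in> Mor ?O M M" unfolding n_def using fg Mt(1) by auto
    have "f = FMor ?incl M M f0 \<oplus>\<^bsub>Hom ?O M M\<^esub> n"
    proof (rule PiE_ext)
      show "f \<in> (\<Pi>\<^sub>E g\<in>carrier \<Gamma>. Mor H M (FOb (E g) M))" using f by simp
      have "FMor ?incl M M f0 \<in> Mor ?O M M" using incl.fmor_closed[of M M f0] f0 Mt(1) by simp
      then show "FMor ?incl M M f0 \<oplus>\<^bsub>Hom ?O M M\<^esub> n \<in> (\<Pi>\<^sub>E g\<in>carrier \<Gamma>. Mor H M (FOb (E g) M))"
        using incl.D.hom_add[of M M "FMor ?incl M M f0" n] n Mt(1) by simp
      fix g assume g: "g \<in> carrier \<Gamma>"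
      show "f g = (FMor ?incl M M f0 \<oplus>\<^bsub>Hom ?O M M\<^esub> n) g"
        using g fg[OF g] Mt(1) by (simp add: f0_def n_def)
    qed
    moreover have "FMor T\<^sub>\<Gamma> M M n \<in> radical H (A M) (A M)"
      by (rule full_orbit_right_radical) (use Mt(1) rad fg S.C.radical_zero in \<open>auto simp: n_def\<close>)
    moreover have nK: "n \<in> Mor (karoubi ?O) ?IM ?IM"
      unfolding IM karoubi_Mor using n Mt(1) incl.D.cmp_idn_left[of M M n] incl.D.cmp_idn_right[of M M n] by simp
    moreover have "f0 \<in> Mor (karoubi (Orb K)) ?M ?M"
      unfolding karoubi_Mor using f0 Mt(1) O.cmp_idn_left[of M M f0] O.cmp_idn_right[of M M f0] by simp
    moreover have IMob: "?IM \<in> Ob (karoubi ?O)" using I.fob_closed[OF M'] .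
    ultimately show "\<exists>f0 \<in> Mor (karoubi (Orb K)) ?M ?M. \<exists>n \<in> Mor (karoubi ?O) ?IM ?IM.
      f = FMor (kar_extend ?incl) ?M ?M f0 \<oplus>\<^bsub>Hom (karoubi ?O) ?IM ?IM\<^esub> n \<and>
      FMor (kar_extend T\<^sub>\<Gamma>) ?IM ?IM n \<in> radical (karoubi H) (FOb (kar_extend T\<^sub>\<Gamma>) ?IM) (FOb (kar_extend T\<^sub>\<Gamma>) ?IM)"
      using S.C.radical_karoubi[OF T.fob_closed[OF IMob] T.fob_closed[OF IMob] T.fmor_closed[OF IMob IMob nK]]
      by (intro bexI[of _ f0] bexI[of _ n]) (simp_all add: orbit_right_def)
  qed
  from full_modulo_radical_retract[OF I.linear_functor_axioms T.linear_functor_axioms Zt(1) M' i p pi this]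
  have full: "full_modulo_radical (karoubi (Orb K)) (karoubi ?O) (karoubi H) (kar_extend ?incl) (kar_extend T\<^sub>\<Gamma>) Z" .
  show ?thesis
  proof (rule trivial_idempotents_modulo_radical[OF I.linear_functor_axioms T.linear_functor_axioms Zt(1)])
    fix f assume f: "f \<in> Mor (karoubi (Orb K)) Z Z"
    have "descending_chain_condition R (Hom (karoubi (Orb K)) Z Z)"
      by (rule karoubi_orbit_endomorphisms_descending[OF K Zt(1)]) (rule fl)
    from I.C.fitting[OF Zt(1) this Zt(3) f] show "nilpotent_or_invertible (karoubi (Orb K)) Z f" .
  next
    fix f assume f: "f \<in> Mor (karoubi ?O) ?Z ?Z" and z: "FMor (kar_extend T\<^sub>\<Gamma>) ?Z ?Z f =
      \<zero>\<^bsub>Hom (karoubi H) (FOb (kar_extend T\<^sub>\<Gamma>) ?Z) (FOb (kar_extend T\<^sub>\<Gamma>) ?Z)\<^esub>"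
    have X: "fst Z \<in> Ob H" using Zt(1) by (simp add: karoubi_Ob)
    have fm: "f \<in> Mor ?O (fst Z) (fst Z)" using f unfolding karoubi_Mor by simp
    have "f = \<zero>\<^bsub>Hom ?O (fst Z) (fst Z)\<^esub>"
    proof (rule adj.right_faithful[of "fst Z" "fst Z", unfolded orbit_left_simps(1)])
      show "FMor T\<^sub>\<Gamma> (fst Z) (fst Z) f = FMor T\<^sub>\<Gamma> (fst Z) (fst Z) \<zero>\<^bsub>Hom ?O (fst Z) (fst Z)\<^esub>"
        using z T\<^sub>\<Gamma>.fmor_zero[of "fst Z" "fst Z"] X by simp
    qed (use X fm incl.D.hom_zero[of "fst Z" "fst Z"] in auto)
    then show "f = \<zero>\<^bsub>Hom (karoubi ?O) ?Z ?Z\<^esub>" by simp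
  qed (rule full)
qed

lemma J_linear_functor_full: "linear_functor R Orb\<^sub>\<Gamma> Kl J\<^sub>\<Gamma>"
  using J_linear_functor[OF subgroup_self] by simp

lemma orbit_to_kleisli_karoubi_equivalence:
  assumes \<Phi>: "equivalence_functor R (karoubi Kl) G \<Phi>"
  defines "F \<equiv> \<Phi> \<circ>\<^sub>F kar_extend J\<^sub>\<Gamma>"
  shows "linear_functor R (karoubi Orb\<^sub>\<Gamma>) G F"
    and "fully_faithful (karoubi Orb\<^sub>\<Gamma>) G F"
    and "essentially_surjective (karoubi Orb\<^sub>\<Gamma>) G F"
proof -
  interpret J: linear_functor R "Orb\<^sub>\<Gamma>" Kl "J\<^sub>\<Gamma>"
    by (rule J_linear_functor_full)
  note P = equivalence_functorD[OF \<Phi>]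
  note ff = J.kar_extend_fully_faithful[OF J_fully_faithful]
  have es: "essentially_surjective (karoubi Orb\<^sub>\<Gamma>) (karoubi Kl) (kar_extend J\<^sub>\<Gamma>)"
    by (rule J.kar_extend_essentially_surjective[OF J_fully_faithful]) simp
  show "linear_functor R (karoubi Orb\<^sub>\<Gamma>) G F"
    unfolding F_def by (rule linear_functor_comp[OF J.kar_extend_linear_functor P(1)])
  show "fully_faithful (karoubi Orb\<^sub>\<Gamma>) G F"
    unfolding F_def by (rule fully_faithful_comp[OF J.kar_extend_linear_functor ff P(2)])
  show "essentially_surjective (karoubi Orb\<^sub>\<Gamma>) G F"
    unfolding F_def by (rule essentially_surjective_comp[OF J.kar_extend_linear_functor P(1) es P(3)])
qed

lemma left_adjoint_factorization:
  assumes K: "subgroup K \<Gamma>" and \<Phi>: "linear_functor R (karoubi Kl) G \<Phi>"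
  shows "nat_isomorphic R H G (\<Phi> \<circ>\<^sub>F kar_embed Kl \<circ>\<^sub>F kleisli_left H TS \<eta>)
    ((\<Phi> \<circ>\<^sub>F kar_extend J\<^sub>\<Gamma> \<circ>\<^sub>F kar_extend (Incl K)) \<circ>\<^sub>F
     (kar_embed (Orb K) \<circ>\<^sub>F Ind K))"
proof (rule nat_isomorphic_of_agree)
  note KG = subgroup.subset[OF K]
  note \<Phi>' = \<Phi>
  interpret O: linear_category R "Orb K" by (rule orbit_linear_category[OF K])
  interpret Kl: linear_category R Kl by (rule kleisli_linear_category)
  interpret incl: linear_functor R "Orb K" "Orb\<^sub>\<Gamma>" "Incl K"
    using orbit_incl_linear_functor[OF K] by simp
  interpret J: linear_functor R "Orb\<^sub>\<Gamma>" Kl "J\<^sub>\<Gamma>"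
    by (rule J_linear_functor_full)
  show "linear_functor R H G (\<Phi> \<circ>\<^sub>F kar_embed Kl \<circ>\<^sub>F kleisli_left H TS \<eta>)"
    by (rule linear_functor_comp[OF linear_functor_comp[OF kleisli_left_linear_functor
        Kl.kar_embed_linear_functor] \<Phi>])
  show "linear_functor R H G ((\<Phi> \<circ>\<^sub>F kar_extend J\<^sub>\<Gamma> \<circ>\<^sub>F
      kar_extend (Incl K)) \<circ>\<^sub>F (kar_embed (Orb K) \<circ>\<^sub>F Ind K))"
    by (rule linear_functor_comp[OF linear_functor_comp[OF orbit_left_linear_functor[OF K] O.kar_embed_linear_functor]
         linear_functor_comp[OF linear_functor_comp[OF incl.kar_extend_linear_functor
             J.kar_extend_linear_functor] \<Phi>]])
  have J_incl: "FMor J\<^sub>\<Gamma> X Y (FMor (Incl K) X Y f) = FMor (J K) X Y f"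
    if "X \<in> Ob H" "Y \<in> Ob H" "f \<in> Mor (Orb K) X Y" for X Y f
    using J_orbit_incl[OF KG that] by simp
  have idn: "FMor J\<^sub>\<Gamma> X X (FMor (Incl K) X X (Idn (Orb K) X)) = \<eta> X"
    if "X \<in> Ob H" for X
    by (simp only: J_incl[OF that that orbit_idn_closed[OF KG that]] J_idn[OF K that])
  show "FOb (\<Phi> \<circ>\<^sub>F kar_embed Kl \<circ>\<^sub>F kleisli_left H TS \<eta>) X =
      FOb ((\<Phi> \<circ>\<^sub>F kar_extend J\<^sub>\<Gamma> \<circ>\<^sub>F
      kar_extend (Incl K)) \<circ>\<^sub>F (kar_embed (Orb K) \<circ>\<^sub>F Ind K)) X"
    if "X \<in> Ob H" for X
    using idn[OF that] by (simp add: comp_functor_def del: orbit_cat_simps(6) orbit_incl_simps(2))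
  show "FMor (\<Phi> \<circ>\<^sub>F kar_embed Kl \<circ>\<^sub>F kleisli_left H TS \<eta>) X Y f =
      FMor ((\<Phi> \<circ>\<^sub>F kar_extend J\<^sub>\<Gamma> \<circ>\<^sub>F
      kar_extend (Incl K)) \<circ>\<^sub>F (kar_embed (Orb K) \<circ>\<^sub>F Ind K)) X Y f"
    if X: "X \<in> Ob H" "Y \<in> Ob H" and f: "f \<in> Mor H X Y" for X Y f
    using idn[OF X(1)] idn[OF X(2)] J_incl[OF X orbit_left_closed[OF KG X f]] J_orbit_left[OF K X f]
    by (simp add: comp_functor_def del: orbit_cat_simps(6) orbit_incl_simps(2) orbit_left_simps(2))
qed

text \<open>The functors \<open>T1\<close> and \<open>T2\<close> are the extensions to Karoubi envelopes of the two right adjoints, composed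
  with quasi-inverses of the equivalences of \<open>H\<close> with its Karoubi envelope and of the Karoubi
  envelope of \<open>H[\<Gamma>]\<close> with \<open>G\<close>. The isomorphisms between right adjoints follow from equality or
  isomorphism of the left adjoints.\<close>

lemma adjoint_pairs_diagram:
  assumes K: "subgroup K \<Gamma>" and ic: "idempotent_complete H"
    and \<Phi>: "equivalence_functor R (karoubi Kl) G \<Phi>"
    and S: "nat_isomorphic R H G S (\<Phi> \<circ>\<^sub>F kar_embed Kl \<circ>\<^sub>F kleisli_left H TS \<eta>)"
  defines "J\<Gamma> \<equiv> J\<^sub>\<Gamma>"
  defines "S1 \<equiv> kar_embed (Orb K) \<circ>\<^sub>F Ind K"
    and "S2 \<equiv> \<Phi> \<circ>\<^sub>F kar_extend J\<Gamma> \<circ>\<^sub>F kar_extend (Incl K)"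
  shows "\<exists>D dinc dprj T\<^sub>0 T1 T2.
            (\<forall>X \<in> Ob H. is_direct_sum H (carrier (sub K)) (\<lambda>g. FOb (E g) X) (D X)
               (\<lambda>g. dinc g X) (\<lambda>g. dprj g X)) \<and>
            adjoint_pair R H (Orb K) (Ind K) (orbit_right H E m D dinc dprj (sub K)) \<and>
            adjoint_pair R (Orb K) Orb\<^sub>\<Gamma> (Incl K) T\<^sub>0 \<and>
            nat_isomorphic R Orb\<^sub>\<Gamma> H (orbit_right H E m A inc prj \<Gamma>)
              (orbit_right H E m D dinc dprj (sub K) \<circ>\<^sub>F T\<^sub>0) \<and>
            nat_isomorphic R (karoubi (Orb K)) (karoubi H)
              (kar_embed H \<circ>\<^sub>F T1) (kar_extend (orbit_right H E m D dinc dprj (sub K))) \<and>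
            nat_isomorphic R (karoubi Orb\<^sub>\<Gamma>) (karoubi (Orb K))
              (T2 \<circ>\<^sub>F \<Phi> \<circ>\<^sub>F kar_extend J\<Gamma>) (kar_extend T\<^sub>0) \<and>
            adjoint_pair R H (karoubi (Orb K)) S1 T1 \<and>
            adjoint_pair R (karoubi (Orb K)) G S2 T2 \<and>
            nat_isomorphic R H G S (S2 \<circ>\<^sub>F S1) \<and>
            nat_isomorphic R G H T (T1 \<circ>\<^sub>F T2)"
proof -
  let ?O = "Orb\<^sub>\<Gamma>" and ?left = "Ind K" and ?incl = "Incl K"
  interpret left: linear_functor R H "Orb K" ?left by (rule orbit_left_linear_functor[OF K])
  have "\<exists>D0. \<forall>X\<in>Ob H. is_direct_sum H K (\<lambda>g. FOb (E g) X) (fst (D0 X)) (fst (snd (D0 X))) (snd (snd (D0 X)))"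
    by (intro bchoice ballI) (use S.C.partial_direct_sum[OF direct_sum subgroup.subset[OF K] ic] in \<open>auto
        simp: split_paired_Ex\<close>)
  then obtain D0 where D0: "is_direct_sum H K (\<lambda>g. FOb (E g) X) (fst (D0 X)) (fst (snd (D0 X))) (snd (snd (D0 X)))"
    if "X \<in> Ob H" for X by blast
  define D where "D X = fst (D0 X)" for X
  define dinc where "dinc g X = fst (snd (D0 X)) g" for g X
  define dprj where "dprj g X = snd (snd (D0 X)) g" for g X
  have ds: "is_direct_sum H K (\<lambda>g. FOb (E g) X) (D X) (\<lambda>g. dinc g X) (\<lambda>g. dprj g X)" if "X \<in> Ob H" for X
    unfolding D_def dinc_def dprj_def using D0[OF that] by simp
  let ?right = "orbit_right H E m D dinc dprj (sub K)"
  have adj1: "adjoint_pair R H (Orb K) ?left ?right"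
    by (rule orbit_right_adjoint[OF K ds])
  obtain T\<^sub>0 where adj0: "adjoint_pair R (Orb K) ?O ?incl T\<^sub>0"
    using orbit_incl_right_adjoint[OF K ic] by blast
  have lin: "linear_functor R (Orb K) H ?right" "linear_functor R ?O (Orb K) T\<^sub>0"
    using adj1 adj0 unfolding adjoint_pair_iff by (blast intro: universal_arrows.right_linear_functor)+
  have iso4: "nat_isomorphic R ?O H T\<^sub>\<Gamma> (?right \<circ>\<^sub>F T\<^sub>0)"
    using right_adjoint_unique[OF full_orbit_right_adjoint adjoint_pair_comp[OF adj1 adj0, unfolded
        orbit_incl_left[OF K]]] .
  obtain P where P: "adjoint_pair R H (karoubi H) (kar_embed H) P" "nat_isomorphic R (karoubi H) (karoubi H)
      (kar_embed H \<circ>\<^sub>F P) id_functor"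
    using quasi_inverse_exists[OF S.C.kar_embed_linear_functor S.C.kar_embed_fully_faithful
        S.C.kar_embed_essentially_surjective[OF ic]] by metis
  define T1 where "T1 = P \<circ>\<^sub>F kar_extend ?right"
  have iso5: "nat_isomorphic R (karoubi (Orb K)) (karoubi H) (kar_embed H \<circ>\<^sub>F T1) (kar_extend ?right)"
    using nat_isomorphic_whisker_right[OF P(2) linear_functor.kar_extend_linear_functor[OF lin(1)]]
    by (simp add: T1_def comp_functor_assoc)
  note F = orbit_to_kleisli_karoubi_equivalence[OF \<Phi>, folded J\<Gamma>_def]
  obtain Q where Q: "adjoint_pair R (karoubi ?O) G (\<Phi> \<circ>\<^sub>F kar_extend J\<Gamma>) Q"
      "nat_isomorphic R (karoubi ?O) (karoubi ?O) (Q \<circ>\<^sub>F \<Phi> \<circ>\<^sub>F kar_extend J\<Gamma>) id_functor"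
    by (rule quasi_inverse_exists[OF F]) (rule that)
  define T2 where "T2 = kar_extend T\<^sub>0 \<circ>\<^sub>F Q"
  have iso6: "nat_isomorphic R (karoubi ?O) (karoubi (Orb K)) (T2 \<circ>\<^sub>F \<Phi> \<circ>\<^sub>F kar_extend J\<Gamma>) (kar_extend T\<^sub>0)"
    using nat_isomorphic_whisker_left[OF Q(2) linear_functor.kar_extend_linear_functor[OF lin(2)]]
    by (simp add: T2_def comp_functor_assoc)
  have adjS1: "adjoint_pair R H (karoubi (Orb K)) S1 T1"
    unfolding S1_def T1_def
    by (rule adjoint_pair_left_iso[OF adjoint_pair_comp[OF P(1) kar_extend_adjoint_pair[OF adj1]]
        left.kar_extend_embed_agree])
  have adjS2: "adjoint_pair R (karoubi (Orb K)) G S2 T2"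
    using adjoint_pair_comp[OF kar_extend_adjoint_pair[OF adj0] Q(1)] by (simp add: S2_def T2_def comp_functor_assoc)
  have isoS: "nat_isomorphic R H G S (S2 \<circ>\<^sub>F S1)"
    unfolding S1_def S2_def J\<Gamma>_def
    by (rule nat_isomorphic_trans[OF S left_adjoint_factorization[OF K equivalence_functorD(1)[OF \<Phi>]]])
  have "adjoint_pair R H G S T" using adjunction_axioms unfolding adjoint_pair_def by blast
  then have isoT: "nat_isomorphic R G H T (T1 \<circ>\<^sub>F T2)"
    by (rule right_adjoint_unique) (rule adjoint_pair_left_iso[OF adjoint_pair_comp[OF adjS1 adjS2] isoS])
  show ?thesis
    by (rule exI[of _ D], rule exI[of _ dinc], rule exI[of _ dprj], rule exI[of _ T\<^sub>0], rule exI[of _ T1],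
        rule exI[of _ T2],
        intro conjI adj1 adj0 iso4 iso5 iso6 adjS1 adjS2 isoS isoT) (use ds in simp)
qed

text \<open>Up to an equivalence the object in question is the image of \<open>Z\<close> in the Karoubi envelope of \<open>H[\<Gamma>]\<close>,
  which has only trivial idempotents; it is nonzero because the inclusion of \<open>H[K]\<close> is faithful.\<close>

lemma induced_indecomposable:
  assumes ic: "idempotent_complete H"
    and fl: "\<And>X Y. \<lbrakk>X \<in> Ob H; Y \<in> Ob H\<rbrakk> \<Longrightarrow> finite_length R (Hom H X Y)"
    and M: "indecomposable H M" and K_def: "K = stabilizer_index H E (carrier \<Gamma>) M"
    and \<Phi>: "equivalence_functor R (karoubi Kl) G \<Phi>"
    and factor: "direct_factor (karoubi (Orb K)) Z (FOb (kar_embed (Orb K)) M)"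
    and Z: "indecomposable (karoubi (Orb K)) Z"
  shows "indecomposable G (FOb (\<Phi> \<circ>\<^sub>F kar_extend J\<^sub>\<Gamma> \<circ>\<^sub>F kar_extend (Incl K)) Z)"
proof -
  have K: "subgroup K \<Gamma>" unfolding K_def using stabilizer_subgroup M by (simp add: indecomposable_def)
  let ?O = "Orb\<^sub>\<Gamma>" and ?I = "kar_extend (Incl K)"
  let ?F = "\<Phi> \<circ>\<^sub>F kar_extend J\<^sub>\<Gamma>"
  note F = orbit_to_kleisli_karoubi_equivalence[OF \<Phi>]
  interpret O: linear_category R "Orb K" by (rule orbit_linear_category[OF K])
  interpret F: linear_functor R "karoubi ?O" G ?F by (rule F(1))
  interpret incl: linear_functor R "Orb K" ?O "Incl K"
    using orbit_incl_linear_functor[OF K] by simp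
  interpret I: linear_functor R "karoubi (Orb K)" "karoubi ?O" ?I by (rule incl.kar_extend_linear_functor)
  note Zt = I.C.indecomposable_trivial_idempotents[OF O.karoubi_idempotent_complete Z]
  have IZ: "FOb ?I Z \<in> Ob (karoubi ?O)" by (rule I.fob_closed[OF Zt(1)])
  have Im: "Idn (karoubi ?O) (FOb ?I Z) \<in> Mor (karoubi ?O) (FOb ?I Z) (FOb ?I Z)"
      "\<zero>\<^bsub>Hom (karoubi ?O) (FOb ?I Z) (FOb ?I Z)\<^esub> \<in> Mor (karoubi ?O) (FOb ?I Z) (FOb ?I Z)"
    using F.C.idn_closed[OF IZ] F.C.hom_zero[OF IZ IZ] .
  have triv: "trivial_idempotents G (FOb ?F (FOb ?I Z))"
    by (rule F.fully_faithful_trivial_idempotents[OF F(2) IZ], rule orbit_incl_trivial_idempotents[OF ic _ M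
        K_def factor Z])
       (rule fl)
  have "Idn G (FOb ?F (FOb ?I Z)) \<noteq> \<zero>\<^bsub>Hom G (FOb ?F (FOb ?I Z)) (FOb ?F (FOb ?I Z))\<^esub>"
  proof
    assume "Idn G (FOb ?F (FOb ?I Z)) = \<zero>\<^bsub>Hom G (FOb ?F (FOb ?I Z)) (FOb ?F (FOb ?I Z))\<^esub>"
    then have "FMor ?F (FOb ?I Z) (FOb ?I Z) (Idn (karoubi ?O) (FOb ?I Z)) =
       FMor ?F (FOb ?I Z) (FOb ?I Z) \<zero>\<^bsub>Hom (karoubi ?O) (FOb ?I Z) (FOb ?I Z)\<^esub>"
      using F.fmor_idn[OF IZ] F.fmor_zero[OF IZ IZ] by metis
    then have "Idn (karoubi ?O) (FOb ?I Z) = \<zero>\<^bsub>Hom (karoubi ?O) (FOb ?I Z) (FOb ?I Z)\<^esub>"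
      by (rule fully_faithful_inj[OF F(2) IZ IZ Im])
    then have eq: "FMor (Incl K) (fst Z) (fst Z) (snd Z) = \<zero>\<^bsub>Hom ?O (fst Z) (fst Z)\<^esub>"
      by (simp del: orbit_cat_simps orbit_incl_simps(2))
    have "snd Z = \<zero>\<^bsub>Hom (Orb K) (fst Z) (fst Z)\<^esub>"
    proof (rule PiE_ext)
      have s: "snd Z \<in> Mor (Orb K) (fst Z) (fst Z)" and X: "fst Z \<in> Ob H"
        using Zt(1) unfolding karoubi_Ob idempotent_in_def by simp_all
      show "snd Z \<in> (\<Pi>\<^sub>E g\<in>K. Mor H (fst Z) (FOb (E g) (fst Z)))" using s by simp
      show "\<zero>\<^bsub>Hom (Orb K) (fst Z) (fst Z)\<^esub> \<in> (\<Pi>\<^sub>E g\<in>K. Mor H (fst Z) (FOb (E g) (fst Z)))"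
        using O.hom_zero[of "fst Z" "fst Z"] X by simp
      fix g assume g: "g \<in> K"
      show "snd Z g = \<zero>\<^bsub>Hom (Orb K) (fst Z) (fst Z)\<^esub> g"
        using fun_cong[OF eq, of g] g subgroup.mem_carrier[OF K g] by simp
    qed
    then show False using Zt(2) by simp
  qed
  then have "indecomposable G (FOb ?F (FOb ?I Z))"
    by (rule S.D.indecomposable_of_trivial_idempotents[OF F.fob_closed[OF IZ] _ triv])
  then show ?thesis by (simp add: comp_functor_def)
qed

end

theorem theorem5p11:
  fixes R :: "'r ring"
    and H :: "('r, 'o, 'm) lcat" and G :: "('r, 'p, 'n) lcat"
    and S :: "('o, 'm, 'p, 'n) cfunctor" and T :: "('p, 'n, 'o, 'm) cfunctor"
    and \<eta> :: "'o \<Rightarrow> 'm" and \<epsilon> :: "'p \<Rightarrow> 'n"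
    and \<Gamma> :: "'i monoid"
    and E :: "'i \<Rightarrow> ('o, 'm, 'o, 'm) cfunctor"
    and inc prj :: "'i \<Rightarrow> 'o \<Rightarrow> 'm"
    and \<Phi> :: "('o \<times> 'm, 'm, 'p, 'n) cfunctor"
    and M :: 'o
  defines "A \<equiv> T \<circ>\<^sub>F S" and "\<mu> \<equiv> adj_mult S T \<epsilon>"
  defines "m \<equiv> (\<lambda>g h. mult_component H A \<mu> E inc prj g h (g \<otimes>\<^bsub>\<Gamma>\<^esub> h))"
    and "u \<equiv> (\<lambda>X. Cmp H X (FOb A X) (FOb (E \<one>\<^bsub>\<Gamma>\<^esub>) X) (prj \<one>\<^bsub>\<Gamma>\<^esub> X) (\<eta> X))"
  defines "Kl \<equiv> kleisli H A \<mu> \<eta>"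
  defines "\<Gamma>\<^sub>M \<equiv> \<Gamma>\<lparr>carrier := stabilizer_index H E (carrier \<Gamma>) M\<rparr>"
  defines "H\<Gamma> \<equiv> orbit_cat H E m u \<Gamma>" and "H\<Gamma>\<^sub>M \<equiv> orbit_cat H E m u \<Gamma>\<^sub>M"
    and "J \<equiv> orbit_to_kleisli H E A inc \<Gamma>"
  defines "S1 \<equiv> kar_embed H\<Gamma>\<^sub>M \<circ>\<^sub>F orbit_left H E u \<Gamma>\<^sub>M"
    and "S2 \<equiv> \<Phi> \<circ>\<^sub>F kar_extend J \<circ>\<^sub>F kar_extend (orbit_incl H E \<Gamma>\<^sub>M \<Gamma>)"
  assumes "cring R" and "noetherian_ring R"
    and "linear_category R H" and "linear_category R G"
    and "idempotent_complete H" and "idempotent_complete G"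
    and "\<And>X Y. \<lbrakk>X \<in> Ob H; Y \<in> Ob H\<rbrakk> \<Longrightarrow> finite_length R (Hom H X Y)"
    and "\<And>X Y. \<lbrakk>X \<in> Ob G; Y \<in> Ob G\<rbrakk> \<Longrightarrow> finite_length R (Hom G X Y)"
    and "adjunction R H G S T \<eta> \<epsilon>"
    and "normal_subgroup_situation R H G S T \<eta> \<epsilon> (carrier \<Gamma>) E inc prj"
    and "group_by_mult H A \<mu> E inc prj \<Gamma>"
    and "finite (carrier \<Gamma>)"
    and "equivalence_functor R (karoubi Kl) G \<Phi>"
    and "nat_isomorphic R H G S (\<Phi> \<circ>\<^sub>F kar_embed Kl \<circ>\<^sub>F kleisli_left H A \<eta>)"
    and "nat_isomorphic R (karoubi Kl) (karoubi H)
           (kar_embed H \<circ>\<^sub>F T \<circ>\<^sub>F \<Phi>) (kar_extend (kleisli_right H A \<mu>))"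
    and "indecomposable H M"
  shows "(\<exists>D dinc dprj T\<^sub>0 T1 T2.
            (\<forall>X \<in> Ob H. is_direct_sum H (carrier \<Gamma>\<^sub>M) (\<lambda>g. FOb (E g) X) (D X)
               (\<lambda>g. dinc g X) (\<lambda>g. dprj g X)) \<and>
            adjoint_pair R H H\<Gamma>\<^sub>M (orbit_left H E u \<Gamma>\<^sub>M) (orbit_right H E m D dinc dprj \<Gamma>\<^sub>M) \<and>
            adjoint_pair R H\<Gamma>\<^sub>M H\<Gamma> (orbit_incl H E \<Gamma>\<^sub>M \<Gamma>) T\<^sub>0 \<and>
            nat_isomorphic R H\<Gamma> H (orbit_right H E m (FOb A) inc prj \<Gamma>)
              (orbit_right H E m D dinc dprj \<Gamma>\<^sub>M \<circ>\<^sub>F T\<^sub>0) \<and>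
            nat_isomorphic R (karoubi H\<Gamma>\<^sub>M) (karoubi H)
              (kar_embed H \<circ>\<^sub>F T1) (kar_extend (orbit_right H E m D dinc dprj \<Gamma>\<^sub>M)) \<and>
            nat_isomorphic R (karoubi H\<Gamma>) (karoubi H\<Gamma>\<^sub>M)
              (T2 \<circ>\<^sub>F \<Phi> \<circ>\<^sub>F kar_extend J) (kar_extend T\<^sub>0) \<and>
            adjoint_pair R H (karoubi H\<Gamma>\<^sub>M) S1 T1 \<and>
            adjoint_pair R (karoubi H\<Gamma>\<^sub>M) G S2 T2 \<and>
            nat_isomorphic R H G S (S2 \<circ>\<^sub>F S1) \<and>
            nat_isomorphic R G H T (T1 \<circ>\<^sub>F T2)) \<and>
         (\<forall>M0. direct_factor (karoubi H\<Gamma>\<^sub>M) M0 (FOb S1 M) \<and> indecomposable (karoubi H\<Gamma>\<^sub>M) M0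
            \<longrightarrow> indecomposable G (FOb S2 M0))"
proof -
  note defs = A_def \<mu>_def m_def u_def Kl_def \<Gamma>\<^sub>M_def H\<Gamma>_def H\<Gamma>\<^sub>M_def J_def S1_def S2_def
  interpret normal_subgroup_group R H G S T \<eta> \<epsilon> \<Gamma> E inc prj
    using \<open>normal_subgroup_situation R H G S T \<eta> \<epsilon> (carrier \<Gamma>) E inc prj\<close>
      \<open>group_by_mult H A \<mu> E inc prj \<Gamma>\<close> \<open>finite (carrier \<Gamma>)\<close>
    unfolding defs by (intro normal_subgroup_group.intro normal_subgroup_group_axioms.intro)
  have "M \<in> Ob H" using \<open>indecomposable H M\<close> by (simp add: indecomposable_def)
  note K = stabilizer_subgroup[OF this]
  note \<Phi> = \<open>equivalence_functor R (karoubi Kl) G \<Phi>\<close>[unfolded defs]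
  note S = \<open>nat_isomorphic R H G S (\<Phi> \<circ>\<^sub>F kar_embed Kl \<circ>\<^sub>F kleisli_left H A \<eta>)\<close>[unfolded defs]
  note ic = \<open>idempotent_complete H\<close> and M = \<open>indecomposable H M\<close>
  have S1_M: "FOb S1 M = FOb (kar_embed H\<Gamma>\<^sub>M) M"
    unfolding S1_def by (simp add: comp_functor_def)
  show ?thesis
    unfolding S1_M unfolding defs
  proof (intro conjI allI impI; (elim conjE)?)
    fix M0
    assume factor: "direct_factor (karoubi (Orb (stabilizer_index H E (carrier \<Gamma>) M))) M0
        (FOb (kar_embed (Orb (stabilizer_index H E (carrier \<Gamma>) M))) M)"
      and ind: "indecomposable (karoubi (Orb (stabilizer_index H E (carrier \<Gamma>) M))) M0"
    show "indecomposable G (FOb (\<Phi> \<circ>\<^sub>F kar_extend (orbit_to_kleisli H E TS inc \<Gamma>) \<circ>\<^sub>F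
        kar_extend (orbit_incl H E (\<Gamma>\<lparr>carrier := stabilizer_index H E (carrier \<Gamma>) M\<rparr>) \<Gamma>)) M0)"
      by (rule induced_indecomposable[OF ic _ M refl \<Phi> factor ind])
         (rule \<open>\<And>X Y. \<lbrakk>X \<in> Ob H; Y \<in> Ob H\<rbrakk> \<Longrightarrow> finite_length R (Hom H X Y)\<close>)
  qed (rule adjoint_pairs_diagram[OF K ic \<Phi> S])
qed

end
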